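(* Let $B_1=(1,1)$, $B_2=(1,0)$, $B_3=(0,1)$ be the rows of $B=\begin{pmatrix}1&1\\1&0\\0&1\end{pmatrix}$. Let $A:(0,1)^2\to\mathbb C^{2\times2}$, $\mathbf b:(0,1)^2\to\mathbb C^2$ and $c:(0,1)^2\to\mathbb C$ be $L^1$ functions, and let $S_{\mathbf n}$, $\mathbf n=(n,n)$, be the $P_1$ finite element stiffness matrix on the square $[0,1]^2$ with these coefficients, as defined in the context. Then $\{S_{\mathbf n}\}_n$ is a ($2$-level) GLT sequence with symbol $$k(x,\theta)=r_{0,0}(x)+r_{0,1}(x)e^{-\mathrm i\theta_2}+r_{1,0}(x)e^{-\mathrm i\theta_1}+r_{-1,0}(x)e^{\mathrm i\theta_1}+r_{0,-1}(x)e^{\mathrm i\theta_2}+r_{1,-1}(x)e^{-\mathrm i\theta_1+\mathrm i\theta_2}+r_{-1,1}(x)e^{\mathrm i\theta_1-\mathrm i\theta_2},$$ where $$r_{0,0}=B_1AB_1^T+B_2AB_2^T+B_3AB_3^T,\qquad r_{0,1}=r_{0,-1}=-\tfrac12B_3AB_1^T-\tfrac12B_1AB_3^T,$$ $$r_{1,-1}=r_{-1,1}=\tfrac12B_2AB_3^T+\tfrac12B_3AB_2^T,\qquad r_{-1,0}=r_{1,0}=-\tfrac12B_1AB_2^T-\tfrac12B_2AB_1^T.$$ If $A(x)$ is also Hermitian for every $x\in(0,1)^2$, then $\{S_{\mathbf n}\}_n\sim_\lambda k(x,\theta)$, where $k$ is considered on $[0,1]^2\times[-\pi,\pi]^2$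.
   Context: $P_1$ matrices. Let $h=1/(n+1)$ and $\Xi_n=\{(ih,jh):0\le i,j\le n+1\}$. With $e_1=(1,0)$, $e_2=(0,1)$, for $p\in\Xi_n$ let $T_{1,p},\dots,T_{6,p}$ be the closed triangles with vertex $p$ and other two vertices, respectively, $\{p+he_1,p+he_2\}$, $\{p+he_1,p+h(e_1-e_2)\}$, $\{p+h(e_1-e_2),p-he_2\}$, $\{p-he_2,p-he_1\}$, $\{p-he_1,p+h(e_2-e_1)\}$, $\{p+h(e_2-e_1),p+he_2\}$, and $T_p=\bigcup_iT_{i,p}$. For $p$ with $T_p\subseteq[0,1]^2$ (i.e. the $n^2$ grid points in $(0,1)^2$), $\psi_{p,n}$ is the continuous function supported on $T_p$, linear on each $T_{i,p}$, equal to $1$ at $p$ and $0$ at all other points of $\Xi_n$. The matrix $S_{\mathbf n}$ has size $n^2\times n^2$, its rows and columns are indexed by the grid points $q,p\in\Xi_n\cap(0,1)^2$ in lexicographic order ($p=(ih,jh)$ corresponding to the 2-index $(i,j)$, $1\le i,j\le n$), and $$(S_{\mathbf n})_{q,p}=\int_{(0,1)^2}(\nabla\psi_{p,n})^TA\nabla\psi_{q,n}+(\nabla\psi_{p,n})^T\mathbf b\,\psi_{q,n}+c\,\psi_{p,n}\psi_{q,n}.$$ Spectral symbol. For square matrices $A_n$ of size $d_n\to\infty$ and a measurable $f:D\to\mathbb C$ with $0<\mu(D)<\infty$ ($\mu$ Lebesgue measure), $\{A_n\}_n\sim_\lambda f$ means $\lim_n\frac1{d_n}\sum_{i=1}^{d_n}F(\lambda_i(A_n))=\frac1{\mu(D)}\int_DF(f)$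 for all $F\in C_c(\mathbb C)$, $\lambda_i$ being the eigenvalues. a.c.s. convergence. For matrices of size $d_n$, $\{B_{n,m}\}_n\xrightarrow{\text{a.c.s.}}\{A_n\}_n$ as $m\to\infty$ means: for every $m$ there is $n_m$ such that for $n>n_m$ one can write $A_n=B_{n,m}+N_{n,m}+R_{n,m}$ with spectral norm $\|N_{n,m}\|\le\omega(m)$ and $\mathrm{rank}(R_{n,m})\le c(m)d_n$, where $\omega(m),c(m)\to0$. GLT sequences ($d=2$, $\mathbf n=(n,n)$, matrices of size $n^2$ indexed by 2-indices $\mathbf i,\mathbf j\in\{1,\dots,n\}^2$ in lexicographic order). For $f\in L^1([-\pi,\pi]^2)$, $T_{\mathbf n}(f)=[f_{\mathbf i-\mathbf j}]_{\mathbf i,\mathbf j}$ with $f_{\mathbf k}=(2\pi)^{-2}\int_{[-\pi,\pi]^2}f(\theta)e^{-\mathrm i\,\mathbf k\cdot\theta}d\theta$; for $a:[0,1]^2\to\mathbb C$, $D_{\mathbf n}(a)=\mathrm{diag}(a(\mathbf i/n))_{\mathbf i}$. $\{A_{\mathbf n}\}_n$ is a GLT sequence with symbol the measurable function $k:[0,1]^2\times[-\pi,\pi]^2\to\mathbb C$ iff there are finitely many (for each $m$) $a_{i,m}\in C^\infty([0,1]^2)$ and bivariate trigonometric polynomials $f_{i,m}$ such that $\sum_ia_{i,m}(x)f_{i,m}(\theta)\to k$ in measure and $\{\sum_iD_{\mathbf n}(a_{i,m})T_{\mathbf n}(f_{i,m})\}_n\xrightarrow{\text{a.c.s.}}\{A_{\mathbf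 n}\}_n$ as $m\to\infty$ (a standard characterization of GLT sequences). The symbol is unique a.e. *)

theory Defs
  imports "HOL-Analysis.Analysis" "Jordan_Normal_Form.DL_Rank" "Jordan_Normal_Form.Char_Poly"
begin

no_notation vec_index (infixl \<open>$\<close> 100)
no_notation scalar_prod (infix \<open>\<bullet>\<close> 70)
hide_const (open) Matrix.mat Matrix.vec Matrix.row Matrix.col Matrix.transpose_mat

section \<open>Eigenvalues, spectral norm and spectral distribution\<close>

definition l2norm :: "complex Matrix.vec \<Rightarrow> real" where
  "l2norm v = sqrt (\<Sum>i<dim_vec v. (cmod (vec_index v i))\<^sup>2)"

definition spectral_norm :: "complex Matrix.mat \<Rightarrow> real" where
  "spectral_norm M =
     Sup {l2norm (M *\<^sub>v v) | v. v \<in> carrier_vec (dim_col M) \<and> l2norm v \<le> 1}"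

text \<open>The eigenvalues are the roots of the characteristic polynomial, repeated according to
  algebraic multiplicity.\<close>

definition eigenvalue_mset :: "complex Matrix.mat \<Rightarrow> complex multiset" where
  "eigenvalue_mset M = proots (char_poly M)"

definition Cc_complex :: "(complex \<Rightarrow> complex) \<Rightarrow> bool" where
  "Cc_complex F \<longleftrightarrow> continuous_on UNIV F \<and> (\<exists>K. compact K \<and> (\<forall>z. z \<notin> K \<longrightarrow> F z = 0))"

definition spectral_distribution ::
  "(nat \<Rightarrow> nat) \<Rightarrow> (nat \<Rightarrow> complex Matrix.mat) \<Rightarrow> 'a::euclidean_space set \<Rightarrow> ('a \<Rightarrow> complex) \<Rightarrow> bool"
where
  "spectral_distribution d M D f \<longleftrightarrow>
     (\<forall>n. M n \<in> carrier_mat (d n) (d n)) \<and> filterlim d at_top sequentially \<and>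
     D \<in> lmeasurable \<and> measure lebesgue D > 0 \<and> f \<in> borel_measurable (lebesgue_on D) \<and>
     (\<forall>F. Cc_complex F \<longrightarrow>
        (\<lambda>n. (\<Sum>l\<in>#eigenvalue_mset (M n). F l) / of_nat (d n))
          \<longlonglongrightarrow> (LINT z|lebesgue_on D. F (f z)) / of_real (measure lebesgue D))"


section \<open>Approximating classes of sequences\<close>

text \<open>\<open>B n m\<close> is the matrix \<open>B\<^sub>n\<^sub>,\<^sub>m\<close>; the limit is for \<open>m \<rightarrow> \<infinity>\<close>.\<close>

definition acs_convergence ::
  "(nat \<Rightarrow> nat) \<Rightarrow> (nat \<Rightarrow> nat \<Rightarrow> complex Matrix.mat) \<Rightarrow> (nat \<Rightarrow> complex Matrix.mat) \<Rightarrow> bool"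
where
  "acs_convergence d B M \<longleftrightarrow>
     (\<forall>n. M n \<in> carrier_mat (d n) (d n)) \<and> (\<forall>n m. B n m \<in> carrier_mat (d n) (d n)) \<and>
     (\<exists>\<omega> c :: nat \<Rightarrow> real. \<omega> \<longlonglongrightarrow> 0 \<and> c \<longlonglongrightarrow> 0 \<and>
        (\<forall>m. \<exists>n\<^sub>m. \<forall>n>n\<^sub>m. \<exists>N R.
           N \<in> carrier_mat (d n) (d n) \<and> R \<in> carrier_mat (d n) (d n) \<and>
           M n = B n m + N + R \<and>
           spectral_norm N \<le> \<omega> m \<and> real (vec_space.rank (d n) R) \<le> c m * real (d n)))"


section \<open>Two-level GLT sequences\<close>

text \<open>The 2-indices in \<open>{1..n}\<^sup>2\<close> are enumerated lexicographically by \<open>0, \<dots>, n\<^sup>2 - 1\<close>.\<close>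

definition lex_index :: "nat \<Rightarrow> nat \<Rightarrow> nat \<times> nat" where
  "lex_index n l = (l div n + 1, l mod n + 1)"

abbreviation unit_square :: "(real^2) set" where
  "unit_square \<equiv> cbox (vec 0) (vec 1)"

abbreviation open_unit_square :: "(real^2) set" where
  "open_unit_square \<equiv> box (vec 0) (vec 1)"

abbreviation freq_square :: "(real^2) set" where
  "freq_square \<equiv> cbox (vec (- pi)) (vec pi)"

definition fourier_char :: "int \<times> int \<Rightarrow> real^2 \<Rightarrow> complex" where
  "fourier_char k \<theta> = exp (\<i> * of_real (of_int (fst k) * \<theta>$1 + of_int (snd k) * \<theta>$2))"

definition fourier_coeff :: "(real^2 \<Rightarrow> complex) \<Rightarrow> int \<times> int \<Rightarrow> complex" where
  "fourier_coeff f k =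
     (LINT \<theta>|lebesgue_on freq_square. f \<theta> * fourier_char (- k) \<theta>) / of_real ((2 * pi)\<^sup>2)"

definition toeplitz2 :: "nat \<Rightarrow> (real^2 \<Rightarrow> complex) \<Rightarrow> complex Matrix.mat" where
  "toeplitz2 n f = Matrix.mat (n\<^sup>2) (n\<^sup>2) (\<lambda>(r, s).
     (case (lex_index n r, lex_index n s) of ((i1, i2), (j1, j2)) \<Rightarrow>
        fourier_coeff f (int i1 - int j1, int i2 - int j2)))"

definition diag_sampling2 :: "nat \<Rightarrow> (real^2 \<Rightarrow> complex) \<Rightarrow> complex Matrix.mat" where
  "diag_sampling2 n a = mat_diag (n\<^sup>2) (\<lambda>r.
     (case lex_index n r of (i1, i2) \<Rightarrow> a (vector [real i1 / real n, real i2 / real n])))"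

text \<open>Smoothness on the closed square: all partial derivatives exist as (one-sided at the
  boundary) Frechet derivatives within the square; \<open>P i j\<close> is the derivative of order \<open>i\<close>
  in the first and \<open>j\<close> in the second variable.\<close>

definition smooth_on_unit_square :: "(real^2 \<Rightarrow> complex) \<Rightarrow> bool" where
  "smooth_on_unit_square a \<longleftrightarrow> (\<exists>P :: nat \<Rightarrow> nat \<Rightarrow> real^2 \<Rightarrow> complex.
     (\<forall>x\<in>unit_square. P 0 0 x = a x) \<and>
     (\<forall>i j. \<forall>x\<in>unit_square.
        (P i j has_derivative (\<lambda>v. v$1 *\<^sub>R P (Suc i) j x + v$2 *\<^sub>R P i (Suc j) x))
          (at x within unit_square)))"

definition trig_polynomial2 :: "(real^2 \<Rightarrow> complex) \<Rightarrow> bool" where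
  "trig_polynomial2 f \<longleftrightarrow>
     (\<exists>K c. finite K \<and> f = (\<lambda>\<theta>. \<Sum>k\<in>K. c k * fourier_char k \<theta>))"

definition converges_in_measure ::
  "'a::euclidean_space set \<Rightarrow> (nat \<Rightarrow> 'a \<Rightarrow> complex) \<Rightarrow> ('a \<Rightarrow> complex) \<Rightarrow> bool" where
  "converges_in_measure D g f \<longleftrightarrow>
     (\<forall>m. g m \<in> borel_measurable (lebesgue_on D)) \<and> f \<in> borel_measurable (lebesgue_on D) \<and>
     (\<forall>\<epsilon>>0. (\<lambda>m. emeasure lebesgue {z\<in>D. cmod (g m z - f z) > \<epsilon>}) \<longlonglongrightarrow> 0)"

definition GLT_sequence2 ::
  "(nat \<Rightarrow> complex Matrix.mat) \<Rightarrow> ((real^2) \<times> (real^2) \<Rightarrow> complex) \<Rightarrow> bool" where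
  "GLT_sequence2 M k \<longleftrightarrow>
     (\<exists>(q :: nat \<Rightarrow> nat) (a :: nat \<Rightarrow> nat \<Rightarrow> real^2 \<Rightarrow> complex) (f :: nat \<Rightarrow> nat \<Rightarrow> real^2 \<Rightarrow> complex).
        (\<forall>m. \<forall>i<q m. smooth_on_unit_square (a i m) \<and> trig_polynomial2 (f i m)) \<and>
        converges_in_measure (unit_square \<times> freq_square)
          (\<lambda>m (x, \<theta>). \<Sum>i<q m. a i m x * f i m \<theta>) k \<and>
        acs_convergence (\<lambda>n. n\<^sup>2)
          (\<lambda>n m. Matrix.mat (n\<^sup>2) (n\<^sup>2) (\<lambda>rs.
             \<Sum>i<q m. (diag_sampling2 n (a i m) * toeplitz2 n (f i m)) $$ rs))
          M)"


section \<open>The finite element stiffness matrix\<close>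

definition mesh_size :: "nat \<Rightarrow> real" where
  "mesh_size n = 1 / (real n + 1)"

definition grid_point :: "nat \<Rightarrow> nat \<times> nat \<Rightarrow> real^2" where
  "grid_point n ij = vector [real (fst ij) * mesh_size n, real (snd ij) * mesh_size n]"

definition grid :: "nat \<Rightarrow> (real^2) set" where
  "grid n = grid_point n ` ({0..n+1} \<times> {0..n+1})"

definition grid_triangles :: "real \<Rightarrow> real^2 \<Rightarrow> (real^2) set set" where
  "grid_triangles h p = (let e1 = axis 1 1; e2 = axis 2 1 in
     {convex hull {p, p + h *\<^sub>R e1, p + h *\<^sub>R e2},
      convex hull {p, p + h *\<^sub>R e1, p + h *\<^sub>R (e1 - e2)},
      convex hull {p, p + h *\<^sub>R (e1 - e2), p - h *\<^sub>R e2},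
      convex hull {p, p - h *\<^sub>R e2, p - h *\<^sub>R e1},
      convex hull {p, p - h *\<^sub>R e1, p + h *\<^sub>R (e2 - e1)},
      convex hull {p, p + h *\<^sub>R (e2 - e1), p + h *\<^sub>R e2}})"

definition is_hat_function :: "nat \<Rightarrow> real^2 \<Rightarrow> (real^2 \<Rightarrow> real) \<Rightarrow> bool" where
  "is_hat_function n p \<psi> \<longleftrightarrow>
     continuous_on UNIV \<psi> \<and>
     (\<forall>x. x \<notin> \<Union> (grid_triangles (mesh_size n) p) \<longrightarrow> \<psi> x = 0) \<and>
     (\<forall>T\<in>grid_triangles (mesh_size n) p. \<exists>v w. \<forall>x\<in>T. \<psi> x = v \<bullet> x + w) \<and>
     \<psi> p = 1 \<and> (\<forall>q\<in>grid n - {p}. \<psi> q = 0)"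

definition hat_function :: "nat \<Rightarrow> real^2 \<Rightarrow> real^2 \<Rightarrow> real" where
  "hat_function n p = (THE \<psi>. is_hat_function n p \<psi>)"

text \<open>The definite description is meaningful: exactly one function has the defining property
  at each interior grid point (extended by zero to the whole plane).\<close>

lemma affine_eq_on_triangle:
  fixes f g :: "real^2 \<Rightarrow> real"
  assumes "\<And>x. x \<in> convex hull {a, b, c} \<Longrightarrow> f x = v \<bullet> x + w"
    and "\<And>x. x \<in> convex hull {a, b, c} \<Longrightarrow> g x = v' \<bullet> x + w'"
    and "f a = g a" "f b = g b" "f c = g c" and x: "x \<in> convex hull {a, b, c}"
  shows "f x = g x"
proof -
  have vert: "a \<in> convex hull {a, b, c}" "b \<in> convex hull {a, b, c}" "c \<in> convex hull {a, b, c}"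
    by (auto intro: hull_inc)
  obtain r s t where rst: "r + s + t = 1" "x = r *\<^sub>R a + s *\<^sub>R b + t *\<^sub>R c"
    using x unfolding convex_hull_3 by blast
  have w: "w = r * w + s * w + t * w" "w' = r * w' + s * w' + t * w'"
    using rst(1) by (metis distrib_right mult_1)+
  have "f x = r * f a + s * f b + t * f c"
    using assms(1)[OF x] assms(1)[OF vert(1)] assms(1)[OF vert(2)] assms(1)[OF vert(3)] w(1)
    by (simp add: rst(2) inner_add_right distrib_left)
  moreover have "g x = r * g a + s * g b + t * g c"
    using assms(2)[OF x] assms(2)[OF vert(1)] assms(2)[OF vert(2)] assms(2)[OF vert(3)] w(2)
    by (simp add: rst(2) inner_add_right distrib_left)
  ultimately show ?thesis using assms(3-5) by simp
qed

lemma grid_triangle_vertices: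
  assumes "1 \<le> i" "i \<le> n" "1 \<le> j" "j \<le> n"
    and "T \<in> grid_triangles (mesh_size n) (grid_point n (i, j))"
  obtains a b c where "{a, b, c} \<subseteq> grid n" "T = convex hull {a, b, c}"
proof -
  define p where "p = grid_point n (i, j)"
  define h where "h = mesh_size n"
  have g: "grid_point n (k, l) \<in> grid n" if "k \<le> n + 1" "l \<le> n + 1" for k l
    using that unfolding grid_def by auto
  have v: "p = grid_point n (i, j)"
     "p + h *\<^sub>R axis 1 1 = grid_point n (i + 1, j)"
     "p + h *\<^sub>R axis 2 1 = grid_point n (i, j + 1)"
     "p - h *\<^sub>R axis 1 1 = grid_point n (i - 1, j)"
     "p - h *\<^sub>R axis 2 1 = grid_point n (i, j - 1)"
     "p + h *\<^sub>R (axis 1 1 - axis 2 1) = grid_point n (i + 1, j - 1)"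
     "p + h *\<^sub>R (axis 2 1 - axis 1 1) = grid_point n (i - 1, j + 1)"
    using assms(1,3)
    by (auto simp: p_def h_def grid_point_def Finite_Cartesian_Product.vec_eq_iff forall_2 axis_def of_nat_diff algebra_simps)
  have "p \<in> grid n" "p + h *\<^sub>R axis 1 1 \<in> grid n" "p + h *\<^sub>R axis 2 1 \<in> grid n"
    "p - h *\<^sub>R axis 1 1 \<in> grid n" "p - h *\<^sub>R axis 2 1 \<in> grid n"
    "p + h *\<^sub>R (axis 1 1 - axis 2 1) \<in> grid n" "p + h *\<^sub>R (axis 2 1 - axis 1 1) \<in> grid n"
    using assms(1-4) unfolding v(2-7) unfolding v(1) by (auto intro!: g)
  then show thesis
    using assms(5) that unfolding grid_triangles_def Let_def p_def[symmetric] h_def[symmetric]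
    by (elim insertE emptyE) blast+
qed

lemma triangle_iff:
  fixes p a b :: "real^2"
  shows "x \<in> convex hull {p, p + a, p + b} \<longleftrightarrow>
    (\<exists>s t. 0 \<le> s \<and> 0 \<le> t \<and> s + t \<le> 1 \<and> x = p + s *\<^sub>R a + t *\<^sub>R b)"
  unfolding convex_hull_3_alt by (auto simp: algebra_simps)

lemma hat_function_ex1:
  assumes ij: "1 \<le> i" "i \<le> n" "1 \<le> j" "j \<le> n"
  shows "\<exists>!\<psi>. is_hat_function n (grid_point n (i, j)) \<psi>"
proof -
  define p where "p = grid_point n (i, j)"
  define h where "h = mesh_size n"
  have h: "h > 0" by (simp add: h_def mesh_size_def)
  define \<phi> where "\<phi> = (\<lambda>x::real^2. let a = (x$1 - p$1) / h; b = (x$2 - p$2) / h in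
     max 0 (1 - max (max \<bar>a\<bar> \<bar>b\<bar>) \<bar>a + b\<bar>))"
  have "is_hat_function n p \<phi>"
    unfolding is_hat_function_def h_def[symmetric]
  proof (intro conjI ballI allI impI)
    show "continuous_on UNIV \<phi>"
      using h unfolding \<phi>_def Let_def by (intro continuous_intros) auto
    show "\<phi> p = 1" by (simp add: \<phi>_def)
    have tri: "grid_triangles h p =
     {convex hull {p, p + h *\<^sub>R axis 1 1, p + h *\<^sub>R axis 2 1},
      convex hull {p, p + h *\<^sub>R axis 1 1, p + h *\<^sub>R (axis 1 1 - axis 2 1)},
      convex hull {p, p + h *\<^sub>R (axis 1 1 - axis 2 1), p + h *\<^sub>R (- axis 2 1)},
      convex hull {p, p + h *\<^sub>R (- axis 2 1), p + h *\<^sub>R (- axis 1 1)},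
      convex hull {p, p + h *\<^sub>R (- axis 1 1), p + h *\<^sub>R (axis 2 1 - axis 1 1)},
      convex hull {p, p + h *\<^sub>R (axis 2 1 - axis 1 1), p + h *\<^sub>R axis 2 1}}"
      by (simp add: grid_triangles_def Let_def)
    { fix x assume x: "x \<notin> \<Union> (grid_triangles h p)"
      define a where "a = (x$1 - p$1) / h"
      define b where "b = (x$2 - p$2) / h"
      have xab: "x$1 = p$1 + a * h" "x$2 = p$2 + b * h" using h by (auto simp: a_def b_def)
      have no: False if "0 \<le> s" "0 \<le> t" "s + t \<le> 1"
        and "a = s * u$1 + t * v$1" "b = s * u$2 + t * v$2"
        and "convex hull {p, p + h *\<^sub>R u, p + h *\<^sub>R v} \<in> grid_triangles h p" for s t u v
      proof -
        have "x = p + s *\<^sub>R (h *\<^sub>R u) + t *\<^sub>R (h *\<^sub>R v)"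
          using xab that(4,5)
          by (simp add: Finite_Cartesian_Product.vec_eq_iff forall_2 algebra_simps)
        then have "x \<in> convex hull {p, p + h *\<^sub>R u, p + h *\<^sub>R v}"
          using that(1-3) unfolding triangle_iff by blast
        then show False using x that(6) by blast
      qed
      have "\<not> (\<bar>a\<bar> \<le> 1 \<and> \<bar>b\<bar> \<le> 1 \<and> \<bar>a + b\<bar> \<le> 1)"
      proof
        assume ab: "\<bar>a\<bar> \<le> 1 \<and> \<bar>b\<bar> \<le> 1 \<and> \<bar>a + b\<bar> \<le> 1"
        consider "a \<ge> 0" "b \<ge> 0" | "a \<ge> 0" "b \<le> 0" "a + b \<ge> 0" | "a \<ge> 0" "b \<le> 0" "a + b \<le> 0"
          | "a \<le> 0" "b \<le> 0" | "a \<le> 0" "b \<ge> 0" "a + b \<le> 0" | "a \<le> 0" "b \<ge> 0" "a + b \<ge> 0"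
          by linarith
        then show False
        proof cases
          case 1
          show ?thesis
            by (rule no[of "a" "b" "axis 1 1" "axis 2 1"])
              (use ab 1 in \<open>simp_all add: axis_def tri\<close>)
        next
          case 2
          show ?thesis
            by (rule no[of "a + b" "- b" "axis 1 1" "axis 1 1 - axis 2 1"])
              (use ab 2 in \<open>simp_all add: axis_def tri\<close>)
        next
          case 3
          show ?thesis
            by (rule no[of "a" "- a - b" "axis 1 1 - axis 2 1" "- axis 2 1"])
              (use ab 3 in \<open>simp_all add: axis_def tri\<close>)
        next
          case 4
          show ?thesis
            by (rule no[of "- b" "- a" "- axis 2 1" "- axis 1 1"])
              (use ab 4 in \<open>simp_all add: axis_def tri\<close>)
        next
          case 5
          show ?thesis
            by (rule no[of "- a - b" "b" "- axis 1 1" "axis 2 1 - axis 1 1"])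
              (use ab 5 in \<open>simp_all add: axis_def tri\<close>)
        next
          case 6
          show ?thesis
            by (rule no[of "- a" "a + b" "axis 2 1 - axis 1 1" "axis 2 1"])
              (use ab 6 in \<open>simp_all add: axis_def tri\<close>)
        qed
      qed
      then have "1 \<le> max (max \<bar>a\<bar> \<bar>b\<bar>) \<bar>a + b\<bar>"
        unfolding le_max_iff_disj de_Morgan_conj not_le by (blast intro: less_imp_le)
      moreover have "\<phi> x = max 0 (1 - max (max \<bar>a\<bar> \<bar>b\<bar>) \<bar>a + b\<bar>)"
        by (simp only: \<phi>_def Let_def a_def b_def)
      ultimately show "\<phi> x = 0" by (simp only: max_absorb1 diff_le_0_iff_le) }
    have affine: "\<exists>v' w. \<forall>x \<in> convex hull {p, p + h *\<^sub>R u, p + h *\<^sub>R v}. \<phi> x = v' \<bullet> x + w"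
      if \<phi>_eq: "\<And>s t. 0 \<le> s \<Longrightarrow> 0 \<le> t \<Longrightarrow> s + t \<le> 1 \<Longrightarrow>
          max 0 (1 - max (max (abs (s * u$1 + t * v$1)) (abs (s * u$2 + t * v$2)))
            (abs (s * u$1 + t * v$1 + (s * u$2 + t * v$2))))
          = 1 + \<alpha> * (s * u$1 + t * v$1) + \<beta> * (s * u$2 + t * v$2)"
      for u v :: "real^2" and \<alpha> \<beta> :: real
    proof -
      define V :: "real^2" where "V = vector [\<alpha> / h, \<beta> / h]"
      have "\<phi> x = V \<bullet> x + (1 - V \<bullet> p)" if xT: "x \<in> convex hull {p, p + h *\<^sub>R u, p + h *\<^sub>R v}" for x
      proof -
        obtain s t where st: "0 \<le> s" "0 \<le> t" "s + t \<le> 1"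
          and x: "x = p + s *\<^sub>R (h *\<^sub>R u) + t *\<^sub>R (h *\<^sub>R v)"
          using xT unfolding triangle_iff by blast
        have "x$i - p$i = h * (s * u$i + t * v$i)" for i by (simp add: x algebra_simps)
        then have ab: "(x$1 - p$1) / h = s * u$1 + t * v$1" "(x$2 - p$2) / h = s * u$2 + t * v$2"
          using h by simp_all
        have "V \<bullet> x - V \<bullet> p = \<alpha> * ((x$1 - p$1) / h) + \<beta> * ((x$2 - p$2) / h)"
          by (simp add: V_def inner_vec_def sum_2 right_diff_distrib diff_divide_distrib)
        then have "V \<bullet> x + (1 - V \<bullet> p) = 1 + \<alpha> * (s * u$1 + t * v$1) + \<beta> * (s * u$2 + t * v$2)"
          unfolding ab by simp
        moreover have "\<phi> x = 1 + \<alpha> * (s * u$1 + t * v$1) + \<beta> * (s * u$2 + t * v$2)"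
          unfolding \<phi>_def Let_def ab by (rule \<phi>_eq[OF st])
        ultimately show ?thesis by simp
      qed
      then show ?thesis by (intro exI ballI)
    qed
    { fix T assume "T \<in> grid_triangles h p"
      then show "\<exists>v w. \<forall>x\<in>T. \<phi> x = v \<bullet> x + w"
        unfolding tri
        apply (elim insertE emptyE; hypsubst)
        subgoal by (rule affine[of _ _ "-1" "-1"]) (auto simp: axis_def max_def)
        subgoal by (rule affine[of _ _ "-1" 0]) (auto simp: axis_def max_def)
        subgoal by (rule affine[of _ _ 0 1]) (auto simp: axis_def max_def)
        subgoal by (rule affine[of _ _ 1 1]) (auto simp: axis_def max_def)
        subgoal by (rule affine[of _ _ 1 0]) (auto simp: axis_def max_def)
        subgoal by (rule affine[of _ _ 0 "-1"]) (auto simp: axis_def max_def)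
        done }
    { fix q assume "q \<in> grid n - {p}"
      then obtain k l where q: "q = grid_point n (k, l)" and "(k, l) \<noteq> (i, j)"
        unfolding grid_def p_def by auto
      then have kl: "\<bar>real k - real i\<bar> \<ge> 1 \<or> \<bar>real l - real j\<bar> \<ge> 1" by auto
      have ab: "(q$1 - p$1) / h = real k - real i" "(q$2 - p$2) / h = real l - real j"
        using h by (simp_all add: q p_def grid_point_def h_def[symmetric] field_simps)
      have "1 \<le> max (max (abs (real k - real i)) (abs (real l - real j)))
          (abs (real k - real i + (real l - real j)))"
        using kl unfolding le_max_iff_disj by blast
      then show "\<phi> q = 0"
        by (simp only: \<phi>_def Let_def ab max_absorb1 diff_le_0_iff_le) }
  qed
  moreover have "\<psi> = \<phi>" if hats: "is_hat_function n p \<psi>" "is_hat_function n p \<phi>" for \<psi> \<phi>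
  proof
    fix x
    have gr: "\<psi> q = \<phi> q" if "q \<in> grid n" for q
      using \<open>is_hat_function n p \<psi>\<close> \<open>is_hat_function n p \<phi>\<close> that
      unfolding is_hat_function_def by (cases "q = p") auto
    show "\<psi> x = \<phi> x"
    proof (cases "x \<in> \<Union> (grid_triangles h p)")
      case False
      then show ?thesis using hats unfolding is_hat_function_def h_def by metis
    next
      case True
      then obtain T where T: "T \<in> grid_triangles h p" "x \<in> T" by blast
      obtain a b c where abc: "{a, b, c} \<subseteq> grid n" "T = convex hull {a, b, c}"
        using grid_triangle_vertices[OF ij T(1)[unfolded p_def h_def]] by blast
      obtain v w v' w' where "\<forall>x\<in>T. \<psi> x = v \<bullet> x + w" "\<forall>x\<in>T. \<phi> x = v' \<bullet> x + w'"
        using hats T(1) unfolding is_hat_function_def h_def by meson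
      then show ?thesis
        using affine_eq_on_triangle[of a b c \<psi> v w \<phi> v' w' x] gr abc T(2) by auto
    qed
  qed
  ultimately show ?thesis unfolding p_def by blast
qed

text \<open>Where \<open>g\<close> is not differentiable, \<open>grad g\<close> is unspecified; for the hat functions this
  happens only on a set of measure zero.\<close>

definition grad :: "(real^2 \<Rightarrow> real) \<Rightarrow> real^2 \<Rightarrow> real^2" where
  "grad g x = (THE D. GDERIV g x :> D)"

definition complex_vector :: "real^2 \<Rightarrow> complex^2" where
  "complex_vector u = (\<chi> i. of_real (u$i))"

text \<open>\<open>bilinear_mult u M v\<close> is \<open>u\<^sup>T M v\<close> and \<open>dot_mult u v\<close> is \<open>u\<^sup>T v\<close>, both without
  complex conjugation.\<close>

definition dot_mult :: "complex^2 \<Rightarrow> complex^2 \<Rightarrow> complex" where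
  "dot_mult u v = (\<Sum>i\<in>UNIV. u$i * v$i)"

definition bilinear_mult :: "complex^2 \<Rightarrow> complex^2^2 \<Rightarrow> complex^2 \<Rightarrow> complex" where
  "bilinear_mult u M v = dot_mult u (M *v v)"

text \<open>The row index \<open>r\<close> belongs to the test function at \<open>q\<close>, the column index \<open>s\<close> to the trial
  function at \<open>p\<close>.\<close>

definition stiffness_matrix ::
  "(real^2 \<Rightarrow> complex^2^2) \<Rightarrow> (real^2 \<Rightarrow> complex^2) \<Rightarrow> (real^2 \<Rightarrow> complex) \<Rightarrow> nat \<Rightarrow> complex Matrix.mat"
where
  "stiffness_matrix A b c n = Matrix.mat (n\<^sup>2) (n\<^sup>2) (\<lambda>(r, s).
     let \<psi>q = hat_function n (grid_point n (lex_index n r));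
         \<psi>p = hat_function n (grid_point n (lex_index n s))
     in LINT x|lebesgue_on open_unit_square.
          bilinear_mult (complex_vector (grad \<psi>p x)) (A x) (complex_vector (grad \<psi>q x))
          + dot_mult (complex_vector (grad \<psi>p x)) (b x) * of_real (\<psi>q x)
          + c x * of_real (\<psi>p x) * of_real (\<psi>q x))"

text \<open>In \<open>P1_symbol\<close>, \<open>Q i j\<close> is \<open>B\<^sub>i A(x) B\<^sub>j\<^sup>T\<close> for the rows of the matrix below; a
  coefficient name such as \<open>r1m1\<close> stands for the index \<open>(1, -1)\<close>.\<close>

definition B_matrix :: "complex^2^3" where
  "B_matrix = vector [vector [1, 1], vector [1, 0], vector [0, 1]]"

definition P1_symbol :: "(real^2 \<Rightarrow> complex^2^2) \<Rightarrow> (real^2) \<times> (real^2) \<Rightarrow> complex" where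
  "P1_symbol A = (\<lambda>(x, \<theta>).
     let Q = (\<lambda>i j. bilinear_mult (B_matrix $ i) (A x) (B_matrix $ j));
         r00 = Q 1 1 + Q 2 2 + Q 3 3;
         r01 = - (1/2) * Q 3 1 - (1/2) * Q 1 3; r0m1 = r01;
         r1m1 = (1/2) * Q 2 3 + (1/2) * Q 3 2; rm11 = r1m1;
         rm10 = - (1/2) * Q 1 2 - (1/2) * Q 2 1; r10 = rm10;
         \<theta>1 = complex_of_real (\<theta>$1); \<theta>2 = complex_of_real (\<theta>$2)
     in r00 + r01 * exp (- \<i> * \<theta>2) + r10 * exp (- \<i> * \<theta>1)
        + rm10 * exp (\<i> * \<theta>1) + r0m1 * exp (\<i> * \<theta>2)
        + r1m1 * exp (- \<i> * \<theta>1 + \<i> * \<theta>2) + rm11 * exp (\<i> * \<theta>1 - \<i> * \<theta>2))"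

definition hermitian_matrix :: "complex^2^2 \<Rightarrow> bool" where
  "hermitian_matrix M \<longleftrightarrow> (\<forall>i j. M$i$j = cnj (M$j$i))"

end

theory Submission
  imports Defs "Jordan_Normal_Form.Schur_Decomposition"
begin

text \<open>The second order term contributes to the entries of the stiffness matrix quantities of order one, the
  first and zeroth order terms only \<open>O(1/n)\<close> in the mean. For a polynomial coefficient matrix \<open>A'\<close> the
  second order part agrees, up to an error that is small in the entrywise \<open>l\<^sup>1\<close> norm relative to \<open>n\<^sup>2\<close>,
  with the sampled Toeplitz matrix of the stencil of \<open>A'\<close>, whose generating function is the symbol. The map from
  \<open>L\<^sup>1\<close> coefficients to entries is bounded for these norms, so density of polynomials in \<open>L\<^sup>1\<close> covers all
  coefficients, and a matrix with small entrywise \<open>l\<^sup>1\<close> norm is the sum of a matrix of small spectral norm and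
  one of small rank. This is the GLT property.

  If \<open>A\<close> is Hermitian, the second order part \<open>X\<close> is Hermitian and the remainder \<open>Y\<close> has Frobenius norm
  \<open>o(n)\<close>, so the diagonal of a unitary Schur form of \<open>X + Y\<close> is close to the spectrum of \<open>X\<close> in
  quadratic mean. Two Hermitian matrices that are close in the entrywise \<open>l\<^sup>1\<close> norm have close resolvents and
  hence close spectra in the mean. This allows one to replace \<open>X\<close> by a block circulant matrix with explicit
  eigenvalues, the values of the symbol at the points of a grid in the unit square times the frequency square,
  and the averages of test functions become Riemann sums.\<close>

no_notation vec_index (infixl \<open>$\<close> 100)
no_notation scalar_prod (infix \<open>\<bullet>\<close> 70)
hide_const (open) Matrix.mat Matrix.vec Matrix.row Matrix.col Matrix.transpose_mat

section \<open>Unitary triangularisation\<close>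

text \<open>The coefficients are only L^1, so replacing them by polynomials is controlled in the sum
  of the moduli of the entries, while neither the symbol nor the norms of the matrices are bounded.
  For Hermitian matrices this control is enough: the squared Frobenius distance of two resolvents is
  a pairing of the difference of the matrices with a matrix whose entries have modulus at most 2,
  however large the eigenvalues are. The lower order terms destroy normality, so resolvents of real
  spectra are of no use for them, and a bound in Frobenius norm is required. It comes from
  interpolation: the sum of their moduli is O(n), and their largest entry is o(n) because an
  integrable function has uniformly small mass on small squares. The block length N of the circulant
  comparison is fixed first and \<open>n\<close> tends to infinity afterwards.\<close>

definition conj_transpose :: "complex Matrix.mat \<Rightarrow> complex Matrix.mat" where
  "conj_transpose M = Matrix.mat (dim_col M) (dim_row M) (\<lambda>(i, j). cnj (M $$ (j, i)))"

lemma conj_transpose_carrier [simp]: "M \<in> carrier_mat n m \<Longrightarrow> conj_transpose M \<in> carrier_mat m n"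
  by (simp add: conj_transpose_def)

lemma index_mult_mat_sum:
  assumes "M \<in> carrier_mat n m" "N \<in> carrier_mat m k" "i < n" "j < k"
  shows "(M * N) $$ (i, j) = (\<Sum>l<m. M $$ (i, l) * N $$ (l, j))"
  using assms by (simp add: scalar_prod_def atLeast0LessThan)

lemma conj_transpose_mult:
  assumes "M \<in> carrier_mat n m" "N \<in> carrier_mat m l"
  shows "conj_transpose (M * N) = conj_transpose N * conj_transpose M"
  using assms
  by (intro eq_matI) (auto simp: conj_transpose_def scalar_prod_def mult.commute)

lemma conj_transpose_block:
  assumes "P \<in> carrier_mat n n"
  shows "conj_transpose (four_block_mat (1\<^sub>m 1) (0\<^sub>m 1 n) (0\<^sub>m n 1) P)
       = four_block_mat (1\<^sub>m 1) (0\<^sub>m 1 n) (0\<^sub>m n 1) (conj_transpose P)"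
  using assms by (intro eq_matI) (auto simp: conj_transpose_def four_block_mat_def Let_def)

text \<open>Gram-Schmidt on a basis headed by the eigenvector keeps that vector in front. After
  normalising the columns, \<open>A\<close> maps the first column of \<open>W\<close> to
  \<open>e\<close> times itself, so the first column of W^H A W is \<open>e\<close> times that of
  W^H W.\<close>

lemma eigenvector_extends_to_unitary:
  assumes A: "(A :: complex Matrix.mat) \<in> carrier_mat n n" and e: "eigenvalue A e"
  obtains W where "W \<in> carrier_mat n n" "conj_transpose W * W = 1\<^sub>m n"
    "\<And>i. i < n \<Longrightarrow> (conj_transpose W * A * W) $$ (i, 0) = (if i = 0 then e else 0)"
proof -
  obtain v where "eigenvector A v e" using e unfolding eigenvalue_def by auto
  then have v: "v \<in> carrier_vec n" "v \<noteq> 0\<^sub>v n" "A *\<^sub>v v = e \<cdot>\<^sub>v v"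
    using A unfolding eigenvector_def by auto
  interpret cof_vec_space n "TYPE(complex)" .
  define b where "b = basis_completion v"
  define ws where "ws = gram_schmidt n b"
  from basis_completion[OF v(1,2), folded b_def]
  have dist_b: "distinct b" and indep: "\<not> lin_dep (set b)" and b: "set b \<subseteq> carrier_vec n"
    and hdb: "hd b = v" and len_b: "length b = n" by auto
  have n: "n > 0" using v(1,2) by (cases n) auto
  then obtain vs where bv: "b = v # vs" using hdb len_b by (cases b) auto
  from gram_schmidt_result[OF b dist_b indep refl, folded ws_def]
  have ws: "set ws \<subseteq> carrier_vec n" "corthogonal ws" "length ws = n" by (auto simp: len_b)
  have ws0: "ws ! 0 = v"
    using gram_schmidt_hd[OF v(1), of vs, folded bv] ws(3) n unfolding ws_def
    by (cases "gram_schmidt n b") auto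
  have wsc: "ws ! j \<in> carrier_vec n" if "j < n" for j using ws(1,3) that by auto
  \<comment> \<open>The orthogonal family is not normalised; \<open>q j\<close> is the squared
    length to be divided out.\<close>
  define q where "q j = (\<Sum>l<n. (cmod (vec_index (ws ! j) l))\<^sup>2)" for j
  have ip: "(\<Sum>l<n. vec_index (ws ! i) l * cnj (vec_index (ws ! j) l)) = (if i = j then of_real (q j) else 0)"
    and q0: "i = j \<Longrightarrow> q j \<noteq> 0" if "i < n" "j < n" for i j
  proof -
    have 1: "(ws ! i) \<bullet>c (ws ! j) = (\<Sum>l<n. vec_index (ws ! i) l * cnj (vec_index (ws ! j) l))"
      using wsc[OF that(1)] wsc[OF that(2)] by (simp add: scalar_prod_def atLeast0LessThan)
    have 2: "(\<Sum>l<n. vec_index (ws ! j) l * cnj (vec_index (ws ! j) l)) = of_real (q j)"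
      unfolding q_def of_real_sum complex_norm_square ..
    show "(\<Sum>l<n. vec_index (ws ! i) l * cnj (vec_index (ws ! j) l)) = (if i = j then of_real (q j) else 0)"
      using corthogonalD[OF ws(2), of i j] that ws(3) 2 unfolding 1 by auto
    show "q j \<noteq> 0" if "i = j"
      using corthogonalD[OF ws(2), of i j] \<open>i < n\<close> \<open>j < n\<close> ws(3) 2 that unfolding 1 by auto
  qed
  have q_pos: "q j > 0" if "j < n" for j
    using q0[OF that that] by (simp add: q_def less_le sum_nonneg)
  define W where "W = Matrix.mat n n (\<lambda>(i, j). vec_index (ws ! j) i / of_real (sqrt (q j)))"
  have W: "W \<in> carrier_mat n n" by (simp add: W_def)
  have WW: "conj_transpose W * W = 1\<^sub>m n"
  proof (rule eq_matI)
    fix i j assume "i < dim_row (1\<^sub>m n :: complex Matrix.mat)" "j < dim_col (1\<^sub>m n :: complex Matrix.mat)"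
    then have ij: "i < n" "j < n" by auto
    have "(conj_transpose W * W) $$ (i, j)
       = (\<Sum>l<n. vec_index (ws ! j) l * cnj (vec_index (ws ! i) l)) / (of_real (sqrt (q i)) * of_real (sqrt (q j)))"
      using ij by (simp add: W_def conj_transpose_def scalar_prod_def atLeast0LessThan sum_divide_distrib mult_ac)
    then show "(conj_transpose W * W) $$ (i, j) = 1\<^sub>m n $$ (i, j)"
      using ij q_pos[OF ij(1)] ip[OF ij(2,1)] by (auto simp flip: of_real_mult)
  qed (auto simp: W_def conj_transpose_def)
  have AW: "(A * W) $$ (i, 0) = e * W $$ (i, 0)" if i: "i < n" for i
  proof -
    have "(A * W) $$ (i, 0) = (\<Sum>l<n. A $$ (i, l) * vec_index v l) / of_real (sqrt (q 0))"
      using i n A by (simp add: W_def scalar_prod_def atLeast0LessThan sum_divide_distrib ws0)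
    also have "(\<Sum>l<n. A $$ (i, l) * vec_index v l) = vec_index (A *\<^sub>v v) i"
      using i A v(1) by (simp add: scalar_prod_def atLeast0LessThan)
    also have "\<dots> = e * vec_index v i" using i v by simp
    finally show ?thesis using i n by (simp add: W_def ws0)
  qed
  have "(conj_transpose W * A * W) $$ (i, 0) = (if i = 0 then e else 0)" if i: "i < n" for i
  proof -
    have "conj_transpose W * A * W = conj_transpose W * (A * W)"
      by (rule assoc_mult_mat[OF conj_transpose_carrier[OF W] A W])
    also have "\<dots> $$ (i, 0) = (\<Sum>l<n. conj_transpose W $$ (i, l) * (A * W) $$ (l, 0))"
      by (rule index_mult_mat_sum[OF conj_transpose_carrier[OF W] mult_carrier_mat[OF A W] i n])
    also have "\<dots> = e * (\<Sum>l<n. conj_transpose W $$ (i, l) * W $$ (l, 0))"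
      by (simp add: AW sum_distrib_left mult_ac)
    also have "(\<Sum>l<n. conj_transpose W $$ (i, l) * W $$ (l, 0)) = (conj_transpose W * W) $$ (i, 0)"
      using i n W by (simp add: scalar_prod_def atLeast0LessThan conj_transpose_def)
    also have "\<dots> = of_bool (i = 0)" unfolding WW using i n by simp
    finally show ?thesis by simp
  qed
  then show thesis using that W WW by blast
qed

text \<open>Deflation along the list of roots: once an eigenvalue is split off, the trailing block
  has the characteristic polynomial with that factor cancelled, so the diagonal appears in the
  prescribed order \<open>es\<close>. Unitarity of the similarity is what later keeps Frobenius
  norms invariant.\<close>

theorem unitary_schur:
  assumes "(A :: complex Matrix.mat) \<in> carrier_mat n n" "char_poly A = (\<Prod>e\<leftarrow>es. [:- e, 1:])"
  shows "\<exists>B P. similar_mat_wit A B P (conj_transpose P) \<and> upper_triangular B \<and> diag_mat B = es"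
  using assms
proof (induction es arbitrary: n A)
  case Nil
  then have "similar_mat_wit A A (1\<^sub>m n) (1\<^sub>m n)" "n = 0"
    using degree_monic_char_poly[of A n] by (auto intro: similar_mat_wit_refl)
  moreover have "conj_transpose (1\<^sub>m n) = 1\<^sub>m n"
    by (intro eq_matI) (auto simp: conj_transpose_def)
  ultimately show ?case using Nil by (intro exI[of _ A] exI[of _ "1\<^sub>m n"]) (auto simp: diag_mat_def)
next
  case (Cons e es n A)
  note A = Cons.prems(1)
  have e: "eigenvalue A e"
    unfolding eigenvalue_root_char_poly[OF A] Cons.prems(2) by simp
  obtain W where W: "W \<in> carrier_mat n n" "conj_transpose W * W = 1\<^sub>m n"
    "\<And>i. i < n \<Longrightarrow> (conj_transpose W * A * W) $$ (i, 0) = (if i = 0 then e else 0)"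
    using eigenvector_extends_to_unitary[OF A e] by metis
  have deg: "degree (char_poly A) = Suc (degree (\<Prod>e\<leftarrow>es. [:- e, 1:]))"
  proof -
    have "monic (\<Prod>e\<leftarrow>es. [:- e, 1:])" by (rule monic_prod_list) auto
    then have "(\<Prod>e\<leftarrow>es. [:- e, 1:]) \<noteq> 0" by auto
    then show ?thesis by (simp add: Cons.prems(2) degree_mult_eq del: mult_pCons_left)
  qed
  obtain m where n: "n = Suc m" using degree_monic_char_poly[OF A, THEN conjunct1] deg by (metis)
  define W' where "W' = conj_transpose W"
  have W': "W' \<in> carrier_mat n n" "W' * W = 1\<^sub>m n" "W * W' = 1\<^sub>m n"
    using W mat_mult_left_right_inverse[of W' n W] by (auto simp: W'_def)
  define A' where "A' = W' * A * W"
  have A': "A' \<in> carrier_mat n n" using W W' A by (auto simp: A'_def)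
  have "similar_mat_wit A' A W' W"
    by (rule similar_mat_witI[OF W'(2,3) A'_def A' A W'(1) W(1)])
  then have sim: "similar_mat_wit A A' W W'" by (rule similar_mat_wit_sym)
  define A1 where "A1 = Matrix.mat 1 1 (\<lambda>_. e)"
  define A2 where "A2 = Matrix.mat 1 m (\<lambda>(i, j). A' $$ (0, Suc j))"
  define A3 where "A3 = Matrix.mat m m (\<lambda>(i, j). A' $$ (Suc i, Suc j))"
  have cr: "A1 \<in> carrier_mat 1 1" "A2 \<in> carrier_mat 1 m" "A3 \<in> carrier_mat m m"
    by (auto simp: A1_def A2_def A3_def)
  have block: "A' = four_block_mat A1 A2 (0\<^sub>m m 1) A3"
  proof (rule eq_matI)
    fix i j assume "i < dim_row (four_block_mat A1 A2 (0\<^sub>m m 1) A3)" "j < dim_col (four_block_mat A1 A2 (0\<^sub>m m 1) A3)"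
    then have ij: "i < Suc m" "j < Suc m" by (auto simp: A1_def A3_def)
    have A'0: "A' $$ (i, 0) = (if i = 0 then e else 0)"
      unfolding A'_def W'_def using W(3)[of i] ij(1) n by blast
    show "A' $$ (i, j) = four_block_mat A1 A2 (0\<^sub>m m 1) A3 $$ (i, j)"
      using ij A'0 by (cases i; cases j) (auto simp: A1_def A2_def A3_def)
  qed (use A' n in \<open>auto simp: A1_def A3_def\<close>)
  have cp1: "char_poly A1 = [:- e, 1:]"
    by (simp add: A1_def char_poly_defs det_def sign_def)
  have "char_poly A = char_poly A1 * char_poly A3"
    using char_poly_similar[of A A'] sim char_poly_four_block_zeros_col[OF cr] block
    unfolding similar_mat_def by metis
  then have "[:- e, 1:] * char_poly A3 = [:- e, 1:] * (\<Prod>e\<leftarrow>es. [:- e, 1:])"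
    using Cons.prems(2) unfolding cp1 by (simp only: list.map prod_list.Cons)
  then have "char_poly A3 = (\<Prod>e\<leftarrow>es. [:- e, 1:])"
    by (subst (asm) mult_left_cancel) auto
  from Cons.IH[OF cr(3) this] obtain B P where IH: "similar_mat_wit A3 B P (conj_transpose P)"
    "upper_triangular B" "diag_mat B = es" by blast
  from similar_mat_witD2[OF cr(3) IH(1)] have B: "B \<in> carrier_mat m m" and P: "P \<in> carrier_mat m m"
    and PP: "P * conj_transpose P = 1\<^sub>m m" by auto
  define P' where "P' = four_block_mat (1\<^sub>m 1) (0\<^sub>m 1 m) (0\<^sub>m m 1) P"
  define C where "C = four_block_mat A1 (A2 * P) (0\<^sub>m m 1) B"
  have P': "P' \<in> carrier_mat n n" using P n by (auto simp: P'_def)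
  \<comment> \<open>The rule for block similarity wants the off-diagonal blocks as products with the
    outer factors; multiplying \<open>A2\<close> by \<open>P\<close> and back brings it to that
    shape.\<close>
  have eq1: "A2 = 1\<^sub>m 1 * (A2 * P) * conj_transpose P"
    using cr(2) P PP by (simp add: assoc_mult_mat[of A2 1 m P m _ m])
  have eq2: "0\<^sub>m m 1 = P * 0\<^sub>m m 1 * 1\<^sub>m 1" using P by auto
  have "similar_mat_wit A' C P' (conj_transpose P')"
    unfolding block C_def P'_def conj_transpose_block[OF P]
    by (rule similar_mat_wit_four_block[OF similar_mat_wit_refl[OF cr(1)] IH(1) eq1 eq2 cr(1,3)]) (simp_all add: mult_carrier_mat[OF cr(2) P] del: One_nat_def)
  from similar_mat_wit_trans[OF sim this]
  have "similar_mat_wit A C (W * P') (conj_transpose (W * P'))"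
    unfolding conj_transpose_mult[OF W(1) P'] W'_def .
  moreover have "upper_triangular C" unfolding C_def
    by (intro upper_triangular_four_block[OF _ B _ IH(2)]) (auto simp: A1_def)
  moreover have "diag_mat C = e # es"
    unfolding C_def diag_four_block_mat[OF cr(1) B] IH(3) by (simp add: A1_def diag_mat_def)
  ultimately show ?case by blast
qed

section \<open>Comparing two unitary eigenbases\<close>

text \<open>Matrices are bare functions of two indices here: sums can be exchanged and reindexed
  freely, and blocks or lexicographic pairs need no change of type.\<close>

definition unitary_on :: "nat \<Rightarrow> (nat \<Rightarrow> nat \<Rightarrow> complex) \<Rightarrow> bool" where
  "unitary_on d U \<longleftrightarrow>
     (\<forall>i<d. \<forall>j<d. (\<Sum>l<d. U l i * cnj (U l j)) = of_bool (i = j)) \<and>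
     (\<forall>i<d. \<forall>j<d. (\<Sum>l<d. U i l * cnj (U j l)) = of_bool (i = j))"

lemma unitary_on_cnj: "unitary_on d U \<Longrightarrow> unitary_on d (\<lambda>i j. cnj (U i j))"
  unfolding unitary_on_def by (simp add: mult.commute)

lemma unitary_on_transpose: "unitary_on d U \<Longrightarrow> unitary_on d (\<lambda>i j. U j i)"
  unfolding unitary_on_def by auto

lemma of_real_sum_cmod_square: "complex_of_real (\<Sum>i\<in>I. (cmod (f i))\<^sup>2) = (\<Sum>i\<in>I. f i * cnj (f i))"
  by (simp only: of_real_sum complex_norm_square)

text \<open>Mind the index order: the vector is multiplied by the transpose of \<open>U\<close>. The
  other variants follow through \<open>unitary_on_cnj\<close> and
  \<open>unitary_on_transpose\<close>.\<close>

lemma unitary_on_parseval: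
  assumes "unitary_on d U"
  shows "(\<Sum>i<d. (cmod (\<Sum>l<d. U l i * f l))\<^sup>2) = (\<Sum>l<d. (cmod (f l))\<^sup>2)"
proof -
  have "complex_of_real (\<Sum>i<d. (cmod (\<Sum>l<d. U l i * f l))\<^sup>2)
      = (\<Sum>i<d. (\<Sum>l<d. U l i * f l) * (\<Sum>m<d. cnj (U m i) * cnj (f m)))"
    by (simp only: of_real_sum_cmod_square cnj_sum complex_cnj_mult)
  also have "\<dots> = (\<Sum>i<d. \<Sum>l<d. \<Sum>m<d. (f l * cnj (f m)) * (U l i * cnj (U m i)))"
    by (simp only: sum_product mult_ac)
  also have "\<dots> = (\<Sum>l<d. \<Sum>m<d. \<Sum>i<d. (f l * cnj (f m)) * (U l i * cnj (U m i)))"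
    by (subst sum.swap) (rule sum.cong[OF refl], rule sum.swap)
  also have "\<dots> = (\<Sum>l<d. \<Sum>m<d. (f l * cnj (f m)) * of_bool (l = m))"
    using assms by (simp add: unitary_on_def flip: sum_distrib_left)
  also have "\<dots> = complex_of_real (\<Sum>l<d. (cmod (f l))\<^sup>2)"
    unfolding of_real_sum_cmod_square by simp
  finally show ?thesis using of_real_eq_iff by blast
qed

lemma unitary_on_column: "unitary_on d U \<Longrightarrow> i < d \<Longrightarrow> (\<Sum>l<d. (cmod (U l i))\<^sup>2) = 1"
proof -
  assume *: "unitary_on d U" "i < d"
  have "complex_of_real (\<Sum>l<d. (cmod (U l i))\<^sup>2) = 1"
    using * unfolding of_real_sum_cmod_square by (simp add: unitary_on_def)
  then show ?thesis using of_real_eq_1_iff by blast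
qed

lemma abs_sum_product_le:
  fixes f h :: "nat \<Rightarrow> complex"
  assumes "(\<Sum>i<d. (cmod (f i))\<^sup>2) \<le> 1" "(\<Sum>i<d. (cmod (h i))\<^sup>2) \<le> 1"
  shows "cmod (\<Sum>i<d. f i * h i) \<le> 1"
proof -
  have "cmod (\<Sum>i<d. f i * h i) \<le> (\<Sum>i<d. cmod (f i) * cmod (h i))"
    by (rule order_trans[OF norm_sum]) (simp add: norm_mult)
  also have "\<dots> \<le> L2_set (\<lambda>i. cmod (f i)) {..<d} * L2_set (\<lambda>i. cmod (h i)) {..<d}"
    using L2_set_mult_ineq[of "\<lambda>i. cmod (f i)" "\<lambda>i. cmod (h i)" "{..<d}"] by simp
  also have "\<dots> \<le> 1 * 1"
    using assms by (intro mult_mono) (auto simp: L2_set_def sum_nonneg)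
  finally show ?thesis by simp
qed

text \<open>The numbers \<open>|W i j|\<^sup>2\<close> below form a doubly stochastic matrix, that is, a coupling of the spectra
  \<open>g\<close> and \<open>x\<close>; the cost of this coupling is controlled by the entries of the difference \<open>E\<close>.\<close>

locale two_bases =
  fixes d :: nat and U V :: "nat \<Rightarrow> nat \<Rightarrow> complex" and g x :: "nat \<Rightarrow> complex"
  assumes U: "unitary_on d U" and V: "unitary_on d V"
begin

text \<open>The matrix U^H V of inner products between the two bases.\<close>

definition W where "W i j = (\<Sum>l<d. cnj (U l i) * V l j)"

text \<open>U diag(g) U^H - V diag(x) V^H, the difference of two normal matrices given by their
  spectral decompositions.\<close>

definition E where
  "E a b = (\<Sum>i<d. U a i * g i * cnj (U b i)) - (\<Sum>j<d. V a j * x j * cnj (V b j))"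

lemma W_row: "i < d \<Longrightarrow> (\<Sum>j<d. (cmod (W i j))\<^sup>2) = 1"
  using unitary_on_parseval[OF V, of "\<lambda>l. cnj (U l i)"] unitary_on_column[OF U, of i]
  by (simp add: W_def mult.commute)

lemma W_column: "j < d \<Longrightarrow> (\<Sum>i<d. (cmod (W i j))\<^sup>2) = 1"
  using unitary_on_parseval[OF unitary_on_cnj[OF U], of "\<lambda>l. V l j"] unitary_on_column[OF V, of j]
  by (simp add: W_def)

text \<open>Row and column sums equal to one allow the sums over both spectra to be written over
  pairs (i, j) with the same weights, so a bound on single differences is integrated against the
  coupling.\<close>

lemma W_sum_le:
  assumes "\<And>i j. i < d \<Longrightarrow> j < d \<Longrightarrow> cmod (F (g i) - F (x j)) \<le> \<epsilon> + C * D i j"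
  shows "cmod ((\<Sum>i<d. F (g i)) - (\<Sum>j<d. F (x j)))
    \<le> \<epsilon> * real d + C * (\<Sum>i<d. \<Sum>j<d. (cmod (W i j))\<^sup>2 * D i j)"
proof -
  have 1: "(\<Sum>i<d. F (g i)) = (\<Sum>i<d. \<Sum>j<d. of_real ((cmod (W i j))\<^sup>2) * F (g i))"
    unfolding sum_distrib_right[symmetric] of_real_sum[symmetric] by (simp add: W_row)
  have 2: "(\<Sum>j<d. F (x j)) = (\<Sum>i<d. \<Sum>j<d. of_real ((cmod (W i j))\<^sup>2) * F (x j))"
    apply (subst sum.swap) unfolding sum_distrib_right[symmetric] of_real_sum[symmetric]
    by (simp add: W_column)
  have "cmod ((\<Sum>i<d. F (g i)) - (\<Sum>j<d. F (x j)))
      = cmod (\<Sum>i<d. \<Sum>j<d. of_real ((cmod (W i j))\<^sup>2) * (F (g i) - F (x j)))"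
    unfolding 1 2 by (simp add: sum_subtractf right_diff_distrib)
  also have "\<dots> \<le> (\<Sum>i<d. \<Sum>j<d. (cmod (W i j))\<^sup>2 * cmod (F (g i) - F (x j)))"
    by (intro order_trans[OF norm_sum] sum_mono) (simp add: norm_mult norm_power)
  also have "\<dots> \<le> (\<Sum>i<d. \<Sum>j<d. (cmod (W i j))\<^sup>2 * (\<epsilon> + C * D i j))"
    using assms by (intro sum_mono mult_left_mono) auto
  also have "\<dots> = (\<Sum>i<d. \<epsilon> * (\<Sum>j<d. (cmod (W i j))\<^sup>2)) + C * (\<Sum>i<d. \<Sum>j<d. (cmod (W i j))\<^sup>2 * D i j)"
    by (simp add: algebra_simps sum.distrib sum_distrib_left)
  also have "(\<Sum>i<d. \<epsilon> * (\<Sum>j<d. (cmod (W i j))\<^sup>2)) = \<epsilon> * real d"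
    using W_row by simp
  finally show ?thesis .
qed

lemma E_V: 
  assumes "j < d"
  shows "(\<Sum>b<d. E a b * V b j) = (\<Sum>i<d. U a i * g i * W i j) - V a j * x j"
proof -
  have "(\<Sum>b<d. (\<Sum>i<d. U a i * g i * cnj (U b i)) * V b j)
      = (\<Sum>i<d. U a i * g i * W i j)"
    unfolding W_def sum_distrib_left sum_distrib_right by (subst sum.swap) (simp add: mult_ac)
  moreover have "(\<Sum>b<d. (\<Sum>i<d. V a i * x i * cnj (V b i)) * V b j)
      = (\<Sum>i<d. V a i * x i * (\<Sum>b<d. V b j * cnj (V b i)))"
    unfolding sum_distrib_left sum_distrib_right by (subst sum.swap) (simp add: mult_ac)
  moreover have "\<dots> = (\<Sum>i<d. V a i * x i * of_bool (j = i))"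
    using V assms by (simp add: unitary_on_def)
  ultimately show ?thesis 
    using assms by (simp add: E_def left_diff_distrib sum_subtractf)
qed

text \<open>In the two eigenbases the difference of the matrices becomes the difference of the
  eigenvalues times the overlap. Both cost estimates rest on this identity.\<close>

lemma U_E_V:
  assumes "i < d" "j < d"
  shows "(\<Sum>a<d. cnj (U a i) * (\<Sum>b<d. E a b * V b j)) = (g i - x j) * W i j"
proof -
  have "(\<Sum>a<d. cnj (U a i) * ((\<Sum>i'<d. U a i' * g i' * W i' j) - V a j * x j))
      = (\<Sum>a<d. cnj (U a i) * (\<Sum>i'<d. U a i' * g i' * W i' j)) - x j * W i j"
    by (simp add: W_def right_diff_distrib sum_subtractf sum_distrib_left mult_ac)
  moreover have "(\<Sum>a<d. cnj (U a i) * (\<Sum>i'<d. U a i' * g i' * W i' j))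
      = (\<Sum>i'<d. g i' * W i' j * (\<Sum>a<d. U a i' * cnj (U a i)))"
    unfolding sum_distrib_left by (subst sum.swap) (simp add: mult_ac)
  moreover have "\<dots> = (\<Sum>i'<d. g i' * W i' j * of_bool (i' = i))"
    using U assms by (simp add: unitary_on_def)
  moreover have "\<dots> = g i * W i j"
    using assms by simp
  ultimately show ?thesis
    unfolding E_V[OF assms(2)] by (simp add: left_diff_distrib)
qed

text \<open>The computation behind the Hoffman-Wielandt inequality: U^H E V has the entries
  \<open>(g i - x j) * W i j\<close>, and unitary factors preserve the Frobenius norm. The
  eigenvalues may be complex.\<close>

lemma W_frobenius:
  "(\<Sum>i<d. \<Sum>j<d. (cmod (W i j))\<^sup>2 * (cmod (g i - x j))\<^sup>2) = (\<Sum>a<d. \<Sum>b<d. (cmod (E a b))\<^sup>2)"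
proof -
  have "(\<Sum>i<d. \<Sum>j<d. (cmod (W i j))\<^sup>2 * (cmod (g i - x j))\<^sup>2)
     = (\<Sum>i<d. \<Sum>j<d. (cmod (\<Sum>a<d. cnj (U a i) * (\<Sum>b<d. E a b * V b j)))\<^sup>2)"
    by (intro sum.cong refl)
      (simp only: lessThan_iff U_E_V norm_mult power_mult_distrib mult.commute[of "(cmod (W _ _))\<^sup>2"])
  also have "\<dots> = (\<Sum>j<d. \<Sum>a<d. (cmod (\<Sum>b<d. E a b * V b j))\<^sup>2)"
    by (subst sum.swap) (simp add: unitary_on_parseval[OF unitary_on_cnj[OF U]])
  also have "\<dots> = (\<Sum>a<d. \<Sum>b<d. (cmod (E a b))\<^sup>2)"
    by (subst sum.swap) (simp add: unitary_on_parseval[OF V] mult.commute[of "E _ _"])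
  finally show ?thesis .
qed

text \<open>The left side is the squared Frobenius norm of the difference of two resolvents. By the
  resolvent identity one of its two factors is -R E R', so the whole is a pairing of
  \<open>E\<close> with a matrix built from unitaries and contractions. The entries of that matrix
  are at most 2, hence only the sum of the moduli of \<open>E\<close> enters.\<close>

lemma W_resolvent:
  assumes "\<And>i. i < d \<Longrightarrow> g i \<in> \<real>" "\<And>j. j < d \<Longrightarrow> x j \<in> \<real>"
  shows "(\<Sum>i<d. \<Sum>j<d. (cmod (W i j))\<^sup>2 * (cmod (1 / (g i + \<i>) - 1 / (x j + \<i>)))\<^sup>2)
    \<le> 2 * (\<Sum>a<d. \<Sum>b<d. cmod (E a b))"
proof -
  define r where "r z = 1 / (z + \<i>)" for z
  have r: "z + \<i> \<noteq> 0" "cmod (r z) \<le> 1" if "z \<in> \<real>" for z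
  proof -
    have "cmod (z + \<i>) \<ge> 1" using abs_Im_le_cmod[of "z + \<i>"] that by (auto elim: Reals_cases)
    then show "z + \<i> \<noteq> 0" "cmod (r z) \<le> 1"
      by (auto simp: r_def norm_divide divide_le_eq)
  qed
  \<comment> \<open>An entry of a product of unitary matrices with the diagonal contractions
    \<alpha> and \<beta>; Cauchy-Schwarz bounds it by 1.\<close>
  define K where "K \<alpha> \<beta> a b = (\<Sum>i<d. \<Sum>j<d. cnj (W i j) * \<alpha> i * \<beta> j * cnj (U a i) * V b j)"
    for \<alpha> \<beta> a b
  have K: "cmod (K \<alpha> \<beta> a b) \<le> 1" 
    if \<alpha>: "\<And>i. i < d \<Longrightarrow> cmod (\<alpha> i) \<le> 1" and \<beta>: "\<And>i. i < d \<Longrightarrow> cmod (\<beta> i) \<le> 1"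
      and ab: "a < d" "b < d" for \<alpha> \<beta> a b
  proof -
    define \<gamma> where "\<gamma> i = \<alpha> i * cnj (U a i)" for i
    have \<gamma>: "(\<Sum>i<d. (cmod (\<gamma> i))\<^sup>2) \<le> 1"
    proof -
      have "(\<Sum>i<d. (cmod (\<gamma> i))\<^sup>2) \<le> (\<Sum>i<d. (cmod (U a i))\<^sup>2)"
        using \<alpha> by (intro sum_mono power_mono) (auto simp: \<gamma>_def norm_mult mult_left_le_one_le)
      also have "\<dots> = 1"
        using unitary_on_column[OF unitary_on_transpose[OF U] ab(1)] by simp
      finally show ?thesis .
    qed
    have eq: "(\<Sum>i<d. cnj (W i j) * \<gamma> i) = (\<Sum>l<d. cnj (V l j) * (\<Sum>i<d. U l i * \<gamma> i))" for j
      unfolding W_def cnj_sum sum_distrib_left sum_distrib_right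
      by (subst sum.swap) (simp add: mult_ac)
    have "(\<Sum>j<d. (cmod (\<Sum>i<d. cnj (W i j) * \<gamma> i))\<^sup>2) = (\<Sum>l<d. (cmod (\<Sum>i<d. U l i * \<gamma> i))\<^sup>2)"
      unfolding eq by (rule unitary_on_parseval[OF unitary_on_cnj[OF V]])
    also have "\<dots> = (\<Sum>i<d. (cmod (\<gamma> i))\<^sup>2)"
      using unitary_on_parseval[OF unitary_on_transpose[OF U]] by simp
    finally have 1: "(\<Sum>j<d. (cmod (\<Sum>i<d. cnj (W i j) * \<gamma> i))\<^sup>2) \<le> 1" using \<gamma> by simp
    have "(\<Sum>j<d. (cmod (\<beta> j * V b j))\<^sup>2) \<le> (\<Sum>j<d. (cmod (V b j))\<^sup>2)"
      using \<beta> by (intro sum_mono power_mono) (auto simp: norm_mult mult_left_le_one_le)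
    also have "\<dots> = 1"
      using unitary_on_column[OF unitary_on_transpose[OF V] ab(2)] by simp
    finally have 2: "(\<Sum>j<d. (cmod (\<beta> j * V b j))\<^sup>2) \<le> 1" .
    have "K \<alpha> \<beta> a b = (\<Sum>j<d. (\<beta> j * V b j) * (\<Sum>i<d. cnj (W i j) * \<gamma> i))"
      unfolding K_def \<gamma>_def sum_distrib_left by (subst sum.swap) (simp add: mult_ac)
    then show ?thesis using abs_sum_product_le[OF 2 1] by simp
  qed
  \<comment> \<open>The conjugated difference of resolvent values is split so that either half has
    bounded diagonal factors on both sides.\<close>
  define K2 where "K2 a b = K (\<lambda>i. cnj (r (g i)) * r (g i)) (\<lambda>j. r (x j)) a b
       - K (\<lambda>i. r (g i)) (\<lambda>j. cnj (r (x j)) * r (x j)) a b" for a b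
  have K2: "cmod (K2 a b) \<le> 2" if "a < d" "b < d" for a b
  proof -
    have "cmod (K (\<lambda>i. cnj (r (g i)) * r (g i)) (\<lambda>j. r (x j)) a b) \<le> 1"
      "cmod (K (\<lambda>i. r (g i)) (\<lambda>j. cnj (r (x j)) * r (x j)) a b) \<le> 1"
      using assms r(2) that by (auto intro!: K simp: norm_mult mult_le_one)
    then show ?thesis unfolding K2_def by (intro order_trans[OF norm_triangle_ineq4]) simp
  qed
  \<comment> \<open>The scalar resolvent identity; together with \<open>U_E_V\<close> it brings in
    \<open>E\<close>.\<close>
  have r_diff: "r (g i) - r (x j) = - (r (g i) * r (x j) * (g i - x j))" if "i < d" "j < d" for i j
    using r(1)[OF assms(1)[OF that(1)]] r(1)[OF assms(2)[OF that(2)]]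
    by (simp add: r_def divide_simps)
  have sq: "complex_of_real ((cmod u)\<^sup>2 * (cmod v)\<^sup>2) = (cnj u * cnj v) * (u * v)" for u v
    by (simp only: of_real_mult complex_norm_square mult_ac)
  have K2_eq: "K2 a b = (\<Sum>i<d. \<Sum>j<d.
      cnj (W i j) * cnj (r (g i) - r (x j)) * r (g i) * r (x j) * cnj (U a i) * V b j)" for a b
    unfolding K2_def K_def sum_subtractf[symmetric]
    by (intro sum.cong refl) (simp only: complex_cnj_diff left_diff_distrib right_diff_distrib mult_ac)
  have "complex_of_real (\<Sum>i<d. \<Sum>j<d. (cmod (W i j))\<^sup>2 * (cmod (r (g i) - r (x j)))\<^sup>2)
      = (\<Sum>i<d. \<Sum>j<d. (cnj (W i j) * cnj (r (g i) - r (x j))) * (W i j * (r (g i) - r (x j))))"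
    unfolding of_real_sum sq ..
  also have "\<dots> = (\<Sum>i<d. \<Sum>j<d. - (cnj (W i j) * cnj (r (g i) - r (x j)) * r (g i) * r (x j))
       * (\<Sum>a<d. cnj (U a i) * (\<Sum>b<d. E a b * V b j)))"
  proof (intro sum.cong refl)
    fix i j assume "i \<in> {..<d}" "j \<in> {..<d}"
    then have ij: "i < d" "j < d" by auto
    have "W i j * (r (g i) - r (x j)) = - (r (g i) * r (x j) * ((g i - x j) * W i j))"
      unfolding r_diff[OF ij] by (simp add: mult_ac)
    then show "(cnj (W i j) * cnj (r (g i) - r (x j))) * (W i j * (r (g i) - r (x j)))
       = - (cnj (W i j) * cnj (r (g i) - r (x j)) * r (g i) * r (x j))
       * (\<Sum>a<d. cnj (U a i) * (\<Sum>b<d. E a b * V b j))"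
      unfolding U_E_V[OF ij] by (simp add: mult_ac)
  qed
  also have "\<dots> = (\<Sum>i<d. \<Sum>j<d. \<Sum>a<d. \<Sum>b<d. 
     - (cnj (W i j) * cnj (r (g i) - r (x j)) * r (g i) * r (x j) * cnj (U a i) * V b j) * E a b)"
    unfolding sum_distrib_left by (intro sum.cong refl) (simp add: mult_ac)
  also have "\<dots> = (\<Sum>i<d. \<Sum>a<d. \<Sum>b<d. \<Sum>j<d.
     - (cnj (W i j) * cnj (r (g i) - r (x j)) * r (g i) * r (x j) * cnj (U a i) * V b j) * E a b)"
    by (rule sum.cong[OF refl], subst sum.swap, rule sum.cong[OF refl], rule sum.swap)
  also have "\<dots> = (\<Sum>a<d. \<Sum>b<d. \<Sum>i<d. \<Sum>j<d.
     - (cnj (W i j) * cnj (r (g i) - r (x j)) * r (g i) * r (x j) * cnj (U a i) * V b j) * E a b)"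
    by (subst sum.swap, rule sum.cong[OF refl], rule sum.swap)
  also have "\<dots> = (\<Sum>a<d. \<Sum>b<d. - K2 a b * E a b)"
    unfolding K2_eq by (simp only: sum_distrib_right sum_negf mult_minus_left)
  finally have "(\<Sum>i<d. \<Sum>j<d. (cmod (W i j))\<^sup>2 * (cmod (r (g i) - r (x j)))\<^sup>2)
      = Re (\<Sum>a<d. \<Sum>b<d. - K2 a b * E a b)"
    by (rule arg_cong[of "complex_of_real _" _ Re, unfolded Re_complex_of_real])
  also have "\<dots> \<le> cmod (\<Sum>a<d. \<Sum>b<d. - K2 a b * E a b)" by (rule complex_Re_le_cmod)
  also have "\<dots> \<le> (\<Sum>a<d. \<Sum>b<d. cmod (K2 a b) * cmod (E a b))"
    by (intro order_trans[OF norm_sum] sum_mono) (simp add: norm_mult)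
  also have "\<dots> \<le> (\<Sum>a<d. \<Sum>b<d. 2 * cmod (E a b))"
    using K2 by (intro sum_mono mult_right_mono) auto
  finally show ?thesis by (simp add: sum_distrib_left r_def)
qed

end

section \<open>Moduli of continuity of compactly supported test functions\<close>

lemma uniformly_continuous_square_bound:
  fixes F :: "complex \<Rightarrow> complex"
  assumes "uniformly_continuous_on S F" "bounded (F ` S)" "\<epsilon> > 0"
  obtains C where "C \<ge> 0"
    "\<And>s t. s \<in> S \<Longrightarrow> t \<in> S \<Longrightarrow> cmod (F s - F t) \<le> \<epsilon> + C * (cmod (s - t))\<^sup>2"
proof -
  obtain B where B: "\<And>s. s \<in> S \<Longrightarrow> cmod (F s) \<le> B"
    using assms(2) unfolding bounded_iff by auto
  obtain \<delta> where \<delta>: "\<delta> > 0" "\<And>s t. s \<in> S \<Longrightarrow> t \<in> S \<Longrightarrow> dist s t < \<delta> \<Longrightarrow> dist (F s) (F t) < \<epsilon>"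
    using assms(1,3) unfolding uniformly_continuous_on_def by metis
  \<comment> \<open>Beyond distance \<delta> the quadratic term alone then exceeds the trivial bound
    2 B; below it uniform continuity gives \<epsilon>.\<close>
  define C where "C = 2 * max B 0 / \<delta>\<^sup>2"
  have "cmod (F s - F t) \<le> \<epsilon> + C * (cmod (s - t))\<^sup>2" if st: "s \<in> S" "t \<in> S" for s t
  proof (cases "dist s t < \<delta>")
    case True
    then have "cmod (F s - F t) \<le> \<epsilon>" using \<delta>(2)[OF st] by (simp add: dist_norm)
    moreover have "0 \<le> C * (cmod (s - t))\<^sup>2" by (simp add: C_def)
    ultimately show ?thesis by simp
  next
    case False
    then have "\<delta>\<^sup>2 \<le> (cmod (s - t))\<^sup>2"
      using \<delta>(1) by (intro power_mono) (auto simp: dist_norm)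
    then have "2 * max B 0 \<le> C * (cmod (s - t))\<^sup>2"
      using \<delta>(1) by (simp add: C_def field_simps mult_left_mono)
    moreover have "cmod (F s - F t) \<le> 2 * max B 0"
      using B[OF st(1)] B[OF st(2)] norm_triangle_ineq4[of "F s" "F t"] by linarith
    ultimately show ?thesis using assms(3) by linarith
  qed
  then show thesis by (intro that[of C]) (simp add: C_def)
qed

lemma Cc_complex_bounded: "Cc_complex F \<Longrightarrow> \<exists>B. \<forall>z. cmod (F z) \<le> B"
proof -
  assume "Cc_complex F"
  then obtain K where K: "compact K" "\<And>z. z \<notin> K \<Longrightarrow> F z = 0" and F: "continuous_on UNIV F"
    unfolding Cc_complex_def by auto
  have "bounded (F ` K)"
    using K(1) F by (meson compact_continuous_image compact_imp_bounded continuous_on_subset subset_UNIV)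
  then obtain B where "\<forall>z\<in>K. cmod (F z) \<le> B" unfolding bounded_iff by auto
  then have "cmod (F z) \<le> max B 0" for z using K(2)[of z] by (cases "z \<in> K") (auto simp: le_max_iff_disj)
  then show ?thesis by auto
qed

lemma Cc_complex_support:
  assumes "Cc_complex F"
  obtains R where "R > 0" "\<And>z. cmod z > R \<Longrightarrow> F z = 0"
proof -
  obtain K where K: "compact K" "\<And>z. z \<notin> K \<Longrightarrow> F z = 0"
    using assms unfolding Cc_complex_def by auto
  then obtain R where "R > 0" "\<forall>z\<in>K. cmod z \<le> R"
    using compact_imp_bounded[OF K(1)] unfolding bounded_pos by auto
  then show thesis using K(2) that[of R] by (meson not_le)
qed

lemma Cc_complex_uniformly_continuous:
  assumes "Cc_complex F"
  shows "uniformly_continuous_on UNIV F"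
  unfolding uniformly_continuous_on_def
proof (intro allI impI)
  fix e :: real assume "e > 0"
  obtain R where R: "R > 0" "\<And>z. cmod z > R \<Longrightarrow> F z = 0" using Cc_complex_support[OF assms] by metis
  have "uniformly_continuous_on (cball 0 (R + 1)) F"
    using assms by (intro compact_uniformly_continuous) (auto simp: Cc_complex_def intro: continuous_on_subset)
  then obtain d where d: "d > 0" 
    "\<And>s t. cmod s \<le> R + 1 \<Longrightarrow> cmod t \<le> R + 1 \<Longrightarrow> dist t s < d \<Longrightarrow> dist (F t) (F s) < e"
    using \<open>e > 0\<close> unfolding uniformly_continuous_on_def by (auto simp: dist_norm)
  \<comment> \<open>With steps shorter than 1, one point outside the ball of radius R + 1 forces
    both outside radius R, where \<open>F\<close> vanishes.\<close>
  have "dist (F t) (F s) < e" if st: "dist t s < min d 1" for s t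
  proof (cases "cmod s \<le> R + 1 \<and> cmod t \<le> R + 1")
    case True
    then show ?thesis using d(2) st by simp
  next
    case False
    have "cmod s \<le> cmod t + dist t s" "cmod t \<le> cmod s + dist t s"
      using norm_triangle_sub[of s t] norm_triangle_sub[of t s] by (auto simp: dist_norm norm_minus_commute)
    then have "cmod s > R" "cmod t > R" using False st by auto
    then show ?thesis using R(2) \<open>e > 0\<close> by simp
  qed
  then show "\<exists>d>0. \<forall>x\<in>UNIV. \<forall>x'\<in>UNIV. dist x' x < d \<longrightarrow> dist (F x') (F x) < e"
    using d(1) by (intro exI[of _ "min d 1"]) auto
qed

lemma Cc_square_bound:
  assumes "Cc_complex F" "\<epsilon> > 0"
  obtains C where "C \<ge> 0" "\<And>s t. cmod (F s - F t) \<le> \<epsilon> + C * (cmod (s - t))\<^sup>2"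
proof -
  have "bounded (F ` UNIV)" using Cc_complex_bounded[OF assms(1)] unfolding bounded_iff by auto
  then show thesis
    using uniformly_continuous_square_bound[OF Cc_complex_uniformly_continuous[OF assms(1)] _ assms(2)] that
    by (metis UNIV_I)
qed

text \<open>The map \<open>t \<mapsto> 1 / (t + \<i>)\<close> compactifies the real line to a circle, on which \<open>F\<close> is
  uniformly continuous.\<close>

lemma Cc_resolvent_bound:
  assumes "Cc_complex F" "\<epsilon> > 0"
  obtains C where "C \<ge> 0"
    "\<And>s t. s \<in> \<real> \<Longrightarrow> t \<in> \<real> \<Longrightarrow> cmod (F s - F t) \<le> \<epsilon> + C * (cmod (1 / (s + \<i>) - 1 / (t + \<i>)))\<^sup>2"
proof -
  obtain R where R: "R > 0" "\<And>z. cmod z > R \<Longrightarrow> F z = 0" using Cc_complex_support[OF assms(1)] by metis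
  \<comment> \<open>\<open>F\<close> read in the coordinate w = 1 / (t + i), with 0 standing for
    infinity.\<close>
  define H where "H w = (if w = 0 then 0 else F (1 / w - \<i>))" for w
  \<comment> \<open>On this disc 1 / w has modulus above R + 2, so 1 / w - i is still outside the
    support, and \<open>H\<close> is constant near the added point.\<close>
  have H0: "H w = 0" if "w \<in> ball 0 (1 / (R + 2))" for w
  proof (cases "w = 0")
    case False
    then have "cmod (1 / w) > R + 2" using that R(1) by (simp add: norm_divide field_simps)
    moreover have "cmod (1 / w) \<le> cmod (1 / w - \<i>) + 1"
      using norm_triangle_sub[of "1 / w" \<i>] by simp
    ultimately show ?thesis using R by (simp add: H_def)
  qed (simp add: H_def)
  have "continuous_on (ball 0 (1 / (R + 2)) \<union> - {0}) H"
  proof (intro continuous_on_open_Un)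
    show "continuous_on (ball 0 (1 / (R + 2))) H"
      by (rule continuous_on_eq[OF continuous_on_const[of _ 0]]) (simp add: H0)
    have "continuous_on (- {0}) (\<lambda>w. F (1 / w - \<i>))"
      using assms(1) unfolding Cc_complex_def
      by (auto intro!: continuous_intros continuous_on_compose2[of UNIV F])
    then show "continuous_on (- {0}) H"
      by (rule continuous_on_eq) (simp add: H_def)
  qed auto
  moreover have "ball 0 (1 / (R + 2)) \<union> - {0} = (UNIV :: complex set)" using R(1) by auto
  ultimately have "continuous_on (cball 0 1) H" using continuous_on_subset by (metis subset_UNIV)
  then have uc: "uniformly_continuous_on (cball 0 1) H" and bd: "bounded (H ` cball 0 1)"
    by (simp_all add: compact_uniformly_continuous compact_imp_bounded[OF compact_continuous_image])
  obtain C where C: "C \<ge> 0" "\<And>s t. s \<in> cball 0 1 \<Longrightarrow> t \<in> cball 0 1 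
      \<Longrightarrow> cmod (H s - H t) \<le> \<epsilon> + C * (cmod (s - t))\<^sup>2"
    using uniformly_continuous_square_bound[OF uc bd assms(2)] by metis
  have r: "1 / (z + \<i>) \<in> cball 0 1" "H (1 / (z + \<i>)) = F z" if "z \<in> \<real>" for z
  proof -
    have "cmod (z + \<i>) \<ge> 1" using abs_Im_le_cmod[of "z + \<i>"] that by (auto elim: Reals_cases)
    then show "1 / (z + \<i>) \<in> cball 0 1" "H (1 / (z + \<i>)) = F z" 
      by (auto simp: H_def norm_divide divide_le_eq)
  qed
  show thesis using C r by (intro that[of C]) metis+
qed

section \<open>Density of polynomials in the coefficient space\<close>

text \<open>Sums of products of one-variable polynomials. The product form yields all partial
  derivatives through \<open>pderiv\<close> in each factor, and the inductive form replaces
  bookkeeping with multi-indices.\<close>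

inductive separable_sum :: "(real^2 \<Rightarrow> complex) \<Rightarrow> bool" where
  monom: "separable_sum (\<lambda>x. c * of_real (poly p (x$1)) * of_real (poly q (x$2)))"
| add: "separable_sum f \<Longrightarrow> separable_sum g \<Longrightarrow> separable_sum (\<lambda>x. f x + g x)"

lemma separable_sum_monom_mult:
  "separable_sum g \<Longrightarrow>
    separable_sum (\<lambda>x. (c * of_real (poly p (x$1)) * of_real (poly q (x$2))) * g x)"
proof (induction rule: separable_sum.induct)
  case (monom c' p' q')
  have "separable_sum (\<lambda>x. (c * c') * of_real (poly (p * p') (x$1)) * of_real (poly (q * q') (x$2)))"
    by (rule separable_sum.monom)
  then show ?case by (simp add: mult_ac)
next
  case (add f g)
  then show ?case using separable_sum.add[OF add.IH] by (simp add: distrib_left)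
qed

lemma separable_sum_mult:
  "separable_sum f \<Longrightarrow> separable_sum g \<Longrightarrow> separable_sum (\<lambda>x. f x * g x)"
proof (induction rule: separable_sum.induct)
  case (add f h)
  then show ?case using separable_sum.add[of "\<lambda>x. f x * g x" "\<lambda>x. h x * g x"] by (simp add: distrib_right)
qed (rule separable_sum_monom_mult)

lemma separable_sum_const: "separable_sum (\<lambda>x. c)"
  using separable_sum.monom[of c 1 1] by simp

lemma separable_sum_cnj: "separable_sum f \<Longrightarrow> separable_sum (\<lambda>x. cnj (f x))"
proof (induction rule: separable_sum.induct)
  case (monom c p q)
  then show ?case using separable_sum.monom[of "cnj c" p q] by simp
next
  case (add f g)
  then show ?case using separable_sum.add[OF add.IH] by simp
qed

lemma separable_sum_real_polynomial:
  fixes h :: "real^2 \<Rightarrow> real"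
  assumes "real_polynomial_function h"
  shows "separable_sum (\<lambda>x. of_real (h x))"
  using assms
proof (induction rule: real_polynomial_function.induct)
  case (linear h)
  have eq: "h x = x$1 * h (axis 1 1) + x$2 * h (axis 2 1)" for x
  proof -
    have "x = x$1 *\<^sub>R axis 1 1 + x$2 *\<^sub>R axis 2 1"
      by (simp add: Finite_Cartesian_Product.vec_eq_iff forall_2 axis_def)
    then have "h x = h (x$1 *\<^sub>R axis 1 1 + x$2 *\<^sub>R axis 2 1)" by simp
    then show ?thesis
      using linear by (simp add: linear_simps bounded_linear.linear)
  qed
  have "separable_sum (\<lambda>x. of_real (h (axis 1 1)) * of_real (poly [:0, 1:] (x$1)) * of_real (poly 1 (x$2))
      + of_real (h (axis 2 1)) * of_real (poly 1 (x$1)) * of_real (poly [:0, 1:] (x$2)))"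
    by (intro separable_sum.intros)
  then show ?case by (subst eq) (simp add: mult_ac)
next
  case (const c)
  then show ?case by (rule separable_sum_const)
next
  case (add f g)
  then show ?case using separable_sum.add[OF add.IH] by simp
next
  case (mult f g)
  then show ?case using separable_sum_mult[OF mult.IH] by simp
qed

lemma separable_sum_polynomial:
  fixes g :: "real^2 \<Rightarrow> complex"
  assumes "polynomial_function g"
  shows "separable_sum g"
proof -
  have "real_polynomial_function (\<lambda>x. Re (g x))" "real_polynomial_function (\<lambda>x. Im (g x))"
    using assms bounded_linear_Re bounded_linear_Im unfolding polynomial_function_def
    by (auto simp: o_def)
  from this[THEN separable_sum_real_polynomial]
  have "separable_sum (\<lambda>x. of_real (Re (g x)) + \<i> * of_real (Im (g x)))"
    by (intro separable_sum.add separable_sum_mult[OF separable_sum_const])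
  then show ?thesis by (simp flip: complex_eq)
qed

lemma separable_sum_continuous: "separable_sum g \<Longrightarrow> continuous_on S g"
  by (induction rule: separable_sum.induct) (auto intro!: continuous_intros)

lemma has_derivative_poly_component:
  "((\<lambda>y::real^2. poly r (y$k)) has_derivative (\<lambda>v. poly (pderiv r) (x$k) * v$k)) (at x within S)"
proof -
  have 1: "((\<lambda>y::real^2. y$k) has_derivative (\<lambda>v. v$k)) (at x within S)"
    by (rule bounded_linear_imp_has_derivative[OF bounded_linear_vec_nth])
  have 2: "(poly r has_derivative (*) (poly (pderiv r) (x$k))) (at (x$k))"
    using poly_DERIV[of r "x$k"] unfolding has_field_derivative_def .
  show ?thesis by (rule has_derivative_compose[OF 1 2])
qed

lemma has_derivative_separable_monom:
  fixes x :: "real^2" and c :: complex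
  shows "((\<lambda>y. c * of_real (poly p (y$1)) * of_real (poly q (y$2))) has_derivative
    (\<lambda>v. v$1 *\<^sub>R (c * of_real (poly (pderiv p) (x$1)) * of_real (poly q (x$2)))
       + v$2 *\<^sub>R (c * of_real (poly p (x$1)) * of_real (poly (pderiv q) (x$2))))) (at x within S)"
  by (rule has_derivative_eq_rhs[OF has_derivative_mult[OF has_derivative_mult[OF has_derivative_const
            has_derivative_of_real[OF has_derivative_poly_component]]
            has_derivative_of_real[OF has_derivative_poly_component]]])
     (rule ext, simp only: scaleR_conv_of_real of_real_mult mult_zero_left add_0_left distrib_left mult_ac add_ac)

lemma separable_sum_smooth: "separable_sum g \<Longrightarrow> smooth_on_unit_square g"
proof (induction rule: separable_sum.induct)
  case (monom c p q)
  \<comment> \<open>All mixed derivatives at once, since smoothness asks for one family closed under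
    differentiation.\<close>
  define P where "P = (\<lambda>i j (x::real^2).
    c * of_real (poly ((pderiv ^^ i) p) (x$1)) * of_real (poly ((pderiv ^^ j) q) (x$2)))"
  have "(P i j has_derivative (\<lambda>v. v$1 *\<^sub>R P (Suc i) j x + v$2 *\<^sub>R P i (Suc j) x)) (at x within unit_square)"
    for i j x
    unfolding P_def funpow.simps o_apply by (rule has_derivative_separable_monom)
  moreover have "P 0 0 x = c * of_real (poly p (x$1)) * of_real (poly q (x$2))" for x
    by (simp add: P_def)
  ultimately show ?case unfolding smooth_on_unit_square_def
    by (intro exI[of _ P] conjI ballI allI)
next
  case (add f g)
  obtain P where P: "\<forall>x\<in>unit_square. P 0 0 x = f x"
    "\<forall>i j. \<forall>x\<in>unit_square. (P i j has_derivative (\<lambda>v. v$1 *\<^sub>R P (Suc i) j x + v$2 *\<^sub>R P i (Suc j) x)) (at x within unit_square)"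
    using add.IH(1) unfolding smooth_on_unit_square_def by (elim exE conjE)
  obtain Q where Q: "\<forall>x\<in>unit_square. Q 0 0 x = g x"
    "\<forall>i j. \<forall>x\<in>unit_square. (Q i j has_derivative (\<lambda>v. v$1 *\<^sub>R Q (Suc i) j x + v$2 *\<^sub>R Q i (Suc j) x)) (at x within unit_square)"
    using add.IH(2) unfolding smooth_on_unit_square_def by (elim exE conjE)
  note P = bspec[OF P(1)] P(2)[rule_format] and Q = bspec[OF Q(1)] Q(2)[rule_format]
  have der: "((\<lambda>x. P i j x + Q i j x) has_derivative
      (\<lambda>v. v$1 *\<^sub>R (P (Suc i) j x + Q (Suc i) j x) + v$2 *\<^sub>R (P i (Suc j) x + Q i (Suc j) x)))
      (at x within unit_square)" if "x \<in> unit_square" for i j x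
    by (rule has_derivative_eq_rhs[OF has_derivative_add[OF P(2)[OF that] Q(2)[OF that]]])
      (simp add: fun_eq_iff scaleR_add_right)
  show ?case unfolding smooth_on_unit_square_def
    by (rule exI[of _ "\<lambda>i j x. P i j x + Q i j x"], intro conjI ballI allI der) (simp only: P(1) Q(1))
qed

declare vec_0 [simp del] vec_1 [simp del]

section \<open>Approximation in L^1 on the open square\<close>

lemma finite_measure_lebesgue_on_open_unit_square: "finite_measure (lebesgue_on open_unit_square)"
  by (rule finite_measure_lebesgue_on) auto

lemma measure_open_unit_square: "measure (lebesgue_on open_unit_square) open_unit_square = 1"
proof -
  have "measure lborel open_unit_square = 1"
    by (subst measure_lborel_box_eq) (auto simp: Basis_vec_def inner_axis intro!: prod.neutral)
  then show ?thesis by (simp add: measure_restrict_space)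
qed

text \<open>Radial retraction onto the disc of radius \<open>K\<close>. Clipping an integrable
  function costs little in L^1 for large \<open>K\<close>, and clipping its continuous approximants
  supplies the bound for dominated convergence.\<close>

definition clip :: "nat \<Rightarrow> complex \<Rightarrow> complex" where
  "clip K z = (real K / max (real K) (cmod z)) *\<^sub>R z"

lemma clip_bound: "cmod (clip K z) \<le> real K"
  by (cases "K = 0") (auto simp: clip_def max_def field_simps)

lemma clip_diff_bound: "cmod (z - clip K z) \<le> cmod z"
proof -
  define t where "t = real K / max (real K) (cmod z)"
  have "0 \<le> t" "t \<le> 1" by (auto simp: t_def max_def divide_le_eq)
  moreover have "z - clip K z = (1 - t) *\<^sub>R z" by (simp add: clip_def t_def algebra_simps)
  ultimately show ?thesis by (auto intro: mult_left_le_one_le)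
qed

lemma clip_tendsto: "(\<lambda>K. clip K z) \<longlonglongrightarrow> z"
proof -
  have "eventually (\<lambda>K. clip K z = z) sequentially"
    using eventually_gt_at_top[of "nat \<lceil>cmod z\<rceil>"]
  proof eventually_elim
    case (elim K)
    then have "cmod z < real K" by linarith
    then show ?case using norm_ge_zero[of z] by (auto simp: clip_def max_def simp del: norm_ge_zero)
  qed
  then show ?thesis by (rule tendsto_eventually)
qed

lemma continuous_on_clip: "K > 0 \<Longrightarrow> continuous_on UNIV (clip K)"
  unfolding clip_def by (intro continuous_intros) (auto simp: max_def)

text \<open>Three errors of \<open>e / 3\<close>: truncating \<open>f\<close>, replacing the
  truncation by a clipped continuous function, and the uniform Weierstrass error, which costs no
  more in L^1 because the square has measure one.\<close>

lemma integrable_approx_separable: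
  fixes f :: "real^2 \<Rightarrow> complex"
  assumes f: "integrable (lebesgue_on open_unit_square) f" and e: "e > 0"
  obtains g where "separable_sum g" "(LINT x|lebesgue_on open_unit_square. cmod (f x - g x)) < e"
proof -
  let ?M = "lebesgue_on open_unit_square"
  interpret finite_measure ?M by (rule finite_measure_lebesgue_on_open_unit_square)
  have fm [measurable]: "f \<in> borel_measurable ?M" using f by auto
  have clipm: "clip K \<in> borel_measurable borel" if "K > 0" for K
    using continuous_on_clip[OF that] by (rule borel_measurable_continuous_onI)
  have cfm: "(\<lambda>x. clip K (f x)) \<in> borel_measurable ?M" if "K > 0" for K
    using measurable_compose[OF fm clipm[OF that]] .
  have "(\<lambda>K. LINT x|?M. cmod (f x - clip (Suc K) (f x))) \<longlonglongrightarrow> (LINT x|?M. 0)"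
  proof (rule integral_dominated_convergence[where w = "\<lambda>x. cmod (f x)"])
    have "(\<lambda>K. cmod (f x - clip (Suc K) (f x))) \<longlonglongrightarrow> cmod (f x - f x)" for x
      by (intro tendsto_intros LIMSEQ_Suc clip_tendsto)
    then show "AE x in ?M. (\<lambda>K. cmod (f x - clip (Suc K) (f x))) \<longlonglongrightarrow> 0" by simp
    show "(\<lambda>x. cmod (f x - clip (Suc K) (f x))) \<in> borel_measurable ?M" for K
      by (rule measurable_compose[OF borel_measurable_diff[OF fm cfm] borel_measurable_norm]) simp
  qed (use f clip_diff_bound in auto)
  then have "eventually (\<lambda>K. (LINT x|?M. cmod (f x - clip (Suc K) (f x))) < e / 3) sequentially"
    using e by (intro order_tendstoD(2)[of _ 0]) auto
  then obtain K where K: "K > 0" "(LINT x|?M. cmod (f x - clip K (f x))) < e / 3"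
    unfolding eventually_sequentially by blast
  \<comment> \<open>Lebesgue measurability as a limit of continuous functions off a negligible set.
    Nothing bounds \<open>h n\<close>, hence the clipping before the limit is taken under the
    integral.\<close>
  obtain N h where h: "negligible N" "\<And>n. continuous_on UNIV (h n)"
    "\<And>x. x \<notin> N \<Longrightarrow> (\<lambda>n. h n x) \<longlonglongrightarrow> (if x \<in> open_unit_square then f x else 0)"
    using measurable_on_iff_borel_measurable[of open_unit_square f] fm unfolding measurable_on_def
    by (auto simp: lmeasurable_box fmeasurableD)
  have hc: "continuous_on UNIV (\<lambda>x. clip K (h n x))" for n
    using continuous_on_compose2[OF continuous_on_clip[OF K(1)] h(2)] by simp
  have hm: "(\<lambda>x. clip K (h n x)) \<in> borel_measurable ?M" for n
    by (intro borel_measurable_if_D continuous_imp_measurable_on_sets_lebesgue continuous_on_subset[OF hc]) auto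
  note cfm = cfm[OF K(1)]
  have "(\<lambda>n. LINT x|?M. cmod (clip K (f x) - clip K (h n x))) \<longlonglongrightarrow> (LINT x|?M. 0)"
  proof (rule integral_dominated_convergence[where w = "\<lambda>x. 2 * real K"])
    have "AE x in ?M. x \<notin> N"
      using h(1) by (auto simp: AE_restrict_space_iff negligible_iff_null_sets intro!: AE_not_in AE_I')
    moreover have "AE x in ?M. x \<in> open_unit_square" by (auto intro: AE_I2)
    ultimately show "AE x in ?M. (\<lambda>n. cmod (clip K (f x) - clip K (h n x))) \<longlonglongrightarrow> 0"
    proof eventually_elim
      case (elim x)
      then have "(\<lambda>n. h n x) \<longlonglongrightarrow> f x" using h(3)[of x] by simp
      then have "(\<lambda>n. clip K (h n x)) \<longlonglongrightarrow> clip K (f x)"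
        using continuous_on_clip[OF K(1)] 
        by (auto intro: isCont_tendsto_compose simp: continuous_on_eq_continuous_at)
      then have "(\<lambda>n. cmod (clip K (f x) - clip K (h n x))) \<longlonglongrightarrow> cmod (clip K (f x) - clip K (f x))"
        by (intro tendsto_intros)
      then show ?case by simp
    qed
    show "AE x in ?M. norm (cmod (clip K (f x) - clip K (h n x))) \<le> 2 * real K" for n
    proof (intro AE_I2)
      fix x 
      show "norm (cmod (clip K (f x) - clip K (h n x))) \<le> 2 * real K"
        using clip_bound[of K "f x"] clip_bound[of K "h n x"] 
          norm_triangle_ineq4[of "clip K (f x)" "clip K (h n x)"] by simp
    qed
  qed (use hm cfm in auto)
  then have "eventually (\<lambda>n. (LINT x|?M. cmod (clip K (f x) - clip K (h n x))) < e / 3) sequentially"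
    using e by (intro order_tendstoD(2)[of _ 0]) auto
  then obtain n where n: "(LINT x|?M. cmod (clip K (f x) - clip K (h n x))) < e / 3"
    unfolding eventually_sequentially by blast
  obtain g where g: "polynomial_function g" "\<And>x. x \<in> unit_square \<Longrightarrow> cmod (clip K (h n x) - g x) < e / 3"
    using Stone_Weierstrass_polynomial_function[of unit_square "\<lambda>x. clip K (h n x)" "e / 3"] e
      continuous_on_subset[OF hc[of n]] by auto
  have sg: "separable_sum g" using g(1) by (rule separable_sum_polynomial)
  have gm: "g \<in> borel_measurable ?M"
    by (intro borel_measurable_if_D continuous_imp_measurable_on_sets_lebesgue separable_sum_continuous[OF sg]) auto
  have sub: "x \<in> open_unit_square \<Longrightarrow> x \<in> unit_square" for x
    using box_subset_cbox by blast
  have i1: "integrable ?M (\<lambda>x. cmod (f x - clip K (f x)))"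
    by (rule Bochner_Integration.integrable_bound[OF integrable_norm[OF f]]) (use cfm clip_diff_bound in auto)
  have i2: "integrable ?M (\<lambda>x. cmod (clip K (f x) - clip K (h n x)))"
  proof (rule integrable_const_bound[where B = "2 * real K"])
    show "AE x in ?M. norm (cmod (clip K (f x) - clip K (h n x))) \<le> 2 * real K"
    proof (intro AE_I2)
      fix x 
      show "norm (cmod (clip K (f x) - clip K (h n x))) \<le> 2 * real K"
        using clip_bound[of K "f x"] clip_bound[of K "h n x"] 
          norm_triangle_ineq4[of "clip K (f x)" "clip K (h n x)"] by simp
    qed
  qed (use hm cfm in auto)
  have i3: "integrable ?M (\<lambda>x. cmod (clip K (h n x) - g x))"
  proof (rule integrable_const_bound[where B = "e / 3"])
    show "AE x in ?M. norm (cmod (clip K (h n x) - g x)) \<le> e / 3"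
      using g(2) sub by (intro AE_I2) (auto intro: less_imp_le)
  qed (use hm gm in auto)
  have "(LINT x|?M. cmod (f x - g x)) \<le> (LINT x|?M. cmod (f x - clip K (f x))
       + cmod (clip K (f x) - clip K (h n x)) + cmod (clip K (h n x) - g x))"
  proof (rule integral_mono')
    fix x
    show "cmod (f x - g x) \<le> cmod (f x - clip K (f x))
       + cmod (clip K (f x) - clip K (h n x)) + cmod (clip K (h n x) - g x)"
      by norm
  qed (use i1 i2 i3 in auto)
  also have "\<dots> = (LINT x|?M. cmod (f x - clip K (f x))) + (LINT x|?M. cmod (clip K (f x) - clip K (h n x)))
      + (LINT x|?M. cmod (clip K (h n x) - g x))"
    using i1 i2 i3 by simp
  also have "(LINT x|?M. cmod (clip K (h n x) - g x)) \<le> (LINT x|?M. e / 3)"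
    using g(2) sub by (intro integral_mono i3) (auto intro: less_imp_le)
  also have "(LINT x|?M. e / 3) = e / 3"
    using measure_open_unit_square by simp
  finally have "(LINT x|?M. cmod (f x - g x)) < e" using K(2) n by linarith
  then show thesis using that sg by blast
qed

section \<open>Riemann sums in space and frequency\<close>

lemma Basis_real2: "(Basis :: (real^2) set) = {axis 1 1, axis 2 1}"
  by (auto simp: Basis_vec_def UNIV_2)

lemma mem_box_real2:
  fixes x :: "real^2"
  shows "x \<in> box a b \<longleftrightarrow> a$1 < x$1 \<and> x$1 < b$1 \<and> a$2 < x$2 \<and> x$2 < b$2"
    and "x \<in> cbox a b \<longleftrightarrow> a$1 \<le> x$1 \<and> x$1 \<le> b$1 \<and> a$2 \<le> x$2 \<and> x$2 \<le> b$2"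
  by (auto simp: mem_box Basis_real2 inner_axis)

lemma measure_box_real2:
  fixes a b :: "real^2"
  assumes "a$1 \<le> b$1" "a$2 \<le> b$2"
  shows "measure lborel (box a b) = (b$1 - a$1) * (b$2 - a$2)"
    and "measure lborel (cbox a b) = (b$1 - a$1) * (b$2 - a$2)"
proof -
  have ne: "axis 1 (1::real) \<noteq> (axis 2 1 :: real^2)" by (simp add: axis_eq_axis)
  show "measure lborel (box a b) = (b$1 - a$1) * (b$2 - a$2)"
    "measure lborel (cbox a b) = (b$1 - a$1) * (b$2 - a$2)"
    using assms ne by (auto simp: measure_lborel_box_eq measure_lborel_cbox_eq Basis_real2 inner_axis)
qed

lemma box_Pair_eq: "box (a, c) (b, d) = box a b \<times> box c d"
  by (auto simp: mem_box Basis_prod_def ball_Un)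

lemma measure_lborel_Times:
  fixes A :: "'a::euclidean_space set" and B :: "'b::euclidean_space set"
  assumes "A \<in> sets borel" "B \<in> sets borel"
  shows "measure lborel (A \<times> B) = measure lborel A * measure lborel B"
proof -
  have "emeasure lborel (A \<times> B) = emeasure lborel A * emeasure lborel B"
    using assms by (subst lborel_prod[symmetric]) (simp add: lborel.emeasure_pair_measure_Times)
  then show ?thesis by (simp add: measure_def enn2real_mult)
qed

lemma lmeasurable_Times_bounded:
  fixes A :: "'a::euclidean_space set" and B :: "'b::euclidean_space set"
  assumes "A \<in> sets borel" "B \<in> sets borel" "bounded A" "bounded B"
  shows "A \<times> B \<in> lmeasurable"
  using assms by (intro bounded_set_imp_lmeasurable bounded_Times sets_completionI_sets) 
    (simp_all add: borel_Times)

text \<open>The step function with the values \<open>v i\<close> is within \<eta> of \<Phi> on the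
  union of the cells. On what they leave uncovered it is 0, and the error is at most
  \<open>Bd\<close>.\<close>

lemma sum_cells_integral_bound:
  fixes \<Phi> :: "'a::euclidean_space \<Rightarrow> complex"
  assumes I: "finite I" and disj: "disjoint_family_on Q I"
    and Q: "\<And>i. i \<in> I \<Longrightarrow> Q i \<in> lmeasurable" "\<And>i. i \<in> I \<Longrightarrow> Q i \<subseteq> D"
    and w: "\<And>i. i \<in> I \<Longrightarrow> measure lebesgue (Q i) = w" and D: "D \<in> lmeasurable"
    and meas: "\<Phi> \<in> borel_measurable (lebesgue_on D)"
    and bd: "\<And>z. z \<in> D \<Longrightarrow> cmod (\<Phi> z) \<le> Bd"
    and \<eta>: "\<And>i z. i \<in> I \<Longrightarrow> z \<in> Q i \<Longrightarrow> cmod (\<Phi> z - v i) \<le> \<eta>"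
  shows "cmod ((\<Sum>i\<in>I. of_real w * v i) - (LINT z|lebesgue_on D. \<Phi> z))
    \<le> \<eta> * (w * card I) + Bd * (measure lebesgue D - w * card I)"
proof -
  let ?M = "lebesgue_on D"
  interpret finite_measure ?M using D by (rule finite_measure_lebesgue_on)
  have sp: "space ?M = D" by simp
  have Dm: "D \<in> sets lebesgue" using D by (rule fmeasurableD)
  have QM: "Q i \<in> sets ?M" and mQ: "measure ?M (Q i) = w" if "i \<in> I" for i
  proof -
    show "Q i \<in> sets ?M" using Q[OF that] Dm by (auto simp: sets_restrict_space_iff fmeasurableD)
    show "measure ?M (Q i) = w" using Q[OF that] Dm w[OF that] by (simp add: measure_restrict_space)
  qed
  define U where "U = (\<Union>i\<in>I. Q i)"
  have UM: "U \<in> sets ?M" using QM I by (auto simp: U_def)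
  have mU: "measure ?M U = w * card I"
    unfolding U_def using disj QM mQ I by (subst finite_measure_finite_Union) auto
  have "U \<subseteq> D" using Q(2) by (auto simp: U_def)
  have mD: "measure ?M D = measure lebesgue D" using Dm by (simp add: measure_restrict_space)
  have DU: "D - U \<in> sets ?M" using UM sets.top[of ?M] by (metis sets.Diff sp)
  have mDU: "measure ?M (D - U) = measure lebesgue D - w * card I"
    using finite_measure_compl[OF UM] mU mD by simp
  define g where "g z = (\<Sum>i\<in>I. indicator (Q i) z *\<^sub>R v i)" for z
  have intQ: "integrable ?M (\<lambda>z. indicator (Q i) z *\<^sub>R v i)" if "i \<in> I" for i
    using QM[OF that] by (intro integrable_scaleR_left integrable_real_indicator) (auto simp: less_top[symmetric])
  have intg: "integrable ?M g" unfolding g_def using intQ by (intro Bochner_Integration.integrable_sum)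
  have int\<Phi>: "integrable ?M \<Phi>"
    by (rule integrable_const_bound[where B = Bd]) (use bd meas in \<open>auto intro!: AE_I2\<close>)
  have "(LINT z|?M. g z) = (\<Sum>i\<in>I. of_real w * v i)"
    unfolding g_def using intQ QM mQ
    by (subst Bochner_Integration.integral_sum) (auto simp: scaleR_conv_of_real Int_absorb2[OF Q(2)])
  then have "cmod ((\<Sum>i\<in>I. of_real w * v i) - (LINT z|?M. \<Phi> z)) = cmod (LINT z|?M. g z - \<Phi> z)"
    using intg int\<Phi> by simp
  also have "\<dots> \<le> (LINT z|?M. cmod (g z - \<Phi> z))" by (rule integral_norm_bound)
  also have "\<dots> \<le> (LINT z|?M. \<eta> * indicator U z + Bd * indicator (D - U) z)"
  proof (rule integral_mono)
    show "integrable ?M (\<lambda>z. cmod (g z - \<Phi> z))" using intg int\<Phi> by auto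
    show "integrable ?M (\<lambda>z. \<eta> * indicator U z + Bd * indicator (D - U) z)"
      using UM DU by (intro Bochner_Integration.integrable_add integrable_mult_right integrable_real_indicator)
        (auto simp: less_top[symmetric])
    fix z assume "z \<in> space ?M"
    then have z: "z \<in> D" by simp
    show "cmod (g z - \<Phi> z) \<le> \<eta> * indicator U z + Bd * indicator (D - U) z"
    proof (cases "z \<in> U")
      case True
      then obtain i where i: "i \<in> I" "z \<in> Q i" by (auto simp: U_def)
      have "z \<notin> Q j" if "j \<in> I" "j \<noteq> i" for j
        using disj i that unfolding disjoint_family_on_def by auto
      then have "g z = (\<Sum>j\<in>I. if j = i then v i else 0)"
        unfolding g_def using i by (intro sum.cong) auto
      then have "g z = v i" using I i by simp
      then show ?thesis using \<eta>[OF i] True by (simp add: norm_minus_commute)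
    next
      case False
      then have "g z = 0" unfolding g_def U_def by (intro sum.neutral) auto
      then show ?thesis using False bd z by simp
    qed
  qed
  also have "\<dots> = \<eta> * (w * card I) + Bd * (measure lebesgue D - w * card I)"
    using UM DU mU mDU Int_absorb2[OF \<open>U \<subseteq> D\<close>] by (subst Bochner_Integration.integral_add)
      (auto intro!: integrable_mult_right integrable_real_indicator simp: less_top[symmetric] Int_absorb2[of "D - U" D])
  finally show ?thesis .
qed

text \<open>The largest multiple of \<open>N\<close> up to \<open>n\<close>. Indices beyond it form
  an incomplete block, which is treated as a negligible remainder.\<close>

definition full_range :: "nat \<Rightarrow> nat \<Rightarrow> nat" where "full_range n N = N * (n div N)"

text \<open>The index \<open>i\<close> is a grid point on the one hand and, through division with remainder by \<open>N\<close>, a pair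
  of a block of \<open>N\<^sup>2\<close> grid points and a discrete frequency on the other hand.\<close>

definition cell_point :: "nat \<Rightarrow> nat \<Rightarrow> nat \<times> nat \<Rightarrow> (real^2) \<times> (real^2)" where
  "cell_point n N i = (vector [real N * real (fst i div N) / real n, real N * real (snd i div N) / real n],
     vector [- pi + 2 * pi * real (fst i mod N) / real N, - pi + 2 * pi * real (snd i mod N) / real N])"

text \<open>In each direction the widths N / n in space and 2 pi / N in frequency multiply to 2 pi /
  n, so every index owns the same share of phase space, whatever \<open>N\<close> is.\<close>

definition cell_size :: "nat \<Rightarrow> nat \<Rightarrow> (real^2) \<times> (real^2)" where
  "cell_size n N = (vec (real N / real n), vec (2 * pi / real N))"

lemma cell_step:
  fixes a b :: nat and c t s :: real
  assumes "c > 0" "s + c * real a < t" "t < s + c * real a + c" "s + c * real b < t" "t < s + c * real b + c"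
  shows "a = b"
proof -
  have "c * real a < c * (real b + 1)" "c * real b < c * (real a + 1)"
    using assms by (simp_all add: distrib_left)
  then show ?thesis using assms(1) by (auto simp: mult_less_cancel_left_pos)
qed

lemma full_range_le: "full_range n N \<le> n"
  unfolding full_range_def by (metis div_mult_mod_eq le_add1 mult.commute)

lemma cell_upper:
  assumes "N > 0" "n > 0" "i < full_range n N"
  shows "real N * real (i div N) / real n + real N / real n \<le> 1"
    "- pi + 2 * pi * real (i mod N) / real N + 2 * pi / real N \<le> pi"
proof -
  have "i div N < n div N" using assms by (simp add: full_range_def less_mult_imp_div_less mult.commute)
  then have "N * (i div N + 1) \<le> N * (n div N)" by (intro mult_le_mono2) simp
  also have "\<dots> \<le> n" using full_range_le[of n N] by (simp add: full_range_def)
  finally have "real (N * (i div N + 1)) \<le> real n" by (simp only: of_nat_le_iff)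
  then have "real N * real (i div N) + real N \<le> real n" by (simp add: distrib_left)
  then have "(real N * real (i div N) + real N) / real n \<le> 1" using assms by simp
  then show "real N * real (i div N) / real n + real N / real n \<le> 1" by (simp add: add_divide_distrib)
  have "i mod N + 1 \<le> N" using assms(1) by (simp add: Suc_leI)
  then have "real (i mod N) + 1 \<le> real N" by linarith
  then have "2 * pi * (real (i mod N) + 1) / real N \<le> 2 * pi" using assms by (simp add: divide_le_eq)
  then show "- pi + 2 * pi * real (i mod N) / real N + 2 * pi / real N \<le> pi"
    by (simp add: distrib_left add_divide_distrib)
qed

text \<open>The boxes are open, hence disjoint outright, and they fill the domain up to their edges
  and the incomplete blocks. As each has volume 4 pi^2 / n^2, the plain average of the
  \<open>v i\<close> is a Riemann sum.\<close>

theorem riemann_cells: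
  fixes \<Phi> :: "(real^2) \<times> (real^2) \<Rightarrow> complex"
  assumes N: "N > 0" and n: "n > 0"
    and meas: "\<Phi> \<in> borel_measurable (lebesgue_on (unit_square \<times> freq_square))"
    and bd: "\<And>z. z \<in> unit_square \<times> freq_square \<Longrightarrow> cmod (\<Phi> z) \<le> Bd"
    and \<eta>: "\<And>i z. i \<in> {..<full_range n N} \<times> {..<full_range n N} \<Longrightarrow>
       z \<in> box (cell_point n N i) (cell_point n N i + cell_size n N) \<Longrightarrow> cmod (\<Phi> z - v i) \<le> \<eta>"
    and \<eta>0: "\<eta> \<ge> 0"
  shows "cmod ((\<Sum>i\<in>{..<full_range n N} \<times> {..<full_range n N}. v i) / of_nat (n\<^sup>2)
       - (LINT z|lebesgue_on (unit_square \<times> freq_square). \<Phi> z) / of_real (4 * pi\<^sup>2))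
    \<le> \<eta> + Bd * (1 - (real (full_range n N) / real n)\<^sup>2)"
    and "measure lebesgue (unit_square \<times> freq_square) = 4 * pi\<^sup>2"
    and "unit_square \<times> freq_square \<in> lmeasurable"
proof -
  let ?I = "{..<full_range n N} \<times> {..<full_range n N}"
  let ?Q = "\<lambda>i. box (cell_point n N i) (cell_point n N i + cell_size n N)"
  let ?D = "unit_square \<times> freq_square"
  define w where "w = 4 * pi\<^sup>2 / (real n)\<^sup>2"
  have Qeq: "?Q i = box (fst (cell_point n N i)) (fst (cell_point n N i) + vec (real N / real n))
      \<times> box (snd (cell_point n N i)) (snd (cell_point n N i) + vec (2 * pi / real N))" for i
    by (cases "cell_point n N i") (simp add: cell_size_def box_Pair_eq)
  have Qm: "measure lebesgue (?Q i) = w" for i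
  proof -
    have "measure lborel (?Q i) = (real N / real n * (real N / real n)) * (2 * pi / real N * (2 * pi / real N))"
      unfolding Qeq by (subst measure_lborel_Times) (auto simp: measure_box_real2)
    also have "\<dots> = w" using N by (simp add: w_def power2_eq_square)
    finally show ?thesis by (simp add: measure_completion)
  qed
  have Ql: "?Q i \<in> lmeasurable" for i
    unfolding Qeq by (intro lmeasurable_Times_bounded) auto
  have Qsub: "?Q i \<subseteq> ?D" if "i \<in> ?I" for i
  proof -
    have i: "fst i < full_range n N" "snd i < full_range n N" using that by auto
    have 0: "0 \<le> real N * real (k div N) / real n" "0 \<le> 2 * pi * real (k mod N) / real N" for k by auto
    show ?thesis
    proof
      fix z assume "z \<in> ?Q i"
      then obtain x \<theta> where z: "z = (x, \<theta>)"
        and x: "x \<in> box (fst (cell_point n N i)) (fst (cell_point n N i) + vec (real N / real n))"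
        and \<theta>: "\<theta> \<in> box (snd (cell_point n N i)) (snd (cell_point n N i) + vec (2 * pi / real N))"
        unfolding Qeq by auto
      have "0 \<le> x$1" "x$1 \<le> 1" "0 \<le> x$2" "x$2 \<le> 1"
        using x cell_upper(1)[OF N n i(1)] cell_upper(1)[OF N n i(2)] 0(1)[of "fst i"] 0(1)[of "snd i"]
        unfolding mem_box_real2 cell_point_def
        by (simp_all only: fst_conv vector_2 vector_add_component vec_component) (elim conjE, linarith)+
      moreover have "- pi \<le> \<theta>$1" "\<theta>$1 \<le> pi" "- pi \<le> \<theta>$2" "\<theta>$2 \<le> pi"
        using \<theta> cell_upper(2)[OF N n i(1)] cell_upper(2)[OF N n i(2)] 0(2)[of "fst i"] 0(2)[of "snd i"]
        unfolding mem_box_real2 cell_point_def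
        by (simp_all only: snd_conv vector_2 vector_add_component vec_component) (elim conjE, linarith)+
      ultimately show "z \<in> ?D" by (simp add: z mem_box_real2 del: vec_0 vec_1)
    qed
  qed
  have disj: "disjoint_family_on ?Q ?I"
    unfolding disjoint_family_on_def
  proof (intro ballI impI, rule ccontr)
    fix i j assume ij: "i \<in> ?I" "j \<in> ?I" "i \<noteq> j" and "?Q i \<inter> ?Q j \<noteq> {}"
    then obtain x \<theta> where "(x, \<theta>) \<in> ?Q i" "(x, \<theta>) \<in> ?Q j" by auto
    then have *: "x \<in> box (fst (cell_point n N i)) (fst (cell_point n N i) + vec (real N / real n))"
      "x \<in> box (fst (cell_point n N j)) (fst (cell_point n N j) + vec (real N / real n))"
      "\<theta> \<in> box (snd (cell_point n N i)) (snd (cell_point n N i) + vec (2 * pi / real N))"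
      "\<theta> \<in> box (snd (cell_point n N j)) (snd (cell_point n N j) + vec (2 * pi / real N))"
      unfolding Qeq by auto
    have c: "real N / real n > 0" "2 * pi / real N > 0" using N n by auto
    have "fst i div N = fst j div N" "snd i div N = snd j div N"
      by (rule cell_step[OF c(1), of 0 _ "x$1"] cell_step[OF c(1), of 0 _ "x$2"],
          use * in \<open>auto simp: mem_box_real2 cell_point_def\<close>)+
    moreover have "fst i mod N = fst j mod N" "snd i mod N = snd j mod N"
      by (rule cell_step[OF c(2), of "-pi" _ "\<theta>$1"] cell_step[OF c(2), of "-pi" _ "\<theta>$2"],
          use * in \<open>auto simp: mem_box_real2 cell_point_def\<close>)+
    ultimately have "fst i = fst j" "snd i = snd j" by (metis div_mult_mod_eq)+
    then show False using ij(3) by (simp add: prod_eq_iff)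
  qed
  show mD: "measure lebesgue ?D = 4 * pi\<^sup>2"
  proof -
    have "measure lborel ?D = (1 - 0) * (1 - 0) * ((pi - - pi) * (pi - - pi))"
      by (subst measure_lborel_Times) (auto simp: measure_box_real2 simp del: vec_0 vec_1)
    moreover have "?D \<in> sets lborel" by (simp add: borel_Times)
    ultimately show ?thesis by (simp add: measure_completion power2_eq_square)
  qed
  show Dl: "?D \<in> lmeasurable" by (intro lmeasurable_Times_bounded) auto
  have card: "card ?I = (full_range n N)\<^sup>2" by (simp add: power2_eq_square)
  have le1: "(real (full_range n N) / real n)\<^sup>2 \<le> 1"
    using full_range_le[of n N] n by (intro power_le_one) auto
  have "cmod ((\<Sum>i\<in>?I. of_real w * v i) - (LINT z|lebesgue_on ?D. \<Phi> z))
      \<le> \<eta> * (w * card ?I) + Bd * (measure lebesgue ?D - w * card ?I)"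
    by (rule sum_cells_integral_bound[OF _ disj Ql Qsub Qm Dl meas bd \<eta>]) auto
  also have "\<dots> = 4 * pi\<^sup>2 * (\<eta> * (real (full_range n N) / real n)\<^sup>2 + Bd * (1 - (real (full_range n N) / real n)\<^sup>2))"
    unfolding mD card w_def by (simp add: power_divide algebra_simps)
  also have "\<dots> \<le> 4 * pi\<^sup>2 * (\<eta> + Bd * (1 - (real (full_range n N) / real n)\<^sup>2))"
    using \<eta>0 le1 by (intro mult_left_mono add_right_mono) (auto intro: mult_right_le_one_le)
  finally have "cmod ((\<Sum>i\<in>?I. of_real w * v i) - (LINT z|lebesgue_on ?D. \<Phi> z)) / (4 * pi\<^sup>2)
      \<le> \<eta> + Bd * (1 - (real (full_range n N) / real n)\<^sup>2)"
    by (simp add: field_simps)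
  moreover have "cmod ((\<Sum>i\<in>?I. of_real w * v i) - (LINT z|lebesgue_on ?D. \<Phi> z)) / (4 * pi\<^sup>2)
      = cmod (((\<Sum>i\<in>?I. of_real w * v i) - (LINT z|lebesgue_on ?D. \<Phi> z)) / of_real (4 * pi\<^sup>2))"
    by (simp add: norm_divide norm_mult norm_power)
  moreover have "((\<Sum>i\<in>?I. of_real w * v i) - (LINT z|lebesgue_on ?D. \<Phi> z)) / of_real (4 * pi\<^sup>2)
     = (\<Sum>i\<in>?I. v i) / of_nat (n\<^sup>2) - (LINT z|lebesgue_on ?D. \<Phi> z) / of_real (4 * pi\<^sup>2)"
    by (simp add: w_def diff_divide_distrib sum_divide_distrib flip: sum_distrib_left)
  ultimately show "cmod ((\<Sum>i\<in>?I. v i) / of_nat (n\<^sup>2)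
       - (LINT z|lebesgue_on ?D. \<Phi> z) / of_real (4 * pi\<^sup>2))
    \<le> \<eta> + Bd * (1 - (real (full_range n N) / real n)\<^sup>2)" by simp
qed

section \<open>Approximation by block circulant matrices\<close>

lemma sum_roots_of_unity:
  fixes t :: int
  assumes "N > 0"
  shows "(\<Sum>j<N. cis (2 * pi * real_of_int t * real j / real N)) = (if int N dvd t then of_nat N else 0)"
proof -
  define z where "z = cis (2 * pi * real_of_int t / real N)"
  have zj: "cis (2 * pi * real_of_int t * real j / real N) = z ^ j" for j
    unfolding z_def Complex.DeMoivre by (simp add: mult_ac)
  have zN: "z ^ N = 1"
    using assms cis_multiple_2pi[of "of_int t"] unfolding z_def Complex.DeMoivre by simp
  show ?thesis
  proof (cases "int N dvd t")
    case True
    then obtain q where "t = int N * q" by auto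
    then have *: "2 * pi * real_of_int t / real N = 2 * pi * real_of_int q" using assms by simp
    have "z = 1" unfolding z_def * by (rule cis_multiple_2pi[OF Ints_of_int])
    then show ?thesis using True by (simp add: zj)
  next
    case False
    have "z \<noteq> 1"
    proof
      assume "z = 1"
      then have "cos (2 * pi * real_of_int t / real N) = 1" by (simp add: z_def complex_eq_iff)
      then obtain q :: int where "2 * pi * real_of_int t / real N = real_of_int q * 2 * pi"
        unfolding cos_one_2pi_int by auto
      then have "real_of_int t = real_of_int (q * int N)" using assms by (simp add: field_simps)
      then have "t = q * int N" by (simp only: of_int_eq_iff)
      then show False using False by simp
    qed
    then show ?thesis using False zN by (simp add: zj geometric_sum)
  qed
qed

lemma div_less_full_range_iff: "N > 0 \<Longrightarrow> i div N < n div N \<longleftrightarrow> i < full_range n N"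
  unfolding full_range_def by (metis div_less_iff_less_mult mult.commute)

lemma sum_block:
  assumes N: "N > 0" and s: "s < n div N"
  shows "(\<Sum>i<n. if i < full_range n N \<and> i div N = s then f i else (0::'a::comm_monoid_add)) = (\<Sum>j<N. f (s * N + j))"
proof -
  have lt: "s * N + j < full_range n N" if "j < N" for j
  proof -
    have "(s * N + j) div N = s" using that N by simp
    then show ?thesis using s div_less_full_range_iff[OF N] by metis
  qed
  have "(\<Sum>i<n. if i < full_range n N \<and> i div N = s then f i else 0)
      = (\<Sum>i\<in>{i\<in>{..<n}. i < full_range n N \<and> i div N = s}. f i)"
    by (rule sum.inter_filter[symmetric]) simp
  also have "\<dots> = (\<Sum>j<N. f (s * N + j))"
  proof (rule sum.reindex_bij_witness[of _ "\<lambda>j. s * N + j" "\<lambda>i. i mod N"])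
    fix i assume i: "i \<in> {i\<in>{..<n}. i < full_range n N \<and> i div N = s}"
    show "s * N + i mod N = i" using i div_mult_mod_eq[of i N] by auto
    show "i mod N \<in> {..<N}" using N by simp
    then show "f (s * N + i mod N) = f i" using \<open>s * N + i mod N = i\<close> by simp
  next
    fix j assume j: "j \<in> {..<N}"
    then show "(s * N + j) mod N = j" by simp
    show "s * N + j \<in> {i\<in>{..<n}. i < full_range n N \<and> i div N = s}"
      using j lt[of j] full_range_le[of n N] by auto
  qed
  finally show ?thesis .
qed

text \<open>The frequencies start at - pi in order to sample \<open>freq_square\<close>; they depend
  on \<open>i mod N\<close> only, so each block carries the same \<open>N\<close> of them.\<close>

definition freq :: "nat \<Rightarrow> nat \<Rightarrow> real" where
  "freq N i = - pi + 2 * pi * real (i mod N) / real N"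

text \<open>Column \<open>i\<close> is a plane wave supported on the block of \<open>i\<close>; on
  the incomplete block the matrix is the identity. The phase uses the global index \<open>l\<close>,
  which changes the usual transform of the block by a factor constant along the column.\<close>

definition block_dft :: "nat \<Rightarrow> nat \<Rightarrow> nat \<Rightarrow> nat \<Rightarrow> complex" where
  "block_dft n N l i =
    (if l < full_range n N \<and> i < full_range n N
     then (if l div N = i div N then cis (- freq N i * real l) / of_real (sqrt (real N)) else 0)
     else of_bool (l = i))"

lemma sum_freq:
  fixes t :: int
  assumes "N > 0"
  shows "(\<Sum>j<N. cis (freq N (s * N + j) * real_of_int t)) = (if int N dvd t then cis (- pi * real_of_int t) * of_nat N else 0)"
proof -
  have "(\<Sum>j<N. cis (freq N (s * N + j) * real_of_int t))
     = (\<Sum>j<N. cis (- pi * real_of_int t) * cis (2 * pi * real_of_int t * real j / real N))"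
  proof (rule sum.cong[OF refl])
    fix j assume "j \<in> {..<N}"
    then have "freq N (s * N + j) * real_of_int t = - pi * real_of_int t + 2 * pi * real_of_int t * real j / real N"
      by (simp add: freq_def algebra_simps)
    then show "cis (freq N (s * N + j) * real_of_int t)
        = cis (- pi * real_of_int t) * cis (2 * pi * real_of_int t * real j / real N)"
      by (simp only: cis_mult)
  qed
  then show ?thesis
    using sum_roots_of_unity[OF assms, of t] by (simp flip: sum_distrib_left)
qed

text \<open>Multiplication by exp (i k \<theta>) on the frequency side, seen in position: the shift
  by \<open>k\<close>, cyclic inside each complete block up to sign, and zero on the incomplete
  one.\<close>

definition block_shift :: "nat \<Rightarrow> nat \<Rightarrow> int \<Rightarrow> nat \<Rightarrow> nat \<Rightarrow> complex" where
  "block_shift n N k a b = (\<Sum>i<full_range n N. block_dft n N a i * cis (freq N i * real_of_int k) * cnj (block_dft n N b i))"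

text \<open>Summing roots of unity leaves the offsets congruent to \<open>k\<close> modulo
  \<open>N\<close>. The factor cis (- pi t) is a sign, caused by the frequencies starting at - pi;
  it is 1 on entries that do not wrap around.\<close>

lemma block_shift_eq:
  assumes N: "N > 0"
  shows "block_shift n N k a b =
    (if a < full_range n N \<and> b < full_range n N \<and> a div N = b div N
     then (let t = k - (int a - int b) in if int N dvd t then cis (- pi * real_of_int t) else 0) else 0)"
proof (cases "a < full_range n N \<and> b < full_range n N \<and> a div N = b div N")
  case True
  define t where "t = k - (int a - int b)"
  have "block_shift n N k a b
      = (\<Sum>i<n. if i < full_range n N \<and> i div N = a div N then cis (freq N i * real_of_int t) / of_nat N else 0)"
  proof -
    have "block_shift n N k a b
      = (\<Sum>i<full_range n N. if i div N = a div N then cis (freq N i * real_of_int t) / of_nat N else 0)"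
      unfolding block_shift_def
    proof (rule sum.cong[OF refl])
      fix i assume i: "i \<in> {..<full_range n N}"
      have sq: "complex_of_real (sqrt (real N)) * complex_of_real (sqrt (real N)) = of_nat N"
        by (simp flip: of_real_mult)
      have "cis (- freq N i * real a) * cis (freq N i * real_of_int k) * cnj (cis (- freq N i * real b))
         = cis (freq N i * real_of_int t)"
        by (simp add: cis_cnj cis_mult t_def algebra_simps)
      then show "block_dft n N a i * cis (freq N i * real_of_int k) * cnj (block_dft n N b i)
        = (if i div N = a div N then cis (freq N i * real_of_int t) / of_nat N else 0)"
        using True i by (auto simp: block_dft_def field_simps sq)
    qed
    also have "\<dots> = (\<Sum>i\<in>{i\<in>{..<n}. i < full_range n N}. if i div N = a div N then cis (freq N i * real_of_int t) / of_nat N else 0)"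
      by (rule sum.cong) (use full_range_le[of n N] in auto)
    also have "\<dots> = (\<Sum>i<n. if i < full_range n N then (if i div N = a div N then cis (freq N i * real_of_int t) / of_nat N else 0) else 0)"
      by (rule sum.inter_filter) simp
    also have "\<dots> = (\<Sum>i<n. if i < full_range n N \<and> i div N = a div N then cis (freq N i * real_of_int t) / of_nat N else 0)"
      by (rule sum.cong) auto
    finally show ?thesis .
  qed
  also have "\<dots> = (\<Sum>j<N. cis (freq N (a div N * N + j) * real_of_int t) / of_nat N)"
    by (rule sum_block[OF N]) (use True div_less_full_range_iff[OF N] in auto)
  also have "\<dots> = (if int N dvd t then cis (- pi * real_of_int t) else 0)"
    using sum_freq[OF N, of "a div N" t] N by (simp flip: sum_divide_distrib)
  finally show ?thesis using True by (simp add: t_def)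
next
  case False
  then show ?thesis
    unfolding block_shift_def by (auto simp: block_dft_def intro!: sum.neutral)
qed

lemma sum_full_range_split:
  "(\<Sum>i<n. f i) = (\<Sum>i<full_range n N. f i) + (\<Sum>i=full_range n N..<n. f i)"
  using sum.atLeastLessThan_concat[of 0 "full_range n N" n f] full_range_le[of n N]
  by (simp add: atLeast0LessThan)

lemma abs_diff_less_of_same_div:
  fixes a b N :: nat
  assumes "a div N = b div N" "N > 0"
  shows "\<bar>int a - int b\<bar> < int N"
proof -
  have "int a - int b = int (a mod N) - int (b mod N)"
    using div_mult_mod_eq[of a N] div_mult_mod_eq[of b N] assms(1)
    by (metis add_diff_cancel_left of_nat_add)
  moreover have "a mod N < N" "b mod N < N" using assms(2) by auto
  ultimately show ?thesis by linarith
qed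

lemma dvd_abs_less_imp_0: "int N dvd t \<Longrightarrow> \<bar>t\<bar> < int N \<Longrightarrow> t = 0"
  using zdvd_imp_le[of "int N" "\<bar>t\<bar>"] by (cases "t = 0") auto

text \<open>Row orthonormality is the block shift by \<open>0\<close>; for columns the geometric sum
  runs over positions instead of frequencies.\<close>

lemma unitary_block_dft:
  assumes N: "N > 0"
  shows "unitary_on n (block_dft n N)"
  unfolding unitary_on_def
proof (intro conjI allI impI)
  fix i j assume ij: "i < n" "j < n"
  have rest: "(\<Sum>l=full_range n N..<n. block_dft n N i l * cnj (block_dft n N j l)) =
      (if i < full_range n N then 0 else of_bool (i = j))"
  proof (cases "i < full_range n N")
    case True
    then show ?thesis by (auto simp: block_dft_def intro!: sum.neutral)
  next
    case False
    have "(\<Sum>l=full_range n N..<n. block_dft n N i l * cnj (block_dft n N j l))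
        = (\<Sum>l=full_range n N..<n. if l = i then of_bool (i = j) else 0)"
      using False by (intro sum.cong) (auto simp: block_dft_def)
    then show ?thesis using False ij by simp
  qed
  have "(\<Sum>l<full_range n N. block_dft n N i l * cnj (block_dft n N j l)) = block_shift n N 0 i j"
    by (simp add: block_shift_def)
  also have "\<dots> = (if i < full_range n N then of_bool (i = j) else 0)"
    unfolding block_shift_eq[OF N] Let_def
    using dvd_abs_less_imp_0[of N "0 - (int i - int j)"] abs_diff_less_of_same_div[of j N i] N by auto
  finally show "(\<Sum>l<n. block_dft n N i l * cnj (block_dft n N j l)) = of_bool (i = j)"
    unfolding sum_full_range_split[of _ n N] rest by auto
next
  fix i j assume ij: "i < n" "j < n"
  show "(\<Sum>l<n. block_dft n N l i * cnj (block_dft n N l j)) = of_bool (i = j)"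
  proof (cases "i < full_range n N \<and> j < full_range n N")
    case True
    show ?thesis
    proof (cases "i div N = j div N")
      case same: True
      define t where "t = int (j mod N) - int (i mod N)"
      have sq: "complex_of_real (sqrt (real N)) * complex_of_real (sqrt (real N)) = of_nat N"
        by (simp flip: of_real_mult)
      have "block_dft n N l i * cnj (block_dft n N l j) =
          (if l < full_range n N \<and> l div N = i div N
           then cis (2 * pi * real_of_int t * real l / real N) / of_nat N else 0)" if "l < n" for l
      proof -
        have "- freq N i * real l + freq N j * real l = 2 * pi * real_of_int t * real l / real N"
          unfolding freq_def t_def by (simp add: algebra_simps diff_divide_distrib)
        then have "cis (- freq N i * real l) * cnj (cis (- freq N j * real l))
            = cis (2 * pi * real_of_int t * real l / real N)"
          by (simp add: cis_cnj cis_mult)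
        then show ?thesis using True same by (auto simp: block_dft_def field_simps sq)
      qed
      then have "(\<Sum>l<n. block_dft n N l i * cnj (block_dft n N l j))
          = (\<Sum>l<n. if l < full_range n N \<and> l div N = i div N
              then cis (2 * pi * real_of_int t * real l / real N) / of_nat N else 0)"
        by (intro sum.cong) auto
      also have "\<dots> = (\<Sum>l<N. cis (2 * pi * real_of_int t * real (i div N * N + l) / real N) / of_nat N)"
        by (rule sum_block[OF N]) (use True div_less_full_range_iff[OF N] in auto)
      \<comment> \<open>The start of the block contributes a multiple of 2 pi to the phase, so
        positions may be counted from zero.\<close>
      also have "\<dots> = (\<Sum>l<N. cis (2 * pi * real_of_int t * real l / real N) / of_nat N)"
      proof (rule sum.cong[OF refl])
        fix l
        have "2 * pi * real_of_int t * real (i div N * N + l) / real N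
           = 2 * pi * real_of_int (t * int (i div N)) + 2 * pi * real_of_int t * real l / real N"
          using N by (simp add: field_simps)
        then show "cis (2 * pi * real_of_int t * real (i div N * N + l) / real N) / of_nat N
           = cis (2 * pi * real_of_int t * real l / real N) / of_nat N"
          by (simp only: cis_mult[symmetric] cis_multiple_2pi[OF Ints_of_int] mult_1)
      qed
      also have "\<dots> = (if int N dvd t then 1 else 0)"
        using sum_roots_of_unity[OF N, of t] N by (simp flip: sum_divide_distrib)
      also have "\<dots> = of_bool (i = j)"
      proof -
        have "i mod N < N" "j mod N < N" using N by auto
        then have "\<bar>t\<bar> < int N" unfolding t_def by linarith
        then have "int N dvd t \<longleftrightarrow> i mod N = j mod N"
          using dvd_abs_less_imp_0[of N t] by (auto simp: t_def)
        then show ?thesis using same by (auto simp: of_bool_def) (metis div_mult_mod_eq)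
      qed
      finally show ?thesis .
    next
      case False
      then show ?thesis using True by (auto simp: block_dft_def intro!: sum.neutral)
    qed
  next
    case False
    have "(\<Sum>l<n. block_dft n N l i * cnj (block_dft n N l j)) = (\<Sum>l<n. if l = (if i < full_range n N then j else i) then of_bool (i = j) else 0)"
      using False by (intro sum.cong) (auto simp: block_dft_def)
    then show ?thesis using ij by simp
  qed
qed

section \<open>Two-level bases and block matrices\<close>

lemma sum_div_mod:
  fixes f :: "nat \<Rightarrow> nat \<Rightarrow> 'a::comm_monoid_add"
  shows "(\<Sum>r<n\<^sup>2. f (r div n) (r mod n)) = (\<Sum>a<n. \<Sum>b<n. f a b)"
proof (cases "n = 0")
  case False
  have "(\<Sum>r<n\<^sup>2. f (r div n) (r mod n)) = (\<Sum>(a, b)\<in>{..<n} \<times> {..<n}. f a b)"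
  proof (rule sum.reindex_bij_witness[of _ "\<lambda>(a, b). a * n + b" "\<lambda>r. (r div n, r mod n)"])
    fix p assume p: "p \<in> {..<n} \<times> {..<n}"
    then obtain a b where ab: "p = (a, b)" "a < n" "b < n" by auto
    have "a * n + b < (a + 1) * n" using ab by simp
    also have "\<dots> \<le> n * n" using ab by (intro mult_right_mono) auto
    finally show "(case p of (a, b) \<Rightarrow> a * n + b) \<in> {..<n\<^sup>2}" by (simp add: ab power2_eq_square)
    show "((case p of (a, b) \<Rightarrow> a * n + b) div n, (case p of (a, b) \<Rightarrow> a * n + b) mod n) = p"
      using ab by simp
  qed (use False in \<open>auto simp: power2_eq_square less_mult_imp_div_less\<close>)
  then show ?thesis by (simp add: sum.cartesian_product)
qed simp

lemma unitary_kronecker: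
  assumes "unitary_on n V"
  shows "unitary_on (n\<^sup>2) (\<lambda>r i. V (r div n) (i div n) * V (r mod n) (i mod n))"
proof -
  have lt: "i div n < n" "i mod n < n" if "i < n\<^sup>2" for i
    using that by (auto simp: power2_eq_square less_mult_imp_div_less) (metis gr0I mod_less_divisor mult_0 not_less0)
  have eq: "i div n = j div n \<and> i mod n = j mod n \<longleftrightarrow> i = j" for i j by (metis div_mult_mod_eq)
  have 1: "(\<Sum>l<n\<^sup>2. V (l div n) (i div n) * V (l mod n) (i mod n) * cnj (V (l div n) (j div n) * V (l mod n) (j mod n)))
      = (\<Sum>a<n. V a (i div n) * cnj (V a (j div n))) * (\<Sum>b<n. V b (i mod n) * cnj (V b (j mod n)))" for i j
    using sum_div_mod[of "\<lambda>a b. V a (i div n) * V b (i mod n) * cnj (V a (j div n) * V b (j mod n))" n]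
    by (simp add: sum_product mult_ac)
  have 2: "(\<Sum>l<n\<^sup>2. V (i div n) (l div n) * V (i mod n) (l mod n) * cnj (V (j div n) (l div n) * V (j mod n) (l mod n)))
      = (\<Sum>a<n. V (i div n) a * cnj (V (j div n) a)) * (\<Sum>b<n. V (i mod n) b * cnj (V (j mod n) b))" for i j
    using sum_div_mod[of "\<lambda>a b. V (i div n) a * V (i mod n) b * cnj (V (j div n) a * V (j mod n) b)" n]
    by (simp add: sum_product mult_ac)
  show ?thesis
    unfolding unitary_on_def 1 2 using assms lt eq by (auto simp: unitary_on_def simp flip: of_bool_conj)
qed

text \<open>\<open>\<rho> x k1 k2\<close> is the coefficient at the offset (k1, k2). The window from
  -1 to 1 suffices since a node interacts with its immediate neighbours only.\<close>

definition symbol_sum :: "(real^2 \<Rightarrow> int \<Rightarrow> int \<Rightarrow> complex) \<Rightarrow> (real^2) \<times> (real^2) \<Rightarrow> complex" where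
  "symbol_sum \<rho> z = (\<Sum>k1\<in>{-1..1}. \<Sum>k2\<in>{-1..1}. \<rho> (fst z) k1 k2 * cis (snd z$1 * of_int k1 + snd z$2 * of_int k2))"

text \<open>The value 0 on incomplete blocks is a default; at most a fraction 2 N / n of the indices
  takes it.\<close>

definition block_eigenvalue where
  "block_eigenvalue \<rho> n N r = (if r div n < full_range n N \<and> r mod n < full_range n N
     then symbol_sum \<rho> (cell_point n N (r div n, r mod n)) else 0)"

definition block_basis :: "nat \<Rightarrow> nat \<Rightarrow> nat \<Rightarrow> nat \<Rightarrow> complex" where
  "block_basis n N r i = block_dft n N (r div n) (i div n) * block_dft n N (r mod n) (i mod n)"

text \<open>On each block of \<open>N\<^sup>2\<close> grid points the coefficients are frozen at the corner and the matrix is made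
  circulant, so that the discrete Fourier transform of the block diagonalises it.\<close>

definition block_matrix where
  "block_matrix \<rho> n N r s = (\<Sum>i<n\<^sup>2. block_basis n N r i * block_eigenvalue \<rho> n N i * cnj (block_basis n N s i))"

lemma unitary_block_basis: "N > 0 \<Longrightarrow> unitary_on (n\<^sup>2) (block_basis n N)"
  using unitary_kronecker[OF unitary_block_dft[of N n]] unfolding block_basis_def[abs_def] .

text \<open>The sampled Toeplitz matrix with coefficients \<rho>, entry by entry. They are frozen at
  the sampling point i / n of the row, not at the mesh node i / (n + 1).\<close>

definition local_matrix :: "(real^2 \<Rightarrow> int \<Rightarrow> int \<Rightarrow> complex) \<Rightarrow> nat \<Rightarrow> nat \<Rightarrow> nat \<Rightarrow> complex" where
  "local_matrix \<rho> n r s = \<rho> (vector [real (r div n + 1) / real n, real (r mod n + 1) / real n])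
     (int (r div n) - int (s div n)) (int (r mod n) - int (s mod n))"

lemma block_matrix_eq:
  assumes N: "N > 0"
  shows "block_matrix \<rho> n N r s = (\<Sum>k1\<in>{-1..1}. \<Sum>k2\<in>{-1..1}.
     \<rho> (fst (cell_point n N (r div n, r mod n))) k1 k2 *
     (block_shift n N k1 (r div n) (s div n) * block_shift n N k2 (r mod n) (s mod n)))"
proof -
  let ?K = "full_range n N"
  let ?V = "block_dft n N"
  define a1 a2 b1 b2 where "a1 = r div n" and "a2 = r mod n" and "b1 = s div n" and "b2 = s mod n"
  define \<mu> where "\<mu> i1 i2 = (if i1 < ?K \<and> i2 < ?K then symbol_sum \<rho> (cell_point n N (i1, i2)) else 0)" for i1 i2
  let ?x = "fst (cell_point n N (a1, a2))"
  \<comment> \<open>Forces the block of \<open>i\<close> to be that of \<open>a\<close>, which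
    permits moving the corner point to the row.\<close>
  have V0: "?V a i = 0" if "i < ?K" "a \<ge> ?K \<or> a div N \<noteq> i div N" for a i
    using that by (auto simp: block_dft_def)
  have "block_matrix \<rho> n N r s = (\<Sum>i1<n. \<Sum>i2<n. ?V a1 i1 * ?V a2 i2 * \<mu> i1 i2 * cnj (?V b1 i1 * ?V b2 i2))"
    unfolding block_matrix_def block_basis_def block_eigenvalue_def a1_def a2_def b1_def b2_def \<mu>_def
    by (rule sum_div_mod)
  also have "\<dots> = (\<Sum>i1<n. \<Sum>i2<?K. ?V a1 i1 * ?V a2 i2 * \<mu> i1 i2 * cnj (?V b1 i1 * ?V b2 i2))"
    by (intro sum.cong refl sum.mono_neutral_right) (use full_range_le[of n N] in \<open>auto simp: \<mu>_def\<close>)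
  also have "\<dots> = (\<Sum>i1<?K. \<Sum>i2<?K. ?V a1 i1 * ?V a2 i2 * \<mu> i1 i2 * cnj (?V b1 i1 * ?V b2 i2))"
    by (intro sum.mono_neutral_right) (use full_range_le[of n N] in \<open>auto simp: \<mu>_def\<close>)
  also have "\<dots> = (\<Sum>i1<?K. \<Sum>i2<?K. \<Sum>k1\<in>{-1..1}. \<Sum>k2\<in>{-1..1}. \<rho> ?x k1 k2 *
      ((?V a1 i1 * cis (freq N i1 * of_int k1) * cnj (?V b1 i1)) * (?V a2 i2 * cis (freq N i2 * of_int k2) * cnj (?V b2 i2))))"
  proof (intro sum.cong refl)
    fix i1 i2 assume "i1 \<in> {..<?K}" "i2 \<in> {..<?K}"
    then have i: "i1 < ?K" "i2 < ?K" by auto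
    show "?V a1 i1 * ?V a2 i2 * \<mu> i1 i2 * cnj (?V b1 i1 * ?V b2 i2)
      = (\<Sum>k1\<in>{-1..1}. \<Sum>k2\<in>{-1..1}. \<rho> ?x k1 k2 *
      ((?V a1 i1 * cis (freq N i1 * of_int k1) * cnj (?V b1 i1)) * (?V a2 i2 * cis (freq N i2 * of_int k2) * cnj (?V b2 i2))))"
    proof (cases "a1 div N = i1 div N \<and> a2 div N = i2 div N")
      case True
      then have "fst (cell_point n N (i1, i2)) = ?x" by (simp add: cell_point_def)
      then have "\<mu> i1 i2 = (\<Sum>k1\<in>{-1..1}. \<Sum>k2\<in>{-1..1}. \<rho> ?x k1 k2 * (cis (freq N i1 * of_int k1) * cis (freq N i2 * of_int k2)))"
        using i by (simp add: \<mu>_def symbol_sum_def cell_point_def freq_def cis_mult)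
      then show ?thesis by (simp add: sum_distrib_left sum_distrib_right mult_ac)
    next
      case False
      then show ?thesis using V0[OF i(1), of a1] V0[OF i(2), of a2] by auto
    qed
  qed
  also have "\<dots> = (\<Sum>k1\<in>{-1..1}. \<Sum>k2\<in>{-1..1}. \<Sum>i1<?K. \<Sum>i2<?K. \<rho> ?x k1 k2 *
      ((?V a1 i1 * cis (freq N i1 * of_int k1) * cnj (?V b1 i1)) * (?V a2 i2 * cis (freq N i2 * of_int k2) * cnj (?V b2 i2))))"
  proof -
    have "(\<Sum>i1\<in>A. \<Sum>i2\<in>B. \<Sum>k1\<in>C. \<Sum>k2\<in>D. f i1 i2 k1 k2) = (\<Sum>k1\<in>C. \<Sum>k2\<in>D. \<Sum>i1\<in>A. \<Sum>i2\<in>B. f i1 i2 k1 k2)"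
      for A B :: "nat set" and C D :: "int set" and f :: "nat \<Rightarrow> nat \<Rightarrow> int \<Rightarrow> int \<Rightarrow> complex"
    proof -
      have "(\<Sum>i1\<in>A. \<Sum>i2\<in>B. \<Sum>k1\<in>C. \<Sum>k2\<in>D. f i1 i2 k1 k2) = (\<Sum>i1\<in>A. \<Sum>k1\<in>C. \<Sum>i2\<in>B. \<Sum>k2\<in>D. f i1 i2 k1 k2)"
        by (rule sum.cong[OF refl], rule sum.swap)
      also have "\<dots> = (\<Sum>k1\<in>C. \<Sum>i1\<in>A. \<Sum>k2\<in>D. \<Sum>i2\<in>B. f i1 i2 k1 k2)"
        by (subst sum.swap, rule sum.cong[OF refl], rule sum.cong[OF refl], rule sum.swap)
      also have "\<dots> = (\<Sum>k1\<in>C. \<Sum>k2\<in>D. \<Sum>i1\<in>A. \<Sum>i2\<in>B. f i1 i2 k1 k2)"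
        by (rule sum.cong[OF refl], rule sum.swap)
      finally show ?thesis .
    qed
    then show ?thesis .
  qed
  also have "\<dots> = (\<Sum>k1\<in>{-1..1}. \<Sum>k2\<in>{-1..1}. \<rho> ?x k1 k2 * (block_shift n N k1 a1 b1 * block_shift n N k2 a2 b2))"
    unfolding block_shift_def sum_product unfolding sum_distrib_left ..
  finally show ?thesis unfolding a1_def a2_def b1_def b2_def .
qed

section \<open>Rows untouched by the wrap-around\<close>

definition inner_index :: "nat \<Rightarrow> nat \<Rightarrow> nat \<Rightarrow> bool" where
  "inner_index n N a \<longleftrightarrow> a < full_range n N \<and> 1 \<le> a mod N \<and> a mod N + 2 \<le> N"

text \<open>An inner index has both neighbours in its own block, so inside the block the only offset
  congruent to \<open>k\<close> modulo \<open>N\<close> is \<open>k\<close> itself. Conversely an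
  index at distance at most one cannot leave the block, which settles the other case.\<close>

lemma block_shift_inner:
  assumes N: "N > 0" and a: "inner_index n N a" and k: "\<bar>k\<bar> \<le> 1"
  shows "block_shift n N k a b = of_bool (k = int a - int b)"
proof (cases "b < full_range n N \<and> a div N = b div N")
  case True
  have "int a - int b = int (a mod N) - int (b mod N)"
    using div_mult_mod_eq[of a N] div_mult_mod_eq[of b N] True
    by (metis add_diff_cancel_left of_nat_add)
  moreover have "b mod N < N" using N by simp
  ultimately have "\<bar>k - (int a - int b)\<bar> < int N" using a k unfolding inner_index_def by linarith
  then have "int N dvd k - (int a - int b) \<longleftrightarrow> k = int a - int b"
    using dvd_abs_less_imp_0[of N "k - (int a - int b)"] by auto
  then show ?thesis using True a unfolding block_shift_eq[OF N] by (auto simp: Let_def inner_index_def)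
next
  case False
  have "k \<noteq> int a - int b"
  proof
    assume "k = int a - int b"
    then have le: "b \<le> a + 1" "a \<le> b + 1" using k by auto
    have "b div N = a div N"
    proof (rule div_nat_eqI)
      have 1: "1 \<le> a mod N" "a mod N + 2 \<le> N" using a by (auto simp: inner_index_def)
      have 2: "a = N * (a div N) + a mod N" by simp
      show "N * (a div N) \<le> b" using 1(1) 2 le(2) by linarith
      have "N * Suc (a div N) = N * (a div N) + N" by simp
      then show "b < N * Suc (a div N)" using 1(2) 2 le(1) by linarith
    qed
    moreover have "b < full_range n N"
      using a div_less_full_range_iff[OF N] \<open>b div N = a div N\<close> unfolding inner_index_def by metis
    ultimately show False using False by simp
  qed
  then show ?thesis using False unfolding block_shift_eq[OF N] by auto
qed

text \<open>Within a block the residue modulo \<open>N\<close> determines \<open>b\<close>, so a row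
  has at most one nonzero entry, of modulus one.\<close>

lemma sum_block_shift_le:
  assumes N: "N > 0"
  shows "(\<Sum>b<n. cmod (block_shift n N k a b)) \<le> 1"
proof -
  define S where "S = {b\<in>{..<n}. a div N = b div N \<and> int N dvd k - (int a - int b)}"
  have "(\<Sum>b<n. cmod (block_shift n N k a b)) \<le> (\<Sum>b<n. if b \<in> S then 1 else 0)"
  proof (rule sum_mono)
    fix b assume "b \<in> {..<n}"
    then show "cmod (block_shift n N k a b) \<le> (if b \<in> S then 1 else 0)"
      unfolding block_shift_eq[OF N] S_def Let_def by simp
  qed
  also have "\<dots> = real (card S)"
  proof -
    have "(\<Sum>b<n. if b \<in> S then 1 else 0 :: real) = (\<Sum>b\<in>{b\<in>{..<n}. b \<in> S}. 1)"
      by (rule sum.inter_filter[symmetric]) simp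
    also have "{b\<in>{..<n}. b \<in> S} = S" by (auto simp: S_def)
    finally show ?thesis by simp
  qed
  also have "card S \<le> 1"
  proof -
    have "b = b'" if "b \<in> S" "b' \<in> S" for b b'
    proof -
      have "int N dvd k - (int a - int b)" "int N dvd k - (int a - int b')"
        using that unfolding S_def by blast+
      from dvd_diff[OF this] have "int N dvd int b - int b'" by simp
      moreover have "b div N = b' div N" using that unfolding S_def by simp
      then have "\<bar>int b - int b'\<bar> < int N" using N by (rule abs_diff_less_of_same_div)
      ultimately have "int b - int b' = 0" by (rule dvd_abs_less_imp_0)
      then show ?thesis by simp
    qed
    moreover have "finite S" by (simp add: S_def)
    ultimately show ?thesis using card_le_Suc0_iff_eq[of S] by simp
  qed
  finally show ?thesis by simp
qed

text \<open>Each block loses its first and last index, and the incomplete block is lost as a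
  whole.\<close>

lemma card_not_inner:
  assumes N: "N > 0"
  shows "real (card {a\<in>{..<n}. \<not> inner_index n N a}) \<le> 2 * real n / real N + real N"
proof -
  have "{a\<in>{..<n}. \<not> inner_index n N a} \<subseteq>
     (\<lambda>s. s * N) ` {..<n div N} \<union> (\<lambda>s. s * N + (N - 1)) ` {..<n div N} \<union> {full_range n N..<n}"
  proof
    fix a assume a: "a \<in> {a\<in>{..<n}. \<not> inner_index n N a}"
    show "a \<in> (\<lambda>s. s * N) ` {..<n div N} \<union> (\<lambda>s. s * N + (N - 1)) ` {..<n div N} \<union> {full_range n N..<n}"
    proof (cases "a < full_range n N")
      case True
      then have "a mod N = 0 \<or> a mod N + 2 > N" using a by (auto simp: inner_index_def)
      then have "a mod N = 0 \<or> a mod N = N - 1" using mod_less_divisor[OF N, of a] by linarith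
      then have "a = a div N * N \<or> a = a div N * N + (N - 1)"
        using div_mult_mod_eq[of a N] by (elim disjE) linarith+
      moreover have "a div N < n div N" using True div_less_full_range_iff[OF N] by blast
      ultimately show ?thesis by blast
    qed (use a in auto)
  qed
  from card_mono[OF _ this]
  have "card {a\<in>{..<n}. \<not> inner_index n N a} \<le> card ((\<lambda>s. s * N) ` {..<n div N}
      \<union> (\<lambda>s. s * N + (N - 1)) ` {..<n div N} \<union> {full_range n N..<n})" by simp
  also have "\<dots> \<le> n div N + n div N + (n - full_range n N)"
    by (intro order_trans[OF card_Un_le] add_mono order_trans[OF card_image_le]) auto
  also have "n - full_range n N = n mod N" by (simp add: full_range_def minus_mult_div_eq_mod)
  finally have "real (card {a\<in>{..<n}. \<not> inner_index n N a}) \<le> 2 * real (n div N) + real (n mod N)" by linarith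
  also have "real (n div N) \<le> real n / real N" by (rule of_nat_div_le_of_nat) 
  also have "real (n mod N) \<le> real N" using N by (simp add: less_imp_le)
  finally show ?thesis by simp
qed

lemma card_near: "card {b\<in>{..<n}. \<bar>int a - int b\<bar> \<le> 1} \<le> 3"
proof -
  have "{b\<in>{..<n}. \<bar>int a - int b\<bar> \<le> 1} \<subseteq> {a - 1, a, a + 1}" by auto
  from card_mono[OF _ this] show ?thesis by (simp add: card_insert_if split: if_splits)
qed

lemma sum_near_le:
  fixes f :: "nat \<Rightarrow> real"
  assumes "\<And>s. s < n\<^sup>2 \<Longrightarrow> f s \<le> (if \<bar>int a - int (s div n)\<bar> \<le> 1 \<and> \<bar>int b - int (s mod n)\<bar> \<le> 1 then w else 0)" "w \<ge> 0"
  shows "(\<Sum>s<n\<^sup>2. f s) \<le> 9 * w"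
proof -
  have "(\<Sum>s<n\<^sup>2. f s) \<le> (\<Sum>s<n\<^sup>2. if \<bar>int a - int (s div n)\<bar> \<le> 1 \<and> \<bar>int b - int (s mod n)\<bar> \<le> 1 then w else 0)"
    using assms(1) by (intro sum_mono) auto
  also have "\<dots> = (\<Sum>c<n. \<Sum>d<n. if \<bar>int a - int c\<bar> \<le> 1 \<and> \<bar>int b - int d\<bar> \<le> 1 then w else 0)"
    by (rule sum_div_mod)
  also have "\<dots> = (\<Sum>c<n. of_bool (\<bar>int a - int c\<bar> \<le> 1)) * (\<Sum>d<n. of_bool (\<bar>int b - int d\<bar> \<le> 1)) * w"
    unfolding sum_product unfolding sum_distrib_right by (intro sum.cong) auto
  also have "\<dots> = real (card {c\<in>{..<n}. \<bar>int a - int c\<bar> \<le> 1}) * real (card {d\<in>{..<n}. \<bar>int b - int d\<bar> \<le> 1}) * w"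
    unfolding of_bool_def sum.inter_filter[OF finite_lessThan, symmetric] by simp
  also have "\<dots> \<le> 3 * 3 * w"
    using card_near[of n a] card_near[of n b] assms(2) by (intro mult_right_mono mult_mono) auto
  finally show ?thesis by simp
qed

lemma sum_window_of_bool:
  fixes g :: "int \<Rightarrow> int \<Rightarrow> complex"
  assumes "\<bar>m1\<bar> > 1 \<or> \<bar>m2\<bar> > 1 \<Longrightarrow> g m1 m2 = 0"
  shows "(\<Sum>k1\<in>{-1..1}. \<Sum>k2\<in>{-1..1}. g k1 k2 * (of_bool (k1 = m1) * of_bool (k2 = m2))) = g m1 m2"
proof (cases "m1 \<in> {-1..1} \<and> m2 \<in> {-1..1}")
  case True
  have "(\<Sum>k1\<in>{-1..1}. \<Sum>k2\<in>{-1..1}. g k1 k2 * (of_bool (k1 = m1) * of_bool (k2 = m2)))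
      = (\<Sum>k1\<in>{-1..1}. \<Sum>k2\<in>{-1..1}. if k2 = m2 then if k1 = m1 then g m1 m2 else 0 else 0)"
    by (intro sum.cong refl) simp
  also have "\<dots> = g m1 m2" using True by simp
  finally show ?thesis .
next
  case False
  then have "g m1 m2 = 0" by (intro assms) auto
  moreover have "(\<Sum>k1\<in>{-1..1}. \<Sum>k2\<in>{-1..1}. g k1 k2 * (of_bool (k1 = m1) * of_bool (k2 = m2))) = 0"
    using False by (intro sum.neutral ballI) auto
  ultimately show ?thesis by simp
qed

text \<open>Rows with two inner indices have the same pattern in both matrices: nine entries that
  differ only through the sampling point. Any other row is estimated by 9 R for each matrix; there
  are at most 2 n such rows per non-inner index, and 36 is twice 18.\<close>

theorem block_matrix_approx:
  assumes N: "N > 0"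
    and \<rho>0: "\<And>x k1 k2. \<bar>k1\<bar> > 1 \<or> \<bar>k2\<bar> > 1 \<Longrightarrow> \<rho> x k1 k2 = 0"
    and R: "\<And>x k1 k2. x \<in> unit_square \<Longrightarrow> cmod (\<rho> x k1 k2) \<le> R"
    and \<omega>: "\<And>x y k1 k2. x \<in> unit_square \<Longrightarrow> y \<in> unit_square \<Longrightarrow> \<bar>x$1 - y$1\<bar> \<le> real N / real n \<Longrightarrow>
       \<bar>x$2 - y$2\<bar> \<le> real N / real n \<Longrightarrow> cmod (\<rho> x k1 k2 - \<rho> y k1 k2) \<le> \<omega>"
  shows "(\<Sum>r<n\<^sup>2. \<Sum>s<n\<^sup>2. cmod (local_matrix \<rho> n r s - block_matrix \<rho> n N r s))
    \<le> 9 * \<omega> * (real n)\<^sup>2 + 36 * R * real n * (2 * real n / real N + real N)"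
proof (cases "n = 0")
  case False
  then have n: "n > 0" by simp
  have u0: "(vec 0 :: real^2) \<in> unit_square" by (simp add: mem_box_real2 del: vec_0 vec_1)
  have R0: "R \<ge> 0" by (rule order_trans[OF norm_ge_zero R[OF u0, of 0 0]])
  have "cmod (\<rho> (vec 0) 0 0 - \<rho> (vec 0) 0 0) \<le> \<omega>" by (rule \<omega>[OF u0 u0]) simp_all
  then have \<omega>0: "\<omega> \<ge> 0" by simp
  define good where "good r \<longleftrightarrow> inner_index n N (r div n) \<and> inner_index n N (r mod n)" for r
  define pt where "pt r = (vector [real (r div n + 1) / real n, real (r mod n + 1) / real n] :: real^2)" for r
  define xb where "xb r = fst (cell_point n N (r div n, r mod n))" for r
  have lt: "r div n < n" "r mod n < n" if "r < n\<^sup>2" for r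
    using that n by (auto simp: power2_eq_square less_mult_imp_div_less)
  have pt: "pt r \<in> unit_square" if "r < n\<^sup>2" for r
  proof -
    have "real (r div n + 1) \<le> real n" "real (r mod n + 1) \<le> real n" using lt[OF that] by linarith+
    then show ?thesis by (simp add: pt_def mem_box_real2 divide_le_eq del: vec_0 vec_1)
  qed
  have xb: "xb r \<in> unit_square" and dist: "\<bar>pt r$1 - xb r$1\<bar> \<le> real N / real n" "\<bar>pt r$2 - xb r$2\<bar> \<le> real N / real n"
    if "r < n\<^sup>2" for r
  proof -
    \<comment> \<open>The sampling point carries \<open>a + 1\<close> and the corner
      \<open>N * (a div N)\<close>; the off-by-one still fits into the width \<open>N\<close> of the
      block.\<close>
    have 1: "N * (a div N) \<le> a" "a + 1 \<le> N * (a div N) + N" for a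
      using N dividend_less_times_div[OF N, of a] by (simp_all add: Suc_leI)
    have 2: "real N * real (a div N) \<le> real a" "real a + 1 \<le> real N * real (a div N) + real N" for a
      using 1[of a] by (simp_all flip: of_nat_mult of_nat_add of_nat_Suc)
    have 3: "real N * real (a div N) / real n \<le> 1" if "a < n" for a
      using 2(1)[of a] that by (simp add: divide_le_eq)
    show "xb r \<in> unit_square"
      using 3[OF lt(1)[OF that]] 3[OF lt(2)[OF that]]
      by (simp add: xb_def cell_point_def mem_box_real2 del: vec_0 vec_1)
    have 4: "\<bar>real (a + 1) / real n - real N * real (a div N) / real n\<bar> \<le> real N / real n" for a
    proof -
      have "\<bar>real (a + 1) - real N * real (a div N)\<bar> \<le> real N" using 2[of a] by simp
      then have "\<bar>real (a + 1) - real N * real (a div N)\<bar> / real n \<le> real N / real n"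
        by (rule divide_right_mono) simp
      then show ?thesis by (simp flip: diff_divide_distrib)
    qed
    show "\<bar>pt r$1 - xb r$1\<bar> \<le> real N / real n" "\<bar>pt r$2 - xb r$2\<bar> \<le> real N / real n"
      using 4 by (simp_all add: pt_def xb_def cell_point_def)
  qed
  have L: "local_matrix \<rho> n r s = \<rho> (pt r) (int (r div n) - int (s div n)) (int (r mod n) - int (s mod n))" for r s
    by (simp add: local_matrix_def pt_def)
  have good_row: "(\<Sum>s<n\<^sup>2. cmod (local_matrix \<rho> n r s - block_matrix \<rho> n N r s)) \<le> 9 * \<omega>"
    if r: "r < n\<^sup>2" "good r" for r
  proof (rule sum_near_le[OF _ \<omega>0])
    fix s assume s: "s < n\<^sup>2"
    let ?k1 = "int (r div n) - int (s div n)" and ?k2 = "int (r mod n) - int (s mod n)"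
    have "block_matrix \<rho> n N r s = (\<Sum>k1\<in>{-1..1}. \<Sum>k2\<in>{-1..1}.
        \<rho> (xb r) k1 k2 * (of_bool (k1 = ?k1) * of_bool (k2 = ?k2)))"
      unfolding block_matrix_eq[OF N] xb_def
    proof (intro sum.cong refl)
      fix k1 k2 :: int assume "k1 \<in> {-1..1}" "k2 \<in> {-1..1}"
      then have k: "\<bar>k1\<bar> \<le> 1" "\<bar>k2\<bar> \<le> 1" by auto
      have g: "inner_index n N (r div n)" "inner_index n N (r mod n)" using r(2) by (auto simp: good_def)
      show "\<rho> (fst (cell_point n N (r div n, r mod n))) k1 k2 *
          (block_shift n N k1 (r div n) (s div n) * block_shift n N k2 (r mod n) (s mod n))
        = \<rho> (fst (cell_point n N (r div n, r mod n))) k1 k2 * (of_bool (k1 = ?k1) * of_bool (k2 = ?k2))"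
        unfolding block_shift_inner[OF N g(1) k(1)] block_shift_inner[OF N g(2) k(2)] ..
    qed
    also have "\<dots> = \<rho> (xb r) ?k1 ?k2"
      by (rule sum_window_of_bool[OF \<rho>0])
    finally show "cmod (local_matrix \<rho> n r s - block_matrix \<rho> n N r s)
       \<le> (if \<bar>?k1\<bar> \<le> 1 \<and> \<bar>?k2\<bar> \<le> 1 then \<omega> else 0)"
      using \<omega>[OF pt[OF r(1)] xb[OF r(1)] dist[OF r(1)], of ?k1 ?k2] \<rho>0[of ?k1 ?k2] by (auto simp: L)
  qed
  have bad_row: "(\<Sum>s<n\<^sup>2. cmod (local_matrix \<rho> n r s - block_matrix \<rho> n N r s)) \<le> 18 * R"
    if r: "r < n\<^sup>2" for r
  proof -
    have 1: "(\<Sum>s<n\<^sup>2. cmod (local_matrix \<rho> n r s)) \<le> 9 * R"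
    proof (rule sum_near_le[OF _ R0])
      fix s assume s: "s < n\<^sup>2"
      let ?k1 = "int (r div n) - int (s div n)" and ?k2 = "int (r mod n) - int (s mod n)"
      show "cmod (local_matrix \<rho> n r s) \<le> (if \<bar>?k1\<bar> \<le> 1 \<and> \<bar>?k2\<bar> \<le> 1 then R else 0)"
        using R[OF pt[OF r(1)], of ?k1 ?k2] \<rho>0[of ?k1 ?k2] by (auto simp: L)
    qed
    have "(\<Sum>s<n\<^sup>2. cmod (block_matrix \<rho> n N r s)) \<le> (\<Sum>s<n\<^sup>2. \<Sum>k1\<in>{-1..1}. \<Sum>k2\<in>{-1..1}.
        R * (cmod (block_shift n N k1 (r div n) (s div n)) * cmod (block_shift n N k2 (r mod n) (s mod n))))"
    proof (rule sum_mono)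
      fix s
      show "cmod (block_matrix \<rho> n N r s) \<le> (\<Sum>k1\<in>{-1..1}. \<Sum>k2\<in>{-1..1}.
        R * (cmod (block_shift n N k1 (r div n) (s div n)) * cmod (block_shift n N k2 (r mod n) (s mod n))))"
        unfolding block_matrix_eq[OF N]
        by (intro order_trans[OF norm_sum] sum_mono)
          (auto simp: norm_mult intro!: mult_right_mono R[OF xb[OF r, unfolded xb_def]])
    qed
    also have "\<dots> = (\<Sum>k1\<in>{-1..1}. \<Sum>k2\<in>{-1..1}. R * (\<Sum>s<n\<^sup>2.
        cmod (block_shift n N k1 (r div n) (s div n)) * cmod (block_shift n N k2 (r mod n) (s mod n))))"
      unfolding sum_distrib_left by (subst sum.swap, rule sum.cong[OF refl], rule sum.swap)
    also have "\<dots> \<le> (\<Sum>k1\<in>{-1..1::int}. \<Sum>k2\<in>{-1..1::int}. R * 1)"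
    proof (intro sum_mono mult_left_mono R0)
      fix k1 k2
      have "(\<Sum>s<n\<^sup>2. cmod (block_shift n N k1 (r div n) (s div n)) * cmod (block_shift n N k2 (r mod n) (s mod n)))
         = (\<Sum>a<n. cmod (block_shift n N k1 (r div n) a)) * (\<Sum>b<n. cmod (block_shift n N k2 (r mod n) b))"
        unfolding sum_product by (rule sum_div_mod)
      also have "\<dots> \<le> 1 * 1"
        by (intro mult_mono sum_block_shift_le[OF N]) (auto intro: sum_nonneg)
      finally show "(\<Sum>s<n\<^sup>2. cmod (block_shift n N k1 (r div n) (s div n)) * cmod (block_shift n N k2 (r mod n) (s mod n))) \<le> 1"
        by simp
    qed
    also have "\<dots> = 9 * R" by simp
    finally have 2: "(\<Sum>s<n\<^sup>2. cmod (block_matrix \<rho> n N r s)) \<le> 9 * R" .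
    have "(\<Sum>s<n\<^sup>2. cmod (local_matrix \<rho> n r s - block_matrix \<rho> n N r s))
       \<le> (\<Sum>s<n\<^sup>2. cmod (local_matrix \<rho> n r s) + cmod (block_matrix \<rho> n N r s))"
      by (intro sum_mono norm_triangle_ineq4)
    then show ?thesis using 1 2 by (simp add: sum.distrib)
  qed
  define bad1 where "bad1 a = (if inner_index n N a then 0 else 1 :: real)" for a
  have bad1: "(\<Sum>a<n. bad1 a) \<le> 2 * real n / real N + real N"
  proof -
    have "(\<Sum>a<n. bad1 a) = (\<Sum>a<n. if \<not> inner_index n N a then 1 else 0)"
      by (intro sum.cong) (auto simp: bad1_def)
    also have "\<dots> = real (card {a\<in>{..<n}. \<not> inner_index n N a})"
      unfolding sum.inter_filter[OF finite_lessThan, symmetric] by simp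
    finally show ?thesis using card_not_inner[OF N] by simp
  qed
  have "(\<Sum>r<n\<^sup>2. \<Sum>s<n\<^sup>2. cmod (local_matrix \<rho> n r s - block_matrix \<rho> n N r s))
     \<le> (\<Sum>r<n\<^sup>2. 9 * \<omega> + 18 * R * (bad1 (r div n) + bad1 (r mod n)))"
  proof (rule sum_mono)
    fix r assume "r \<in> {..<n\<^sup>2}"
    then have r: "r < n\<^sup>2" by simp
    show "(\<Sum>s<n\<^sup>2. cmod (local_matrix \<rho> n r s - block_matrix \<rho> n N r s)) \<le> 9 * \<omega> + 18 * R * (bad1 (r div n) + bad1 (r mod n))"
    proof (cases "good r")
      case True
      then show ?thesis using good_row[OF r] by (simp add: bad1_def good_def)
    next
      case False
      then have "18 * R * 1 \<le> 18 * R * (bad1 (r div n) + bad1 (r mod n))"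
        using R0 by (intro mult_left_mono) (auto simp: good_def bad1_def)
      then show ?thesis using bad_row[OF r] \<omega>0 by simp
    qed
  qed
  also have "\<dots> = 9 * \<omega> * (real n)\<^sup>2 + 18 * R * (\<Sum>r<n\<^sup>2. bad1 (r div n) + bad1 (r mod n))"
    by (simp add: sum.distrib distrib_left sum_distrib_left)
  also have "(\<Sum>r<n\<^sup>2. bad1 (r div n) + bad1 (r mod n)) = (\<Sum>a<n. \<Sum>b<n. bad1 a + bad1 b)"
    by (rule sum_div_mod[of "\<lambda>a b. bad1 a + bad1 b"])
  also have "\<dots> = 2 * real n * (\<Sum>a<n. bad1 a)"
    by (simp add: sum.distrib sum_distrib_left mult.assoc)
  also have "18 * R * (2 * real n * (\<Sum>a<n. bad1 a)) \<le> 18 * R * (2 * real n * (2 * real n / real N + real N))"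
    using R0 bad1 by (intro mult_left_mono) auto
  finally show ?thesis by (simp add: mult_ac)
qed simp

section \<open>Hat functions and their gradients\<close>

lemma mesh_size_pos: "mesh_size n > 0"
  by (simp add: mesh_size_def)

lemma grid_point_nth [simp]:
  "grid_point n (i, j) $ 1 = real i * mesh_size n" "grid_point n (i, j) $ 2 = real j * mesh_size n"
  by (simp_all add: grid_point_def)

lemma grid_point_inj: "grid_point n (i, j) = grid_point n (k, l) \<longleftrightarrow> i = k \<and> j = l"
  using mesh_size_pos[of n] by (auto simp: Finite_Cartesian_Product.vec_eq_iff forall_2)

locale interior_node =
  fixes n i j :: nat
  assumes ij: "1 \<le> i" "i \<le> n" "1 \<le> j" "j \<le> n"
begin

abbreviation "h \<equiv> mesh_size n"
abbreviation "p \<equiv> grid_point n (i, j)"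
abbreviation "\<psi> \<equiv> hat_function n p"

text \<open>Coordinates centred at the node in units of the mesh size, in which the six triangles do
  not depend on \<open>n\<close>.\<close>

definition ax :: "real^2 \<Rightarrow> real" where "ax x = x$1 / h - real i"
definition bx :: "real^2 \<Rightarrow> real" where "bx x = x$2 / h - real j"

lemma hat: "is_hat_function n p \<psi>"
  unfolding hat_function_def by (rule theI'[OF hat_function_ex1[OF ij]])

lemma x_eq: "x$1 = p$1 + h * ax x" "x$2 = p$2 + h * bx x"
  using mesh_size_pos[of n] by (simp_all add: ax_def bx_def field_simps)

text \<open>An affine function on a triangle is fixed by its vertex values 1, 0, 0 and so equals the
  barycentric coordinate of \<open>p\<close>. The neighbours are named as grid points because the
  zeros are prescribed on the grid only.\<close>

lemma hat_on_triangle: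
  assumes T: "convex hull {p, p + h *\<^sub>R u, p + h *\<^sub>R v} \<in> grid_triangles h p"
    and q: "p + h *\<^sub>R u = grid_point n k" "p + h *\<^sub>R v = grid_point n l"
    and kl: "k \<in> {0..n+1} \<times> {0..n+1}" "l \<in> {0..n+1} \<times> {0..n+1}" "k \<noteq> (i, j)" "l \<noteq> (i, j)"
    and st: "0 \<le> s" "0 \<le> t" "s + t \<le> 1" "ax x = s * u$1 + t * v$1" "bx x = s * u$2 + t * v$2"
  shows "\<psi> x = 1 - s - t"
proof -
  let ?T = "convex hull {p, p + h *\<^sub>R u, p + h *\<^sub>R v}"
  obtain V w where VT: "\<forall>x\<in>?T. \<psi> x = V \<bullet> x + w"
    using hat T unfolding is_hat_function_def by meson
  have vert: "p \<in> ?T" "p + h *\<^sub>R u \<in> ?T" "p + h *\<^sub>R v \<in> ?T" by (auto intro: hull_inc)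
  have ne: "grid_point n k \<noteq> p" "grid_point n l \<noteq> p"
    using kl(3,4) grid_point_inj by (metis surj_pair)+
  have "\<psi> p = 1" "\<psi> (p + h *\<^sub>R u) = 0" "\<psi> (p + h *\<^sub>R v) = 0"
    using hat kl(1,2) ne unfolding is_hat_function_def q grid_def by auto
  then have e: "V \<bullet> p + w = 1" "V \<bullet> (p + h *\<^sub>R u) + w = 0" "V \<bullet> (p + h *\<^sub>R v) + w = 0"
    using VT vert by auto
  have x: "x = p + s *\<^sub>R (h *\<^sub>R u) + t *\<^sub>R (h *\<^sub>R v)"
    using x_eq[of x] st(4,5) by (simp add: Finite_Cartesian_Product.vec_eq_iff forall_2 algebra_simps)
  then have "x \<in> ?T" using st(1-3) unfolding triangle_iff by blast
  then have "\<psi> x = V \<bullet> x + w" using VT by blast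
  also have "\<dots> = (V \<bullet> p + w) + s * ((V \<bullet> (p + h *\<^sub>R u) + w) - (V \<bullet> p + w)) + t * ((V \<bullet> (p + h *\<^sub>R v) + w) - (V \<bullet> p + w))"
    by (simp add: x inner_add_right algebra_simps)
  finally show ?thesis unfolding e by simp
qed

lemma triangles:
  "grid_triangles h p =
     {convex hull {p, p + h *\<^sub>R vector [1, 0], p + h *\<^sub>R vector [0, 1]},
      convex hull {p, p + h *\<^sub>R vector [1, 0], p + h *\<^sub>R vector [1, -1]},
      convex hull {p, p + h *\<^sub>R vector [1, -1], p + h *\<^sub>R vector [0, -1]},
      convex hull {p, p + h *\<^sub>R vector [0, -1], p + h *\<^sub>R vector [-1, 0]},
      convex hull {p, p + h *\<^sub>R vector [-1, 0], p + h *\<^sub>R vector [-1, 1]},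
      convex hull {p, p + h *\<^sub>R vector [-1, 1], p + h *\<^sub>R vector [0, 1]}}"
proof -
  have "axis 1 1 = (vector [1, 0] :: real^2)" "axis 2 1 = (vector [0, 1] :: real^2)"
    "axis 1 1 - axis 2 1 = (vector [1, -1] :: real^2)" "axis 2 1 - axis 1 1 = (vector [-1, 1] :: real^2)"
    "p - h *\<^sub>R axis 2 1 = p + h *\<^sub>R vector [0, -1]" "p - h *\<^sub>R axis 1 1 = p + h *\<^sub>R vector [-1, 0]"
    by (auto simp: Finite_Cartesian_Product.vec_eq_iff forall_2 axis_def)
  then show ?thesis unfolding grid_triangles_def Let_def by (simp only:)
qed

lemma neighbours:
  "p + h *\<^sub>R vector [1, 0] = grid_point n (i + 1, j)" "p + h *\<^sub>R vector [0, 1] = grid_point n (i, j + 1)"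
  "p + h *\<^sub>R vector [1, -1] = grid_point n (i + 1, j - 1)" "p + h *\<^sub>R vector [-1, 1] = grid_point n (i - 1, j + 1)"
  "p + h *\<^sub>R vector [-1, 0] = grid_point n (i - 1, j)" "p + h *\<^sub>R vector [0, -1] = grid_point n (i, j - 1)"
  using ij by (auto simp: Finite_Cartesian_Product.vec_eq_iff forall_2 of_nat_diff algebra_simps)

text \<open>One formula per triangle, in the order of \<open>triangles\<close>; the weights handed
  to \<open>hat_on_triangle\<close> are the barycentric coordinates of the two neighbours.\<close>

lemma hat_formula:
  "0 \<le> ax x \<Longrightarrow> 0 \<le> bx x \<Longrightarrow> ax x + bx x \<le> 1 \<Longrightarrow> \<psi> x = 1 - ax x - bx x"
  "ax x \<le> 1 \<Longrightarrow> bx x \<le> 0 \<Longrightarrow> 0 \<le> ax x + bx x \<Longrightarrow> \<psi> x = 1 - ax x"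
  "0 \<le> ax x \<Longrightarrow> -1 \<le> bx x \<Longrightarrow> ax x + bx x \<le> 0 \<Longrightarrow> \<psi> x = 1 + bx x"
  "ax x \<le> 0 \<Longrightarrow> bx x \<le> 0 \<Longrightarrow> -1 \<le> ax x + bx x \<Longrightarrow> \<psi> x = 1 + ax x + bx x"
  "-1 \<le> ax x \<Longrightarrow> 0 \<le> bx x \<Longrightarrow> ax x + bx x \<le> 0 \<Longrightarrow> \<psi> x = 1 + ax x"
  "ax x \<le> 0 \<Longrightarrow> bx x \<le> 1 \<Longrightarrow> 0 \<le> ax x + bx x \<Longrightarrow> \<psi> x = 1 - bx x"
proof -
  have nb: "(i + 1, j) \<in> {0..n+1} \<times> {0..n+1}" "(i, j + 1) \<in> {0..n+1} \<times> {0..n+1}"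
    "(i + 1, j - 1) \<in> {0..n+1} \<times> {0..n+1}" "(i - 1, j + 1) \<in> {0..n+1} \<times> {0..n+1}"
    "(i - 1, j) \<in> {0..n+1} \<times> {0..n+1}" "(i, j - 1) \<in> {0..n+1} \<times> {0..n+1}"
    "(i + 1, j) \<noteq> (i, j)" "(i, j + 1) \<noteq> (i, j)" "(i + 1, j - 1) \<noteq> (i, j)" "(i - 1, j + 1) \<noteq> (i, j)"
    "(i - 1, j) \<noteq> (i, j)" "(i, j - 1) \<noteq> (i, j)"
    using ij by auto
  note [simp] = triangles
  show "\<psi> x = 1 - ax x - bx x" if "0 \<le> ax x" "0 \<le> bx x" "ax x + bx x \<le> 1"
    using hat_on_triangle[OF _ neighbours(1,2) nb(1,2,7,8), of "ax x" "bx x" x] that by simp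
  show "\<psi> x = 1 - ax x" if "ax x \<le> 1" "bx x \<le> 0" "0 \<le> ax x + bx x"
    using hat_on_triangle[OF _ neighbours(1,3) nb(1,3,7,9), of "ax x + bx x" "- bx x" x] that by simp
  show "\<psi> x = 1 + bx x" if "0 \<le> ax x" "-1 \<le> bx x" "ax x + bx x \<le> 0"
    using hat_on_triangle[OF _ neighbours(3,6) nb(3,6,9,12), of "ax x" "- ax x - bx x" x] that by simp
  show "\<psi> x = 1 + ax x + bx x" if "ax x \<le> 0" "bx x \<le> 0" "-1 \<le> ax x + bx x"
    using hat_on_triangle[OF _ neighbours(6,5) nb(6,5,12,11), of "- bx x" "- ax x" x] that by simp
  show "\<psi> x = 1 + ax x" if "-1 \<le> ax x" "0 \<le> bx x" "ax x + bx x \<le> 0"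
    using hat_on_triangle[OF _ neighbours(5,4) nb(5,4,11,10), of "- ax x - bx x" "bx x" x] that by simp
  show "\<psi> x = 1 - bx x" if "ax x \<le> 0" "bx x \<le> 1" "0 \<le> ax x + bx x"
    using hat_on_triangle[OF _ neighbours(4,2) nb(4,2,10,8), of "- ax x" "ax x + bx x" x] that by simp
qed

lemma hat_outside:
  assumes "\<bar>ax x\<bar> > 1 \<or> \<bar>bx x\<bar> > 1 \<or> \<bar>ax x + bx x\<bar> > 1"
  shows "\<psi> x = 0"
proof -
  have "x \<notin> T" if "T \<in> grid_triangles h p" for T
  proof
    assume "x \<in> T"
    have *: False if "x \<in> convex hull {p, p + h *\<^sub>R vector [u1, u2], p + h *\<^sub>R vector [v1, v2]}"
      and b: "\<bar>u1\<bar> \<le> 1" "\<bar>u2\<bar> \<le> 1" "\<bar>v1\<bar> \<le> 1" "\<bar>v2\<bar> \<le> 1" "\<bar>u1 + u2\<bar> \<le> 1" "\<bar>v1 + v2\<bar> \<le> 1" for u1 u2 v1 v2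
    proof -
      obtain s t where st: "0 \<le> s" "0 \<le> t" "s + t \<le> 1"
        and x: "x = p + s *\<^sub>R (h *\<^sub>R vector [u1, u2]) + t *\<^sub>R (h *\<^sub>R vector [v1, v2])"
        using \<open>x \<in> convex hull _\<close> unfolding triangle_iff by blast
      have ab: "ax x = s * u1 + t * v1" "bx x = s * u2 + t * v2"
        using mesh_size_pos[of n] by (simp_all add: ax_def bx_def x field_simps)
      have bd: "\<bar>s * y + t * z\<bar> \<le> 1" if "\<bar>y\<bar> \<le> 1" "\<bar>z\<bar> \<le> 1" for y z
      proof -
        have "\<bar>s * y + t * z\<bar> \<le> s * \<bar>y\<bar> + t * \<bar>z\<bar>" using st by (simp add: abs_mult order_trans[OF abs_triangle_ineq])
        also have "\<dots> \<le> s * 1 + t * 1" using st that by (intro add_mono mult_left_mono) auto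
        finally show ?thesis using st by simp
      qed
      have "ax x + bx x = s * (u1 + u2) + t * (v1 + v2)" by (simp add: ab algebra_simps)
      then show False using assms bd[OF b(1,3)] bd[OF b(2,4)] bd[OF b(5,6)] ab by auto
    qed
    show False using \<open>T \<in> _\<close> \<open>x \<in> T\<close> unfolding triangles by (elim insertE emptyE; hypsubst) (erule *; simp)+
  qed
  then show ?thesis using hat unfolding is_hat_function_def by blast
qed

lemma hat_bounds: "0 \<le> \<psi> x" "\<psi> x \<le> of_bool (\<bar>ax x\<bar> \<le> 1 \<and> \<bar>bx x\<bar> \<le> 1)"
proof -
  have "0 \<le> \<psi> x \<and> \<psi> x \<le> of_bool (\<bar>ax x\<bar> \<le> 1 \<and> \<bar>bx x\<bar> \<le> 1)"
  proof (cases "\<bar>ax x\<bar> \<le> 1 \<and> \<bar>bx x\<bar> \<le> 1 \<and> \<bar>ax x + bx x\<bar> \<le> 1")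
    case True
    consider "0 \<le> ax x" "0 \<le> bx x" | "bx x \<le> 0" "0 \<le> ax x + bx x" | "0 \<le> ax x" "ax x + bx x \<le> 0"
      | "ax x \<le> 0" "bx x \<le> 0" | "0 \<le> bx x" "ax x + bx x \<le> 0" | "ax x \<le> 0" "0 \<le> ax x + bx x" by linarith
    then show ?thesis using True by cases (use hat_formula[of x] in \<open>auto simp: abs_le_iff\<close>)
  next
    case False
    then have "\<psi> x = 0" by (intro hat_outside) linarith
    then show ?thesis by simp
  qed
  then show "0 \<le> \<psi> x" "\<psi> x \<le> of_bool (\<bar>ax x\<bar> \<le> 1 \<and> \<bar>bx x\<bar> \<le> 1)" by auto
qed

lemma grad_affine:
  fixes f :: "real^2 \<Rightarrow> real"
  assumes "open S" "x \<in> S" "\<And>y. y \<in> S \<Longrightarrow> f y = c + \<alpha> * ax y + \<beta> * bx y"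
  shows "grad f x = vector [\<alpha> / h, \<beta> / h]"
proof -
  let ?D = "vector [\<alpha> / h, \<beta> / h] :: real^2"
  have eq: "c + \<alpha> * ax y + \<beta> * bx y = ?D \<bullet> y + (c - \<alpha> * real i - \<beta> * real j)" for y
    by (simp add: ax_def bx_def inner_vec_def sum_2 algebra_simps)
  have "((\<lambda>y. ?D \<bullet> y + (c - \<alpha> * real i - \<beta> * real j)) has_derivative (\<lambda>y. ?D \<bullet> y + 0)) (at x)"
    by (intro has_derivative_add has_derivative_const bounded_linear_imp_has_derivative bounded_linear_inner_right)
  then have "(f has_derivative (\<lambda>y. ?D \<bullet> y)) (at x)"
    by (simp add: has_derivative_transform_within_open[OF _ assms(1,2)] assms(3) eq)
  then have "GDERIV f x :> ?D" by (simp add: gderiv_def inner_commute)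
  \<comment> \<open>\<open>grad\<close> is a definite description, so uniqueness of the derivative
    is needed besides its existence.\<close>
  moreover have "E = ?D" if "GDERIV f x :> E" for E
  proof -
    have "(\<lambda>y. y \<bullet> E) = (\<lambda>y. y \<bullet> ?D)"
      using that \<open>GDERIV f x :> ?D\<close> unfolding gderiv_def by (rule has_derivative_unique)
    then show ?thesis by (metis vector_eq_ldot)
  qed
  ultimately show ?thesis unfolding grad_def by (rule the_equality)
qed

end

section \<open>Triangles of the mesh and slopes on them\<close>

definition cell1 :: "nat \<Rightarrow> real^2 \<Rightarrow> int" where "cell1 n x = \<lfloor>x$1 / mesh_size n\<rfloor>"
definition cell2 :: "nat \<Rightarrow> real^2 \<Rightarrow> int" where "cell2 n x = \<lfloor>x$2 / mesh_size n\<rfloor>"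
text \<open>Tells whether the fractional parts of the two scaled coordinates add up to less than 1,
  that is, on which side of the diagonal of its square the point lies.\<close>

definition cell_up :: "nat \<Rightarrow> real^2 \<Rightarrow> int" where
  "cell_up n x = \<lfloor>(x$1 + x$2) / mesh_size n\<rfloor> - cell1 n x - cell2 n x"

text \<open>Each mesh square is cut into a lower (\<open>\<sigma> = 0\<close>) and an upper (\<open>\<sigma> = 1\<close>) triangle; on the
  triangle \<open>(m\<^sub>1, m\<^sub>2, \<sigma>)\<close> the hat function of node \<open>(i, j)\<close> has gradient
  \<open>(cell_slope1, cell_slope2) / h\<close>.\<close>

definition cell_slope1 :: "int \<Rightarrow> int \<Rightarrow> int \<Rightarrow> int \<Rightarrow> int \<Rightarrow> real" where
  "cell_slope1 m1 m2 \<sigma> i j = of_bool (i = m1 + 1 \<and> j = m2 + \<sigma>) - of_bool (i = m1 \<and> j = m2 + \<sigma>)"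

definition cell_slope2 :: "int \<Rightarrow> int \<Rightarrow> int \<Rightarrow> int \<Rightarrow> int \<Rightarrow> real" where
  "cell_slope2 m1 m2 \<sigma> i j = of_bool (j = m2 + 1 \<and> i = m1 + \<sigma>) - of_bool (j = m2 \<and> i = m1 + \<sigma>)"

definition mesh_lines :: "nat \<Rightarrow> (real^2) set" where
  "mesh_lines n = (\<Union>m::int. {x. x$1 = of_int m * mesh_size n} \<union> {x. x$2 = of_int m * mesh_size n}
      \<union> {x. x$1 + x$2 = of_int m * mesh_size n})"

lemma negligible_diagonal: "negligible {x::real^2. x$1 + x$2 = c}"
proof -
  have "{x::real^2. x$1 + x$2 = c} = {x. vector [1, 1] \<bullet> x = c}"
    by (auto simp: inner_vec_def sum_2)
  moreover have "(vector [1, 1] :: real^2) \<noteq> 0"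
    by (auto simp: Finite_Cartesian_Product.vec_eq_iff forall_2)
  ultimately show ?thesis using negligible_hyperplane[of "vector [1, 1] :: real^2" c] by simp
qed

lemma negligible_vertical: "negligible {x::real^2. x$k = c}"
  using negligible_hyperplane[of "axis k 1 :: real^2" c] by (simp add: inner_axis' axis_eq_0_iff)

lemma negligible_mesh_lines: "negligible (mesh_lines n)"
  unfolding mesh_lines_def
  by (intro negligible_countable_Union negligible_Un) 
    (auto intro: negligible_diagonal negligible_vertical negligible_Un)

lemma cell_up_01: "cell_up n x = 0 \<or> cell_up n x = 1"
proof -
  have "\<lfloor>x$1 / mesh_size n\<rfloor> + \<lfloor>x$2 / mesh_size n\<rfloor> \<le> \<lfloor>x$1 / mesh_size n + x$2 / mesh_size n\<rfloor>"
    "\<lfloor>x$1 / mesh_size n + x$2 / mesh_size n\<rfloor> \<le> \<lfloor>x$1 / mesh_size n\<rfloor> + \<lfloor>x$2 / mesh_size n\<rfloor> + 1"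
    by linarith+
  then show ?thesis by (simp add: cell_up_def cell1_def cell2_def add_divide_distrib) linarith
qed

context interior_node
begin

text \<open>Off the mesh lines all floor inequalities are strict, so the point has a neighbourhood
  on which the hat function is a single affine expression or zero.\<close>

lemma grad_hat:
  assumes x: "x \<notin> mesh_lines n"
  shows "grad \<psi> x = vector [cell_slope1 (cell1 n x) (cell2 n x) (cell_up n x) (int i) (int j) / h,
     cell_slope2 (cell1 n x) (cell2 n x) (cell_up n x) (int i) (int j) / h]"
proof -
  define m1 m2 \<sigma> where "m1 = cell1 n x" and "m2 = cell2 n x" and "\<sigma> = cell_up n x"
  define a b where "a = ax x" and "b = bx x"
  have h: "h > 0" by (rule mesh_size_pos)
  have ns: "x$1 / h \<noteq> of_int m" "x$2 / h \<noteq> of_int m" "(x$1 + x$2) / h \<noteq> of_int m" for m :: int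
    using x h by (auto simp: mesh_lines_def field_simps)
  have fl: "of_int \<lfloor>t\<rfloor> < t \<and> t < of_int \<lfloor>t\<rfloor> + 1" if "\<And>m. t \<noteq> of_int m" for t :: real
    using that[of "\<lfloor>t\<rfloor>"] by linarith
  \<comment> \<open>Position of the mesh square relative to the node; only -1 and 0 are possible
    inside the support.\<close>
  define k1 k2 where "k1 = m1 - int i" and "k2 = m2 - int j"
  have 1: "of_int k1 < a" "a < of_int k1 + 1"
    using fl[OF ns(1)] by (auto simp: a_def ax_def k1_def m1_def cell1_def)
  have 2: "of_int k2 < b" "b < of_int k2 + 1"
    using fl[OF ns(2)] by (auto simp: b_def bx_def k2_def m2_def cell2_def)
  have 3: "of_int (k1 + k2 + \<sigma>) < a + b" "a + b < of_int (k1 + k2 + \<sigma>) + 1"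
    using fl[OF ns(3)]
    by (auto simp: a_def ax_def b_def bx_def k1_def k2_def m1_def m2_def \<sigma>_def cell_up_def add_divide_distrib)
  have \<sigma>: "\<sigma> = 0 \<or> \<sigma> = 1" unfolding \<sigma>_def by (rule cell_up_01)
  have slopes: "cell_slope1 m1 m2 \<sigma> (int i) (int j) = of_bool (k1 = -1 \<and> k2 = - \<sigma>) - of_bool (k1 = 0 \<and> k2 = - \<sigma>)"
    "cell_slope2 m1 m2 \<sigma> (int i) (int j) = of_bool (k2 = -1 \<and> k1 = - \<sigma>) - of_bool (k2 = 0 \<and> k1 = - \<sigma>)"
    unfolding cell_slope1_def cell_slope2_def k1_def k2_def
    by (auto intro!: arg_cong2[where f = "(-)"] arg_cong[where f = of_bool])
  have cont: "continuous_on UNIV ax" "continuous_on UNIV bx"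
    unfolding ax_def bx_def using h by (auto intro!: continuous_intros)
  have op: "open {y. f y < g y}" if "continuous_on UNIV f" "continuous_on UNIV g" for f g :: "real^2 \<Rightarrow> real"
    using open_Collect_less that by blast
  \<comment> \<open>Three strict inequalities between continuous functions cut out the open
    neighbourhood; each case names its own three.\<close>
  have goal: "grad \<psi> x = vector [\<alpha> / h, \<beta> / h]"
    if "\<And>y. f y < g y \<Longrightarrow> f' y < g' y \<Longrightarrow> f'' y < g'' y \<Longrightarrow> \<psi> y = c + \<alpha> * ax y + \<beta> * bx y"
      "f x < g x" "f' x < g' x" "f'' x < g'' x"
      "continuous_on UNIV f" "continuous_on UNIV g" "continuous_on UNIV f'"
      "continuous_on UNIV g'" "continuous_on UNIV f''" "continuous_on UNIV g''"
    for f f' f'' g g' g'' :: "real^2 \<Rightarrow> real" and \<alpha> \<beta> c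
  proof (rule grad_affine[of "{y. f y < g y} \<inter> {y. f' y < g' y} \<inter> {y. f'' y < g'' y}"])
    show "open ({y. f y < g y} \<inter> {y. f' y < g' y} \<inter> {y. f'' y < g'' y})"
      using that(5-) by (intro open_Int op)
  qed (use that in auto)
  note ci = continuous_on_const continuous_on_add cont
  note ab = a_def[symmetric] b_def[symmetric]
  have out: "grad \<psi> x = vector [0 / h, 0 / h]"
    if "\<And>y. f y < g y \<Longrightarrow> \<psi> y = 0" "f x < g x" "continuous_on UNIV f" "continuous_on UNIV g" for f g :: "real^2 \<Rightarrow> real"
    by (rule goal[of f g f g f g 0]) (use that in auto)
  show ?thesis
    unfolding m1_def[symmetric] m2_def[symmetric] \<sigma>_def[symmetric] slopes
  proof (cases "k1 \<in> {-1, 0} \<and> k2 \<in> {-1, 0}")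
    case False
    then have "k1 \<ge> 1 \<or> k1 \<le> -2 \<or> k2 \<ge> 1 \<or> k2 \<le> -2" by auto
    then consider "1 < a" | "a < -1" | "1 < b" | "b < -1" using 1 2 by linarith
    then have "grad \<psi> x = vector [0 / h, 0 / h]"
    proof cases
      case 1 then show ?thesis by (intro out[of "\<lambda>_. 1" ax] hat_outside) (auto simp: ab intro: ci)
    next
      case 2 then show ?thesis by (intro out[of ax "\<lambda>_. -1"] hat_outside) (auto simp: ab intro: ci)
    next
      case 3 then show ?thesis by (intro out[of "\<lambda>_. 1" bx] hat_outside) (auto simp: ab intro: ci)
    next
      case 4 then show ?thesis by (intro out[of bx "\<lambda>_. -1"] hat_outside) (auto simp: ab intro: ci)
    qed
    moreover have "\<not> (k1 = -1 \<and> k2 = - \<sigma>)" "\<not> (k1 = 0 \<and> k2 = - \<sigma>)" "\<not> (k2 = -1 \<and> k1 = - \<sigma>)" "\<not> (k2 = 0 \<and> k1 = - \<sigma>)"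
      using False \<sigma> by auto
    ultimately show "grad \<psi> x = vector [(of_bool (k1 = - 1 \<and> k2 = - \<sigma>) - of_bool (k1 = 0 \<and> k2 = - \<sigma>)) / h,
       (of_bool (k2 = - 1 \<and> k1 = - \<sigma>) - of_bool (k2 = 0 \<and> k1 = - \<sigma>)) / h]"
      by (simp only: of_bool_eq diff_self simp_thms)
  next
    case True
    \<comment> \<open>Eight triangles fill the four squares at the node. The last two cases are the
      triangles beyond the hexagon, where the hat function vanishes.\<close>
    then consider "k1 = 0" "k2 = 0" "\<sigma> = 0" | "k1 = 0" "k2 = -1" "\<sigma> = 1" | "k1 = 0" "k2 = -1" "\<sigma> = 0"
      | "k1 = -1" "k2 = -1" "\<sigma> = 1" | "k1 = -1" "k2 = 0" "\<sigma> = 0" | "k1 = -1" "k2 = 0" "\<sigma> = 1"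
      | "k1 = 0" "k2 = 0" "\<sigma> = 1" | "k1 = -1" "k2 = -1" "\<sigma> = 0" using \<sigma> by blast
    then show "grad \<psi> x = vector [(of_bool (k1 = - 1 \<and> k2 = - \<sigma>) - of_bool (k1 = 0 \<and> k2 = - \<sigma>)) / h,
       (of_bool (k2 = - 1 \<and> k1 = - \<sigma>) - of_bool (k2 = 0 \<and> k1 = - \<sigma>)) / h]"
    proof cases
      case 1
      have "grad \<psi> x = vector [(-1) / h, (-1) / h]"
        by (rule goal[of "\<lambda>_. 0" ax "\<lambda>_. 0" bx "\<lambda>y. ax y + bx y" "\<lambda>_. 1" 1])
          (use 1 \<open>of_int k1 < a\<close> 2 3 hat_formula(1) in \<open>auto simp: ab intro: ci\<close>)
      then show ?thesis using 1 by simp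
    next
      case c: 2
      have "grad \<psi> x = vector [(-1) / h, 0 / h]"
        by (rule goal[of ax "\<lambda>_. 1" bx "\<lambda>_. 0" "\<lambda>_. 0" "\<lambda>y. ax y + bx y" 1])
          (use c 1 2 3 hat_formula(2) in \<open>auto simp: ab intro: ci\<close>)
      then show ?thesis using c by simp
    next
      case c: 3
      have "grad \<psi> x = vector [0 / h, 1 / h]"
        by (rule goal[of "\<lambda>_. 0" ax "\<lambda>_. -1" bx "\<lambda>y. ax y + bx y" "\<lambda>_. 0" 1])
          (use c 1 2 3 hat_formula(3) in \<open>auto simp: ab intro: ci\<close>)
      then show ?thesis using c by simp
    next
      case c: 4
      have "grad \<psi> x = vector [1 / h, 1 / h]"
        by (rule goal[of ax "\<lambda>_. 0" bx "\<lambda>_. 0" "\<lambda>_. -1" "\<lambda>y. ax y + bx y" 1])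
          (use c 1 2 3 hat_formula(4) in \<open>auto simp: ab intro: ci\<close>)
      then show ?thesis using c by simp
    next
      case c: 5
      have "grad \<psi> x = vector [1 / h, 0 / h]"
        by (rule goal[of "\<lambda>_. -1" ax "\<lambda>_. 0" bx "\<lambda>y. ax y + bx y" "\<lambda>_. 0" 1])
          (use c 1 2 3 hat_formula(5) in \<open>auto simp: ab intro: ci\<close>)
      then show ?thesis using c by simp
    next
      case c: 6
      have "grad \<psi> x = vector [0 / h, (-1) / h]"
        by (rule goal[of ax "\<lambda>_. 0" bx "\<lambda>_. 1" "\<lambda>_. 0" "\<lambda>y. ax y + bx y" 1])
          (use c 1 2 3 hat_formula(6) in \<open>auto simp: ab intro: ci\<close>)
      then show ?thesis using c by simp
    next
      case c: 7
      have "grad \<psi> x = vector [0 / h, 0 / h]"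
        by (rule out[of "\<lambda>_. 1" "\<lambda>y. ax y + bx y"]) (use c 3 hat_outside in \<open>auto simp: ab intro: ci\<close>)
      then show ?thesis using c by simp
    next
      case c: 8
      have "grad \<psi> x = vector [0 / h, 0 / h]"
        by (rule out[of "\<lambda>y. ax y + bx y" "\<lambda>_. -1"]) (use c 3 hat_outside in \<open>auto simp: ab intro: ci\<close>)
      then show ?thesis using c by simp
    qed
  qed
qed

end

section \<open>Entries of the stiffness matrix\<close>

abbreviation "\<mu>\<^sub>S \<equiv> lebesgue_on open_unit_square"

definition cslope :: "2 \<Rightarrow> int \<Rightarrow> int \<Rightarrow> int \<Rightarrow> int \<Rightarrow> int \<Rightarrow> real" where
  "cslope k m1 m2 \<sigma> i j = (if k = 1 then cell_slope1 m1 m2 \<sigma> i j else cell_slope2 m1 m2 \<sigma> i j)"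

text \<open>One-based as in \<open>lex_index\<close>, but integer valued, so that differences of
  nodes may be negative.\<close>

definition node1 :: "nat \<Rightarrow> nat \<Rightarrow> int" where "node1 n r = int (r div n) + 1"
definition node2 :: "nat \<Rightarrow> nat \<Rightarrow> int" where "node2 n r = int (r mod n) + 1"

definition slope :: "nat \<Rightarrow> nat \<Rightarrow> 2 \<Rightarrow> real^2 \<Rightarrow> real" where
  "slope n r k x = cslope k (cell1 n x) (cell2 n x) (cell_up n x) (node1 n r) (node2 n r)"

text \<open>Indicator of the square of side 2 h around the node. It contains the hexagonal support,
  dominates hat function and slopes alike, and factorises over the coordinates, which makes counting
  easy.\<close>

definition near :: "nat \<Rightarrow> nat \<Rightarrow> real^2 \<Rightarrow> real" where
  "near n r x = of_bool (\<bar>x$1 / mesh_size n - of_int (node1 n r)\<bar> \<le> 1 \<and> \<bar>x$2 / mesh_size n - of_int (node2 n r)\<bar> \<le> 1)"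

abbreviation node_hat :: "nat \<Rightarrow> nat \<Rightarrow> real^2 \<Rightarrow> real" where
  "node_hat n r \<equiv> hat_function n (grid_point n (lex_index n r))"

lemma div_mod_less: "(r::nat) < n\<^sup>2 \<Longrightarrow> r div n < n \<and> r mod n < n"
  by (metis gr0I less_mult_imp_div_less mod_less_divisor mult_0 not_less0 power2_eq_square)

lemma interior_node_index: "r < n\<^sup>2 \<Longrightarrow> interior_node n (r div n + 1) (r mod n + 1)"
  using div_mod_less[of r n] by unfold_locales auto

lemma vec2_cases: "(k::2) = 1 \<or> k = 2" by (rule exhaust_2)

lemma grad_node_hat:
  assumes "r < n\<^sup>2" "x \<notin> mesh_lines n"
  shows "grad (node_hat n r) x $ k = slope n r k x / mesh_size n"
  using interior_node.grad_hat[OF interior_node_index[OF assms(1)] assms(2)] vec2_cases[of k]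
  by (auto simp: lex_index_def slope_def cslope_def node1_def node2_def add.commute)

lemma node_hat_bounds:
  assumes "r < n\<^sup>2"
  shows "0 \<le> node_hat n r x" "node_hat n r x \<le> near n r x"
proof -
  note node = interior_node_index[OF assms]
  have "interior_node.ax n (r div n + 1) x = x$1 / mesh_size n - of_int (node1 n r)"
    "interior_node.bx n (r mod n + 1) x = x$2 / mesh_size n - of_int (node2 n r)"
    unfolding interior_node.ax_def[OF node] interior_node.bx_def[OF node] node1_def node2_def by simp_all
  with interior_node.hat_bounds[OF node, of x]
  show "0 \<le> node_hat n r x" "node_hat n r x \<le> near n r x"
    unfolding near_def lex_index_def by (simp_all only:)
qed

lemma node_hat_continuous: "r < n\<^sup>2 \<Longrightarrow> continuous_on UNIV (node_hat n r)"
  using interior_node.hat[OF interior_node_index, of r n] unfolding is_hat_function_def lex_index_def by simp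

lemma floor_node:
  fixes t :: real
  shows "\<lfloor>t\<rfloor> = m \<or> \<lfloor>t\<rfloor> = m - 1 \<Longrightarrow> \<bar>t - of_int m\<bar> \<le> 1"
  by linarith

lemma cslope_bound:
  assumes "\<sigma> = 0 \<or> \<sigma> = 1"
  shows "\<bar>cslope k m1 m2 \<sigma> i j\<bar> \<le> of_bool ((m1 = i \<or> m1 = i - 1) \<and> (m2 = j \<or> m2 = j - 1))"
proof -
  have *: "\<bar>of_bool P - of_bool Q :: real\<bar> \<le> of_bool R" if "P \<Longrightarrow> R" "Q \<Longrightarrow> R" for P Q R
    using that by (cases P; cases Q; cases R) simp_all
  show ?thesis
  proof (cases "k = 1")
    case True
    show ?thesis unfolding cslope_def cell_slope1_def if_P[OF True] by (rule *) (use assms in auto)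
  next
    case False
    show ?thesis unfolding cslope_def cell_slope2_def if_not_P[OF False] by (rule *) (use assms in auto)
  qed
qed

lemma slope_bound: "\<bar>slope n r k x\<bar> \<le> near n r x"
proof -
  have "\<bar>slope n r k x\<bar> \<le> of_bool ((cell1 n x = node1 n r \<or> cell1 n x = node1 n r - 1) \<and>
     (cell2 n x = node2 n r \<or> cell2 n x = node2 n r - 1))"
    unfolding slope_def using cell_up_01 by (rule cslope_bound)
  also have "\<dots> \<le> near n r x"
    unfolding near_def cell1_def cell2_def of_bool_less_eq_iff
    by (intro impI conjI; elim conjE; rule floor_node; assumption)
  finally show ?thesis .
qed

lemma near_01: "0 \<le> near n r x" "near n r x \<le> 1"
  by (auto simp: near_def)

lemma component_measurable [measurable]: "(\<lambda>x::real^2. x$k) \<in> borel_measurable borel"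
  by (intro borel_measurable_continuous_onI continuous_intros)

lemma cells_measurable [measurable]:
  "cell1 n \<in> measurable borel (count_space UNIV)" "cell2 n \<in> measurable borel (count_space UNIV)"
  "cell_up n \<in> measurable borel (count_space UNIV)"
proof -
  show 1 [measurable]: "cell1 n \<in> measurable borel (count_space UNIV)" unfolding cell1_def[abs_def] by measurable
  show 2 [measurable]: "cell2 n \<in> measurable borel (count_space UNIV)" unfolding cell2_def[abs_def] by measurable
  show "cell_up n \<in> measurable borel (count_space UNIV)" unfolding cell_up_def[abs_def] by measurable
qed

lemma slope_measurable [measurable]: "slope n r k \<in> borel_measurable borel"
proof (cases "k = 1")
  case True
  then show ?thesis
    unfolding slope_def[abs_def] cslope_def cell_slope1_def of_bool_def by simp
next
  case False
  then show ?thesis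
    unfolding slope_def[abs_def] cslope_def cell_slope2_def of_bool_def by simp
qed

lemma near_measurable [measurable]: "near n r \<in> borel_measurable borel"
  unfolding near_def[abs_def] of_bool_def by simp

lemma node_hat_measurable: "r < n\<^sup>2 \<Longrightarrow> node_hat n r \<in> borel_measurable borel"
  using node_hat_continuous by (rule borel_measurable_continuous_onI)

lemma measurable_lebesgue_onI: "f \<in> borel_measurable borel \<Longrightarrow> f \<in> borel_measurable (lebesgue_on S)"
  for f :: "real^2 \<Rightarrow> 'a::euclidean_space"
  by (intro measurable_restrict_space1 measurable_completion) simp

text \<open>A closed interval of length two may contain three integers.\<close>

lemma card_near_real: "card {a\<in>{..<n}. \<bar>(u::real) - of_int (int a + 1)\<bar> \<le> 1} \<le> 3"
proof -
  have "inj_on int {a\<in>{..<n}. \<bar>u - of_int (int a + 1)\<bar> \<le> 1}" by (simp add: inj_on_def)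
  moreover have "int ` {a\<in>{..<n}. \<bar>u - of_int (int a + 1)\<bar> \<le> 1} \<subseteq> {\<lfloor>u\<rfloor> - 2..\<lfloor>u\<rfloor>}"
  proof
    fix z assume "z \<in> int ` {a\<in>{..<n}. \<bar>u - of_int (int a + 1)\<bar> \<le> 1}"
    then have "\<bar>u - of_int (z + 1)\<bar> \<le> 1" by blast
    then have "\<lfloor>u\<rfloor> - 2 \<le> z" "z \<le> \<lfloor>u\<rfloor>" by linarith+
    then show "z \<in> {\<lfloor>u\<rfloor> - 2..\<lfloor>u\<rfloor>}" by simp
  qed
  ultimately have "card {a\<in>{..<n}. \<bar>u - of_int (int a + 1)\<bar> \<le> 1} \<le> card {\<lfloor>u\<rfloor> - 2..\<lfloor>u\<rfloor>}"
    by (intro card_inj_on_le) auto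
  then show ?thesis by simp
qed

lemma sum_near: "(\<Sum>r<n\<^sup>2. near n r x) \<le> 9"
proof -
  let ?P = "\<lambda>a. \<bar>x$1 / mesh_size n - of_int (int a + 1)\<bar> \<le> 1"
  let ?Q = "\<lambda>a. \<bar>x$2 / mesh_size n - of_int (int a + 1)\<bar> \<le> 1"
  have cnt: "(\<Sum>a<n. of_bool (P a)) = real (card {a\<in>{..<n}. P a})" for P
    unfolding of_bool_def sum.inter_filter[OF finite_lessThan, symmetric] by simp
  have "(\<Sum>r<n\<^sup>2. near n r x) = (\<Sum>a<n. \<Sum>b<n. of_bool (?P a) * of_bool (?Q b))"
    unfolding near_def node1_def node2_def of_bool_conj
    by (rule sum_div_mod[of "\<lambda>a b. of_bool (?P a) * of_bool (?Q b)"])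
  also have "\<dots> = real (card {a\<in>{..<n}. ?P a}) * real (card {a\<in>{..<n}. ?Q a})"
    unfolding sum_product[symmetric] cnt ..
  also have "\<dots> \<le> 3 * 3"
  proof (intro mult_mono)
    show "real (card {a\<in>{..<n}. ?P a}) \<le> 3" "real (card {a\<in>{..<n}. ?Q a}) \<le> 3"
      using card_near_real[of n "x$1 / mesh_size n"] card_near_real[of n "x$2 / mesh_size n"] by linarith+
  qed simp_all
  finally show ?thesis by simp
qed

text \<open>At most nine nodes are near a given point, so at most 81 pairs contribute there.
  Exchanging sum and integral bounds the moduli of all entries together by one integral, with a
  constant free of \<open>n\<close>; this is the boundedness of the map from coefficients to
  entries.\<close>

lemma sum_integrals_le:
  fixes w :: "nat \<Rightarrow> nat \<Rightarrow> real^2 \<Rightarrow> complex"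
  assumes f: "integrable \<mu>\<^sub>S f" "\<And>x. f x \<ge> 0"
    and w: "\<And>r s. r < n\<^sup>2 \<Longrightarrow> s < n\<^sup>2 \<Longrightarrow> w r s \<in> borel_measurable \<mu>\<^sub>S"
    and wb: "\<And>r s x. r < n\<^sup>2 \<Longrightarrow> s < n\<^sup>2 \<Longrightarrow> x \<in> open_unit_square \<Longrightarrow> cmod (w r s x) \<le> near n r x * near n s x * f x"
  shows "(\<Sum>r<n\<^sup>2. \<Sum>s<n\<^sup>2. cmod (LINT x|\<mu>\<^sub>S. w r s x)) \<le> 81 * (LINT x|\<mu>\<^sub>S. f x)"
proof -
  have sp: "space \<mu>\<^sub>S = open_unit_square" by simp
  have nf: "integrable \<mu>\<^sub>S (\<lambda>x. near n r x * near n s x * f x)" for r s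
  proof (rule Bochner_Integration.integrable_bound[OF f(1)])
    show "(\<lambda>x. near n r x * near n s x * f x) \<in> borel_measurable \<mu>\<^sub>S"
      using f(1) by (intro borel_measurable_times measurable_lebesgue_onI near_measurable borel_measurable_integrable)
    show "AE x in \<mu>\<^sub>S. norm (near n r x * near n s x * f x) \<le> norm (f x)"
      using near_01 f(2) by (intro AE_I2) (auto simp: abs_mult intro!: mult_left_le_one_le mult_le_one)
  qed
  have "(\<Sum>r<n\<^sup>2. \<Sum>s<n\<^sup>2. cmod (LINT x|\<mu>\<^sub>S. w r s x)) \<le> (\<Sum>r<n\<^sup>2. \<Sum>s<n\<^sup>2. LINT x|\<mu>\<^sub>S. near n r x * near n s x * f x)"
  proof (intro sum_mono)
    fix r s assume "r \<in> {..<n\<^sup>2}" "s \<in> {..<n\<^sup>2}"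
    then have rs: "r < n\<^sup>2" "s < n\<^sup>2" by auto
    have iw: "integrable \<mu>\<^sub>S (w r s)"
    proof (rule Bochner_Integration.integrable_bound[OF nf[of r s] w[OF rs]])
      show "AE x in \<mu>\<^sub>S. norm (w r s x) \<le> norm (near n r x * near n s x * f x)"
      proof (rule AE_I2)
        fix x assume "x \<in> space \<mu>\<^sub>S"
        then show "norm (w r s x) \<le> norm (near n r x * near n s x * f x)"
          using wb[OF rs, of x] f(2)[of x] near_01[of n r x] near_01[of n s x] by (simp add: abs_mult)
      qed
    qed
    have "cmod (LINT x|\<mu>\<^sub>S. w r s x) \<le> (LINT x|\<mu>\<^sub>S. cmod (w r s x))" by (rule integral_norm_bound)
    also have "\<dots> \<le> (LINT x|\<mu>\<^sub>S. near n r x * near n s x * f x)"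
      by (rule integral_mono[OF integrable_norm[OF iw] nf]) (use wb[OF rs] sp in auto)
    finally show "cmod (LINT x|\<mu>\<^sub>S. w r s x) \<le> (LINT x|\<mu>\<^sub>S. near n r x * near n s x * f x)" .
  qed
  also have "\<dots> = (LINT x|\<mu>\<^sub>S. (\<Sum>r<n\<^sup>2. \<Sum>s<n\<^sup>2. near n r x * near n s x * f x))"
    using nf by (simp add: Bochner_Integration.integral_sum Bochner_Integration.integrable_sum)
  also have "\<dots> \<le> (LINT x|\<mu>\<^sub>S. 81 * f x)"
  proof (rule integral_mono)
    show "integrable \<mu>\<^sub>S (\<lambda>x. \<Sum>r<n\<^sup>2. \<Sum>s<n\<^sup>2. near n r x * near n s x * f x)"
      using nf by (intro Bochner_Integration.integrable_sum)
    show "integrable \<mu>\<^sub>S (\<lambda>x. 81 * f x)" using f by simp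
    fix x
    have "(\<Sum>r<n\<^sup>2. \<Sum>s<n\<^sup>2. near n r x * near n s x * f x) = (\<Sum>r<n\<^sup>2. near n r x) * (\<Sum>s<n\<^sup>2. near n s x) * f x"
      unfolding sum_product unfolding sum_distrib_right ..
    also have "\<dots> \<le> 9 * 9 * f x"
      using sum_near[of n x] near_01 f(2) by (intro mult_right_mono mult_mono sum_nonneg) auto
    finally show "(\<Sum>r<n\<^sup>2. \<Sum>s<n\<^sup>2. near n r x * near n s x * f x) \<le> 81 * f x" by simp
  qed
  finally show ?thesis using f by simp
qed

section \<open>Integrals over single triangles\<close>

definition cell :: "nat \<Rightarrow> int \<Rightarrow> int \<Rightarrow> int \<Rightarrow> (real^2) set" where
  "cell n m1 m2 \<sigma> = {x. cell1 n x = m1 \<and> cell2 n x = m2 \<and> cell_up n x = \<sigma>}"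

lemma cell_sets: "cell n m1 m2 \<sigma> \<in> sets borel"
proof -
  have "{x \<in> space borel. cell1 n x = m1 \<and> cell2 n x = m2 \<and> cell_up n x = \<sigma>} \<in> sets borel"
    by measurable
  then show ?thesis by (simp add: cell_def)
qed

text \<open>The half-open cell agrees up to three lines with a closed right triangle of legs
  h.\<close>

lemma measure_cell:
  assumes \<sigma>: "\<sigma> = 0 \<or> \<sigma> = 1"
  shows "cell n m1 m2 \<sigma> \<in> lmeasurable" "measure lebesgue (cell n m1 m2 \<sigma>) = (mesh_size n)\<^sup>2 / 2"
proof -
  define h where "h = mesh_size n"
  have h: "h > 0" unfolding h_def by (rule mesh_size_pos)
  define P :: "real^2" where "P = vector [of_int m1 * h, of_int m2 * h]"
  \<comment> \<open>The right-angled corner: lower left for the lower triangle, upper right for the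
    upper one, with \<delta> as signed leg.\<close>
  define Q :: "real^2" where "Q = (if \<sigma> = 0 then P else P + vector [h, h])"
  define \<delta> where "\<delta> = (if \<sigma> = 0 then h else - h)"
  let ?T = "convex hull {Q, Q + vector [\<delta>, 0], Q + vector [0, \<delta>]}"
  let ?N = "{x::real^2. x$1 = (of_int m1 + 1) * h} \<union> {x. x$2 = (of_int m2 + 1) * h} \<union> {x. x$1 + x$2 = (of_int (m1 + m2) + 1) * h}"
  have neg: "negligible ?N"
    by (intro negligible_Un negligible_vertical negligible_diagonal)
  have mT: "measure lborel ?T = h\<^sup>2 / 2"
    unfolding content_triangle by (auto simp: \<delta>_def power2_eq_square)
  have T: "x \<in> ?T \<longleftrightarrow> 0 \<le> (x$1 - Q$1) / \<delta> \<and> 0 \<le> (x$2 - Q$2) / \<delta> \<and> (x$1 - Q$1) / \<delta> + (x$2 - Q$2) / \<delta> \<le> 1" for x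
  proof -
    have \<delta>: "\<delta> \<noteq> 0" using h by (auto simp: \<delta>_def)
    show ?thesis unfolding triangle_iff
    proof
      assume "\<exists>s t. 0 \<le> s \<and> 0 \<le> t \<and> s + t \<le> 1 \<and> x = Q + s *\<^sub>R vector [\<delta>, 0] + t *\<^sub>R vector [0, \<delta>]"
      then obtain s t where st: "0 \<le> s" "0 \<le> t" "s + t \<le> 1" "x = Q + s *\<^sub>R vector [\<delta>, 0] + t *\<^sub>R vector [0, \<delta>]" by blast
      then have "(x$1 - Q$1) / \<delta> = s" "(x$2 - Q$2) / \<delta> = t" using \<delta> by simp_all
      then show "0 \<le> (x$1 - Q$1) / \<delta> \<and> 0 \<le> (x$2 - Q$2) / \<delta> \<and> (x$1 - Q$1) / \<delta> + (x$2 - Q$2) / \<delta> \<le> 1" using st by simp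
    next
      assume *: "0 \<le> (x$1 - Q$1) / \<delta> \<and> 0 \<le> (x$2 - Q$2) / \<delta> \<and> (x$1 - Q$1) / \<delta> + (x$2 - Q$2) / \<delta> \<le> 1"
      have "x = Q + ((x$1 - Q$1) / \<delta>) *\<^sub>R vector [\<delta>, 0] + ((x$2 - Q$2) / \<delta>) *\<^sub>R vector [0, \<delta>]"
        using \<delta> by (simp add: Finite_Cartesian_Product.vec_eq_iff forall_2)
      then show "\<exists>s t. 0 \<le> s \<and> 0 \<le> t \<and> s + t \<le> 1 \<and> x = Q + s *\<^sub>R vector [\<delta>, 0] + t *\<^sub>R vector [0, \<delta>]"
        using * by blast
    qed
  qed
  have T': "x \<in> ?T \<longleftrightarrow> (if \<sigma> = 0 then of_int m1 * h \<le> x$1 \<and> of_int m2 * h \<le> x$2 \<and> x$1 + x$2 \<le> (of_int (m1 + m2) + 1) * h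
     else x$1 \<le> (of_int m1 + 1) * h \<and> x$2 \<le> (of_int m2 + 1) * h \<and> (of_int (m1 + m2) + 1) * h \<le> x$1 + x$2)" for x
  proof (cases "\<sigma> = 0")
    case True
    then show ?thesis
      using h unfolding T add_divide_distrib[symmetric] unfolding Q_def P_def \<delta>_def
      by (simp add: zero_le_divide_iff divide_le_eq algebra_simps)
  next
    case False
    then show ?thesis
      using h unfolding T add_divide_distrib[symmetric] unfolding Q_def P_def \<delta>_def
      by (simp add: zero_le_divide_iff divide_le_eq le_divide_eq algebra_simps)
  qed
  have C: "x \<in> cell n m1 m2 \<sigma> \<longleftrightarrow> of_int m1 * h \<le> x$1 \<and> x$1 < (of_int m1 + 1) * h \<and>
      of_int m2 * h \<le> x$2 \<and> x$2 < (of_int m2 + 1) * h \<and>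
      (of_int (m1 + m2 + \<sigma>)) * h \<le> x$1 + x$2 \<and> x$1 + x$2 < (of_int (m1 + m2 + \<sigma>) + 1) * h" for x
  proof -
    have "x \<in> cell n m1 m2 \<sigma> \<longleftrightarrow> \<lfloor>x$1 / h\<rfloor> = m1 \<and> \<lfloor>x$2 / h\<rfloor> = m2 \<and> \<lfloor>(x$1 + x$2) / h\<rfloor> = m1 + m2 + \<sigma>"
      unfolding cell_def cell1_def cell2_def cell_up_def h_def by auto
    then show ?thesis using h unfolding floor_eq_iff by (simp add: le_divide_eq divide_less_eq)
  qed
  have sub1: "cell n m1 m2 \<sigma> \<subseteq> ?T"
  proof
    fix x assume x: "x \<in> cell n m1 m2 \<sigma>"
    show "x \<in> ?T"
      using x \<sigma> unfolding T' C by (auto simp: algebra_simps)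
  qed
  have sub2: "?T - ?N \<subseteq> cell n m1 m2 \<sigma>"
  proof
    fix x assume "x \<in> ?T - ?N"
    then have x: "x \<in> ?T" "x \<notin> ?N" by auto
    then have ne: "x$1 \<noteq> (of_int m1 + 1) * h" "x$2 \<noteq> (of_int m2 + 1) * h" "x$1 + x$2 \<noteq> (of_int (m1 + m2) + 1) * h" by auto
    show "x \<in> cell n m1 m2 \<sigma>"
      using x(1) ne \<sigma> unfolding T' C by (auto simp: algebra_simps)
  qed
  have TL: "?T \<in> lmeasurable"
    by (intro lmeasurable_compact compact_convex_hull) auto
  have neg2: "negligible (?T - cell n m1 m2 \<sigma> \<union> (cell n m1 m2 \<sigma> - ?T))"
    by (rule negligible_subset[OF neg]) (use sub1 sub2 in blast)
  show "cell n m1 m2 \<sigma> \<in> lmeasurable"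
    using lmeasurable_negligible_symdiff[OF TL neg2] .
  show "measure lebesgue (cell n m1 m2 \<sigma>) = (mesh_size n)\<^sup>2 / 2"
  proof -
    have "?T \<in> sets borel" by (intro borel_closed compact_imp_closed compact_convex_hull) auto
    then show ?thesis
      using measure_negligible_symdiff[OF TL neg2] mT by (simp add: h_def measure_completion)
  qed
qed

text \<open>Slopes of node \<open>r\<close> vanish outside the four squares that meet at it, so the
  product is constant on eight triangles and zero elsewhere; \<open>u\<close> and \<open>v\<close>
  count back from the node to the lower left corner of the square.\<close>

lemma slope_product_cells:
  "slope n s k x * slope n r l x =
   (\<Sum>u\<in>{0,1}. \<Sum>v\<in>{0,1}. \<Sum>\<sigma>\<in>{0,1}. indicator (cell n (node1 n r - u) (node2 n r - v) \<sigma>) x *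
      (cslope k (node1 n r - u) (node2 n r - v) \<sigma> (node1 n s) (node2 n s) *
       cslope l (node1 n r - u) (node2 n r - v) \<sigma> (node1 n r) (node2 n r)))"
  (is "?L = (\<Sum>u\<in>?B. \<Sum>v\<in>?B. \<Sum>\<sigma>\<in>?B. ?I u v \<sigma> * ?F u v \<sigma>)")
proof -
  define u0 v0 \<sigma>0 where "u0 = node1 n r - cell1 n x" and "v0 = node2 n r - cell2 n x" and "\<sigma>0 = cell_up n x"
  have L: "?L = ?F u0 v0 \<sigma>0" by (simp add: slope_def u0_def v0_def \<sigma>0_def)
  have I: "?I u v \<sigma> = of_bool (u = u0) * of_bool (v = v0) * of_bool (\<sigma> = \<sigma>0)" for u v \<sigma>
  proof -
    have "x \<in> cell n (node1 n r - u) (node2 n r - v) \<sigma> \<longleftrightarrow> u = u0 \<and> v = v0 \<and> \<sigma> = \<sigma>0"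
      unfolding cell_def u0_def v0_def \<sigma>0_def mem_Collect_eq by linarith
    then show ?thesis by (simp add: indicator_def)
  qed
  have delta: "(\<Sum>u\<in>{0,1::int}. of_bool (u = a) * f u) = (if a \<in> {0,1} then f a else (0::real))" for a f
    by (simp add: of_bool_def) 
  have "(\<Sum>u\<in>?B. \<Sum>v\<in>?B. \<Sum>\<sigma>\<in>?B. ?I u v \<sigma> * ?F u v \<sigma>)
     = (\<Sum>u\<in>?B. of_bool (u = u0) * (\<Sum>v\<in>?B. of_bool (v = v0) * (\<Sum>\<sigma>\<in>?B. of_bool (\<sigma> = \<sigma>0) * ?F u v \<sigma>)))"
    unfolding I sum_distrib_left by (simp only: mult.assoc)
  also have "\<dots> = (if u0 \<in> {0,1} then if v0 \<in> {0,1} then if \<sigma>0 \<in> {0,1} then ?F u0 v0 \<sigma>0 else 0 else 0 else 0)"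
    unfolding delta ..
  also have "\<dots> = ?F u0 v0 \<sigma>0"
  proof (cases "u0 \<in> {0,1} \<and> v0 \<in> {0,1}")
    case True
    moreover have "\<sigma>0 \<in> {0,1}" using cell_up_01 by (simp add: \<sigma>0_def)
    ultimately show ?thesis by (simp only: simp_thms if_True)
  next
    case False
    have "\<bar>cslope l (node1 n r - u0) (node2 n r - v0) \<sigma>0 (node1 n r) (node2 n r)\<bar>
       \<le> of_bool ((node1 n r - u0 = node1 n r \<or> node1 n r - u0 = node1 n r - 1) \<and>
          (node2 n r - v0 = node2 n r \<or> node2 n r - v0 = node2 n r - 1))"
      by (rule cslope_bound) (simp add: \<sigma>0_def cell_up_01)
    also have "\<dots> = 0" using False by auto
    finally have "cslope l (node1 n r - u0) (node2 n r - v0) \<sigma>0 (node1 n r) (node2 n r) = 0" by simp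
    then have z: "?F u0 v0 \<sigma>0 = 0" by simp
    show ?thesis unfolding z by (simp only: if_cancel)
  qed
  finally show ?thesis using L by simp
qed

text \<open>As (n + 1) h = 1, cells with these indices lie in the closed unit square, and a
  half-open cell sticks out of the open square only along the left and lower edges.\<close>

lemma integral_cell:
  assumes \<sigma>: "\<sigma> = 0 \<or> \<sigma> = 1" and m: "0 \<le> m1" "m1 \<le> int n" "0 \<le> m2" "m2 \<le> int n"
  shows "(LINT x|\<mu>\<^sub>S. indicator (cell n m1 m2 \<sigma>) x) = (mesh_size n)\<^sup>2 / 2"
    "integrable \<mu>\<^sub>S (indicator (cell n m1 m2 \<sigma>) :: real^2 \<Rightarrow> real)"
proof -
  let ?C = "cell n m1 m2 \<sigma>"
  have h: "mesh_size n > 0" by (rule mesh_size_pos)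
  have sub: "?C - open_unit_square \<subseteq> {x. x$1 = 0} \<union> {x. x$2 = 0}"
  proof
    fix x assume x: "x \<in> ?C - open_unit_square"
    then have fl: "\<lfloor>x$1 / mesh_size n\<rfloor> = m1" "\<lfloor>x$2 / mesh_size n\<rfloor> = m2" by (auto simp: cell_def cell1_def cell2_def)
    have bd: "0 \<le> t \<and> t < 1" if "\<lfloor>t / mesh_size n\<rfloor> = m" "0 \<le> m" "m \<le> int n" for t m
    proof -
      have "of_int m \<le> t / mesh_size n" "t / mesh_size n < of_int m + 1" using that(1) by (auto simp: floor_eq_iff)
      moreover have "0 \<le> real_of_int m" "real_of_int m \<le> real n" using that(2,3) by linarith+
      ultimately have "0 \<le> t / mesh_size n" "t / mesh_size n < real n + 1" by linarith+
      moreover have "(real n + 1) * mesh_size n = 1" by (simp add: mesh_size_def)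
      ultimately show ?thesis using h by (auto simp: zero_le_divide_iff divide_less_eq)
    qed
    show "x \<in> {x. x$1 = 0} \<union> {x. x$2 = 0}"
      using bd[OF fl(1) m(1,2)] bd[OF fl(2) m(3,4)] x by (auto simp: mem_box_real2)
  qed
  have neg: "negligible (?C - ?C \<inter> open_unit_square \<union> (?C \<inter> open_unit_square - ?C))"
    by (rule negligible_subset[OF negligible_Un[OF negligible_vertical[of 1 0] negligible_vertical[of 2 0]]])
      (use sub in blast)
  have m: "measure lebesgue (?C \<inter> open_unit_square) = (mesh_size n)\<^sup>2 / 2"
    using measure_negligible_symdiff[OF measure_cell(1)[OF \<sigma>] neg] measure_cell(2)[OF \<sigma>] by simp
  have box: "open_unit_square \<in> sets lebesgue" by (simp add: fmeasurableD)
  have "(LINT x|\<mu>\<^sub>S. indicator ?C x) = measure \<mu>\<^sub>S (?C \<inter> open_unit_square)" by simp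
  also have "\<dots> = measure lebesgue (?C \<inter> open_unit_square)"
    using box by (intro measure_restrict_space) auto
  finally show "(LINT x|\<mu>\<^sub>S. indicator ?C x) = (mesh_size n)\<^sup>2 / 2" using m by simp
  interpret finite_measure \<mu>\<^sub>S by (rule finite_measure_lebesgue_on_open_unit_square)
  have "(indicator ?C :: real^2 \<Rightarrow> real) \<in> borel_measurable borel"
    by (intro borel_measurable_indicator cell_sets)
  then show "integrable \<mu>\<^sub>S (indicator ?C :: real^2 \<Rightarrow> real)"
    by (intro integrable_const_bound[where B = 1] measurable_lebesgue_onI) (auto simp: indicator_def)
qed

text \<open>The slope product summed over the triangles at node \<open>r\<close>, with that node
  moved to the origin by translation invariance; \<open>(d1, d2)\<close> is the offset of the other
  node.\<close>

definition cell_weight :: "2 \<Rightarrow> 2 \<Rightarrow> int \<Rightarrow> int \<Rightarrow> real" where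
  "cell_weight k l d1 d2 = (\<Sum>u\<in>{0,1}. \<Sum>v\<in>{0,1}. \<Sum>\<sigma>\<in>{0,1}.
      cslope k (- u) (- v) \<sigma> d1 d2 * cslope l (- u) (- v) \<sigma> 0 0)"

lemma cslope_translate: "cslope k (a + m1) (b + m2) \<sigma> (a + i) (b + j) = cslope k m1 m2 \<sigma> i j"
  by (simp add: cslope_def cell_slope1_def cell_slope2_def add.assoc)

lemma integral_slope_product:
  assumes r: "r < n\<^sup>2"
  shows "(LINT x|\<mu>\<^sub>S. slope n s k x * slope n r l x) =
    (mesh_size n)\<^sup>2 / 2 * cell_weight k l (node1 n s - node1 n r) (node2 n s - node2 n r)"
proof -
  have nd: "1 \<le> node1 n r" "node1 n r \<le> int n" "1 \<le> node2 n r" "node2 n r \<le> int n"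
    using div_mod_less[OF r] by (auto simp: node1_def node2_def)
  let ?F = "\<lambda>u v \<sigma>. cslope k (node1 n r - u) (node2 n r - v) \<sigma> (node1 n s) (node2 n s) *
       cslope l (node1 n r - u) (node2 n r - v) \<sigma> (node1 n r) (node2 n r)"
  have ic: "(LINT x|\<mu>\<^sub>S. indicator (cell n (node1 n r - u) (node2 n r - v) \<sigma>) x) = (mesh_size n)\<^sup>2 / 2"
     "integrable \<mu>\<^sub>S (indicator (cell n (node1 n r - u) (node2 n r - v) \<sigma>) :: real^2 \<Rightarrow> real)"
    if "u \<in> {0,1}" "v \<in> {0,1}" "\<sigma> \<in> {0,1}" for u v \<sigma> :: int
    using that nd by (intro integral_cell; auto)+
  have "(LINT x|\<mu>\<^sub>S. slope n s k x * slope n r l x) =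
     (\<Sum>u\<in>{0,1}. \<Sum>v\<in>{0,1}. \<Sum>\<sigma>\<in>{0,1}. (mesh_size n)\<^sup>2 / 2 * ?F u v \<sigma>)"
  proof -
    have i1: "has_bochner_integral \<mu>\<^sub>S (\<lambda>x. indicator (cell n (node1 n r - u) (node2 n r - v) \<sigma>) x * ?F u v \<sigma>)
        ((mesh_size n)\<^sup>2 / 2 * ?F u v \<sigma>)" if "u \<in> {0,1}" "v \<in> {0,1}" "\<sigma> \<in> {0,1}" for u v \<sigma> :: int
      by (intro has_bochner_integral_mult_left) (use ic[OF that] in \<open>simp add: has_bochner_integral_iff\<close>)
    have "has_bochner_integral \<mu>\<^sub>S (\<lambda>x. slope n s k x * slope n r l x)
       (\<Sum>u\<in>{0,1}. \<Sum>v\<in>{0,1}. \<Sum>\<sigma>\<in>{0,1}. (mesh_size n)\<^sup>2 / 2 * ?F u v \<sigma>)"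
      unfolding slope_product_cells by (intro has_bochner_integral_sum i1)
    then show ?thesis by (rule has_bochner_integral_integral_eq)
  qed
  also have "\<dots> = (mesh_size n)\<^sup>2 / 2 * (\<Sum>u\<in>{0,1}. \<Sum>v\<in>{0,1}. \<Sum>\<sigma>\<in>{0,1}. ?F u v \<sigma>)"
    unfolding sum_distrib_left ..
  also have "(\<Sum>u\<in>{0,1}. \<Sum>v\<in>{0,1}. \<Sum>\<sigma>\<in>{0,1}. ?F u v \<sigma>) = cell_weight k l (node1 n s - node1 n r) (node2 n s - node2 n r)"
    unfolding cell_weight_def
  proof (intro sum.cong refl)
    fix u v \<sigma>
    show "?F u v \<sigma> = cslope k (- u) (- v) \<sigma> (node1 n s - node1 n r) (node2 n s - node2 n r) * cslope l (- u) (- v) \<sigma> 0 0"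
      using cslope_translate[of k "node1 n r" "- u" "node2 n r" "- v" \<sigma> "node1 n s - node1 n r" "node2 n s - node2 n r"]
        cslope_translate[of l "node1 n r" "- u" "node2 n r" "- v" \<sigma> 0 0] by simp
  qed
  finally show ?thesis .
qed

text \<open>The coefficients of the symbol expanded in the entries of the coefficient matrix, with
  \<open>t\<close> the mean of the two off-diagonal entries.\<close>

definition stencil :: "complex^2^2 \<Rightarrow> int \<Rightarrow> int \<Rightarrow> complex" where
  "stencil C k1 k2 = (let t = (C$1$2 + C$2$1) / 2 in
     if k1 = 0 \<and> k2 = 0 then 2 * (C$1$1 + C$2$2 + t)
     else if k1 = 0 \<and> \<bar>k2\<bar> = 1 then - C$2$2 - t
     else if \<bar>k1\<bar> = 1 \<and> k2 = 0 then - C$1$1 - t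
     else if \<bar>k1\<bar> = 1 \<and> k2 = - k1 then t else 0)"

lemma stencil_uminus: "stencil C (- k1) (- k2) = stencil C k1 k2"
proof -
  have "(- k2 = k1) = (k2 = - k1)" by linarith
  then show ?thesis
    by (simp only: stencil_def abs_minus_cancel neg_equal_0_iff_equal minus_minus)
qed

lemma stencil_zero:
  assumes "\<bar>k1\<bar> > 1 \<or> \<bar>k2\<bar> > 1"
  shows "stencil C k1 k2 = 0"
proof -
  have "\<not> (k1 = 0 \<and> k2 = 0)" "\<not> (k1 = 0 \<and> \<bar>k2\<bar> = 1)" "\<not> (\<bar>k1\<bar> = 1 \<and> k2 = 0)" "\<not> (\<bar>k1\<bar> = 1 \<and> k2 = - k1)"
    using assms by linarith+
  then show ?thesis unfolding stencil_def Let_def by (simp only: if_False)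
qed

lemma cell_weight_zero:
  assumes "\<bar>d1\<bar> > 1 \<or> \<bar>d2\<bar> > 1"
  shows "cell_weight k l d1 d2 = 0"
proof -
  have "cslope k (- u) (- v) \<sigma> d1 d2 = 0" if "u \<in> {0,1}" "v \<in> {0,1}" "\<sigma> \<in> {0,1}" for u v \<sigma>
    using that assms unfolding cslope_def cell_slope1_def cell_slope2_def by (elim insertE emptyE; simp; linarith?)
  then show ?thesis unfolding cell_weight_def by (intro sum.neutral ballI) simp
qed

text \<open>Reduces to nine offsets and four index pairs, where the slopes around a node are
  evaluated outright. The factor 1 / 2 is the area of a triangle in units of h^2.\<close>

lemma stencil_eq:
  "stencil C d1 d2 = (\<Sum>k\<in>UNIV. \<Sum>l\<in>UNIV. of_real (cell_weight k l d1 d2 / 2) * C$k$l)"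
proof (cases "\<bar>d1\<bar> > 1 \<or> \<bar>d2\<bar> > 1")
  case True
  then show ?thesis by (simp add: cell_weight_zero stencil_zero)
next
  case False
  then have "d1 = -1 \<or> d1 = 0 \<or> d1 = 1" "d2 = -1 \<or> d2 = 0 \<or> d2 = 1" by linarith+
  note d = this
  have s: "(\<Sum>u\<in>{0,1::int}. f u) = f 0 + f 1" for f :: "int \<Rightarrow> real" by simp
  have cs: "cslope 1 = cell_slope1" "cslope 2 = cell_slope2" by (auto simp: cslope_def fun_eq_iff)
  have w: "cell_weight 1 1 d1 d2 = 2 * of_bool (d2 = 0) * (2 * of_bool (d1 = 0) - of_bool (d1 = -1) - of_bool (d1 = 1))"
    "cell_weight 2 2 d1 d2 = 2 * of_bool (d1 = 0) * (2 * of_bool (d2 = 0) - of_bool (d2 = -1) - of_bool (d2 = 1))"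
    "cell_weight 1 2 d1 d2 = of_bool (d1 = 1 \<and> d2 = -1) - of_bool (d1 = 0 \<and> d2 = -1) - of_bool (d1 = 1 \<and> d2 = 0)
       + 2 * of_bool (d1 = 0 \<and> d2 = 0) - of_bool (d1 = -1 \<and> d2 = 0) - of_bool (d1 = 0 \<and> d2 = 1) + of_bool (d1 = -1 \<and> d2 = 1)"
    "cell_weight 2 1 d1 d2 = of_bool (d1 = 1 \<and> d2 = -1) - of_bool (d1 = 0 \<and> d2 = -1) - of_bool (d1 = 1 \<and> d2 = 0)
       + 2 * of_bool (d1 = 0 \<and> d2 = 0) - of_bool (d1 = -1 \<and> d2 = 0) - of_bool (d1 = 0 \<and> d2 = 1) + of_bool (d1 = -1 \<and> d2 = 1)"
    unfolding cell_weight_def s cs using d by (elim disjE; hypsubst; simp add: cell_slope1_def cell_slope2_def)+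
  show ?thesis
    unfolding sum_2 w using d
    by (elim disjE; hypsubst) (simp_all add: stencil_def Let_def add_divide_distrib)
qed

section \<open>Second order and lower order parts of the entries\<close>

lemma open_unit_square_sets: "open_unit_square \<in> sets lebesgue" by (simp add: fmeasurableD)

lemma integrable_on_open_unit_square:
  fixes f :: "real^2 \<Rightarrow> 'a::euclidean_space"
  assumes "f absolutely_integrable_on open_unit_square"
  shows "integrable \<mu>\<^sub>S f"
  using assms open_unit_square_sets unfolding set_integrable_def by (simp add: integrable_restrict_space)

lemma integrable_matrix_component:
  fixes A :: "real^2 \<Rightarrow> complex^2^2"
  assumes "A absolutely_integrable_on open_unit_square"
  shows "integrable \<mu>\<^sub>S (\<lambda>x. A x $ k $ l)"
  by (rule integrable_bounded_linear[OF bounded_linear_compose[OF bounded_linear_vec_nth bounded_linear_vec_nth]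
        integrable_on_open_unit_square[OF assms]])

lemma integrable_vector_component:
  fixes b :: "real^2 \<Rightarrow> complex^2"
  assumes "b absolutely_integrable_on open_unit_square"
  shows "integrable \<mu>\<^sub>S (\<lambda>x. b x $ k)"
  by (rule integrable_bounded_linear[OF bounded_linear_vec_nth integrable_on_open_unit_square[OF assms]])

text \<open>Measurability is asked of \<open>g\<close> only: the original integrand contains
  gradients left unspecified on the mesh lines, and completeness of Lebesgue measure carries
  measurability over.\<close>

lemma integral_cong_negligible:
  fixes f g :: "real^2 \<Rightarrow> complex"
  assumes g: "g \<in> borel_measurable \<mu>\<^sub>S" and N: "negligible N" and eq: "\<And>x. x \<notin> N \<Longrightarrow> f x = g x"
  shows "(LINT x|\<mu>\<^sub>S. f x) = (LINT x|\<mu>\<^sub>S. g x)"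
proof -
  have gm: "(\<lambda>x. indicator open_unit_square x *\<^sub>R g x) \<in> borel_measurable lebesgue"
    using g open_unit_square_sets by (simp add: borel_measurable_restrict_space_iff)
  have ae: "AE x in lebesgue. indicator open_unit_square x *\<^sub>R g x = indicator open_unit_square x *\<^sub>R f x"
    using N eq unfolding negligible_iff_null_sets by (auto intro!: AE_I'[of N])
  have "integral\<^sup>L lebesgue (\<lambda>x. indicator open_unit_square x *\<^sub>R f x) = integral\<^sup>L lebesgue (\<lambda>x. indicator open_unit_square x *\<^sub>R g x)"
    using borel_measurable_AE[OF gm ae] gm ae by (intro integral_cong_AE) auto
  then show ?thesis using open_unit_square_sets by (simp add: integral_restrict_space)
qed

lemma integrable_bounded_mult:
  fixes f :: "real^2 \<Rightarrow> complex" and g :: "real^2 \<Rightarrow> real"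
  assumes f: "integrable \<mu>\<^sub>S f" and g: "g \<in> borel_measurable borel" and B: "\<And>x. \<bar>g x\<bar> \<le> B"
  shows "integrable \<mu>\<^sub>S (\<lambda>x. of_real (g x) * f x)"
proof (rule Bochner_Integration.integrable_bound)
  show "integrable \<mu>\<^sub>S (\<lambda>x. of_real B * f x)" using f by simp
  show "(\<lambda>x. of_real (g x) * f x) \<in> borel_measurable \<mu>\<^sub>S"
    using f measurable_lebesgue_onI[OF g] by (intro borel_measurable_times borel_measurable_of_real) auto
  show "AE x in \<mu>\<^sub>S. norm (of_real (g x) * f x) \<le> norm (of_real B * f x)"
    using B by (intro AE_I2) (simp add: norm_mult mult_right_mono order_trans[OF B abs_ge_self])
qed

text \<open>\<open>k\<close> goes with the trial function of column \<open>s\<close> and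
  \<open>l\<close> with the test function of row \<open>r\<close>, in the order of the bilinear
  form. The division by h^2 turns slopes into gradients.\<close>

definition main_weight :: "nat \<Rightarrow> nat \<Rightarrow> nat \<Rightarrow> 2 \<Rightarrow> 2 \<Rightarrow> real^2 \<Rightarrow> real" where
  "main_weight n r s k l x = slope n s k x * slope n r l x / (mesh_size n)\<^sup>2"

definition main_entry :: "(real^2 \<Rightarrow> complex^2^2) \<Rightarrow> nat \<Rightarrow> nat \<Rightarrow> nat \<Rightarrow> complex" where
  "main_entry A n r s = (LINT x|\<mu>\<^sub>S. (\<Sum>k\<in>UNIV. \<Sum>l\<in>UNIV. of_real (main_weight n r s k l x) * A x $ k $ l))"

definition low_integrand :: "(real^2 \<Rightarrow> complex^2) \<Rightarrow> (real^2 \<Rightarrow> complex) \<Rightarrow> nat \<Rightarrow> nat \<Rightarrow> nat \<Rightarrow> real^2 \<Rightarrow> complex" where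
  "low_integrand b c n r s x = (\<Sum>k\<in>UNIV. of_real (slope n s k x / mesh_size n * node_hat n r x) * b x $ k)
      + of_real (node_hat n s x * node_hat n r x) * c x"

definition low_entry :: "(real^2 \<Rightarrow> complex^2) \<Rightarrow> (real^2 \<Rightarrow> complex) \<Rightarrow> nat \<Rightarrow> nat \<Rightarrow> nat \<Rightarrow> complex" where
  "low_entry b c n r s = (LINT x|\<mu>\<^sub>S. low_integrand b c n r s x)"

lemma abs_mult_le: "\<bar>a\<bar> \<le> p \<Longrightarrow> \<bar>b\<bar> \<le> q \<Longrightarrow> \<bar>a * b\<bar> \<le> p * q" for a b p q :: real
  unfolding abs_mult by (intro mult_mono) auto

lemma main_weight_bound: "\<bar>main_weight n r s k l x\<bar> \<le> near n r x * near n s x * (real n + 1)\<^sup>2"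
proof -
  have "\<bar>slope n s k x * slope n r l x\<bar> \<le> near n s x * near n r x"
    by (intro abs_mult_le slope_bound)
  then have "\<bar>slope n s k x * slope n r l x\<bar> * (real n + 1)\<^sup>2 \<le> near n s x * near n r x * (real n + 1)\<^sup>2"
    by (intro mult_right_mono) auto
  then show ?thesis
    by (simp add: main_weight_def mesh_size_def power_divide abs_mult mult_ac)
qed

lemma main_weight_measurable: "main_weight n r s k l \<in> borel_measurable borel"
  unfolding main_weight_def[abs_def]
  by (intro borel_measurable_divide borel_measurable_times slope_measurable borel_measurable_const)

lemma near_mult_le: "near n r x * near n s x \<le> 1"
  by (intro mult_le_one near_01)

lemma main_weight_bounded: "\<bar>main_weight n r s k l x\<bar> \<le> (real n + 1)\<^sup>2"
proof -
  have "near n r x * near n s x * (real n + 1)\<^sup>2 \<le> 1 * (real n + 1)\<^sup>2"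
    by (intro mult_right_mono near_mult_le) auto
  then show ?thesis using main_weight_bound[of n r s k l x] by linarith
qed

lemma main_integrable:
  fixes A :: "real^2 \<Rightarrow> complex^2^2"
  assumes "\<And>k l. integrable \<mu>\<^sub>S (\<lambda>x. A x $ k $ l)"
  shows "integrable \<mu>\<^sub>S (\<lambda>x. \<Sum>k\<in>UNIV. \<Sum>l\<in>UNIV. of_real (main_weight n r s k l x) * A x $ k $ l)"
  by (intro Bochner_Integration.integrable_sum integrable_bounded_mult[OF assms main_weight_measurable main_weight_bounded])

lemma low_bounds:
  assumes r: "r < n\<^sup>2" "s < n\<^sup>2"
  shows "\<bar>slope n s k x / mesh_size n * node_hat n r x\<bar> \<le> near n r x * near n s x * (real n + 1)"
    "\<bar>node_hat n s x * node_hat n r x\<bar> \<le> near n r x * near n s x * (real n + 1)"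
proof -
  have \<psi>: "\<bar>node_hat n r x\<bar> \<le> near n r x" "\<bar>node_hat n s x\<bar> \<le> near n s x"
    using node_hat_bounds[OF r(1), of x] node_hat_bounds[OF r(2), of x] by auto
  have "\<bar>slope n s k x * node_hat n r x\<bar> \<le> near n s x * near n r x"
    by (intro abs_mult_le slope_bound \<psi>)
  then have "\<bar>slope n s k x * node_hat n r x\<bar> * (real n + 1) \<le> near n s x * near n r x * (real n + 1)"
    by (intro mult_right_mono) auto
  then show "\<bar>slope n s k x / mesh_size n * node_hat n r x\<bar> \<le> near n r x * near n s x * (real n + 1)"
    by (simp add: mesh_size_def abs_mult mult_ac)
  have "\<bar>node_hat n s x * node_hat n r x\<bar> \<le> near n s x * near n r x" by (intro abs_mult_le \<psi>)
  also have "\<dots> \<le> near n s x * near n r x * (real n + 1)"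
    using near_01[of n s x] near_01[of n r x] by (simp add: distrib_left)
  finally show "\<bar>node_hat n s x * node_hat n r x\<bar> \<le> near n r x * near n s x * (real n + 1)"
    by (simp add: mult_ac)
qed

lemma low_integrable:
  fixes b :: "real^2 \<Rightarrow> complex^2" and c :: "real^2 \<Rightarrow> complex"
  assumes r: "r < n\<^sup>2" "s < n\<^sup>2" and b: "\<And>k. integrable \<mu>\<^sub>S (\<lambda>x. b x $ k)" and c: "integrable \<mu>\<^sub>S c"
  shows "integrable \<mu>\<^sub>S (low_integrand b c n r s)"
proof -
  have nb: "near n r x * near n s x * (real n + 1) \<le> real n + 1" for x
    using mult_right_mono[OF near_mult_le, of "real n + 1" n r x s] by simp
  show ?thesis
    unfolding low_integrand_def[abs_def]
    by (intro Bochner_Integration.integrable_add Bochner_Integration.integrable_sum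
        integrable_bounded_mult[OF b _ order_trans[OF low_bounds(1)[OF r] nb]]
        integrable_bounded_mult[OF c _ order_trans[OF low_bounds(2)[OF r] nb]]
        borel_measurable_times borel_measurable_divide slope_measurable borel_measurable_const
        node_hat_measurable[OF r(1)] node_hat_measurable[OF r(2)])
qed

lemma stiffness_entry:
  fixes A :: "real^2 \<Rightarrow> complex^2^2" and b :: "real^2 \<Rightarrow> complex^2" and c :: "real^2 \<Rightarrow> complex"
  assumes r: "r < n\<^sup>2" "s < n\<^sup>2" and A: "\<And>k l. integrable \<mu>\<^sub>S (\<lambda>x. A x $ k $ l)"
    and b: "\<And>k. integrable \<mu>\<^sub>S (\<lambda>x. b x $ k)" and c: "integrable \<mu>\<^sub>S c"
  shows "stiffness_matrix A b c n $$ (r, s) = main_entry A n r s + low_entry b c n r s"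
proof -
  let ?g = "\<lambda>x. (\<Sum>k\<in>UNIV. \<Sum>l\<in>UNIV. of_real (main_weight n r s k l x) * A x $ k $ l) + low_integrand b c n r s x"
  have "stiffness_matrix A b c n $$ (r, s) = (LINT x|\<mu>\<^sub>S.
          bilinear_mult (complex_vector (grad (node_hat n s) x)) (A x) (complex_vector (grad (node_hat n r) x))
          + dot_mult (complex_vector (grad (node_hat n s) x)) (b x) * of_real (node_hat n r x)
          + c x * of_real (node_hat n s x) * of_real (node_hat n r x))"
    using r by (simp add: stiffness_matrix_def Let_def)
  also have "\<dots> = (LINT x|\<mu>\<^sub>S. ?g x)"
  proof (rule integral_cong_negligible[OF _ negligible_mesh_lines[of n]])
    show "?g \<in> borel_measurable \<mu>\<^sub>S"
      by (intro borel_measurable_integrable Bochner_Integration.integrable_add main_integrable A low_integrable r b c)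
    fix x assume x: "x \<notin> mesh_lines n"
    show "bilinear_mult (complex_vector (grad (node_hat n s) x)) (A x) (complex_vector (grad (node_hat n r) x))
          + dot_mult (complex_vector (grad (node_hat n s) x)) (b x) * of_real (node_hat n r x)
          + c x * of_real (node_hat n s x) * of_real (node_hat n r x) = ?g x"
      using mesh_size_pos[of n]
      by (simp add: bilinear_mult_def dot_mult_def complex_vector_def matrix_vector_mult_def sum_2
          grad_node_hat[OF r(1) x] grad_node_hat[OF r(2) x] main_weight_def low_integrand_def power2_eq_square field_simps)
  qed
  also have "\<dots> = main_entry A n r s + low_entry b c n r s"
    unfolding main_entry_def low_entry_def
    by (intro Bochner_Integration.integral_add main_integrable A low_integrable r b c)
  finally show ?thesis .
qed

text \<open>The weights are real, and interchanging \<open>r\<close> and \<open>s\<close>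
  interchanges \<open>k\<close> and \<open>l\<close> in them, which conjugation of the coefficient
  matrix undoes.\<close>

lemma main_entry_hermitian:
  fixes A :: "real^2 \<Rightarrow> complex^2^2"
  assumes "\<And>x. x \<in> open_unit_square \<Longrightarrow> hermitian_matrix (A x)"
  shows "cnj (main_entry A n r s) = main_entry A n s r"
proof -
  have "cnj (main_entry A n r s) = (LINT x|\<mu>\<^sub>S. cnj (\<Sum>k\<in>UNIV. \<Sum>l\<in>UNIV. of_real (main_weight n r s k l x) * A x $ k $ l))"
    unfolding main_entry_def by (rule Bochner_Integration.integral_cnj[symmetric])
  also have "\<dots> = main_entry A n s r"
    unfolding main_entry_def
  proof (rule Bochner_Integration.integral_cong[OF refl])
    fix x assume "x \<in> space \<mu>\<^sub>S"
    then have h: "hermitian_matrix (A x)" using assms by simp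
    have eq: "A x $ k $ l = cnj (A x $ l $ k)" for k l using h unfolding hermitian_matrix_def by blast
    have "cnj (\<Sum>k\<in>UNIV. \<Sum>l\<in>UNIV. of_real (main_weight n r s k l x) * A x $ k $ l)
       = (\<Sum>k\<in>UNIV. \<Sum>l\<in>UNIV. of_real (main_weight n r s k l x) * A x $ l $ k)"
      by (simp only: cnj_sum complex_cnj_mult complex_cnj_complex_of_real eq[symmetric])
    also have "\<dots> = (\<Sum>l\<in>UNIV. \<Sum>k\<in>UNIV. of_real (main_weight n s r l k x) * A x $ l $ k)"
      by (subst sum.swap) (simp only: main_weight_def mult.commute[of "slope n s _ x"])
    finally show "cnj (\<Sum>k\<in>UNIV. \<Sum>l\<in>UNIV. of_real (main_weight n r s k l x) * A x $ k $ l)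
       = (\<Sum>k\<in>UNIV. \<Sum>l\<in>UNIV. of_real (main_weight n s r k l x) * A x $ k $ l)" .
  qed
  finally show ?thesis .
qed

text \<open>The factor \<open>(real n + 1)\<^sup>2\<close> is 1 / h^2 from two gradients. As there
  are n^2 rows, the mean error per row is of the order of the L^1 distance of the
  coefficients.\<close>

lemma main_entry_diff_l1:
  fixes A A' :: "real^2 \<Rightarrow> complex^2^2"
  assumes A: "\<And>k l. integrable \<mu>\<^sub>S (\<lambda>x. A x $ k $ l)" and A': "\<And>k l. integrable \<mu>\<^sub>S (\<lambda>x. A' x $ k $ l)"
  shows "(\<Sum>r<n\<^sup>2. \<Sum>s<n\<^sup>2. cmod (main_entry A n r s - main_entry A' n r s))
    \<le> 81 * (real n + 1)\<^sup>2 * (\<Sum>k\<in>UNIV. \<Sum>l\<in>UNIV. LINT x|\<mu>\<^sub>S. cmod (A x $ k $ l - A' x $ k $ l))"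
proof -
  let ?f = "\<lambda>x. (real n + 1)\<^sup>2 * (\<Sum>k\<in>UNIV. \<Sum>l\<in>UNIV. cmod (A x $ k $ l - A' x $ k $ l))"
  let ?w = "\<lambda>r s x. \<Sum>k\<in>UNIV. \<Sum>l\<in>UNIV. of_real (main_weight n r s k l x) * (A x $ k $ l - A' x $ k $ l)"
  have D: "integrable \<mu>\<^sub>S (\<lambda>x. cmod (A x $ k $ l - A' x $ k $ l))" for k l
    using A A' by (intro integrable_norm Bochner_Integration.integrable_diff)
  have eq: "main_entry A n r s - main_entry A' n r s = (LINT x|\<mu>\<^sub>S. ?w r s x)" for r s
    unfolding main_entry_def
    by (subst Bochner_Integration.integral_diff[OF main_integrable[OF A] main_integrable[OF A'], symmetric])
      (simp only: right_diff_distrib sum_subtractf)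
  have "(\<Sum>r<n\<^sup>2. \<Sum>s<n\<^sup>2. cmod (LINT x|\<mu>\<^sub>S. ?w r s x)) \<le> 81 * (LINT x|\<mu>\<^sub>S. ?f x)"
  proof (rule sum_integrals_le)
    show "integrable \<mu>\<^sub>S ?f" using D by (intro integrable_mult_right Bochner_Integration.integrable_sum)
    show "?f x \<ge> 0" for x by (intro mult_nonneg_nonneg sum_nonneg) auto
    show "?w r s \<in> borel_measurable \<mu>\<^sub>S" for r s
      by (intro borel_measurable_integrable Bochner_Integration.integrable_sum
          integrable_bounded_mult[OF Bochner_Integration.integrable_diff[OF A A'] main_weight_measurable main_weight_bounded])
    show "cmod (?w r s x) \<le> near n r x * near n s x * ?f x" for r s x
    proof -
      have "cmod (?w r s x) \<le> (\<Sum>k\<in>UNIV. \<Sum>l\<in>UNIV. \<bar>main_weight n r s k l x\<bar> * cmod (A x $ k $ l - A' x $ k $ l))"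
        by (intro order_trans[OF norm_sum] sum_mono) (simp add: norm_mult)
      also have "\<dots> \<le> (\<Sum>k\<in>UNIV. \<Sum>l\<in>UNIV. near n r x * near n s x * (real n + 1)\<^sup>2 * cmod (A x $ k $ l - A' x $ k $ l))"
        by (intro sum_mono mult_right_mono main_weight_bound) auto
      also have "\<dots> = near n r x * near n s x * ?f x" unfolding sum_distrib_left by (simp only: mult.assoc)
      finally show ?thesis .
    qed
  qed
  also have "(LINT x|\<mu>\<^sub>S. ?f x) = (real n + 1)\<^sup>2 * (\<Sum>k\<in>UNIV. \<Sum>l\<in>UNIV. LINT x|\<mu>\<^sub>S. cmod (A x $ k $ l - A' x $ k $ l))"
    using D by (simp add: Bochner_Integration.integral_sum Bochner_Integration.integrable_sum)
  finally show ?thesis unfolding eq by (simp add: mult_ac)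
qed

text \<open>Freezing \<open>A\<close> at the sampling point of the row turns the entry into a
  stencil value exactly, because the weights integrate to the stencil. Only the oscillation of
  \<open>A\<close> over the support remains; 324 is 81 times the four matrix entries.\<close>

lemma main_entry_local_l1:
  fixes A :: "real^2 \<Rightarrow> complex^2^2"
  assumes n: "n > 0" and A: "\<And>k l. integrable \<mu>\<^sub>S (\<lambda>x. A x $ k $ l)"
    and \<omega>: "\<And>x y k l. x \<in> unit_square \<Longrightarrow> y \<in> unit_square \<Longrightarrow> \<bar>x$1 - y$1\<bar> \<le> 2 * mesh_size n \<Longrightarrow>
       \<bar>x$2 - y$2\<bar> \<le> 2 * mesh_size n \<Longrightarrow> cmod (A x $ k $ l - A y $ k $ l) \<le> \<omega>"
  shows "(\<Sum>r<n\<^sup>2. \<Sum>s<n\<^sup>2. cmod (main_entry A n r s - local_matrix (\<lambda>x. stencil (A x)) n r s))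
    \<le> 324 * \<omega> * (real n + 1)\<^sup>2"
proof -
  interpret finite_measure \<mu>\<^sub>S by (rule finite_measure_lebesgue_on_open_unit_square)
  let ?h = "mesh_size n"
  have h: "?h > 0" by (rule mesh_size_pos)
  define pt where "pt r = (vector [real (r div n + 1) / real n, real (r mod n + 1) / real n] :: real^2)" for r
  have u0: "(vec 0 :: real^2) \<in> unit_square" by (simp add: mem_box_real2)
  have "cmod (A (vec 0) $ 1 $ 1 - A (vec 0) $ 1 $ 1) \<le> \<omega>" by (rule \<omega>[OF u0 u0]) (use h in simp_all)
  then have \<omega>0: "\<omega> \<ge> 0" by simp
  let ?w = "\<lambda>r s x. \<Sum>k\<in>UNIV. \<Sum>l\<in>UNIV. of_real (main_weight n r s k l x) * (A x $ k $ l - A (pt r) $ k $ l)"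
  have pt: "pt r \<in> unit_square" if "r < n\<^sup>2" for r
  proof -
    have "real (r div n + 1) \<le> real n" "real (r mod n + 1) \<le> real n" using div_mod_less[OF that] by linarith+
    then show ?thesis by (simp add: pt_def mem_box_real2 divide_le_eq)
  qed
  have near_pt: "\<bar>x$1 - pt r$1\<bar> \<le> 2 * ?h" "\<bar>x$2 - pt r$2\<bar> \<le> 2 * ?h" if r: "r < n\<^sup>2" and nr: "near n r x \<noteq> 0" for r x
  proof -
    \<comment> \<open>One mesh size from the point to the node i h, and another from there to the
      sampling point i / n.\<close>
    have *: "\<bar>t - real (a + 1) / real n\<bar> \<le> 2 * ?h" if "a < n" "\<bar>t / ?h - of_int (int a + 1)\<bar> \<le> 1" for t and a :: nat
    proof -
      have "\<bar>t - real (a + 1) * ?h\<bar> = \<bar>t / ?h - of_int (int a + 1)\<bar> * ?h"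
      proof -
        have "t - real (a + 1) * ?h = (t / ?h - of_int (int a + 1)) * ?h" using h by (simp add: field_simps)
        then show ?thesis using h by (simp only: abs_mult abs_of_pos)
      qed
      also have "\<dots> \<le> 1 * ?h" using that(2) h by (intro mult_right_mono) auto
      finally have 1: "\<bar>t - real (a + 1) * ?h\<bar> \<le> ?h" by simp
      have "real (a + 1) / real n - real (a + 1) * ?h = (real (a + 1) / real n) * ?h"
        using n by (simp add: mesh_size_def field_simps)
      moreover have "0 \<le> real (a + 1) / real n" "real (a + 1) / real n \<le> 1" using that(1) n by (auto simp: divide_le_eq)
      ultimately have "\<bar>real (a + 1) / real n - real (a + 1) * ?h\<bar> \<le> ?h"
        using h mult_right_mono[of "real (a + 1) / real n" 1 ?h] by (simp add: abs_mult)
      then show ?thesis using 1 by linarith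
    qed
    have "\<bar>x$1 / ?h - of_int (int (r div n) + 1)\<bar> \<le> 1" "\<bar>x$2 / ?h - of_int (int (r mod n) + 1)\<bar> \<le> 1"
      using nr by (auto simp: near_def node1_def node2_def)
    then show "\<bar>x$1 - pt r$1\<bar> \<le> 2 * ?h" "\<bar>x$2 - pt r$2\<bar> \<le> 2 * ?h"
      using * div_mod_less[OF r] by (auto simp: pt_def)
  qed
  have mwi: "integrable \<mu>\<^sub>S (main_weight n r s k l)" for r s k l
    using main_weight_bounded
    by (intro integrable_const_bound[where B = "(real n + 1)\<^sup>2"] measurable_lebesgue_onI main_weight_measurable) auto
  have loc: "local_matrix (\<lambda>x. stencil (A x)) n r s
      = (LINT x|\<mu>\<^sub>S. (\<Sum>k\<in>UNIV. \<Sum>l\<in>UNIV. of_real (main_weight n r s k l x) * A (pt r) $ k $ l))" if r: "r < n\<^sup>2" for r s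
  proof -
    have mw: "(LINT x|\<mu>\<^sub>S. main_weight n r s k l x) = cell_weight k l (node1 n s - node1 n r) (node2 n s - node2 n r) / 2" for k l
    proof -
      have "(LINT x|\<mu>\<^sub>S. main_weight n r s k l x) = (LINT x|\<mu>\<^sub>S. slope n s k x * slope n r l x) / ?h\<^sup>2"
        unfolding main_weight_def by simp
      then show ?thesis unfolding integral_slope_product[OF r] using h by simp
    qed
    \<comment> \<open>The stencil is even, so the offset r - s of the Toeplitz structure and the
      offset s - r of the weights give the same value.\<close>
    have "local_matrix (\<lambda>x. stencil (A x)) n r s = stencil (A (pt r)) (node1 n s - node1 n r) (node2 n s - node2 n r)"
      using stencil_uminus[of "A (pt r)" "node1 n r - node1 n s" "node2 n r - node2 n s"]
      by (simp add: local_matrix_def pt_def node1_def node2_def)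
    also have "\<dots> = (\<Sum>k\<in>UNIV. \<Sum>l\<in>UNIV. of_real (LINT x|\<mu>\<^sub>S. main_weight n r s k l x) * A (pt r) $ k $ l)"
      unfolding stencil_eq mw ..
    also have "\<dots> = (\<Sum>k\<in>UNIV. \<Sum>l\<in>UNIV. LINT x|\<mu>\<^sub>S. of_real (main_weight n r s k l x) * A (pt r) $ k $ l)"
      by simp
    also have "\<dots> = (LINT x|\<mu>\<^sub>S. (\<Sum>k\<in>UNIV. \<Sum>l\<in>UNIV. of_real (main_weight n r s k l x) * A (pt r) $ k $ l))"
      using mwi by (simp add: Bochner_Integration.integral_sum Bochner_Integration.integrable_sum)
    finally show ?thesis .
  qed
  have ci: "integrable \<mu>\<^sub>S (\<lambda>x. \<Sum>k\<in>UNIV. \<Sum>l\<in>UNIV. of_real (main_weight n r s k l x) * A (pt r) $ k $ l)" for r s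
    using mwi by (intro Bochner_Integration.integrable_sum integrable_mult_left integrable_of_real)
  have eq: "main_entry A n r s - local_matrix (\<lambda>x. stencil (A x)) n r s = (LINT x|\<mu>\<^sub>S. ?w r s x)" if "r < n\<^sup>2" for r s
    unfolding main_entry_def loc[OF that]
    by (subst Bochner_Integration.integral_diff[OF main_integrable[OF A] ci, symmetric])
      (simp only: right_diff_distrib sum_subtractf)
  have "(\<Sum>r<n\<^sup>2. \<Sum>s<n\<^sup>2. cmod (LINT x|\<mu>\<^sub>S. ?w r s x)) \<le> 81 * (LINT x|\<mu>\<^sub>S. (real n + 1)\<^sup>2 * (4 * \<omega>))"
  proof (rule sum_integrals_le)
    show "integrable \<mu>\<^sub>S (\<lambda>x. (real n + 1)\<^sup>2 * (4 * \<omega>))" by (rule integrable_const)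
    show "(real n + 1)\<^sup>2 * (4 * \<omega>) \<ge> 0" using \<omega>0 by simp
    show "?w r s \<in> borel_measurable \<mu>\<^sub>S" for r s
      by (intro borel_measurable_integrable Bochner_Integration.integrable_sum
          integrable_bounded_mult[OF Bochner_Integration.integrable_diff[OF A integrable_const] main_weight_measurable main_weight_bounded])
    show "cmod (?w r s x) \<le> near n r x * near n s x * ((real n + 1)\<^sup>2 * (4 * \<omega>))"
      if "r < n\<^sup>2" "s < n\<^sup>2" "x \<in> open_unit_square" for r s x
    proof -
      have xu: "x \<in> unit_square" using that(3) box_subset_cbox by blast
      have "cmod (?w r s x) \<le> (\<Sum>k\<in>UNIV. \<Sum>l\<in>UNIV. \<bar>main_weight n r s k l x\<bar> * cmod (A x $ k $ l - A (pt r) $ k $ l))"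
        by (intro order_trans[OF norm_sum] sum_mono) (simp add: norm_mult)
      also have "\<dots> \<le> (\<Sum>k\<in>(UNIV::2 set). \<Sum>l\<in>(UNIV::2 set). near n r x * near n s x * (real n + 1)\<^sup>2 * \<omega>)"
      proof (intro sum_mono)
        fix k l
        show "\<bar>main_weight n r s k l x\<bar> * cmod (A x $ k $ l - A (pt r) $ k $ l) \<le> near n r x * near n s x * (real n + 1)\<^sup>2 * \<omega>"
        proof (cases "near n r x = 0")
          case True
          then show ?thesis using main_weight_bound[of n r s k l x] by simp
        next
          case False
          show ?thesis
            by (intro mult_mono main_weight_bound \<omega>[OF xu pt[OF that(1)] near_pt[OF that(1) False]])
              (use near_01 in auto)
        qed
      qed
      also have "\<dots> = near n r x * near n s x * ((real n + 1)\<^sup>2 * (4 * \<omega>))" by (simp add: sum_2)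
      finally show ?thesis .
    qed
  qed
  also have "(LINT x|\<mu>\<^sub>S. (real n + 1)\<^sup>2 * (4 * \<omega>)) = (real n + 1)\<^sup>2 * (4 * \<omega>)"
    using measure_open_unit_square by simp
  finally show ?thesis using eq by (simp add: mult_ac)
qed

section \<open>Lower order terms\<close>

definition low_mass :: "(real^2 \<Rightarrow> complex^2) \<Rightarrow> (real^2 \<Rightarrow> complex) \<Rightarrow> real^2 \<Rightarrow> real" where
  "low_mass b c x = cmod (b x $ 1) + cmod (b x $ 2) + cmod (c x)"

lemma low_integrand_bound:
  assumes r: "r < n\<^sup>2" "s < n\<^sup>2"
  shows "cmod (low_integrand b c n r s x) \<le> near n r x * near n s x * ((real n + 1) * low_mass b c x)"
proof -
  let ?K = "near n r x * near n s x * (real n + 1)"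
  have "cmod (low_integrand b c n r s x) \<le>
     \<bar>slope n s 1 x / mesh_size n * node_hat n r x\<bar> * cmod (b x $ 1) +
     \<bar>slope n s 2 x / mesh_size n * node_hat n r x\<bar> * cmod (b x $ 2) + \<bar>node_hat n s x * node_hat n r x\<bar> * cmod (c x)"
    unfolding low_integrand_def sum_2
    by (intro order_trans[OF norm_triangle_ineq] add_mono) (simp_all add: norm_mult norm_divide abs_mult)
  also have "\<dots> \<le> ?K * cmod (b x $ 1) + ?K * cmod (b x $ 2) + ?K * cmod (c x)"
    by (intro add_mono mult_right_mono low_bounds[OF r]) auto
  also have "\<dots> = near n r x * near n s x * ((real n + 1) * low_mass b c x)"
    by (simp add: low_mass_def algebra_simps)
  finally show ?thesis .
qed

lemma low_mass_integrable:
  fixes b :: "real^2 \<Rightarrow> complex^2" and c :: "real^2 \<Rightarrow> complex"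
  assumes "\<And>k. integrable \<mu>\<^sub>S (\<lambda>x. b x $ k)" "integrable \<mu>\<^sub>S c"
  shows "integrable \<mu>\<^sub>S (low_mass b c)"
  unfolding low_mass_def[abs_def] using assms by (intro Bochner_Integration.integrable_add integrable_norm)

lemma low_entry_l1:
  fixes b :: "real^2 \<Rightarrow> complex^2" and c :: "real^2 \<Rightarrow> complex"
  assumes b: "\<And>k. integrable \<mu>\<^sub>S (\<lambda>x. b x $ k)" and c: "integrable \<mu>\<^sub>S c"
  shows "(\<Sum>r<n\<^sup>2. \<Sum>s<n\<^sup>2. cmod (low_entry b c n r s)) \<le> 81 * (real n + 1) * (LINT x|\<mu>\<^sub>S. low_mass b c x)"
proof -
  have "(\<Sum>r<n\<^sup>2. \<Sum>s<n\<^sup>2. cmod (low_entry b c n r s)) \<le> 81 * (LINT x|\<mu>\<^sub>S. (real n + 1) * low_mass b c x)"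
    unfolding low_entry_def
  proof (rule sum_integrals_le)
    show "integrable \<mu>\<^sub>S (\<lambda>x. (real n + 1) * low_mass b c x)"
      using low_mass_integrable[OF b c] by (rule integrable_mult_right)
    show "(real n + 1) * low_mass b c x \<ge> 0" for x by (simp add: low_mass_def)
  qed (use low_integrable[OF _ _ b c] low_integrand_bound in auto)
  then show ?thesis by (simp only: integral_mult_right_zero mult.assoc)
qed

lemma integral_near_le:
  assumes r: "r < n\<^sup>2"
  shows "(LINT x|\<mu>\<^sub>S. near n r x) \<le> 4 * (mesh_size n)\<^sup>2" "integrable \<mu>\<^sub>S (near n r)"
proof -
  let ?h = "mesh_size n"
  have h: "?h > 0" by (rule mesh_size_pos)
  let ?a = "vector [(of_int (node1 n r) - 1) * ?h, (of_int (node2 n r) - 1) * ?h] :: real^2"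
  let ?b = "vector [(of_int (node1 n r) + 1) * ?h, (of_int (node2 n r) + 1) * ?h] :: real^2"
  have nb: "near n r x = indicator (cbox ?a ?b) x" for x
  proof -
    have *: "\<bar>t / ?h - m\<bar> \<le> 1 \<longleftrightarrow> (m - 1) * ?h \<le> t \<and> t \<le> (m + 1) * ?h" for t m :: real
      using h by (auto simp: abs_le_iff field_simps)
    show ?thesis unfolding near_def indicator_def * mem_box_real2 by (simp add: conj_ac)
  qed
  interpret finite_measure \<mu>\<^sub>S by (rule finite_measure_lebesgue_on_open_unit_square)
  show "integrable \<mu>\<^sub>S (near n r)"
    using near_01 by (intro integrable_const_bound[where B = 1] measurable_lebesgue_onI near_measurable) auto
  have "(LINT x|\<mu>\<^sub>S. near n r x) = measure \<mu>\<^sub>S (cbox ?a ?b \<inter> open_unit_square)"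
    unfolding nb by simp
  also have "\<dots> = measure lebesgue (cbox ?a ?b \<inter> open_unit_square)"
    using open_unit_square_sets by (intro measure_restrict_space) auto
  also have "\<dots> \<le> measure lebesgue (cbox ?a ?b)"
    by (intro measure_mono_fmeasurable) (auto simp: fmeasurableD fmeasurable_Int_fmeasurable open_unit_square_sets)
  also have "\<dots> = 4 * ?h\<^sup>2"
    using h by (simp add: measure_completion measure_box_real2 power2_eq_square algebra_simps)
  finally show "(LINT x|\<mu>\<^sub>S. near n r x) \<le> 4 * ?h\<^sup>2" .
qed

text \<open>The sum of squares is at most the largest entry times the sum of the moduli. The latter
  is O(n). The former is bounded by n + 1 times the mass of the data on a square of area 4 h^2, and
  this mass is uniformly small although the data are only L^1.\<close>

lemma low_entry_frobenius:
  fixes b :: "real^2 \<Rightarrow> complex^2" and c :: "real^2 \<Rightarrow> complex"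
  assumes b: "\<And>k. integrable \<mu>\<^sub>S (\<lambda>x. b x $ k)" and c: "integrable \<mu>\<^sub>S c" and \<epsilon>: "\<epsilon> > 0"
  shows "\<exists>n0. \<forall>n\<ge>n0. (\<Sum>r<n\<^sup>2. \<Sum>s<n\<^sup>2. (cmod (low_entry b c n r s))\<^sup>2) \<le> \<epsilon> * (real n)\<^sup>2"
proof -
  let ?f = "low_mass b c"
  have f: "integrable \<mu>\<^sub>S ?f" by (rule low_mass_integrable[OF b c])
  have f0: "?f x \<ge> 0" for x by (simp add: low_mass_def)
  define I where "I = (LINT x|\<mu>\<^sub>S. ?f x)"
  have I0: "I \<ge> 0" unfolding I_def using f0 by (intro Bochner_Integration.integral_nonneg) auto
  \<comment> \<open>81 comes from the sum of the moduli; 8 leaves half of \<epsilon> after (n + 1)^2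
    \<le> 4 n^2; the added 1 covers I = 0.\<close>
  define \<eta> where "\<eta> = \<epsilon> / (81 * 8 * (I + 1))"
  have \<eta>: "\<eta> > 0" using \<epsilon> I0 by (simp add: \<eta>_def)
  obtain g where g: "separable_sum g" "(LINT x|\<mu>\<^sub>S. cmod (of_real (?f x) - g x)) < \<eta>"
    using integrable_approx_separable[OF integrable_of_real[OF f] \<eta>] by blast
  have "bounded (g ` unit_square)"
    by (intro compact_imp_bounded compact_continuous_image separable_sum_continuous g(1)) auto
  then obtain B where B: "\<And>x. x \<in> unit_square \<Longrightarrow> cmod (g x) \<le> B" unfolding bounded_iff by auto
  have B0: "B \<ge> 0" using order_trans[OF norm_ge_zero B[of "vec 0"]] by (simp add: mem_box_real2)
  have gm: "g \<in> borel_measurable \<mu>\<^sub>S"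
    by (intro measurable_lebesgue_onI borel_measurable_continuous_onI separable_sum_continuous g(1))
  have gi: "integrable \<mu>\<^sub>S (\<lambda>x. cmod (of_real (?f x) - g x))"
  proof -
    interpret finite_measure \<mu>\<^sub>S by (rule finite_measure_lebesgue_on_open_unit_square)
    have "integrable \<mu>\<^sub>S g"
    proof (rule integrable_const_bound[OF AE_I2 gm])
      fix x assume "x \<in> space \<mu>\<^sub>S"
      then have "x \<in> unit_square" using box_subset_cbox by auto
      then show "norm (g x) \<le> B" by (rule B)
    qed
    then show ?thesis by (intro integrable_norm Bochner_Integration.integrable_diff integrable_of_real f)
  qed
  \<comment> \<open>Uniform integrability: a polynomial close to the data in L^1 is bounded on the
    square, so it has mass O(h^2) on each patch, and the error \<eta> does not depend on the
    patch.\<close>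
  have local_mass: "(LINT x|\<mu>\<^sub>S. near n r x * ?f x) \<le> 4 * B * (mesh_size n)\<^sup>2 + \<eta>" if r: "r < n\<^sup>2" for n r
  proof -
    have "(LINT x|\<mu>\<^sub>S. near n r x * ?f x) \<le> (LINT x|\<mu>\<^sub>S. B * near n r x + cmod (of_real (?f x) - g x))"
    proof (rule integral_mono)
      show "integrable \<mu>\<^sub>S (\<lambda>x. near n r x * ?f x)"
      proof (rule Bochner_Integration.integrable_bound[OF f])
        show "(\<lambda>x. near n r x * ?f x) \<in> borel_measurable \<mu>\<^sub>S"
          by (rule borel_measurable_times[OF measurable_lebesgue_onI[OF near_measurable] borel_measurable_integrable[OF f]])
        show "AE x in \<mu>\<^sub>S. norm (near n r x * ?f x) \<le> norm (?f x)"
          using near_01 f0 by (intro AE_I2) (simp add: abs_mult mult_left_le_one_le)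
      qed
      show "integrable \<mu>\<^sub>S (\<lambda>x. B * near n r x + cmod (of_real (?f x) - g x))"
        using integral_near_le(2)[OF r] gi by (intro Bochner_Integration.integrable_add integrable_mult_right)
      fix x assume "x \<in> space \<mu>\<^sub>S"
      then have "x \<in> unit_square" using box_subset_cbox by auto
      then have gB: "cmod (g x) \<le> B" by (rule B)
      have "?f x = cmod (of_real (?f x))" using f0 by simp
      also have "\<dots> \<le> cmod (g x) + cmod (of_real (?f x) - g x)" by (rule norm_triangle_sub)
      finally have "near n r x * ?f x \<le> near n r x * (B + cmod (of_real (?f x) - g x))"
        using gB near_01 by (intro mult_left_mono) auto
      also have "\<dots> \<le> B * near n r x + 1 * cmod (of_real (?f x) - g x)"
        unfolding distrib_left using near_01 by (intro add_mono mult_right_mono) (auto simp: mult.commute)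
      finally show "near n r x * ?f x \<le> B * near n r x + cmod (of_real (?f x) - g x)" by simp
    qed
    also have "\<dots> = B * (LINT x|\<mu>\<^sub>S. near n r x) + (LINT x|\<mu>\<^sub>S. cmod (of_real (?f x) - g x))"
      using integral_near_le(2)[OF r] gi by simp
    also have "\<dots> \<le> B * (4 * (mesh_size n)\<^sup>2) + \<eta>"
      using integral_near_le(1)[OF r] g(2) B0 by (intro add_mono mult_left_mono) auto
    finally show ?thesis by simp
  qed
  have entry: "cmod (low_entry b c n r s) \<le> (real n + 1) * (4 * B * (mesh_size n)\<^sup>2 + \<eta>)" if r: "r < n\<^sup>2" "s < n\<^sup>2" for n r s
  proof -
    have nf: "integrable \<mu>\<^sub>S (\<lambda>x. near n r x * ?f x)"
    proof (rule Bochner_Integration.integrable_bound[OF f])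
      show "(\<lambda>x. near n r x * ?f x) \<in> borel_measurable \<mu>\<^sub>S"
        by (rule borel_measurable_times[OF measurable_lebesgue_onI[OF near_measurable] borel_measurable_integrable[OF f]])
      show "AE x in \<mu>\<^sub>S. norm (near n r x * ?f x) \<le> norm (?f x)"
        using near_01 f0 by (intro AE_I2) (simp add: abs_mult mult_left_le_one_le)
    qed
    have "cmod (low_entry b c n r s) \<le> (LINT x|\<mu>\<^sub>S. cmod (low_integrand b c n r s x))"
      unfolding low_entry_def by (rule integral_norm_bound)
    also have "\<dots> \<le> (LINT x|\<mu>\<^sub>S. (real n + 1) * (near n r x * ?f x))"
    proof (rule integral_mono)
      show "integrable \<mu>\<^sub>S (\<lambda>x. cmod (low_integrand b c n r s x))" using low_integrable[OF r b c] by (rule integrable_norm)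
      show "integrable \<mu>\<^sub>S (\<lambda>x. (real n + 1) * (near n r x * ?f x))" using nf by (rule integrable_mult_right)
      fix x
      have "cmod (low_integrand b c n r s x) \<le> near n r x * near n s x * ((real n + 1) * ?f x)"
        by (rule low_integrand_bound[OF r])
      also have "\<dots> = near n s x * ((real n + 1) * (near n r x * ?f x))" by (simp only: mult_ac)
      also have "\<dots> \<le> 1 * ((real n + 1) * (near n r x * ?f x))"
        using near_01 f0 by (intro mult_right_mono) auto
      finally show "cmod (low_integrand b c n r s x) \<le> (real n + 1) * (near n r x * ?f x)" by simp
    qed
    also have "\<dots> = (real n + 1) * (LINT x|\<mu>\<^sub>S. near n r x * ?f x)" by simp
    also have "\<dots> \<le> (real n + 1) * (4 * B * (mesh_size n)\<^sup>2 + \<eta>)"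
      using local_mass[OF r(1)] by (intro mult_left_mono) auto
    finally show ?thesis .
  qed
  have total: "(\<Sum>r<n\<^sup>2. \<Sum>s<n\<^sup>2. (cmod (low_entry b c n r s))\<^sup>2) \<le> 81 * I * (4 * B + \<eta> * (real n + 1)\<^sup>2)" for n
  proof -
    let ?m = "(real n + 1) * (4 * B * (mesh_size n)\<^sup>2 + \<eta>)"
    have m0: "?m \<ge> 0" using B0 \<eta> by (intro mult_nonneg_nonneg add_nonneg_nonneg) auto
    have "(\<Sum>r<n\<^sup>2. \<Sum>s<n\<^sup>2. (cmod (low_entry b c n r s))\<^sup>2) \<le> (\<Sum>r<n\<^sup>2. \<Sum>s<n\<^sup>2. ?m * cmod (low_entry b c n r s))"
    proof (intro sum_mono)
      fix r s assume "r \<in> {..<n\<^sup>2}" "s \<in> {..<n\<^sup>2}"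
      then have "cmod (low_entry b c n r s) * cmod (low_entry b c n r s) \<le> ?m * cmod (low_entry b c n r s)"
        by (intro mult_right_mono entry) auto
      then show "(cmod (low_entry b c n r s))\<^sup>2 \<le> ?m * cmod (low_entry b c n r s)"
        unfolding power2_eq_square[of "cmod _"] .
    qed
    also have "\<dots> = ?m * (\<Sum>r<n\<^sup>2. \<Sum>s<n\<^sup>2. cmod (low_entry b c n r s))" unfolding sum_distrib_left ..
    also have "\<dots> \<le> ?m * (81 * (real n + 1) * I)"
      unfolding I_def using low_entry_l1[OF b c, of n] m0 by (rule mult_left_mono)
    also have "\<dots> = 81 * I * (4 * B * ((real n + 1) * mesh_size n)\<^sup>2 + \<eta> * (real n + 1)\<^sup>2)"
      by (simp add: power2_eq_square algebra_simps)
    also have "(real n + 1) * mesh_size n = 1" by (simp add: mesh_size_def)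
    finally show ?thesis by simp
  qed
  \<comment> \<open>Brings the term with \<open>B\<close>, which does not grow with
    \<open>n\<close>, below half of \<epsilon> n^2.\<close>
  define n0 where "n0 = nat \<lceil>81 * I * 8 * B / \<epsilon>\<rceil> + 1"
  have "(\<Sum>r<n\<^sup>2. \<Sum>s<n\<^sup>2. (cmod (low_entry b c n r s))\<^sup>2) \<le> \<epsilon> * (real n)\<^sup>2" if "n \<ge> n0" for n
  proof -
    have n: "real n \<ge> 81 * I * 8 * B / \<epsilon>" "real n \<ge> 1"
      using that unfolding n0_def by linarith+
    have "81 * I * 8 * B / \<epsilon> * 1 \<le> real n * real n" using n I0 B0 \<epsilon> by (intro mult_mono) auto
    then have 1: "81 * I * (4 * B) \<le> \<epsilon> * (real n)\<^sup>2 / 2" using \<epsilon> by (simp add: field_simps power2_eq_square)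
    have "(real n + 1)\<^sup>2 \<le> (2 * real n)\<^sup>2" using n by (intro power_mono) auto
    then have "81 * I * (\<eta> * (real n + 1)\<^sup>2) \<le> 81 * I * (\<eta> * (2 * real n)\<^sup>2)"
      using I0 \<eta> by (intro mult_left_mono) auto
    also have "\<dots> = (81 * 4 * I * \<eta>) * (real n)\<^sup>2" by (simp add: power2_eq_square)
    also have "\<dots> \<le> (\<epsilon> / 2) * (real n)\<^sup>2"
      using I0 \<epsilon> by (intro mult_right_mono) (auto simp: \<eta>_def field_simps)
    finally have 2: "81 * I * (\<eta> * (real n + 1)\<^sup>2) \<le> \<epsilon> * (real n)\<^sup>2 / 2" by simp
    show ?thesis using total[of n] 1 2 by (simp add: distrib_left)
  qed
  then show ?thesis by blast
qed

section \<open>The symbol\<close>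

lemma integral_lborel_product:
  fixes f :: "'a::euclidean_space \<Rightarrow> complex" and g :: "'b::euclidean_space \<Rightarrow> complex"
  assumes f: "integrable lborel f" and g: "integrable lborel g"
  shows "has_bochner_integral lborel (\<lambda>z. f (fst z) * g (snd z)) (integral\<^sup>L lborel f * integral\<^sup>L lborel g)"
proof -
  have m: "(\<lambda>(x, y). f x * g y) \<in> borel_measurable (lborel \<Otimes>\<^sub>M lborel)"
    using borel_measurable_integrable[OF f] borel_measurable_integrable[OF g] by measurable
  have i: "integrable (lborel \<Otimes>\<^sub>M lborel) (\<lambda>(x, y). f x * g y)"
  proof (rule lborel_pair.Fubini_integrable[OF m])
    have "integrable lborel (\<lambda>x. cmod (f x) * (LINT y|lborel. cmod (g y)))"
      using f by (intro integrable_mult_left integrable_norm)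
    then show "integrable lborel (\<lambda>x. LINT (y::'b)|lborel. norm (case (x, y) of (x, y) \<Rightarrow> f x * g y))"
      by (simp add: norm_mult)
    show "AE x in lborel. integrable (lborel :: 'b measure) (\<lambda>y. case (x, y) of (x, y) \<Rightarrow> f x * g y)"
      using g by simp
  qed
  have "integral\<^sup>L (lborel \<Otimes>\<^sub>M lborel) (\<lambda>(x, y). f x * g y) = (LINT x|lborel. (LINT y|lborel. f x * g y))"
    using lborel_pair.integral_fst[OF i] by simp
  also have "\<dots> = integral\<^sup>L lborel f * integral\<^sup>L lborel g" by simp
  finally show ?thesis using i unfolding has_bochner_integral_iff lborel_prod case_prod_unfold by simp
qed

lemma vector_pair_measurable: "(\<lambda>z::real \<times> real. vector [fst z, snd z] :: real^2) \<in> borel_measurable borel"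
proof (rule borel_measurable_continuous_onI)
  have "continuous_on UNIV (\<lambda>z::real \<times> real. (\<chi> i. if i = 1 then fst z else snd z) :: real^2)"
  proof (rule continuous_on_vec_lambda)
    show "continuous_on UNIV (\<lambda>z::real \<times> real. if i = 1 then fst z else snd z)" for i :: 2
      by (cases "i = 1") (auto intro!: continuous_intros)
  qed
  moreover have "((\<chi> i. if i = 1 then fst z else snd z) :: real^2) = (vector [fst z, snd z] :: real^2)" for z :: "real \<times> real"
    by (simp add: Finite_Cartesian_Product.vec_eq_iff forall_2)
  ultimately show "continuous_on UNIV (\<lambda>z::real \<times> real. vector [fst z, snd z] :: real^2)" by simp
qed

text \<open>Splits the plane into two real variables, so that the Fourier integrals factorise by
  Fubini.\<close>

lemma lborel_real2: "(lborel :: (real^2) measure) = distr lborel borel (\<lambda>z. vector [fst z, snd z])"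
proof (rule lborel_eqI)
  note cont = vector_pair_measurable
  fix l u :: "real^2" assume lu: "\<And>b. b \<in> Basis \<Longrightarrow> l \<bullet> b \<le> u \<bullet> b"
  have le: "l$1 \<le> u$1" "l$2 \<le> u$2"
    using lu[of "axis 1 1"] lu[of "axis 2 1"] by (auto simp: Basis_real2 inner_axis)
  have "(\<lambda>z. vector [fst z, snd z]) -` box l u \<inter> space lborel = {l$1<..<u$1} \<times> {l$2<..<u$2}"
    by (auto simp: mem_box_real2)
  then have "emeasure (distr lborel borel (\<lambda>z. vector [fst z, snd z])) (box l u) = emeasure lborel ({l$1<..<u$1} \<times> {l$2<..<u$2})"
    using cont by (simp add: emeasure_distr)
  also have "\<dots> = emeasure lborel {l$1<..<u$1} * emeasure lborel {l$2<..<u$2}"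
    by (subst lborel_prod[symmetric]) (simp add: lborel.emeasure_pair_measure_Times)
  also have "\<dots> = ennreal ((u$1 - l$1) * (u$2 - l$2))" using le by (simp add: ennreal_mult)
  also have "(u$1 - l$1) * (u$2 - l$2) = (\<Prod>b\<in>Basis. (u - l) \<bullet> b)"
    by (simp add: Basis_real2 axis_eq_axis inner_axis)
  finally show "emeasure (distr lborel borel (\<lambda>z. vector [fst z, snd z])) (box l u) = ennreal (\<Prod>b\<in>Basis. (u - l) \<bullet> b)" .
qed simp

lemma integral_exp_period:
  fixes m :: int
  shows "has_bochner_integral lborel (\<lambda>t. indicator {-pi..pi} t *\<^sub>R exp (\<i> * of_int m * of_real t)) (if m = 0 then 2 * pi else 0)"
proof (cases "m = 0")
  case True
  have "has_bochner_integral lborel (\<lambda>t. indicator {-pi..pi} t *\<^sub>R (1::complex)) (of_real (measure lborel {-pi..pi}))"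
    using has_bochner_integral_scaleR_left[OF has_bochner_integral_real_indicator[of "{-pi..pi}" lborel], of "1::complex"]
    by (simp add: scaleR_conv_of_real)
  then show ?thesis using True by simp
next
  case False
  define c where "c = \<i> * of_int m"
  have c: "c \<noteq> 0" using False by (simp add: c_def)
  have "has_bochner_integral lborel (\<lambda>t. indicator {-pi..pi} t *\<^sub>R exp (t *\<^sub>R c))
     (exp (pi *\<^sub>R c) / c - exp ((-pi) *\<^sub>R c) / c)"
  proof (rule has_bochner_integral_FTC_Icc)
    fix t
    have "((\<lambda>t. exp (t *\<^sub>R c) * (1 / c)) has_vector_derivative (exp (t *\<^sub>R c) * c) * (1 / c)) (at t within {-pi..pi})"
      by (intro has_vector_derivative_mult_left exp_scaleR_has_vector_derivative_right)
    then show "((\<lambda>t. exp (t *\<^sub>R c) / c) has_vector_derivative exp (t *\<^sub>R c)) (at t within {-pi..pi})"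
      using c by simp
  qed (auto intro!: continuous_intros)
  moreover have "exp (pi *\<^sub>R c) = exp ((-pi) *\<^sub>R c)"
  proof -
    have e: "exp (pi *\<^sub>R c) = cis (pi * of_int m)" "exp ((-pi) *\<^sub>R c) = cis (- pi * of_int m)"
      by (simp_all add: c_def cis_conv_exp scaleR_conv_of_real mult_ac)
    have "cis (pi * of_int m) = cis (- pi * of_int m) * cis (2 * pi * of_int m)"
      unfolding cis_mult by (rule arg_cong[of _ _ cis]) (simp add: algebra_simps)
    also have "cis (2 * pi * of_int m) = 1" by (rule cis_multiple_2pi[OF Ints_of_int])
    finally show ?thesis unfolding e by (rule trans[OF _ mult_1_right])
  qed
  ultimately show ?thesis using False by (simp add: c_def scaleR_conv_of_real mult_ac)
qed

lemma integral_fourier_char: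
  "(LINT \<theta>|lebesgue_on freq_square. fourier_char m \<theta>) = (if m = 0 then (2 * pi)\<^sup>2 else 0)"
proof -
  let ?e = "\<lambda>k t. indicator {-pi..pi} t *\<^sub>R exp (\<i> * of_int k * of_real t) :: complex"
  let ?v = "\<lambda>z::real \<times> real. vector [fst z, snd z] :: real^2"
  have eq: "indicator freq_square (?v z) *\<^sub>R fourier_char m (?v z) = ?e (fst m) (fst z) * ?e (snd m) (snd z)" for z
    by (auto simp: indicator_def mem_box_real2 fourier_char_def exp_add[symmetric] algebra_simps)
  have meas: "(\<lambda>\<theta>. indicator freq_square \<theta> *\<^sub>R fourier_char m \<theta>) \<in> borel_measurable borel"
    unfolding fourier_char_def by (intro borel_measurable_scaleR borel_measurable_indicator borel_measurable_continuous_onI continuous_intros) auto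
  have cont: "?v \<in> borel_measurable borel" by (rule vector_pair_measurable)
  have "(LINT \<theta>|lebesgue_on freq_square. fourier_char m \<theta>) = (LINT \<theta>|lborel. indicator freq_square \<theta> *\<^sub>R fourier_char m \<theta>)"
    using meas by (simp add: integral_restrict_space integral_completion)
  also have "\<dots> = (LINT z|lborel. indicator freq_square (?v z) *\<^sub>R fourier_char m (?v z))"
    using meas cont by (subst lborel_real2) (simp add: integral_distr)
  also have "\<dots> = integral\<^sup>L lborel (?e (fst m)) * integral\<^sup>L lborel (?e (snd m))"
    unfolding eq using integral_lborel_product[of "?e (fst m)" "?e (snd m)"] integral_exp_period
    by (simp add: has_bochner_integral_iff)
  also have "\<dots> = (if m = 0 then (2 * pi)\<^sup>2 else 0)"
    using integral_exp_period[of "fst m"] integral_exp_period[of "snd m"]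
    by (cases m) (auto simp: has_bochner_integral_iff power2_eq_square zero_prod_def)
  finally show ?thesis .
qed

lemma fourier_coeff_fourier_char: "fourier_coeff (fourier_char k) l = of_bool (k = l)"
proof -
  have "fourier_char k \<theta> * fourier_char (- l) \<theta> = fourier_char (k - l) \<theta>" for \<theta>
    by (simp add: fourier_char_def exp_add[symmetric] algebra_simps)
  then show ?thesis
    unfolding fourier_coeff_def by (simp add: integral_fourier_char)
qed

text \<open>The coefficients at opposite offsets agree, so the opposite sign conventions for the
  frequency in the two expressions lead to the same sum.\<close>

lemma P1_symbol_eq: "P1_symbol A = symbol_sum (\<lambda>x. stencil (A x))"
proof
  fix z :: "(real^2) \<times> (real^2)"
  obtain x \<theta> where z: "z = (x, \<theta>)" by (cases z)
  define t where "t = (A x $ 1 $ 2 + A x $ 2 $ 1) / 2"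
  have c: "complex_of_real (cos (- t)) = cos t" for t by simp
  have iv: "{-1..1::int} = {-1, 0, 1}" by auto
  have Bm: "B_matrix $ 1 = vector [1, 1]" "B_matrix $ 2 = vector [1, 0]" "B_matrix $ 3 = vector [0, 1]"
    by (simp_all add: B_matrix_def)
  have st: "stencil (A x) 0 0 = 2 * (A x $ 1 $ 1 + A x $ 2 $ 2 + t)" "stencil (A x) 0 1 = - A x $ 2 $ 2 - t"
    "stencil (A x) 0 (-1) = - A x $ 2 $ 2 - t" "stencil (A x) 1 0 = - A x $ 1 $ 1 - t" "stencil (A x) (-1) 0 = - A x $ 1 $ 1 - t"
    "stencil (A x) 1 (-1) = t" "stencil (A x) (-1) 1 = t" "stencil (A x) 1 1 = 0" "stencil (A x) (-1) (-1) = 0"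
    by (simp_all add: stencil_def t_def)
  have ex: "exp (- \<i> * of_real (\<theta>$2)) = cis (- \<theta>$2)" "exp (- \<i> * of_real (\<theta>$1)) = cis (- \<theta>$1)"
    "exp (\<i> * of_real (\<theta>$1)) = cis (\<theta>$1)" "exp (\<i> * of_real (\<theta>$2)) = cis (\<theta>$2)"
    "exp (- \<i> * of_real (\<theta>$1) + \<i> * of_real (\<theta>$2)) = cis (- \<theta>$1 + \<theta>$2)"
    "exp (\<i> * of_real (\<theta>$1) - \<i> * of_real (\<theta>$2)) = cis (\<theta>$1 - \<theta>$2)"
    by (simp_all add: cis_conv_exp algebra_simps)
  have "P1_symbol A z = 2 * (A x $ 1 $ 1 + A x $ 2 $ 2 + t) + (- A x $ 2 $ 2 - t) * cis (- \<theta>$2) + (- A x $ 1 $ 1 - t) * cis (- \<theta>$1)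
      + (- A x $ 1 $ 1 - t) * cis (\<theta>$1) + (- A x $ 2 $ 2 - t) * cis (\<theta>$2) + t * cis (- \<theta>$1 + \<theta>$2) + t * cis (\<theta>$1 - \<theta>$2)"
    unfolding z P1_symbol_def split Let_def ex Bm
    by (simp add: bilinear_mult_def dot_mult_def matrix_vector_mult_def sum_2 t_def field_simps)
  also have "\<dots> = symbol_sum (\<lambda>x. stencil (A x)) z"
    unfolding symbol_sum_def iv z by (simp add: st algebra_simps)
  finally show "P1_symbol A z = symbol_sum (\<lambda>x. stencil (A x)) z" .
qed

lemma stencil_diff_bound: "cmod (stencil C k1 k2 - stencil C' k1 k2) \<le> 4 * (\<Sum>k\<in>UNIV. \<Sum>l\<in>UNIV. cmod (C $ k $ l - C' $ k $ l))"
proof -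
  define a b c d where "a = C$1$1 - C'$1$1" and "b = C$2$2 - C'$2$2" and "c = C$1$2 - C'$1$2" and "d = C$2$1 - C'$2$1"
  have t: "(C$1$2 + C$2$1) / 2 - (C'$1$2 + C'$2$1) / 2 = (c + d) / 2" by (simp add: c_def d_def diff_divide_distrib add_divide_distrib)
  have "stencil C k1 k2 - stencil C' k1 k2 \<in> {2 * (a + b + (c + d) / 2), - b - (c + d) / 2, - a - (c + d) / 2, (c + d) / 2, 0}"
    unfolding stencil_def Let_def a_def b_def t[symmetric] by (auto simp: algebra_simps)
  moreover have "cmod z \<le> 4 * (cmod a + cmod b + cmod c + cmod d)"
    if "z \<in> {2 * (a + b + (c + d) / 2), - b - (c + d) / 2, - a - (c + d) / 2, (c + d) / 2, 0}" for z
  proof -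
    have nn: "0 \<le> cmod a" "0 \<le> cmod b" "0 \<le> cmod c" "0 \<le> cmod d" by simp_all
    have "cmod (c + d) / 2 \<le> cmod c + cmod d" using norm_triangle_ineq[of c d] nn(3,4) by linarith
    then have cd: "cmod ((c + d) / 2) \<le> cmod c + cmod d" by (simp add: norm_divide)
    have 1: "cmod (2 * (a + b + (c + d) / 2)) \<le> 2 * (cmod a + cmod b + cmod ((c + d) / 2))"
      unfolding norm_mult by (intro mult_mono order_trans[OF norm_triangle_ineq] add_mono norm_triangle_ineq) auto
    have 2: "cmod (- b - (c + d) / 2) \<le> cmod b + cmod ((c + d) / 2)" "cmod (- a - (c + d) / 2) \<le> cmod a + cmod ((c + d) / 2)"
      using norm_triangle_ineq4[of "- b" "(c + d) / 2"] norm_triangle_ineq4[of "- a" "(c + d) / 2"] by simp_all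
    show ?thesis
      using that
    proof (elim insertE emptyE)
      assume z: "z = 2 * (a + b + (c + d) / 2)"
      show ?thesis unfolding z using 1 cd nn by argo
    next
      assume z: "z = - b - (c + d) / 2"
      show ?thesis unfolding z using 2(1) cd nn by argo
    next
      assume z: "z = - a - (c + d) / 2"
      show ?thesis unfolding z using 2(2) cd nn by argo
    next
      assume z: "z = (c + d) / 2"
      show ?thesis unfolding z using cd nn by argo
    next
      assume "z = 0" then show ?thesis using nn by simp
    qed
  qed
  ultimately have "cmod (stencil C k1 k2 - stencil C' k1 k2) \<le> 4 * (cmod a + cmod b + cmod c + cmod d)" by blast
  then show ?thesis by (simp add: sum_2 a_def b_def c_def d_def)
qed

lemma symbol_sum_diff_bound:
  "cmod (symbol_sum (\<lambda>x. stencil (A x)) z - symbol_sum (\<lambda>x. stencil (A' x)) z)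
    \<le> 36 * (\<Sum>k\<in>UNIV. \<Sum>l\<in>UNIV. cmod (A (fst z) $ k $ l - A' (fst z) $ k $ l))"
proof -
  let ?S = "\<Sum>k\<in>UNIV. \<Sum>l\<in>UNIV. cmod (A (fst z) $ k $ l - A' (fst z) $ k $ l)"
  have "cmod (symbol_sum (\<lambda>x. stencil (A x)) z - symbol_sum (\<lambda>x. stencil (A' x)) z)
     \<le> (\<Sum>k1\<in>{-1..1}. \<Sum>k2\<in>{-1..1}. cmod ((stencil (A (fst z)) k1 k2 - stencil (A' (fst z)) k1 k2) * cis (snd z$1 * of_int k1 + snd z$2 * of_int k2)))"
    unfolding symbol_sum_def sum_subtractf[symmetric] left_diff_distrib[symmetric]
    by (intro order_trans[OF norm_sum] sum_mono) simp
  also have "\<dots> \<le> (\<Sum>k1\<in>{-1..1::int}. \<Sum>k2\<in>{-1..1::int}. 4 * ?S)"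
    by (intro sum_mono) (simp only: norm_mult norm_cis mult_1_right stencil_diff_bound)
  also have "\<dots> = 36 * ?S" by simp
  finally show ?thesis .
qed

text \<open>A Lebesgue function of the first variable is replaced by a Borel representative, since
  composition with a projection is only immediate for Borel functions.\<close>

lemma integral_fst_unit_square:
  fixes f :: "real^2 \<Rightarrow> real"
  assumes f: "integrable \<mu>\<^sub>S f"
  shows "has_bochner_integral (lebesgue_on (unit_square \<times> freq_square)) (\<lambda>z. f (fst z)) (4 * pi\<^sup>2 * (LINT x|\<mu>\<^sub>S. f x))"
proof -
  let ?D = "unit_square \<times> freq_square"
  let ?g = "\<lambda>x. indicator open_unit_square x *\<^sub>R f x"
  have S: "open_unit_square \<in> sets lebesgue" by (simp add: fmeasurableD)
  have g: "integrable lebesgue ?g" using f S by (simp add: integrable_restrict_space)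
  obtain f' where f': "f' \<in> borel_measurable lborel" and ae: "AE x in lborel. ?g x = f' x"
    using completion_ex_borel_measurable_real[OF borel_measurable_integrable[OF g]] by blast
  have ae2: "AE x in lebesgue. ?g x = f' x" using ae by (rule AE_completion)
  have f'l: "f' \<in> borel_measurable lebesgue" using f' by (rule measurable_completion)
  have f'i: "integrable lborel f'"
    using integrable_cong_AE[OF borel_measurable_integrable[OF g] f'l ae2] g f' by (simp add: integrable_completion)
  have f'v: "integral\<^sup>L lborel f' = (LINT x|\<mu>\<^sub>S. f x)"
    using integral_cong_AE[OF borel_measurable_integrable[OF g] f'l ae2] f' S
    by (simp add: integral_completion integral_restrict_space)
  have fm: "measure lborel freq_square = 4 * pi\<^sup>2" by (simp add: measure_box_real2 power2_eq_square)
  have ind: "has_bochner_integral lborel (\<lambda>\<theta>. of_real (indicator freq_square \<theta>) :: complex) (of_real (4 * pi\<^sup>2))"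
    using has_bochner_integral_of_real[OF has_bochner_integral_real_indicator[of freq_square lborel], where 'a = complex] 
    by (simp add: fm emeasure_lborel_cbox_finite[unfolded infinity_ennreal_def])
  have "has_bochner_integral lborel (\<lambda>z. of_real (f' (fst z)) * of_real (indicator freq_square (snd z)) :: complex)
      (of_real (LINT x|\<mu>\<^sub>S. f x) * of_real (4 * pi\<^sup>2))"
    using integral_lborel_product[OF integrable_of_real[OF f'i], of "\<lambda>\<theta>. of_real (indicator freq_square \<theta>)"] ind
    by (simp add: has_bochner_integral_iff f'v)
  from has_bochner_integral_Re[OF this]
  have prod: "has_bochner_integral lborel (\<lambda>z. f' (fst z) * indicator freq_square (snd z)) (4 * pi\<^sup>2 * (LINT x|\<mu>\<^sub>S. f x))"
    by (simp add: mult.commute)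
  have prodl: "has_bochner_integral lebesgue (\<lambda>z. f' (fst z) * indicator freq_square (snd z)) (4 * pi\<^sup>2 * (LINT x|\<mu>\<^sub>S. f x))"
    using prod by (auto simp: has_bochner_integral_iff integrable_completion integral_completion)
  obtain N where N: "{x \<in> space lborel. ?g x \<noteq> f' x} \<subseteq> N" "emeasure lborel N = 0" "N \<in> sets lborel"
    using ae by (rule AE_E)
  \<comment> \<open>A cylinder over the exceptional points in space. The boundary is included
    because the coefficients live on the open square and the symbol on the closed one.\<close>
  define N' where "N' = (N \<union> (unit_square - open_unit_square)) \<times> (UNIV :: (real^2) set)"
  have b0: "emeasure lborel (unit_square - open_unit_square) = 0"
  proof -
    have "negligible (unit_square - open_unit_square)"
      by (rule negligible_subset[OF negligible_frontier_interval]) auto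
    then show ?thesis by (simp add: negligible_iff_null_sets null_sets_completion_iff null_sets_def)
  qed
  have N'0: "N' \<in> null_sets lborel"
  proof -
    have "N \<union> (unit_square - open_unit_square) \<in> null_sets lborel"
      using N b0 by (intro null_sets.Un) (auto simp: null_sets_def)
    then have "N' \<in> null_sets (lborel \<Otimes>\<^sub>M lborel)"
      unfolding N'_def by (auto simp: null_sets_def lborel.emeasure_pair_measure_Times)
    then show ?thesis by (simp add: lborel_prod)
  qed
  have eq: "indicator ?D z *\<^sub>R f (fst z) = f' (fst z) * indicator freq_square (snd z)" if "z \<notin> N'" for z
  proof -
    have "?g (fst z) = f' (fst z)" "fst z \<in> open_unit_square \<longleftrightarrow> fst z \<in> unit_square"
      using that N(1) box_subset_cbox[of "vec 0 :: real^2" "vec 1"] by (cases z; auto simp: N'_def)+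
    then show ?thesis by (cases z) (auto simp: indicator_def)
  qed
  have ae3: "AE z in lebesgue. f' (fst z) * indicator freq_square (snd z) = indicator ?D z *\<^sub>R f (fst z)"
  proof (rule AE_I'[of N'])
    show "N' \<in> null_sets lebesgue" using N'0 by (rule null_sets_completionI)
    show "{z \<in> space lebesgue. f' (fst z) * indicator freq_square (snd z) \<noteq> indicator ?D z *\<^sub>R f (fst z)} \<subseteq> N'"
      using eq by force
  qed
  have fm: "(\<lambda>z. f' (fst z) * indicator freq_square (snd z)) \<in> borel_measurable lebesgue"
    using prodl by (rule borel_measurable_has_bochner_integral)
  have "has_bochner_integral lebesgue (\<lambda>z. indicator ?D z *\<^sub>R f (fst z)) (4 * pi\<^sup>2 * (LINT x|\<mu>\<^sub>S. f x))"
    using prodl has_bochner_integral_cong_AE[OF fm borel_measurable_AE[OF fm ae3] ae3] by blast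
  moreover have "?D \<in> sets lebesgue" by (rule fmeasurableD[OF lmeasurable_Times_bounded]) auto
  ultimately show ?thesis
    by (simp add: has_bochner_integral_iff integrable_restrict_space integral_restrict_space)
qed

section \<open>Small norm plus low rank\<close>

definition mat_of :: "nat \<Rightarrow> (nat \<Rightarrow> nat \<Rightarrow> complex) \<Rightarrow> complex Matrix.mat" where
  "mat_of d f = Matrix.mat d d (\<lambda>(r, s). f r s)"

lemma mat_of_carrier [simp]: "mat_of d f \<in> carrier_mat d d"
  by (simp add: mat_of_def)

lemma mat_of_dim [simp]: "dim_row (mat_of d f) = d" "dim_col (mat_of d f) = d"
  by (simp_all add: mat_of_def)

lemma mat_of_index [simp]: "r < d \<Longrightarrow> s < d \<Longrightarrow> mat_of d f $$ (r, s) = f r s"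
  by (simp add: mat_of_def)

lemma rank_sum_products_le:
  assumes "finite I"
  shows "vec_space.rank d (mat_of d (\<lambda>r s. \<Sum>i\<in>I. f i r * g i s)) \<le> card I"
  using assms
proof (induction rule: finite_induct)
  case empty
  have "mat_of d (\<lambda>r s. \<Sum>i\<in>{}. f i r * g i s) = 0\<^sub>m d d" by (rule eq_matI) (auto simp: mat_of_def)
  then show ?case by (simp add: vec_space.rank_0I)
next
  case (insert i I)
  have eq: "mat_of d (\<lambda>r s. \<Sum>i\<in>insert i I. f i r * g i s)
      = mat_of d (\<lambda>r s. f i r * g i s) + mat_of d (\<lambda>r s. \<Sum>i\<in>I. f i r * g i s)"
    using insert by (intro eq_matI) (auto simp: mat_of_def)
  have "vec_space.rank d (mat_of d (\<lambda>r s. f i r * g i s)) \<le> 1"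
    by (rule vec_space.rank_le_1_product_entries[of _ d d "f i" "g i"]) (auto simp: mat_of_def)
  then have "vec_space.rank d (mat_of d (\<lambda>r s. \<Sum>i\<in>insert i I. f i r * g i s))
      \<le> 1 + card I"
    unfolding eq using insert.IH by (intro order_trans[OF vec_space.rank_subadditive[OF mat_of_carrier mat_of_carrier] add_mono]) auto
  then show ?case using insert by simp
qed

text \<open>Schur's test: writing the moduli of the entries as products of two square roots,
  Cauchy-Schwarz uses the row sums once and the column sums once.\<close>

lemma spectral_norm_le:
  assumes \<epsilon>: "\<epsilon> \<ge> 0" and row: "\<And>r. r < d \<Longrightarrow> (\<Sum>s<d. cmod (f r s)) \<le> \<epsilon>"
    and col: "\<And>s. s < d \<Longrightarrow> (\<Sum>r<d. cmod (f r s)) \<le> \<epsilon>"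
  shows "spectral_norm (mat_of d f) \<le> \<epsilon>"
  unfolding spectral_norm_def
proof (rule cSup_least)
  have "l2norm (0\<^sub>v d) \<le> 1" by (simp add: l2norm_def)
  then show "{l2norm (mat_of d f *\<^sub>v v) |v. v \<in> carrier_vec (dim_col (mat_of d f)) \<and> l2norm v \<le> 1} \<noteq> {}"
    by (auto simp: mat_of_def intro!: exI[of _ "0\<^sub>v d"])
  fix x assume "x \<in> {l2norm (mat_of d f *\<^sub>v v) |v. v \<in> carrier_vec (dim_col (mat_of d f)) \<and> l2norm v \<le> 1}"
  then obtain v where x: "x = l2norm (mat_of d f *\<^sub>v v)" and v: "v \<in> carrier_vec d" "l2norm v \<le> 1"
    by (auto simp: mat_of_def)
  let ?v = "\<lambda>s. cmod (vec_index v s)"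
  have v1: "(\<Sum>s<d. (?v s)\<^sup>2) \<le> 1" using v by (simp add: l2norm_def)
  have entry: "vec_index (mat_of d f *\<^sub>v v) r = (\<Sum>s<d. f r s * vec_index v s)" if "r < d" for r
    using that v by (simp add: mat_of_def scalar_prod_def atLeast0LessThan)
  have bound: "(cmod (\<Sum>s<d. f r s * vec_index v s))\<^sup>2 \<le> \<epsilon> * (\<Sum>s<d. cmod (f r s) * (?v s)\<^sup>2)" if "r < d" for r
  proof -
    have "cmod (\<Sum>s<d. f r s * vec_index v s) \<le> (\<Sum>s<d. sqrt (cmod (f r s)) * (sqrt (cmod (f r s)) * ?v s))"
      by (rule order_trans[OF norm_sum]) (simp add: norm_mult mult.assoc[symmetric])
    then have "(cmod (\<Sum>s<d. f r s * vec_index v s))\<^sup>2 \<le> (\<Sum>s<d. sqrt (cmod (f r s)) * (sqrt (cmod (f r s)) * ?v s))\<^sup>2"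
      by (intro power_mono) auto
    also have "\<dots> \<le> (\<Sum>s<d. (sqrt (cmod (f r s)))\<^sup>2) * (\<Sum>s<d. (sqrt (cmod (f r s)) * ?v s)\<^sup>2)"
      by (rule Cauchy_Schwarz_ineq_sum)
    also have "\<dots> = (\<Sum>s<d. cmod (f r s)) * (\<Sum>s<d. cmod (f r s) * (?v s)\<^sup>2)"
      by (simp add: power_mult_distrib)
    also have "\<dots> \<le> \<epsilon> * (\<Sum>s<d. cmod (f r s) * (?v s)\<^sup>2)"
      by (intro mult_right_mono row that sum_nonneg) auto
    finally show ?thesis .
  qed
  have "(\<Sum>r<d. (cmod (\<Sum>s<d. f r s * vec_index v s))\<^sup>2) \<le> (\<Sum>r<d. \<epsilon> * (\<Sum>s<d. cmod (f r s) * (?v s)\<^sup>2))"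
    by (intro sum_mono bound) auto
  also have "\<dots> = \<epsilon> * (\<Sum>s<d. (\<Sum>r<d. cmod (f r s)) * (?v s)\<^sup>2)"
    unfolding sum_distrib_left[symmetric] sum_distrib_right by (subst sum.swap) (rule refl)
  also have "\<dots> \<le> \<epsilon> * (\<Sum>s<d. \<epsilon> * (?v s)\<^sup>2)"
    using col by (intro mult_left_mono sum_mono mult_right_mono \<epsilon>) auto
  also have "\<dots> = \<epsilon>\<^sup>2 * (\<Sum>s<d. (?v s)\<^sup>2)" by (simp add: sum_distrib_left power2_eq_square mult.assoc)
  also have "\<dots> \<le> \<epsilon>\<^sup>2" using v1 by (intro mult_left_le) auto
  finally have "sqrt (\<Sum>r<d. (cmod (\<Sum>s<d. f r s * vec_index v s))\<^sup>2) \<le> \<epsilon>"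
    using \<epsilon> by (intro real_le_lsqrt) (auto intro: sum_nonneg)
  moreover have "x = sqrt (\<Sum>r<d. (cmod (\<Sum>s<d. f r s * vec_index v s))\<^sup>2)"
    unfolding x l2norm_def using entry by (simp add: mat_of_def)
  ultimately show "x \<le> \<epsilon>" by simp
qed

text \<open>Markov's inequality for counting measure.\<close>

lemma card_large_le:
  fixes g :: "nat \<Rightarrow> real"
  assumes "\<epsilon> > 0" "\<And>r. 0 \<le> g r" "(\<Sum>r<d. g r) \<le> \<epsilon>\<^sup>2 * real d"
  shows "real (card {r\<in>{..<d}. g r > \<epsilon>}) \<le> \<epsilon> * real d"
proof -
  have "\<epsilon> * real (card {r\<in>{..<d}. g r > \<epsilon>}) = (\<Sum>r\<in>{r\<in>{..<d}. g r > \<epsilon>}. \<epsilon>)" by simp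
  also have "\<dots> \<le> (\<Sum>r\<in>{r\<in>{..<d}. g r > \<epsilon>}. g r)" by (intro sum_mono) auto
  also have "\<dots> \<le> (\<Sum>r<d. g r)" by (intro sum_mono2) (auto intro: assms)
  also have "\<dots> \<le> \<epsilon> * (\<epsilon> * real d)" using assms(3) by (simp add: power2_eq_square mult.assoc)
  finally show ?thesis using assms(1) by (simp add: mult_le_cancel_left_pos)
qed

text \<open>Rows and columns of large \<open>l\<^sup>1\<close> norm are few and go into the low rank part; what is left is
  small by Schur's test.\<close>

lemma small_norm_plus_low_rank:
  fixes f :: "nat \<Rightarrow> nat \<Rightarrow> complex"
  assumes \<epsilon>: "\<epsilon> > 0" and f: "(\<Sum>r<d. \<Sum>s<d. cmod (f r s)) \<le> \<epsilon>\<^sup>2 * real d"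
  obtains N R where "N \<in> carrier_mat d d" "R \<in> carrier_mat d d" "mat_of d f = N + R"
    "spectral_norm N \<le> \<epsilon>" "real (vec_space.rank d R) \<le> 2 * \<epsilon> * real d"
proof -
  define P where "P = {r\<in>{..<d}. (\<Sum>s<d. cmod (f r s)) > \<epsilon>}"
  define Q where "Q = {s\<in>{..<d}. (\<Sum>r<d. cmod (f r s)) > \<epsilon>}"
  have fin: "finite P" "finite Q" by (auto simp: P_def Q_def)
  have P: "real (card P) \<le> \<epsilon> * real d"
    unfolding P_def by (rule card_large_le[OF \<epsilon> _ f]) (auto intro: sum_nonneg)
  have f': "(\<Sum>s<d. \<Sum>r<d. cmod (f r s)) \<le> \<epsilon>\<^sup>2 * real d" using f by (subst sum.swap)
  have Q: "real (card Q) \<le> \<epsilon> * real d"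
    unfolding Q_def by (rule card_large_le[OF \<epsilon> _ f']) (auto intro: sum_nonneg)
  define N where "N = mat_of d (\<lambda>r s. if r \<in> P \<or> s \<in> Q then 0 else f r s)"
  \<comment> \<open>\<open>R1\<close> holds the large rows and \<open>R2\<close> the large columns
    restricted to the other rows, so no entry is counted twice.\<close>
  define R1 where "R1 = mat_of d (\<lambda>r s. \<Sum>i\<in>P. of_bool (r = i) * f i s)"
  define R2 where "R2 = mat_of d (\<lambda>r s. \<Sum>j\<in>Q. (of_bool (r \<notin> P) * f r j) * of_bool (s = j))"
  have c: "N \<in> carrier_mat d d" "R1 \<in> carrier_mat d d" "R2 \<in> carrier_mat d d"
    by (simp_all add: N_def R1_def R2_def)
  have R1: "R1 $$ (r, s) = (if r \<in> P then f r s else 0)" if "r < d" "s < d" for r s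
  proof -
    have "R1 $$ (r, s) = (\<Sum>i\<in>P. if r = i then f i s else 0)"
      unfolding R1_def mat_of_index[OF that] by (intro sum.cong) auto
    also have "\<dots> = (if r \<in> P then f r s else 0)" unfolding sum.delta'[OF fin(1)] by simp
    finally show ?thesis .
  qed
  have R2: "R2 $$ (r, s) = (if r \<notin> P \<and> s \<in> Q then f r s else 0)" if "r < d" "s < d" for r s
  proof -
    have "R2 $$ (r, s) = (\<Sum>j\<in>Q. if s = j then (if r \<notin> P then f r j else 0) else 0)"
      unfolding R2_def mat_of_index[OF that] by (intro sum.cong) auto
    also have "\<dots> = (if r \<notin> P \<and> s \<in> Q then f r s else 0)" unfolding sum.delta[OF fin(2)] sum.delta'[OF fin(2)] by simp
    finally show ?thesis .
  qed
  have eq: "mat_of d f = N + (R1 + R2)"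
    using c by (intro eq_matI) (auto simp: N_def R1 R2 simp del: index_mult_mat)
  have norm: "spectral_norm N \<le> \<epsilon>"
    unfolding N_def
  proof (rule spectral_norm_le)
    fix r assume "r < d"
    have "(\<Sum>s<d. cmod (if r \<in> P \<or> s \<in> Q then 0 else f r s)) \<le> (\<Sum>s<d. if r \<in> P then 0 else cmod (f r s))"
      by (intro sum_mono) auto
    also have "\<dots> \<le> \<epsilon>"
    proof (cases "r \<in> P")
      case False
      then have "(\<Sum>s<d. cmod (f r s)) \<le> \<epsilon>" using \<open>r < d\<close> unfolding P_def by simp
      then show ?thesis using False by simp
    qed (use \<epsilon> in simp)
    finally show "(\<Sum>s<d. cmod (if r \<in> P \<or> s \<in> Q then 0 else f r s)) \<le> \<epsilon>" .
  next
    fix s assume "s < d"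
    have "(\<Sum>r<d. cmod (if r \<in> P \<or> s \<in> Q then 0 else f r s)) \<le> (\<Sum>r<d. if s \<in> Q then 0 else cmod (f r s))"
      by (intro sum_mono) auto
    also have "\<dots> \<le> \<epsilon>"
    proof (cases "s \<in> Q")
      case False
      then have "(\<Sum>r<d. cmod (f r s)) \<le> \<epsilon>" using \<open>s < d\<close> unfolding Q_def by simp
      then show ?thesis using False by simp
    qed (use \<epsilon> in simp)
    finally show "(\<Sum>r<d. cmod (if r \<in> P \<or> s \<in> Q then 0 else f r s)) \<le> \<epsilon>" .
  qed (use \<epsilon> in simp)
  have "vec_space.rank d (R1 + R2) \<le> card P + card Q"
    using rank_sum_products_le[OF fin(1), of d "\<lambda>i r. of_bool (r = i)" f]
      rank_sum_products_le[OF fin(2), of d "\<lambda>j r. of_bool (r \<notin> P) * f r j" "\<lambda>j s. of_bool (s = j)"]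
    by (intro order_trans[OF vec_space.rank_subadditive[OF c(2,3)] add_mono]) (simp_all add: R1_def R2_def)
  then have "real (vec_space.rank d (R1 + R2)) \<le> 2 * \<epsilon> * real d" using P Q by linarith
  then show thesis using that[OF c(1) _ eq norm] c by simp
qed

lemma separable_integrable:
  assumes "separable_sum g"
  shows "integrable \<mu>\<^sub>S g"
proof -
  have "g absolutely_integrable_on unit_square"
    by (rule absolutely_integrable_continuous[OF separable_sum_continuous[OF assms]])
  then have "g absolutely_integrable_on open_unit_square"
    by (rule set_integrable_subset[OF _ open_unit_square_sets box_subset_cbox])
  then show ?thesis by (rule integrable_on_open_unit_square)
qed

lemma hermitian_matrixD: "hermitian_matrix C \<Longrightarrow> C $ k $ l = cnj (C $ l $ k)"
  unfolding hermitian_matrix_def by blast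

text \<open>If \<open>A\<close> is Hermitian, the adjoint of an approximation approximates equally
  well, and so does their average. The average is Hermitian on the whole plane, which makes the
  approximating symbol real everywhere.\<close>

lemma separable_matrix_approximation:
  fixes A :: "real^2 \<Rightarrow> complex^2^2"
  assumes A: "\<And>k l. integrable \<mu>\<^sub>S (\<lambda>x. A x $ k $ l)" and \<delta>: "\<delta> > 0"
  obtains A' where "\<And>k l. separable_sum (\<lambda>x. A' x $ k $ l)"
    "(\<Sum>k\<in>UNIV. \<Sum>l\<in>UNIV. LINT x|\<mu>\<^sub>S. cmod (A x $ k $ l - A' x $ k $ l)) < \<delta>"
    "(\<forall>x\<in>open_unit_square. hermitian_matrix (A x)) \<Longrightarrow> (\<And>x. hermitian_matrix (A' x))"
proof -
  interpret finite_measure \<mu>\<^sub>S by (rule finite_measure_lebesgue_on_open_unit_square)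
  have "\<exists>g. separable_sum g \<and> (LINT x|\<mu>\<^sub>S. cmod (A x $ k $ l - g x)) < \<delta> / 4" for k l
  proof -
    have "\<delta> / 4 > 0" using \<delta> by simp
    then show ?thesis using integrable_approx_separable[OF A[of k l]] by blast
  qed
  then obtain P where P: "\<And>k l. separable_sum (P k l)" "\<And>k l. (LINT x|\<mu>\<^sub>S. cmod (A x $ k $ l - P k l x)) < \<delta> / 4"
    by meson
  have D: "integrable \<mu>\<^sub>S (\<lambda>x. cmod (A x $ k $ l - P k l x))" for k l
    by (rule integrable_norm[OF Bochner_Integration.integrable_diff[OF A separable_integrable[OF P(1)]]])
  have sum4: "(\<Sum>k\<in>UNIV. \<Sum>l\<in>UNIV. f k l) < \<delta>" if "\<And>k l. f k l < \<delta> / 4" for f :: "2 \<Rightarrow> 2 \<Rightarrow> real"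
    using that[of 1 1] that[of 1 2] that[of 2 1] that[of 2 2] by (simp add: sum_2)
  show thesis
  proof (cases "\<forall>x\<in>open_unit_square. hermitian_matrix (A x)")
    case False
    show thesis
    proof (rule that)
      show "separable_sum (\<lambda>x. (\<chi> k l. P k l x) $ k $ l)" for k l using P(1) by simp
      show "(\<Sum>k\<in>UNIV. \<Sum>l\<in>UNIV. LINT x|\<mu>\<^sub>S. cmod (A x $ k $ l - (\<chi> k l. P k l x) $ k $ l)) < \<delta>"
        unfolding vec_lambda_beta by (rule sum4[OF P(2)])
    qed (use False in blast)
  next
    case True
    let ?A = "\<lambda>x. \<chi> k l. (1/2) * (P k l x + cnj (P l k x))"
    have sep: "separable_sum (\<lambda>x. (1/2) * (P k l x + cnj (P l k x)))" for k l
      by (intro separable_sum_mult separable_sum_const separable_sum.add separable_sum_cnj P)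
    have approx: "(LINT x|\<mu>\<^sub>S. cmod (A x $ k $ l - (1/2) * (P k l x + cnj (P l k x)))) < \<delta> / 4" for k l
    proof -
      have "(LINT x|\<mu>\<^sub>S. cmod (A x $ k $ l - (1/2) * (P k l x + cnj (P l k x))))
         \<le> (LINT x|\<mu>\<^sub>S. (1/2) * (cmod (A x $ k $ l - P k l x) + cmod (A x $ l $ k - P l k x)))"
      proof (rule integral_mono)
        show "integrable \<mu>\<^sub>S (\<lambda>x. cmod (A x $ k $ l - (1/2) * (P k l x + cnj (P l k x))))"
          by (rule integrable_norm[OF Bochner_Integration.integrable_diff[OF A separable_integrable[OF sep]]])
        show "integrable \<mu>\<^sub>S (\<lambda>x. (1/2) * (cmod (A x $ k $ l - P k l x) + cmod (A x $ l $ k - P l k x)))"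
          by (rule integrable_mult_right[OF Bochner_Integration.integrable_add[OF D D]])
        fix x assume "x \<in> space \<mu>\<^sub>S"
        then have "A x $ k $ l = cnj (A x $ l $ k)" using True by (intro hermitian_matrixD) simp
        then have "A x $ k $ l - (1/2) * (P k l x + cnj (P l k x))
            = (1/2) * ((A x $ k $ l - P k l x) + cnj (A x $ l $ k - P l k x))"
          by (simp add: field_simps)
        also have "cmod \<dots> \<le> (1/2) * (cmod (A x $ k $ l - P k l x) + cmod (A x $ l $ k - P l k x))"
          using norm_triangle_ineq[of "A x $ k $ l - P k l x" "cnj (A x $ l $ k - P l k x)"]
          unfolding norm_mult complex_mod_cnj by simp
        finally show "cmod (A x $ k $ l - (1/2) * (P k l x + cnj (P l k x)))
          \<le> (1/2) * (cmod (A x $ k $ l - P k l x) + cmod (A x $ l $ k - P l k x))" .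
      qed
      also have "\<dots> = (1/2) * ((LINT x|\<mu>\<^sub>S. cmod (A x $ k $ l - P k l x)) + (LINT x|\<mu>\<^sub>S. cmod (A x $ l $ k - P l k x)))"
        unfolding integral_mult_right_zero Bochner_Integration.integral_add[OF D D] ..
      also have "\<dots> < \<delta> / 4" using P(2)[of k l] P(2)[of l k] by simp
      finally show ?thesis .
    qed
    show thesis
    proof (rule that)
      show "separable_sum (\<lambda>x. ?A x $ k $ l)" for k l unfolding vec_lambda_beta by (rule sep)
      show "(\<Sum>k\<in>UNIV. \<Sum>l\<in>UNIV. LINT x|\<mu>\<^sub>S. cmod (A x $ k $ l - ?A x $ k $ l)) < \<delta>"
        unfolding vec_lambda_beta by (rule sum4[OF approx])
      show "hermitian_matrix (?A x)" for x
        unfolding hermitian_matrix_def vec_lambda_beta by (simp add: add.commute)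
    qed
  qed
qed

section \<open>Smooth coefficients\<close>

lemma separable_matrix_continuous:
  fixes A :: "real^2 \<Rightarrow> complex^2^2"
  assumes "\<And>k l. separable_sum (\<lambda>x. A x $ k $ l)"
  shows "continuous_on S A"
proof -
  have "continuous_on S (\<lambda>x. \<chi> k l. A x $ k $ l)"
    by (intro continuous_on_vec_lambda separable_sum_continuous assms)
  then show ?thesis by (simp add: vec_lambda_eta)
qed

lemma separable_matrix_modulus:
  fixes A :: "real^2 \<Rightarrow> complex^2^2"
  assumes A: "\<And>k l. separable_sum (\<lambda>x. A x $ k $ l)" and \<omega>: "\<omega> > 0"
  obtains \<delta> where "\<delta> > 0" "\<And>x y k l. x \<in> unit_square \<Longrightarrow> y \<in> unit_square \<Longrightarrow> \<bar>x$1 - y$1\<bar> \<le> \<delta> \<Longrightarrow>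
       \<bar>x$2 - y$2\<bar> \<le> \<delta> \<Longrightarrow> cmod (A x $ k $ l - A y $ k $ l) \<le> \<omega>"
proof -
  have "uniformly_continuous_on unit_square A"
    by (rule compact_uniformly_continuous[OF separable_matrix_continuous[OF A] compact_cbox])
  then obtain d where d: "d > 0" "\<And>x y. x \<in> unit_square \<Longrightarrow> y \<in> unit_square \<Longrightarrow> dist x y < d \<Longrightarrow> dist (A x) (A y) < \<omega>"
    unfolding uniformly_continuous_on_def using \<omega> by metis
  have "cmod (A x $ k $ l - A y $ k $ l) \<le> \<omega>"
    if "x \<in> unit_square" "y \<in> unit_square" "\<bar>x$1 - y$1\<bar> \<le> d / 3" "\<bar>x$2 - y$2\<bar> \<le> d / 3" for x y k l
  proof -
    have "dist x y \<le> (\<Sum>i\<in>UNIV. \<bar>(x - y) $ i\<bar>)" unfolding dist_norm by (rule norm_le_l1_cart)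
    also have "\<dots> < d" using that d(1) by (simp add: sum_2)
    finally have "norm (A x - A y) < \<omega>" using d(2) that by (simp add: dist_norm)
    moreover have "cmod ((A x - A y) $ k $ l) \<le> norm (A x - A y)"
      by (rule order_trans[OF Finite_Cartesian_Product.norm_nth_le Finite_Cartesian_Product.norm_nth_le])
    ultimately show ?thesis by simp
  qed
  then show thesis using that[of "d / 3"] d(1) by simp
qed

lemma main_entry_local_approx:
  fixes A A' :: "real^2 \<Rightarrow> complex^2^2"
  assumes A: "\<And>k l. integrable \<mu>\<^sub>S (\<lambda>x. A x $ k $ l)" and A': "\<And>k l. separable_sum (\<lambda>x. A' x $ k $ l)"
    and \<delta>: "(\<Sum>k\<in>UNIV. \<Sum>l\<in>UNIV. LINT x|\<mu>\<^sub>S. cmod (A x $ k $ l - A' x $ k $ l)) < \<delta>"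
  shows "\<exists>n0. \<forall>n\<ge>n0. (\<Sum>r<n\<^sup>2. \<Sum>s<n\<^sup>2. cmod (main_entry A n r s - local_matrix (\<lambda>x. stencil (A' x)) n r s))
     \<le> 400 * \<delta> * (real n)\<^sup>2"
proof -
  have "0 \<le> (\<Sum>k\<in>UNIV. \<Sum>l\<in>UNIV. LINT x|\<mu>\<^sub>S. cmod (A x $ k $ l - A' x $ k $ l))"
    by (intro sum_nonneg Bochner_Integration.integral_nonneg) simp
  then have \<delta>0: "\<delta> > 0" using \<delta> by linarith
  \<comment> \<open>A hundredth suffices: 81 + 3.24 stays below 100, and (n + 1)^2 \<le> 4 n^2 then
    gives 400.\<close>
  then have "\<delta> / 100 > 0" by simp
  from separable_matrix_modulus[OF A' this] obtain h where h: "h > 0"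
    and mod: "\<And>x y k l. x \<in> unit_square \<Longrightarrow> y \<in> unit_square \<Longrightarrow> \<bar>x$1 - y$1\<bar> \<le> h \<Longrightarrow>
       \<bar>x$2 - y$2\<bar> \<le> h \<Longrightarrow> cmod (A' x $ k $ l - A' y $ k $ l) \<le> \<delta> / 100" by metis
  define n0 where "n0 = nat \<lceil>2 / h\<rceil> + 1"
  have "(\<Sum>r<n\<^sup>2. \<Sum>s<n\<^sup>2. cmod (main_entry A n r s - local_matrix (\<lambda>x. stencil (A' x)) n r s)) \<le> 400 * \<delta> * (real n)\<^sup>2"
    if n: "n \<ge> n0" for n
  proof -
    have n1: "real n \<ge> 2 / h" "real n \<ge> 1" using n unfolding n0_def by linarith+
    then have m: "2 * mesh_size n \<le> h" using h by (simp add: mesh_size_def field_simps)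
    have sq: "(real n + 1)\<^sup>2 \<le> 4 * (real n)\<^sup>2"
      using power_mono[of "real n + 1" "2 * real n" 2] n1 by simp
    let ?L = "local_matrix (\<lambda>x. stencil (A' x)) n"
    have "(\<Sum>r<n\<^sup>2. \<Sum>s<n\<^sup>2. cmod (main_entry A n r s - ?L r s))
        \<le> (\<Sum>r<n\<^sup>2. \<Sum>s<n\<^sup>2. cmod (main_entry A n r s - main_entry A' n r s) + cmod (main_entry A' n r s - ?L r s))"
      by (intro sum_mono norm_triangle_le order_trans[OF _ norm_triangle_ineq]) simp
    also have "\<dots> \<le> 81 * (real n + 1)\<^sup>2 * (\<Sum>k\<in>UNIV. \<Sum>l\<in>UNIV. LINT x|\<mu>\<^sub>S. cmod (A x $ k $ l - A' x $ k $ l))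
        + 324 * (\<delta> / 100) * (real n + 1)\<^sup>2"
      unfolding sum.distrib
    proof (intro add_mono main_entry_diff_l1 main_entry_local_l1 A separable_integrable[OF A'])
      show "n > 0" using n1 by simp
      fix x y :: "real^2" and k l :: 2
      assume "x \<in> unit_square" "y \<in> unit_square" "\<bar>x$1 - y$1\<bar> \<le> 2 * mesh_size n" "\<bar>x$2 - y$2\<bar> \<le> 2 * mesh_size n"
      then show "cmod (A' x $ k $ l - A' y $ k $ l) \<le> \<delta> / 100" using m by (intro mod) auto
    qed
    also have "\<dots> \<le> 81 * (real n + 1)\<^sup>2 * \<delta> + 324 * (\<delta> / 100) * (real n + 1)\<^sup>2"
      using \<delta> by (intro add_right_mono mult_left_mono) auto
    also have "\<dots> = (85 * \<delta> - (76 / 100) * \<delta>) * (real n + 1)\<^sup>2" by (simp add: algebra_simps)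
    also have "\<dots> \<le> (100 * \<delta>) * (4 * (real n)\<^sup>2)" using \<delta>0 sq by (intro mult_mono) auto
    finally show ?thesis by simp
  qed
  then show ?thesis by blast
qed

text \<open>The order of the quantifiers matters: long blocks make wrapped rows rare, and then large
  \<open>n\<close> makes a block short in space, so that the coefficients vary little on it.\<close>

lemma local_block_approx:
  fixes A :: "real^2 \<Rightarrow> complex^2^2"
  assumes A: "\<And>k l. separable_sum (\<lambda>x. A x $ k $ l)" and \<delta>: "\<delta> > 0"
  shows "\<exists>N0>0. \<forall>N\<ge>N0. \<exists>n0. \<forall>n\<ge>n0.
     (\<Sum>r<n\<^sup>2. \<Sum>s<n\<^sup>2. cmod (local_matrix (\<lambda>x. stencil (A x)) n r s - block_matrix (\<lambda>x. stencil (A x)) n N r s))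
       \<le> \<delta> * (real n)\<^sup>2"
proof -
  let ?\<rho> = "\<lambda>x. stencil (A x)"
  have "bounded (A ` unit_square)"
    by (intro compact_imp_bounded compact_continuous_image separable_matrix_continuous A compact_cbox)
  then obtain B where B: "\<And>x. x \<in> unit_square \<Longrightarrow> norm (A x) \<le> B" unfolding bounded_iff by auto
  \<comment> \<open>Comparison with the zero matrix gives a factor 4 on each of four entries; the
    added 1 makes \<open>R\<close> positive.\<close>
  define R where "R = 16 * \<bar>B\<bar> + 1"
  have R: "cmod (?\<rho> x k1 k2) \<le> R" if x: "x \<in> unit_square" for x k1 k2
  proof -
    have z: "stencil 0 k1 k2 = 0" by (simp add: stencil_def)
    have "cmod (A x $ k $ l) \<le> \<bar>B\<bar>" for k l
    proof -
      have "cmod (A x $ k $ l) \<le> norm (A x)" by (rule order_trans[OF Finite_Cartesian_Product.norm_nth_le Finite_Cartesian_Product.norm_nth_le])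
      then show ?thesis using B[OF x] by linarith
    qed
    then have "(\<Sum>k\<in>UNIV. \<Sum>l\<in>UNIV. cmod (A x $ k $ l)) \<le> (\<Sum>k\<in>(UNIV::2 set). \<Sum>l\<in>(UNIV::2 set). \<bar>B\<bar>)"
      by (intro sum_mono)
    then show ?thesis using stencil_diff_bound[of "A x" k1 k2 0] z by (simp add: R_def)
  qed
  have R0: "R > 0" by (simp add: R_def add_nonneg_pos)
  \<comment> \<open>The stencil varies at most 16 times as much as the entries, and 16 / 600 \<le> 1
    / 36.\<close>
  have "\<delta> / 600 > 0" using \<delta> by simp
  from separable_matrix_modulus[OF A this] obtain h where h: "h > 0"
    and mod: "\<And>x y k l. x \<in> unit_square \<Longrightarrow> y \<in> unit_square \<Longrightarrow> \<bar>x$1 - y$1\<bar> \<le> h \<Longrightarrow>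
       \<bar>x$2 - y$2\<bar> \<le> h \<Longrightarrow> cmod (A x $ k $ l - A y $ k $ l) \<le> \<delta> / 600" by metis
  \<comment> \<open>Yields 72 R / N \<le> \<delta> / 4, the share of the wrapped rows.\<close>
  define N0 where "N0 = nat \<lceil>288 * R / \<delta>\<rceil> + 1"
  have main: "(\<Sum>r<n\<^sup>2. \<Sum>s<n\<^sup>2. cmod (local_matrix ?\<rho> n r s - block_matrix ?\<rho> n N r s)) \<le> \<delta> * (real n)\<^sup>2"
    if N: "N \<ge> N0" and n: "n \<ge> nat \<lceil>real N / h\<rceil> + nat \<lceil>144 * R * real N / \<delta>\<rceil> + 1" for N n
  proof -
    have N1: "real N \<ge> 288 * R / \<delta>" "real N \<ge> 1" using N unfolding N0_def by linarith+
    have n1: "real n \<ge> real N / h" "real n \<ge> 144 * R * real N / \<delta>" "real n \<ge> 1" using n by linarith+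
    have Nh: "real N / real n \<le> h" using n1 h by (simp add: field_simps)
    have "(\<Sum>r<n\<^sup>2. \<Sum>s<n\<^sup>2. cmod (local_matrix ?\<rho> n r s - block_matrix ?\<rho> n N r s))
       \<le> 9 * (\<delta> / 36) * (real n)\<^sup>2 + 36 * R * real n * (2 * real n / real N + real N)"
    proof (rule block_matrix_approx)
      show "N > 0" using N1 by simp
      show "?\<rho> x k1 k2 = 0" if "\<bar>k1\<bar> > 1 \<or> \<bar>k2\<bar> > 1" for x k1 k2 using that by (rule stencil_zero)
      show "cmod (?\<rho> x k1 k2) \<le> R" if "x \<in> unit_square" for x k1 k2 by (rule R[OF that])
      show "cmod (?\<rho> x k1 k2 - ?\<rho> y k1 k2) \<le> \<delta> / 36"
        if "x \<in> unit_square" "y \<in> unit_square" "\<bar>x$1 - y$1\<bar> \<le> real N / real n" "\<bar>x$2 - y$2\<bar> \<le> real N / real n" for x y k1 k2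
      proof -
        have "(\<Sum>k\<in>UNIV. \<Sum>l\<in>UNIV. cmod (A x $ k $ l - A y $ k $ l)) \<le> (\<Sum>k\<in>(UNIV::2 set). \<Sum>l\<in>(UNIV::2 set). \<delta> / 600)"
          using that Nh by (intro sum_mono mod) auto
        then show ?thesis using stencil_diff_bound[of "A x" k1 k2 "A y"] \<delta> by simp
      qed
    qed
    also have "\<dots> \<le> \<delta> / 4 * (real n)\<^sup>2 + (\<delta> / 4 * (real n)\<^sup>2 + \<delta> / 4 * (real n)\<^sup>2)"
    proof -
      have a: "72 * R / real N \<le> \<delta> / 4" using N1 \<delta> by (simp add: field_simps)
      have b: "36 * R * real N \<le> \<delta> / 4 * real n" using n1 \<delta> by (simp add: field_simps)
      have "72 * R / real N * (real n)\<^sup>2 \<le> \<delta> / 4 * (real n)\<^sup>2" using a by (intro mult_right_mono) auto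
      moreover have "36 * R * real N * real n \<le> \<delta> / 4 * real n * real n" using b by (intro mult_right_mono) auto
      moreover have "36 * R * real n * (2 * real n / real N + real N) = 72 * R / real N * (real n)\<^sup>2 + 36 * R * real N * real n"
        by (simp add: algebra_simps power2_eq_square)
      moreover have "\<delta> / 4 * real n * real n = \<delta> / 4 * (real n)\<^sup>2" by (simp add: power2_eq_square)
      moreover have "9 * (\<delta> / 36) * (real n)\<^sup>2 = \<delta> / 4 * (real n)\<^sup>2" by simp
      ultimately show ?thesis by linarith
    qed
    also have "\<dots> \<le> \<delta> * (real n)\<^sup>2"
      using mult_nonneg_nonneg[of \<delta> "(real n)\<^sup>2"] \<delta> by simp
    finally show ?thesis .
  qed
  have "N0 > 0" by (simp add: N0_def)
  then show ?thesis using main by blast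
qed

section \<open>The GLT property\<close>

abbreviation "\<mu>\<^sub>D \<equiv> lebesgue_on (unit_square \<times> freq_square)"

lemma symbol_measurable:
  fixes A :: "real^2 \<Rightarrow> complex^2^2"
  assumes A: "\<And>k l. integrable \<mu>\<^sub>S (\<lambda>x. A x $ k $ l)"
  shows "symbol_sum (\<lambda>x. stencil (A x)) \<in> borel_measurable \<mu>\<^sub>D"
proof -
  have "(\<lambda>z. Re (A (fst z) $ k $ l)) \<in> borel_measurable \<mu>\<^sub>D" "(\<lambda>z. Im (A (fst z) $ k $ l)) \<in> borel_measurable \<mu>\<^sub>D" for k l
    using integral_fst_unit_square[OF integrable_Re[OF A[of k l]]] integral_fst_unit_square[OF integrable_Im[OF A[of k l]]]
    by (auto dest: borel_measurable_has_bochner_integral)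
  then have A': "(\<lambda>z. A (fst z) $ k $ l) \<in> borel_measurable \<mu>\<^sub>D" for k l
    by (simp add: borel_measurable_complex_iff)
  have c: "(\<lambda>z::(real^2)\<times>(real^2). cis (snd z$1 * of_int k1 + snd z$2 * of_int k2)) \<in> borel_measurable \<mu>\<^sub>D" for k1 k2
    by (rule continuous_imp_measurable_on_sets_lebesgue)
      (auto intro!: continuous_intros fmeasurableD[OF lmeasurable_Times_bounded] simp: cis_conv_exp)
  show ?thesis
    unfolding symbol_sum_def[abs_def] stencil_eq
    by (intro borel_measurable_sum borel_measurable_times A' c borel_measurable_const)
qed

text \<open>The constant is 36 from \<open>symbol_sum_diff_bound\<close> times the area 4 pi^2 of
  the frequency square.\<close>

lemma symbol_diff_l1:
  fixes A A' :: "real^2 \<Rightarrow> complex^2^2"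
  assumes A: "\<And>k l. integrable \<mu>\<^sub>S (\<lambda>x. A x $ k $ l)" and A': "\<And>k l. integrable \<mu>\<^sub>S (\<lambda>x. A' x $ k $ l)"
  shows "integrable \<mu>\<^sub>D (\<lambda>z. cmod (symbol_sum (\<lambda>x. stencil (A x)) z - symbol_sum (\<lambda>x. stencil (A' x)) z))"
    and "(LINT z|\<mu>\<^sub>D. cmod (symbol_sum (\<lambda>x. stencil (A x)) z - symbol_sum (\<lambda>x. stencil (A' x)) z))
      \<le> 144 * pi\<^sup>2 * (\<Sum>k\<in>UNIV. \<Sum>l\<in>UNIV. LINT x|\<mu>\<^sub>S. cmod (A x $ k $ l - A' x $ k $ l))"
proof -
  let ?s = "\<lambda>z. cmod (symbol_sum (\<lambda>x. stencil (A x)) z - symbol_sum (\<lambda>x. stencil (A' x)) z)"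
  let ?h = "\<lambda>z. 36 * (\<Sum>k\<in>UNIV. \<Sum>l\<in>UNIV. cmod (A (fst z) $ k $ l - A' (fst z) $ k $ l))"
  have "integrable \<mu>\<^sub>S (\<lambda>x. cmod (A x $ k $ l - A' x $ k $ l))" for k l
    by (rule integrable_norm[OF Bochner_Integration.integrable_diff[OF A A']])
  note i = integral_fst_unit_square[OF this]
  have h: "has_bochner_integral \<mu>\<^sub>D ?h (36 * (\<Sum>k\<in>UNIV. \<Sum>l\<in>UNIV. 4 * pi\<^sup>2 * (LINT x|\<mu>\<^sub>S. cmod (A x $ k $ l - A' x $ k $ l))))"
    by (intro has_bochner_integral_mult_right has_bochner_integral_sum i)
  have m: "?s \<in> borel_measurable \<mu>\<^sub>D"
    by (rule measurable_compose[OF borel_measurable_diff[OF symbol_measurable[OF A] symbol_measurable[OF A']] borel_measurable_norm])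
  show s: "integrable \<mu>\<^sub>D ?s"
  proof (rule Bochner_Integration.integrable_bound[OF _ m])
    show "integrable \<mu>\<^sub>D ?h" using h unfolding has_bochner_integral_iff by (rule conjunct1)
    show "AE z in \<mu>\<^sub>D. norm (?s z) \<le> norm (?h z)"
      using symbol_sum_diff_bound[of A _ A'] by (intro AE_I2) (auto intro: order_trans[OF _ abs_ge_self])
  qed
  have "(LINT z|\<mu>\<^sub>D. ?s z) \<le> (LINT z|\<mu>\<^sub>D. ?h z)"
    using h symbol_sum_diff_bound by (intro integral_mono s) (auto simp: has_bochner_integral_iff)
  also have "\<dots> = 144 * pi\<^sup>2 * (\<Sum>k\<in>UNIV. \<Sum>l\<in>UNIV. LINT x|\<mu>\<^sub>S. cmod (A x $ k $ l - A' x $ k $ l))"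
  proof -
    have "(LINT z|\<mu>\<^sub>D. ?h z) = 36 * (\<Sum>k\<in>UNIV. \<Sum>l\<in>UNIV. 4 * pi\<^sup>2 * (LINT x|\<mu>\<^sub>S. cmod (A x $ k $ l - A' x $ k $ l)))"
      using h unfolding has_bochner_integral_iff by (rule conjunct2)
    also have "\<dots> = 144 * pi\<^sup>2 * (\<Sum>k\<in>UNIV. \<Sum>l\<in>UNIV. LINT x|\<mu>\<^sub>S. cmod (A x $ k $ l - A' x $ k $ l))"
    proof -
      have "36 * ((4 * p * u + 4 * p * v) + (4 * p * w + 4 * p * t)) = 144 * p * ((u + v) + (w + t))" for p u v w t :: real
        by (simp add: algebra_simps)
      then show ?thesis unfolding sum_2 .
    qed
    finally show ?thesis .
  qed
  finally show "(LINT z|\<mu>\<^sub>D. ?s z) \<le> 144 * pi\<^sup>2 * (\<Sum>k\<in>UNIV. \<Sum>l\<in>UNIV. LINT x|\<mu>\<^sub>S. cmod (A x $ k $ l - A' x $ k $ l))" .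
qed

text \<open>A GLT representation sums over an initial segment of the naturals, so the nine offsets
  are numbered by base 3 digits.\<close>

definition offset :: "nat \<Rightarrow> int \<times> int" where
  "offset i = (int (i div 3) - 1, int (i mod 3) - 1)"

lemma sum_offset: "(\<Sum>i<9. h (fst (offset i)) (snd (offset i))) = (\<Sum>k1\<in>{-1..1}. \<Sum>k2\<in>{-1..1}. h k1 k2)"
  for h :: "int \<Rightarrow> int \<Rightarrow> complex"
proof -
  have iv: "{-1..1::int} = {-1, 0, 1}" by auto
  have "(\<Sum>i<3\<^sup>2. h (int (i div 3) - 1) (int (i mod 3) - 1)) = (\<Sum>a<3. \<Sum>b<3. h (int a - 1) (int b - 1))"
    by (rule sum_div_mod)
  then have "(\<Sum>i<9. h (fst (offset i)) (snd (offset i))) = (\<Sum>a<3. \<Sum>b<3. h (int a - 1) (int b - 1))"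
    by (simp add: offset_def)
  also have "\<dots> = (\<Sum>k1\<in>{-1..1}. \<Sum>k2\<in>{-1..1}. h k1 k2)"
    unfolding iv by (simp add: numeral_3_eq_3)
  finally show ?thesis .
qed

lemma fourier_char_eq_cis: "fourier_char k \<theta> = cis (\<theta>$1 * of_int (fst k) + \<theta>$2 * of_int (snd k))"
  by (simp add: fourier_char_def cis_conv_exp mult_ac)

text \<open>The Toeplitz matrix of one Fourier character has ones on a single two-level diagonal. An
  entry thus receives exactly the term whose offset fits, or none, in which case \<rho> vanishes as
  well.\<close>

lemma sampled_toeplitz_sum:
  assumes \<rho>: "\<And>x k1 k2. \<bar>k1\<bar> > 1 \<or> \<bar>k2\<bar> > 1 \<Longrightarrow> \<rho> x k1 k2 = 0"
  shows "Matrix.mat (n\<^sup>2) (n\<^sup>2) (\<lambda>rs. \<Sum>i<9. (diag_sampling2 n (\<lambda>x. \<rho> x (fst (offset i)) (snd (offset i)))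
       * toeplitz2 n (fourier_char (offset i))) $$ rs) = mat_of (n\<^sup>2) (local_matrix \<rho> n)"
proof (rule eq_matI)
  fix r s assume "r < dim_row (mat_of (n\<^sup>2) (local_matrix \<rho> n))" "s < dim_col (mat_of (n\<^sup>2) (local_matrix \<rho> n))"
  then have rs: "r < n\<^sup>2" "s < n\<^sup>2" by simp_all
  let ?x = "vector [real (r div n + 1) / real n, real (r mod n + 1) / real n] :: real^2"
  let ?m1 = "int (r div n) - int (s div n)" and ?m2 = "int (r mod n) - int (s mod n)"
  have T: "toeplitz2 n f \<in> carrier_mat (n\<^sup>2) (n\<^sup>2)" for f by (simp add: toeplitz2_def)
  have "(diag_sampling2 n a * toeplitz2 n (fourier_char k)) $$ (r, s) = a ?x * (of_bool (fst k = ?m1) * of_bool (snd k = ?m2))" for a k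
    unfolding diag_sampling2_def mat_diag_mult_left[OF T]
    using rs by (cases k) (simp add: toeplitz2_def lex_index_def fourier_coeff_fourier_char of_bool_conj)
  then have "(\<Sum>i<9. (diag_sampling2 n (\<lambda>x. \<rho> x (fst (offset i)) (snd (offset i))) * toeplitz2 n (fourier_char (offset i))) $$ (r, s))
     = (\<Sum>i<9. \<rho> ?x (fst (offset i)) (snd (offset i)) * (of_bool (fst (offset i) = ?m1) * of_bool (snd (offset i) = ?m2)))"
    by simp
  also have "\<dots> = (\<Sum>k1\<in>{-1..1}. \<Sum>k2\<in>{-1..1}. \<rho> ?x k1 k2 * (of_bool (k1 = ?m1) * of_bool (k2 = ?m2)))"
    by (rule sum_offset[of "\<lambda>k1 k2. \<rho> ?x k1 k2 * (of_bool (k1 = ?m1) * of_bool (k2 = ?m2))"])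
  also have "\<dots> = \<rho> ?x ?m1 ?m2" by (rule sum_window_of_bool[OF \<rho>])
  finally show "Matrix.mat (n\<^sup>2) (n\<^sup>2) (\<lambda>rs. \<Sum>i<9. (diag_sampling2 n (\<lambda>x. \<rho> x (fst (offset i)) (snd (offset i)))
       * toeplitz2 n (fourier_char (offset i))) $$ rs) $$ (r, s) = mat_of (n\<^sup>2) (local_matrix \<rho> n) $$ (r, s)"
    using rs by (simp add: local_matrix_def)
qed simp_all

lemma low_entry_l1_small:
  fixes b :: "real^2 \<Rightarrow> complex^2" and c :: "real^2 \<Rightarrow> complex"
  assumes b: "\<And>k. integrable \<mu>\<^sub>S (\<lambda>x. b x $ k)" and c: "integrable \<mu>\<^sub>S c" and \<epsilon>: "\<epsilon> > 0"
  shows "\<exists>n0. \<forall>n\<ge>n0. (\<Sum>r<n\<^sup>2. \<Sum>s<n\<^sup>2. cmod (low_entry b c n r s)) \<le> \<epsilon> * (real n)\<^sup>2"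
proof -
  let ?I = "LINT x|\<mu>\<^sub>S. low_mass b c x"
  have I0: "?I \<ge> 0" by (intro Bochner_Integration.integral_nonneg) (simp add: low_mass_def)
  have "(\<Sum>r<n\<^sup>2. \<Sum>s<n\<^sup>2. cmod (low_entry b c n r s)) \<le> \<epsilon> * (real n)\<^sup>2" if "n \<ge> nat \<lceil>162 * ?I / \<epsilon>\<rceil> + 1" for n
  proof -
    have n: "real n \<ge> 162 * ?I / \<epsilon>" "real n \<ge> 1" using that by linarith+
    have "81 * (real n + 1) * ?I \<le> 81 * (2 * real n) * ?I" using n I0 by (intro mult_right_mono mult_left_mono) auto
    also have "\<dots> = 162 * ?I * real n" by simp
    also have "\<dots> \<le> \<epsilon> * real n * real n" using n \<epsilon> by (intro mult_right_mono) (auto simp: field_simps)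
    finally show ?thesis using low_entry_l1[OF b c, of n] by (simp add: power2_eq_square)
  qed
  then show ?thesis by blast
qed

lemma stiffness_matrix_carrier: "stiffness_matrix A b c n \<in> carrier_mat (n\<^sup>2) (n\<^sup>2)"
  unfolding stiffness_matrix_def by (rule mat_carrier)

lemma tendsto_zero_ennreal_le:
  fixes f g :: "nat \<Rightarrow> ennreal"
  assumes "\<And>m. f m \<le> g m" "g \<longlonglongrightarrow> 0"
  shows "f \<longlonglongrightarrow> 0"
  by (rule tendsto_sandwich[of "\<lambda>_. 0" f sequentially g]) (auto simp: assms)

text \<open>The approximating matrices belong to polynomial coefficients at L^1 distance below
  \<open>\<delta> m\<close>. This distance bounds the symbols in L^1, hence in measure by Markov,
  and for large \<open>n\<close> the matrices in the sum of moduli, hence up to small norm plus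
  small rank.\<close>

theorem GLT_stiffness_matrix:
  fixes A :: "real^2 \<Rightarrow> complex^2^2" and b :: "real^2 \<Rightarrow> complex^2" and c :: "real^2 \<Rightarrow> complex"
  assumes A: "\<And>k l. integrable \<mu>\<^sub>S (\<lambda>x. A x $ k $ l)"
    and b: "\<And>k. integrable \<mu>\<^sub>S (\<lambda>x. b x $ k)" and c: "integrable \<mu>\<^sub>S c"
  shows "GLT_sequence2 (stiffness_matrix A b c) (P1_symbol A)"
proof -
  define \<epsilon> where "\<epsilon> m = 1 / (real m + 1)" for m
  \<comment> \<open>400 \<delta> is half of \<epsilon>^2, and the lower order terms take the other
    half; \<epsilon>^2 is what a splitting into norm \<epsilon> and relative rank 2 \<epsilon> asks
    for.\<close>
  define \<delta> where "\<delta> m = (\<epsilon> m)\<^sup>2 / 800" for m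
  have \<epsilon>: "\<epsilon> m > 0" for m by (simp add: \<epsilon>_def)
  have \<delta>: "\<delta> m > 0" for m using \<epsilon>[of m] by (simp add: \<delta>_def)
  have \<epsilon>0: "\<epsilon> \<longlonglongrightarrow> 0"
    unfolding \<epsilon>_def[abs_def] using LIMSEQ_inverse_real_of_nat by (simp add: inverse_eq_divide add.commute)
  have \<delta>0: "\<delta> \<longlonglongrightarrow> 0"
    using tendsto_divide[OF tendsto_power[OF \<epsilon>0, of 2] tendsto_const, of 800] by (simp add: \<delta>_def[abs_def])
  define P where "P m A' \<longleftrightarrow> (\<forall>k l. separable_sum (\<lambda>x. A' x $ k $ l)) \<and>
    (\<Sum>k\<in>UNIV. \<Sum>l\<in>UNIV. LINT x|\<mu>\<^sub>S. cmod (A x $ k $ l - A' x $ k $ l)) < \<delta> m" for m and A' :: "real^2 \<Rightarrow> complex^2^2"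
  have "\<exists>A'. P m A'" for m
    unfolding P_def by (rule separable_matrix_approximation[OF A \<delta>[of m]]) blast
  then obtain A' where A': "\<And>m. P m (A' m)" by metis
  have sep: "separable_sum (\<lambda>x. A' m x $ k $ l)" for m k l using A'[of m] unfolding P_def by blast
  have close: "(\<Sum>k\<in>UNIV. \<Sum>l\<in>UNIV. LINT x|\<mu>\<^sub>S. cmod (A x $ k $ l - A' m x $ k $ l)) < \<delta> m" for m
    using A'[of m] unfolding P_def by (rule conjunct2)
  note A'i = separable_integrable[OF sep]
  let ?\<rho> = "\<lambda>m x. stencil (A' m x)"
  define a where "a i m x = ?\<rho> m x (fst (offset i)) (snd (offset i))" for i m x
  define f where "f i m = fourier_char (offset i)" for i and m :: nat
  have a: "smooth_on_unit_square (a i m)" for i m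
  proof -
    have s: "separable_sum (\<lambda>x. of_real t * A' m x $ k $ l)" for t k l
      by (rule separable_sum_mult[OF separable_sum_const sep])
    have "separable_sum (a i m)"
      unfolding a_def[abs_def] stencil_eq sum_2 by (rule separable_sum.add[OF separable_sum.add[OF s s] separable_sum.add[OF s s]])
    then show ?thesis by (rule separable_sum_smooth)
  qed
  have f: "trig_polynomial2 (f i m)" for i m
    unfolding trig_polynomial2_def f_def by (rule exI[of _ "{offset i}"], rule exI[of _ "\<lambda>_. 1"]) simp
  have g: "(\<lambda>(x, \<theta>). \<Sum>i<9. a i m x * f i m \<theta>) = symbol_sum (?\<rho> m)" for m
  proof
    fix z :: "(real^2) \<times> (real^2)"
    show "(\<lambda>(x, \<theta>). \<Sum>i<9. a i m x * f i m \<theta>) z = symbol_sum (?\<rho> m) z"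
      unfolding symbol_sum_def split_beta a_def f_def fourier_char_eq_cis
      by (rule sum_offset[of "\<lambda>k1 k2. ?\<rho> m (fst z) k1 k2 * cis (snd z$1 * of_int k1 + snd z$2 * of_int k2)"])
  qed
  have measure: "converges_in_measure (unit_square \<times> freq_square) (\<lambda>m (x, \<theta>). \<Sum>i<9. a i m x * f i m \<theta>) (P1_symbol A)"
    unfolding converges_in_measure_def g P1_symbol_eq
  proof (intro conjI allI impI)
    show "symbol_sum (?\<rho> m) \<in> borel_measurable \<mu>\<^sub>D" for m by (rule symbol_measurable[OF A'i])
    show "symbol_sum (\<lambda>x. stencil (A x)) \<in> borel_measurable \<mu>\<^sub>D" by (rule symbol_measurable[OF A])
    fix e :: real assume e: "e > 0"
    let ?s = "\<lambda>m z. cmod (symbol_sum (\<lambda>x. stencil (A x)) z - symbol_sum (?\<rho> m) z)"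
    have D: "unit_square \<times> freq_square \<in> sets lebesgue" by (rule fmeasurableD[OF lmeasurable_Times_bounded]) auto
    have le: "emeasure lebesgue {z \<in> unit_square \<times> freq_square. e < cmod (symbol_sum (?\<rho> m) z - symbol_sum (\<lambda>x. stencil (A x)) z)}
       \<le> ennreal (144 * pi\<^sup>2 / e * \<delta> m)" for m
    proof -
      note s = symbol_diff_l1[OF A A'i[of m]]
      have meas: "{z \<in> space \<mu>\<^sub>D. ?s m z \<ge> e} \<in> sets \<mu>\<^sub>D"
        using borel_measurable_integrable[OF s(1)] unfolding borel_measurable_iff_ge by blast
      have "emeasure lebesgue {z \<in> unit_square \<times> freq_square. e < cmod (symbol_sum (?\<rho> m) z - symbol_sum (\<lambda>x. stencil (A x)) z)}
         \<le> emeasure lebesgue {z \<in> space \<mu>\<^sub>D. ?s m z \<ge> e}"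
      proof (rule emeasure_mono)
        show "{z \<in> space \<mu>\<^sub>D. ?s m z \<ge> e} \<in> sets lebesgue"
        proof -
          have "unit_square \<times> freq_square \<inter> space lebesgue \<in> sets lebesgue" using D by simp
          from meas[unfolded sets_restrict_space_iff[OF this]] show ?thesis by (rule conjunct2)
        qed
        show "{z \<in> unit_square \<times> freq_square. e < cmod (symbol_sum (?\<rho> m) z - symbol_sum (\<lambda>x. stencil (A x)) z)}
          \<subseteq> {z \<in> space \<mu>\<^sub>D. ?s m z \<ge> e}"
        proof
          fix z assume "z \<in> {z \<in> unit_square \<times> freq_square. e < cmod (symbol_sum (?\<rho> m) z - symbol_sum (\<lambda>x. stencil (A x)) z)}"
          then have z: "z \<in> unit_square \<times> freq_square" "e < ?s m z" by (simp_all only: mem_Collect_eq norm_minus_commute[of "symbol_sum (?\<rho> m) z"])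
          then show "z \<in> {z \<in> space \<mu>\<^sub>D. ?s m z \<ge> e}" unfolding mem_Collect_eq space_lebesgue_on by (intro conjI less_imp_le)
        qed
      qed
      also have "\<dots> = emeasure \<mu>\<^sub>D {z \<in> space \<mu>\<^sub>D. ?s m z \<ge> e}"
        by (rule emeasure_restrict_space[symmetric]) (use D in \<open>simp, simp only: space_lebesgue_on, blast\<close>)
      also have "\<dots> \<le> (1 / e) * (LINT z|\<mu>\<^sub>D. ?s m z)"
        by (rule integral_Markov_inequality[OF s(1) AE_I2 e]) (rule norm_ge_zero)
      also have "\<dots> \<le> ennreal (144 * pi\<^sup>2 / e * \<delta> m)"
      proof (rule ennreal_leI)
        have "144 * pi\<^sup>2 * (\<Sum>k\<in>UNIV. \<Sum>l\<in>UNIV. LINT x|\<mu>\<^sub>S. cmod (A x $ k $ l - A' m x $ k $ l)) \<le> 144 * pi\<^sup>2 * \<delta> m"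
          by (rule mult_left_mono[OF less_imp_le[OF close]]) simp
        then have "(LINT z|\<mu>\<^sub>D. ?s m z) \<le> 144 * pi\<^sup>2 * \<delta> m" using s(2) by linarith
        then have "(1 / e) * (LINT z|\<mu>\<^sub>D. ?s m z) \<le> (1 / e) * (144 * pi\<^sup>2 * \<delta> m)"
          by (rule mult_left_mono) (use e in simp)
        also have "\<dots> = 144 * pi\<^sup>2 / e * \<delta> m" by simp
        finally show "(1 / e) * (LINT z|\<mu>\<^sub>D. ?s m z) \<le> 144 * pi\<^sup>2 / e * \<delta> m" .
      qed
      finally show ?thesis .
    qed
    have lim: "(\<lambda>m. ennreal (144 * pi\<^sup>2 / e * \<delta> m)) \<longlonglongrightarrow> 0"
      using tendsto_ennrealI[OF tendsto_mult_right_zero[OF \<delta>0, of "144 * pi\<^sup>2 / e"]] by simp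
    show "(\<lambda>m. emeasure lebesgue {z \<in> unit_square \<times> freq_square. e < cmod (symbol_sum (?\<rho> m) z - symbol_sum (\<lambda>x. stencil (A x)) z)}) \<longlonglongrightarrow> 0"
      by (rule tendsto_zero_ennreal_le[OF le lim])
  qed
  have B: "Matrix.mat (n\<^sup>2) (n\<^sup>2) (\<lambda>rs. \<Sum>i<9. (diag_sampling2 n (a i m) * toeplitz2 n (f i m)) $$ rs)
      = mat_of (n\<^sup>2) (local_matrix (?\<rho> m) n)" for n m
    unfolding a_def[abs_def] f_def by (rule sampled_toeplitz_sum[of "?\<rho> m", OF stencil_zero])
  have acs: "acs_convergence (\<lambda>n. n\<^sup>2) (\<lambda>n m. mat_of (n\<^sup>2) (local_matrix (?\<rho> m) n)) (stiffness_matrix A b c)"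
    unfolding acs_convergence_def
  proof (rule conjI[OF _ conjI[OF _ exI[of _ \<epsilon>, OF exI[of _ "\<lambda>m. 2 * \<epsilon> m"]]]])
    have S: "stiffness_matrix A b c n \<in> carrier_mat (n\<^sup>2) (n\<^sup>2)" for n by (rule stiffness_matrix_carrier)
    then show "\<forall>n. stiffness_matrix A b c n \<in> carrier_mat (n\<^sup>2) (n\<^sup>2)" ..
    show "\<forall>n m. mat_of (n\<^sup>2) (local_matrix (?\<rho> m) n) \<in> carrier_mat (n\<^sup>2) (n\<^sup>2)" by simp
    have c0: "(\<lambda>m. 2 * \<epsilon> m) \<longlonglongrightarrow> 0" using tendsto_mult_right_zero[OF \<epsilon>0, of 2] .
    have split: "\<exists>n\<^sub>m. \<forall>n>n\<^sub>m. \<exists>N R. N \<in> carrier_mat (n\<^sup>2) (n\<^sup>2) \<and> R \<in> carrier_mat (n\<^sup>2) (n\<^sup>2) \<and>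
       stiffness_matrix A b c n = mat_of (n\<^sup>2) (local_matrix (?\<rho> m) n) + N + R \<and>
       spectral_norm N \<le> \<epsilon> m \<and> real (vec_space.rank (n\<^sup>2) R) \<le> 2 * \<epsilon> m * real (n\<^sup>2)" for m
    proof -
    obtain n1 where n1: "\<And>n. n \<ge> n1 \<Longrightarrow> (\<Sum>r<n\<^sup>2. \<Sum>s<n\<^sup>2. cmod (main_entry A n r s - local_matrix (?\<rho> m) n r s)) \<le> 400 * \<delta> m * (real n)\<^sup>2"
      using main_entry_local_approx[OF A sep close[of m]] by blast
    have "(\<epsilon> m)\<^sup>2 / 2 > 0" using \<epsilon>[of m] by simp
    then obtain n2 where n2: "\<And>n. n \<ge> n2 \<Longrightarrow> (\<Sum>r<n\<^sup>2. \<Sum>s<n\<^sup>2. cmod (low_entry b c n r s)) \<le> (\<epsilon> m)\<^sup>2 / 2 * (real n)\<^sup>2"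
      using low_entry_l1_small[OF b c] by blast
    show ?thesis
    proof (intro exI[of _ "max n1 n2"] allI impI)
      fix n assume n: "n > max n1 n2"
      define f where "f r s = (main_entry A n r s - local_matrix (?\<rho> m) n r s) + low_entry b c n r s" for r s
      have "(\<Sum>r<n\<^sup>2. \<Sum>s<n\<^sup>2. cmod (f r s)) \<le> (\<Sum>r<n\<^sup>2. \<Sum>s<n\<^sup>2. cmod (main_entry A n r s - local_matrix (?\<rho> m) n r s) + cmod (low_entry b c n r s))"
        unfolding f_def by (intro sum_mono norm_triangle_ineq)
      also have "\<dots> \<le> 400 * \<delta> m * (real n)\<^sup>2 + (\<epsilon> m)\<^sup>2 / 2 * (real n)\<^sup>2"
        unfolding sum.distrib using n by (intro add_mono n1 n2) auto
      also have "\<dots> = (\<epsilon> m)\<^sup>2 * real (n\<^sup>2)" by (simp add: \<delta>_def)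
      finally obtain N R where NR: "N \<in> carrier_mat (n\<^sup>2) (n\<^sup>2)" "R \<in> carrier_mat (n\<^sup>2) (n\<^sup>2)" "mat_of (n\<^sup>2) f = N + R"
        "spectral_norm N \<le> \<epsilon> m" "real (vec_space.rank (n\<^sup>2) R) \<le> 2 * \<epsilon> m * real (n\<^sup>2)"
        using small_norm_plus_low_rank[OF \<epsilon>] by blast
      have "stiffness_matrix A b c n = mat_of (n\<^sup>2) (local_matrix (?\<rho> m) n) + mat_of (n\<^sup>2) f"
        using S[of n] by (intro eq_matI) (simp_all add: stiffness_entry[OF _ _ A b c] f_def)
      also have "\<dots> = mat_of (n\<^sup>2) (local_matrix (?\<rho> m) n) + N + R"
        unfolding NR(3) by (rule assoc_add_mat[OF mat_of_carrier NR(1,2), symmetric])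
      finally show "\<exists>N R. N \<in> carrier_mat (n\<^sup>2) (n\<^sup>2) \<and> R \<in> carrier_mat (n\<^sup>2) (n\<^sup>2) \<and>
         stiffness_matrix A b c n = mat_of (n\<^sup>2) (local_matrix (?\<rho> m) n) + N + R \<and>
         spectral_norm N \<le> \<epsilon> m \<and> real (vec_space.rank (n\<^sup>2) R) \<le> 2 * \<epsilon> m * real (n\<^sup>2)"
        using NR by blast
    qed
    qed
    show "\<epsilon> \<longlonglongrightarrow> 0 \<and> (\<lambda>m. 2 * \<epsilon> m) \<longlonglongrightarrow> 0 \<and> (\<forall>m. \<exists>n\<^sub>m. \<forall>n>n\<^sub>m. \<exists>N R. N \<in> carrier_mat (n\<^sup>2) (n\<^sup>2) \<and> R \<in> carrier_mat (n\<^sup>2) (n\<^sup>2) \<and>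
       stiffness_matrix A b c n = mat_of (n\<^sup>2) (local_matrix (?\<rho> m) n) + N + R \<and>
       spectral_norm N \<le> \<epsilon> m \<and> real (vec_space.rank (n\<^sup>2) R) \<le> 2 * \<epsilon> m * real (n\<^sup>2))"
      by (intro conjI allI \<epsilon>0 c0 split)
  qed
  show ?thesis
    unfolding GLT_sequence2_def
  proof (rule exI[of _ "\<lambda>_. 9"], rule exI[of _ a], rule exI[of _ f], intro conjI)
    show "\<forall>m. \<forall>i<9. smooth_on_unit_square (a i m) \<and> trig_polynomial2 (f i m)" using a f by (intro allI impI conjI)
    show "converges_in_measure (unit_square \<times> freq_square) (\<lambda>m (x, \<theta>). \<Sum>i<9. a i m x * f i m \<theta>) (P1_symbol A)"
      by (rule measure)
  qed (simp only: B acs)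
qed

section \<open>Eigenvalues of perturbed Hermitian matrices\<close>

text \<open>The diagonal of \<open>T\<close> lists the roots of the characteristic polynomial with
  multiplicity, which turns eigenvalue sums into sums over indices.\<close>

lemma schur_form:
  obtains U T :: "nat \<Rightarrow> nat \<Rightarrow> complex" where "unitary_on d U"
    "\<And>a b. a < d \<Longrightarrow> b < d \<Longrightarrow> Z a b = (\<Sum>i<d. \<Sum>j<d. U a i * T i j * cnj (U b j))"
    "\<And>i j. i < d \<Longrightarrow> j < i \<Longrightarrow> T i j = 0"
    "\<And>F :: complex \<Rightarrow> complex. (\<Sum>l\<in>#eigenvalue_mset (mat_of d Z). F l) = (\<Sum>i<d. F (T i i))"
proof -
  let ?M = "mat_of d Z"
  obtain es where es: "char_poly ?M = (\<Prod>e\<leftarrow>es. [:- e, 1:])"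
    using char_poly_factorized[OF mat_of_carrier] by blast
  obtain B P where B: "similar_mat_wit ?M B P (conj_transpose P)" "upper_triangular B" "diag_mat B = es"
    using unitary_schur[OF mat_of_carrier es] by blast
  note w = similar_mat_witD2[OF mat_of_carrier B(1)]
  define U where "U i j = P $$ (i, j)" for i j
  define T where "T i j = B $$ (i, j)" for i j
  have PH: "conj_transpose P $$ (i, j) = cnj (U j i)" if "i < d" "j < d" for i j
    using that w(6) by (simp add: conj_transpose_def U_def)
  have U: "unitary_on d U"
    unfolding unitary_on_def
  proof (intro conjI allI impI)
    fix i j assume ij: "i < d" "j < d"
    have "of_bool (i = j) = (conj_transpose P * P) $$ (j, i)" using ij by (auto simp: w(2))
    also have "\<dots> = (\<Sum>l<d. U l i * cnj (U l j))"
      unfolding index_mult_mat_sum[OF w(7,6) ij(2,1)] using ij PH by (intro sum.cong) (auto simp: U_def mult.commute)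
    finally show "(\<Sum>l<d. U l i * cnj (U l j)) = of_bool (i = j)" ..
    have "of_bool (i = j) = (P * conj_transpose P) $$ (i, j)" using ij by (auto simp: w(1))
    also have "\<dots> = (\<Sum>l<d. U i l * cnj (U j l))"
      unfolding index_mult_mat_sum[OF w(6,7) ij] using ij PH by (intro sum.cong) (auto simp: U_def)
    finally show "(\<Sum>l<d. U i l * cnj (U j l)) = of_bool (i = j)" ..
  qed
  have Z: "Z a b = (\<Sum>i<d. \<Sum>j<d. U a i * T i j * cnj (U b j))" if ab: "a < d" "b < d" for a b
  proof -
    have "Z a b = ?M $$ (a, b)" using ab by simp
    also have "\<dots> = (P * B * conj_transpose P) $$ (a, b)" by (rule arg_cong[OF w(3), of "\<lambda>M. M $$ (a, b)"])
    also have "\<dots> = (\<Sum>j<d. (P * B) $$ (a, j) * conj_transpose P $$ (j, b))"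
      by (rule index_mult_mat_sum[OF mult_carrier_mat[OF w(6,5)] w(7) ab])
    also have "\<dots> = (\<Sum>j<d. \<Sum>i<d. U a i * T i j * cnj (U b j))"
      using ab PH index_mult_mat_sum[OF w(6,5) ab(1)]
      by (intro sum.cong refl) (simp add: U_def T_def sum_distrib_right)
    also have "\<dots> = (\<Sum>i<d. \<Sum>j<d. U a i * T i j * cnj (U b j))" by (rule sum.swap)
    finally show ?thesis .
  qed
  have T: "T i j = 0" if "i < d" "j < i" for i j
    using B(2) w(5) that unfolding T_def upper_triangular_def by auto
  have "(\<Sum>l\<in>#eigenvalue_mset ?M. F l) = (\<Sum>i<d. F (T i i))" for F :: "complex \<Rightarrow> complex"
  proof -
    have "proots (\<Prod>e\<leftarrow>xs. [:- e, 1:]) = mset xs" for xs :: "complex list"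
    proof (induction xs)
      case (Cons x xs)
      have "(\<Prod>e\<leftarrow>xs. [:- e, 1:]) \<noteq> 0" by (auto simp: prod_list_zero_iff)
      then have "proots ([:- x, 1:] * (\<Prod>e\<leftarrow>xs. [:- e, 1:])) = proots [:- x, 1:] + proots (\<Prod>e\<leftarrow>xs. [:- e, 1:])"
        by (intro proots_mult) auto
      then show ?case using Cons.IH by simp
    qed simp
    then have "eigenvalue_mset ?M = mset es" unfolding eigenvalue_mset_def es by blast
    also have "es = map (\<lambda>i. T i i) [0..<d]" using B(3) w(5) by (auto simp: diag_mat_def T_def)
    finally have e: "eigenvalue_mset ?M = mset (map (\<lambda>i. T i i) [0..<d])" .
    show ?thesis
      unfolding e mset_map[symmetric] sum_mset_sum_list map_map o_def
      by (simp add: interv_sum_list_conv_sum_set_nat atLeast0LessThan)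
  qed
  then show thesis using that U Z T by blast
qed

lemma unitary_conj_frobenius:
  assumes "unitary_on d U"
  shows "(\<Sum>a<d. \<Sum>b<d. (cmod (\<Sum>i<d. \<Sum>j<d. U a i * M i j * cnj (U b j)))\<^sup>2) = (\<Sum>i<d. \<Sum>j<d. (cmod (M i j))\<^sup>2)"
proof -
  have "(\<Sum>a<d. \<Sum>b<d. (cmod (\<Sum>i<d. \<Sum>j<d. U a i * M i j * cnj (U b j)))\<^sup>2)
     = (\<Sum>b<d. \<Sum>a<d. (cmod (\<Sum>i<d. U a i * (\<Sum>j<d. cnj (U b j) * M i j)))\<^sup>2)"
    by (subst sum.swap) (simp add: sum_distrib_left mult_ac)
  also have "\<dots> = (\<Sum>b<d. \<Sum>i<d. (cmod (\<Sum>j<d. cnj (U b j) * M i j))\<^sup>2)"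
    by (intro sum.cong refl unitary_on_parseval[OF unitary_on_transpose[OF assms]])
  also have "\<dots> = (\<Sum>i<d. \<Sum>b<d. (cmod (\<Sum>j<d. cnj (U b j) * M i j))\<^sup>2)" by (rule sum.swap)
  also have "\<dots> = (\<Sum>i<d. \<Sum>j<d. (cmod (M i j))\<^sup>2)"
    by (intro sum.cong refl unitary_on_parseval[OF unitary_on_transpose[OF unitary_on_cnj[OF assms]]])
  finally show ?thesis .
qed

text \<open>Unitary conjugation commutes with taking the adjoint and preserves the Frobenius
  norm.\<close>

lemma schur_antihermitian_part:
  assumes U: "unitary_on d U"
    and Z: "\<And>a b. a < d \<Longrightarrow> b < d \<Longrightarrow> Z a b = (\<Sum>i<d. \<Sum>j<d. U a i * T i j * cnj (U b j))"
  shows "(\<Sum>i<d. \<Sum>j<d. (cmod (T i j - cnj (T j i)))\<^sup>2) = (\<Sum>a<d. \<Sum>b<d. (cmod (Z a b - cnj (Z b a)))\<^sup>2)"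
proof -
  have "(\<Sum>i<d. \<Sum>j<d. U a i * (T i j - cnj (T j i)) * cnj (U b j)) = Z a b - cnj (Z b a)" if "a < d" "b < d" for a b
  proof -
    have "cnj (Z b a) = (\<Sum>j<d. \<Sum>i<d. U a i * cnj (T j i) * cnj (U b j))"
      unfolding Z[OF that(2,1)] by (simp add: mult_ac)
    also have "\<dots> = (\<Sum>i<d. \<Sum>j<d. U a i * cnj (T j i) * cnj (U b j))" by (rule sum.swap)
    finally show ?thesis
      unfolding Z[OF that] by (simp add: sum_subtractf left_diff_distrib right_diff_distrib)
  qed
  then show ?thesis using unitary_conj_frobenius[OF U, of "\<lambda>i j. T i j - cnj (T j i)"] by simp
qed

lemma sum_sum_square_eq_0D:
  fixes g :: "nat \<Rightarrow> nat \<Rightarrow> complex"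
  assumes 0: "(\<Sum>i<d. \<Sum>j<d. (cmod (g i j))\<^sup>2) = 0" and "i < d" "j < d"
  shows "g i j = 0"
proof -
  have "(cmod (g i j))\<^sup>2 \<le> (\<Sum>j<d. (cmod (g i j))\<^sup>2)"
    by (rule member_le_sum) (use assms in auto)
  also have "\<dots> \<le> (\<Sum>i<d. \<Sum>j<d. (cmod (g i j))\<^sup>2)"
    by (rule member_le_sum[of i "{..<d}" "\<lambda>i. \<Sum>j<d. (cmod (g i j))\<^sup>2"]) (use assms in \<open>auto intro: sum_nonneg\<close>)
  finally show ?thesis unfolding 0 by simp
qed

text \<open>The Schur form of a Hermitian matrix is both Hermitian and triangular, hence diagonal
  and real.\<close>

lemma hermitian_diagonalisation:
  assumes X: "\<And>a b. a < d \<Longrightarrow> b < d \<Longrightarrow> cnj (X a b) = X b a"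
  obtains V x where "unitary_on d V" "\<And>i. i < d \<Longrightarrow> x i \<in> \<real>"
    "\<And>a b. a < d \<Longrightarrow> b < d \<Longrightarrow> X a b = (\<Sum>i<d. V a i * x i * cnj (V b i))"
proof -
  obtain V T where V: "unitary_on d V"
    and X': "\<And>a b. a < d \<Longrightarrow> b < d \<Longrightarrow> X a b = (\<Sum>i<d. \<Sum>j<d. V a i * T i j * cnj (V b j))"
    and T: "\<And>i j. i < d \<Longrightarrow> j < i \<Longrightarrow> T i j = 0"
    by (rule schur_form[of d X]) blast
  have "(\<Sum>i<d. \<Sum>j<d. (cmod (T i j - cnj (T j i)))\<^sup>2) = 0"
  proof -
    have "(\<Sum>i<d. \<Sum>j<d. (cmod (T i j - cnj (T j i)))\<^sup>2) = (\<Sum>a<d. \<Sum>b<d. (cmod (X a b - cnj (X b a)))\<^sup>2)"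
      by (rule schur_antihermitian_part[OF V]) (rule X')
    also have "\<dots> = 0" by (intro sum.neutral ballI) (simp add: X)
    finally show ?thesis .
  qed
  then have h: "T i j = cnj (T j i)" if "i < d" "j < d" for i j
    using sum_sum_square_eq_0D[of "\<lambda>i j. T i j - cnj (T j i)" d i j] that by simp
  have off: "T i j = 0" if "i < d" "j < d" "i \<noteq> j" for i j
    using T[of i j] T[of j i] h[of i j] that by (cases "i < j") auto
  have "X a b = (\<Sum>i<d. V a i * T i i * cnj (V b i))" if "a < d" "b < d" for a b
  proof -
    have "(\<Sum>j<d. V a i * T i j * cnj (V b j)) = V a i * T i i * cnj (V b i)" if "i < d" for i
    proof -
      have "(\<Sum>j<d. V a i * T i j * cnj (V b j)) = (\<Sum>j<d. if j = i then V a i * T i i * cnj (V b i) else 0)"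
        using off that by (intro sum.cong) auto
      then show ?thesis using that by simp
    qed
    then show ?thesis unfolding X'[OF that] by simp
  qed
  moreover have "T i i \<in> \<real>" if "i < d" for i using h[OF that that] by (metis Reals_cnj_iff)
  ultimately show thesis using that[of V "\<lambda>i. T i i"] V by blast
qed

lemma cmod_diff_square_le: "(cmod (u - v))\<^sup>2 \<le> 2 * (cmod u)\<^sup>2 + 2 * (cmod v)\<^sup>2"
proof -
  have "(cmod (u - v))\<^sup>2 \<le> (cmod u + cmod v)\<^sup>2" by (intro power_mono norm_triangle_ineq4) simp
  also have "\<dots> \<le> 2 * (cmod u)\<^sup>2 + 2 * (cmod v)\<^sup>2"
    using sum_squares_bound[of "cmod u" "cmod v"] by (simp add: power2_sum)
  finally show ?thesis .
qed

text \<open>The non-normal part of \<open>X + Y\<close>, i.e. the strictly upper triangular part of its Schur form,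
  only sees the antihermitian part of \<open>Y\<close>.\<close>

lemma perturbed_eigenvalue_sum:
  fixes F :: "complex \<Rightarrow> complex"
  assumes V: "unitary_on d V" and x: "\<And>i. i < d \<Longrightarrow> x i \<in> \<real>"
    and X: "\<And>a b. a < d \<Longrightarrow> b < d \<Longrightarrow> X a b = (\<Sum>i<d. V a i * x i * cnj (V b i))"
    and F: "\<And>s t. cmod (F s - F t) \<le> \<epsilon> + C * (cmod (s - t))\<^sup>2" and C: "C \<ge> 0"
  shows "cmod ((\<Sum>l\<in>#eigenvalue_mset (mat_of d (\<lambda>a b. X a b + Y a b)). F l) - (\<Sum>i<d. F (x i)))
    \<le> \<epsilon> * real d + 10 * C * (\<Sum>a<d. \<Sum>b<d. (cmod (Y a b))\<^sup>2)"
proof -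
  let ?Y = "\<Sum>a<d. \<Sum>b<d. (cmod (Y a b))\<^sup>2"
  let ?Z = "\<lambda>a b. X a b + Y a b"
  obtain U T where U: "unitary_on d U"
    and Z: "\<And>a b. a < d \<Longrightarrow> b < d \<Longrightarrow> ?Z a b = (\<Sum>i<d. \<Sum>j<d. U a i * T i j * cnj (U b j))"
    and T: "\<And>i j. i < d \<Longrightarrow> j < i \<Longrightarrow> T i j = 0"
    and eig: "\<And>F :: complex \<Rightarrow> complex. (\<Sum>l\<in>#eigenvalue_mset (mat_of d ?Z). F l) = (\<Sum>i<d. F (T i i))"
    by (rule schur_form[of d ?Z]) blast
  \<comment> \<open>Off the diagonal one of \<open>T i j\<close> and \<open>T j i\<close> vanishes,
    so \<open>K\<close> is dominated by the difference of \<open>T\<close> and its adjoint.\<close>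
  define K where "K i j = (if i = j then 0 else T i j)" for i j
  have "(\<Sum>i<d. \<Sum>j<d. (cmod (K i j))\<^sup>2) \<le> (\<Sum>i<d. \<Sum>j<d. (cmod (T i j - cnj (T j i)))\<^sup>2)"
  proof (intro sum_mono)
    fix i j assume "i \<in> {..<d}" "j \<in> {..<d}"
    then show "(cmod (K i j))\<^sup>2 \<le> (cmod (T i j - cnj (T j i)))\<^sup>2"
      using T[of i j] T[of j i] by (cases i j rule: linorder_cases) (auto simp: K_def)
  qed
  also have "\<dots> = (\<Sum>a<d. \<Sum>b<d. (cmod (?Z a b - cnj (?Z b a)))\<^sup>2)" by (rule schur_antihermitian_part[OF U]) (rule Z)
  also have "\<dots> = (\<Sum>a<d. \<Sum>b<d. (cmod (Y a b - cnj (Y b a)))\<^sup>2)"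
  proof (intro sum.cong refl)
    fix a b assume "a \<in> {..<d}" "b \<in> {..<d}"
    then have ab: "a < d" "b < d" by simp_all
    have "cnj (X b a) = (\<Sum>i<d. V a i * cnj (x i) * cnj (V b i))" unfolding X[OF ab(2,1)] by (simp add: mult_ac)
    also have "\<dots> = X a b" unfolding X[OF ab] using x by (intro sum.cong refl) (simp add: Reals_cnj_iff)
    finally show "(cmod (?Z a b - cnj (?Z b a)))\<^sup>2 = (cmod (Y a b - cnj (Y b a)))\<^sup>2" by simp
  qed
  also have "\<dots> \<le> (\<Sum>a<d. \<Sum>b<d. 2 * (cmod (Y a b))\<^sup>2 + 2 * (cmod (Y b a))\<^sup>2)"
    using cmod_diff_square_le[of _ "cnj _"] by (intro sum_mono) simp
  also have "\<dots> = 4 * ?Y"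
    using sum.swap[of "\<lambda>a b. (cmod (Y b a))\<^sup>2" "{..<d}" "{..<d}"] by (simp add: sum.distrib sum_distrib_left[symmetric])
  finally have K: "(\<Sum>i<d. \<Sum>j<d. (cmod (K i j))\<^sup>2) \<le> 4 * ?Y" .
  \<comment> \<open>The coupling compares \<open>X\<close> with the normal matrix that keeps only
    the diagonal of the Schur form; the discarded triangle \<open>K\<close> therefore enters
    \<open>E\<close> beside \<open>Y\<close>.\<close>
  interpret two_bases d U V "\<lambda>i. T i i" x by unfold_locales (rule U, rule V)
  let ?UK = "\<lambda>a b. \<Sum>i<d. \<Sum>j<d. U a i * K i j * cnj (U b j)"
  have E: "E a b = Y a b - ?UK a b" if ab: "a < d" "b < d" for a b
  proof -
    have "(\<Sum>j<d. U a i * T i j * cnj (U b j)) = U a i * T i i * cnj (U b i) + (\<Sum>j<d. U a i * K i j * cnj (U b j))" if "i < d" for i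
    proof -
      have "(\<Sum>j<d. U a i * T i j * cnj (U b j))
        = (\<Sum>j<d. (if j = i then U a i * T i i * cnj (U b i) else 0) + U a i * K i j * cnj (U b j))"
        by (intro sum.cong refl) (simp add: K_def)
      then show ?thesis using that by (simp add: sum.distrib)
    qed
    then have "X a b + Y a b = (\<Sum>i<d. U a i * T i i * cnj (U b i)) + ?UK a b"
      unfolding Z[OF ab] by (simp add: sum.distrib)
    then show ?thesis unfolding E_def X[OF ab, symmetric] by (simp add: algebra_simps)
  qed
  have "(\<Sum>a<d. \<Sum>b<d. (cmod (E a b))\<^sup>2) \<le> (\<Sum>a<d. \<Sum>b<d. 2 * (cmod (Y a b))\<^sup>2 + 2 * (cmod (?UK a b))\<^sup>2)"
    by (intro sum_mono) (simp only: lessThan_iff E cmod_diff_square_le)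
  also have "\<dots> = 2 * ?Y + 2 * (\<Sum>i<d. \<Sum>j<d. (cmod (K i j))\<^sup>2)"
    unfolding sum.distrib sum_distrib_left[symmetric] unitary_conj_frobenius[OF U] ..
  \<comment> \<open>10 = 2 + 2 * 4, where 4 is the cost of \<open>K\<close>.\<close>
  also have "\<dots> \<le> 10 * ?Y" using K by linarith
  finally have "C * (\<Sum>a<d. \<Sum>b<d. (cmod (E a b))\<^sup>2) \<le> C * (10 * ?Y)" using C by (rule mult_left_mono)
  moreover have "cmod ((\<Sum>i<d. F (T i i)) - (\<Sum>j<d. F (x j)))
      \<le> \<epsilon> * real d + C * (\<Sum>i<d. \<Sum>j<d. (cmod (W i j))\<^sup>2 * (cmod (T i i - x j))\<^sup>2)"
    by (rule W_sum_le) (rule F)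
  ultimately show ?thesis unfolding eig W_frobenius by simp
qed

lemma hermitian_eigenvalue_sum_diff:
  fixes F :: "complex \<Rightarrow> complex"
  assumes V: "unitary_on d V" and x: "\<And>i. i < d \<Longrightarrow> x i \<in> \<real>"
    and W: "unitary_on d W" and g: "\<And>i. i < d \<Longrightarrow> g i \<in> \<real>"
    and F: "\<And>s t. s \<in> \<real> \<Longrightarrow> t \<in> \<real> \<Longrightarrow> cmod (F s - F t) \<le> \<epsilon> + C * (cmod (1 / (s + \<i>) - 1 / (t + \<i>)))\<^sup>2" and C: "C \<ge> 0"
  shows "cmod ((\<Sum>i<d. F (x i)) - (\<Sum>i<d. F (g i))) \<le> \<epsilon> * real d +
     2 * C * (\<Sum>a<d. \<Sum>b<d. cmod ((\<Sum>i<d. V a i * x i * cnj (V b i)) - (\<Sum>i<d. W a i * g i * cnj (W b i))))"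
proof -
  interpret two_bases d V W x g by unfold_locales (rule V, rule W)
  have "cmod ((\<Sum>i<d. F (x i)) - (\<Sum>i<d. F (g i))) \<le> \<epsilon> * real d +
     C * (\<Sum>i<d. \<Sum>j<d. (cmod (two_bases.W d V W i j))\<^sup>2 * (cmod (1 / (x i + \<i>) - 1 / (g j + \<i>)))\<^sup>2)"
    by (rule W_sum_le) (intro F x g)
  also have "\<dots> \<le> \<epsilon> * real d + C * (2 * (\<Sum>a<d. \<Sum>b<d. cmod (E a b)))"
    using C by (intro add_left_mono mult_left_mono W_resolvent x g)
  finally show ?thesis unfolding E_def by simp
qed

section \<open>The spectral distribution\<close>

text \<open>Hermitian coefficients make the stencil real, and its evenness turns conjugation into a
  reflection of the summation window.\<close>

lemma symbol_real:
  assumes A: "\<And>x. hermitian_matrix (A x)"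
  shows "symbol_sum (\<lambda>x. stencil (A x)) z \<in> \<real>"
proof -
  have iv: "{-1..1::int} = {-1, 0, 1}" by auto
  have st: "cnj (stencil (A x) k1 k2) = stencil (A x) k1 k2" for x k1 k2
  proof -
    have h: "cnj (A x $ 1 $ 1) = A x $ 1 $ 1" "cnj (A x $ 2 $ 2) = A x $ 2 $ 2"
      "cnj (A x $ 1 $ 2) = A x $ 2 $ 1" "cnj (A x $ 2 $ 1) = A x $ 1 $ 2"
      using hermitian_matrixD[OF A] by metis+
    show ?thesis by (simp add: stencil_def Let_def h add.commute)
  qed
  have flip: "(\<Sum>k\<in>{-1..1::int}. f (- k)) = (\<Sum>k\<in>{-1..1}. f k)" for f :: "int \<Rightarrow> complex"
    unfolding iv by (simp add: add_ac)
  let ?h = "\<lambda>k1 k2. stencil (A (fst z)) k1 k2 * cis (snd z$1 * of_int k1 + snd z$2 * of_int k2)"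
  have "cnj (symbol_sum (\<lambda>x. stencil (A x)) z) = (\<Sum>k1\<in>{-1..1}. \<Sum>k2\<in>{-1..1}. ?h (- k1) (- k2))"
    unfolding symbol_sum_def cnj_sum
  proof (intro sum.cong refl)
    fix k1 k2
    have "- (snd z$1 * of_int k1 + snd z$2 * of_int k2) = snd z$1 * of_int (- k1) + snd z$2 * of_int (- k2)" by simp
    then show "cnj (?h k1 k2) = ?h (- k1) (- k2)"
      by (simp only: complex_cnj_mult st cis_cnj stencil_uminus)
  qed
  also have "\<dots> = (\<Sum>k1\<in>{-1..1}. \<Sum>k2\<in>{-1..1}. ?h (- k1) k2)"
    by (rule sum.cong[OF refl]) (rule flip)
  also have "\<dots> = symbol_sum (\<lambda>x. stencil (A x)) z"
    unfolding symbol_sum_def by (rule flip[of "\<lambda>k1. \<Sum>k2\<in>{-1..1}. ?h k1 k2"])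
  finally show ?thesis unfolding Reals_cnj_iff .
qed

lemma symbol_continuous:
  fixes A :: "real^2 \<Rightarrow> complex^2^2"
  assumes A: "\<And>k l. separable_sum (\<lambda>x. A x $ k $ l)"
  shows "continuous_on S (symbol_sum (\<lambda>x. stencil (A x)))"
proof -
  have "continuous_on S (\<lambda>z. A (fst z) $ k $ l)" for k l
    by (rule continuous_on_compose2[OF separable_sum_continuous[OF A, of UNIV] continuous_on_fst[OF continuous_on_id] subset_UNIV])
  moreover have "continuous_on S (\<lambda>z::(real^2)\<times>(real^2). cis (snd z$1 * of_int k1 + snd z$2 * of_int k2))" for k1 k2
    unfolding cis_conv_exp by (intro continuous_intros)
  ultimately show ?thesis
    unfolding symbol_sum_def[abs_def] stencil_eq by (intro continuous_on_sum continuous_on_mult continuous_on_const)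
qed

lemma cell_in_square:
  assumes N: "N > 0" and n: "n > 0"
    and i: "i \<in> {..<full_range n N} \<times> {..<full_range n N}"
    and z: "\<And>k. fst (cell_point n N i) $ k \<le> fst z $ k" "\<And>k. fst z $ k \<le> fst (cell_point n N i) $ k + real N / real n"
      "\<And>k. snd (cell_point n N i) $ k \<le> snd z $ k" "\<And>k. snd z $ k \<le> snd (cell_point n N i) $ k + 2 * pi / real N"
  shows "z \<in> unit_square \<times> freq_square"
proof -
  have i': "fst i < full_range n N" "snd i < full_range n N" using i by (simp_all add: mem_Times_iff)
  note u = cell_upper[OF N n i'(1)] cell_upper[OF N n i'(2)]
  have pos: "0 \<le> real N * real a / real n" "0 \<le> 2 * pi * real a / real N" for a by simp_all
  have cp: "fst (cell_point n N i) $ 1 = real N * real (fst i div N) / real n"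
    "fst (cell_point n N i) $ 2 = real N * real (snd i div N) / real n"
    "snd (cell_point n N i) $ 1 = - pi + 2 * pi * real (fst i mod N) / real N"
    "snd (cell_point n N i) $ 2 = - pi + 2 * pi * real (snd i mod N) / real N"
    by (simp_all add: cell_point_def)
  have "0 \<le> fst z $ 1" using z(1)[of 1] pos(1)[of "fst i div N"] unfolding cp by linarith
  moreover have "0 \<le> fst z $ 2" using z(1)[of 2] pos(1)[of "snd i div N"] unfolding cp by linarith
  moreover have "fst z $ 1 \<le> 1" using z(2)[of 1] u(1) unfolding cp by linarith
  moreover have "fst z $ 2 \<le> 1" using z(2)[of 2] u(3) unfolding cp by linarith
  moreover have "- pi \<le> snd z $ 1" using z(3)[of 1] pos(2)[of "fst i mod N"] unfolding cp by linarith
  moreover have "- pi \<le> snd z $ 2" using z(3)[of 2] pos(2)[of "snd i mod N"] unfolding cp by linarith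
  moreover have "snd z $ 1 \<le> pi" using z(4)[of 1] u(2) unfolding cp by linarith
  moreover have "snd z $ 2 \<le> pi" using z(4)[of 2] u(4) unfolding cp by linarith
  ultimately show ?thesis by (simp add: mem_Times_iff mem_box_real2)
qed

lemma dist_le_components:
  fixes z w :: "(real^2) \<times> (real^2)"
  assumes "\<And>k. \<bar>fst z $ k - fst w $ k\<bar> \<le> s" "\<And>k. \<bar>snd z $ k - snd w $ k\<bar> \<le> t"
  shows "dist z w \<le> 2 * s + 2 * t"
proof -
  have "dist u v \<le> 2 * s" if "\<And>k. \<bar>u $ k - v $ k\<bar> \<le> s" for u v :: "real^2" and s
    using norm_le_l1_cart[of "u - v"] that[of 1] that[of 2] by (simp add: dist_norm sum_2)
  from this[of "fst z" "fst w" s] this[of "snd z" "snd w" t] assms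
  have "dist (fst z) (fst w) \<le> 2 * s" "dist (snd z) (snd w) \<le> 2 * t" by blast+
  moreover have "dist z w \<le> dist (fst z) (fst w) + dist (snd z) (snd w)"
    using sqrt_sum_squares_le_sum[of "dist (fst z) (fst w)" "dist (snd z) (snd w)"] by (simp add: dist_prod_def)
  ultimately show ?thesis by linarith
qed

lemma box_Pair_bounds:
  fixes p :: "(real^2) \<times> (real^2)"
  assumes "z \<in> box p (p + (vec s, vec t))"
  shows "fst p $ k \<le> fst z $ k" "fst z $ k \<le> fst p $ k + s" "snd p $ k \<le> snd z $ k" "snd z $ k \<le> snd p $ k + t"
proof -
  have "fst z \<in> box (fst p) (fst p + vec s)" "snd z \<in> box (snd p) (snd p + vec t)"
    using assms box_Pair_eq[of "fst p" "snd p" "fst p + vec s" "snd p + vec t"]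
    by (cases p; cases z; simp)+
  then show "fst p $ k \<le> fst z $ k" "fst z $ k \<le> fst p $ k + s" "snd p $ k \<le> snd z $ k" "snd z $ k \<le> snd p $ k + t"
    using exhaust_2[of k] by (auto simp: mem_box_real2)
qed

lemma sum_block_eigenvalues:
  fixes F :: "complex \<Rightarrow> complex"
  shows "(\<Sum>r<n\<^sup>2. F (block_eigenvalue \<rho> n N r)) =
    (\<Sum>i\<in>{..<full_range n N} \<times> {..<full_range n N}. F (symbol_sum \<rho> (cell_point n N i)))
    + of_nat (n\<^sup>2 - (full_range n N)\<^sup>2) * F 0"
proof -
  let ?K = "full_range n N" and ?g = "\<lambda>i. F (symbol_sum \<rho> (cell_point n N i))"
  let ?h = "\<lambda>i. if i \<in> {..<?K} \<times> {..<?K} then ?g i else F 0"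
  have sub: "{..<?K} \<times> {..<?K} \<subseteq> {..<n} \<times> {..<n}" using full_range_le[of n N] by auto
  have "(\<Sum>r<n\<^sup>2. F (block_eigenvalue \<rho> n N r)) = (\<Sum>a<n. \<Sum>b<n. ?h (a, b))"
    unfolding block_eigenvalue_def sum_div_mod[symmetric] by (intro sum.cong refl) simp
  also have "\<dots> = (\<Sum>i\<in>{..<n} \<times> {..<n}. ?h i)" unfolding sum.cartesian_product by (intro sum.cong refl) (simp add: case_prod_beta mem_Times_iff)
  also have "\<dots> = (\<Sum>i\<in>{..<?K} \<times> {..<?K}. ?h i) + (\<Sum>i\<in>{..<n} \<times> {..<n} - {..<?K} \<times> {..<?K}. ?h i)"
    by (subst add.commute) (rule sum.subset_diff[OF sub finite_cartesian_product], rule finite_lessThan, rule finite_lessThan)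
  also have "(\<Sum>i\<in>{..<?K} \<times> {..<?K}. ?h i) = (\<Sum>i\<in>{..<?K} \<times> {..<?K}. ?g i)" by (intro sum.cong refl) simp
  also have "(\<Sum>i\<in>{..<n} \<times> {..<n} - {..<?K} \<times> {..<?K}. ?h i) = (\<Sum>i\<in>{..<n} \<times> {..<n} - {..<?K} \<times> {..<?K}. F 0)"
    by (intro sum.cong refl) simp
  also have "\<dots> = of_nat (n\<^sup>2 - ?K\<^sup>2) * F 0"
    using card_Diff_subset[OF _ sub] by (simp add: card_cartesian_product power2_eq_square)
  finally show ?thesis .
qed

lemma full_range_fraction:
  assumes N: "N > 0" and n: "n > 0"
  shows "1 - (real (full_range n N) / real n)\<^sup>2 \<le> 2 * real N / real n"
proof -
  let ?t = "real (full_range n N) / real n"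
  have "n = full_range n N + n mod N" by (simp add: full_range_def)
  moreover have "n mod N < N" using N by simp
  ultimately have "real n \<le> real (full_range n N) + real N" by linarith
  then have "1 \<le> ?t + real N / real n" using n by (simp add: add_divide_distrib[symmetric] le_divide_eq)
  moreover have "1 - ?t\<^sup>2 \<le> 2 * (1 - ?t)" using zero_le_power2[of "1 - ?t"] by (simp add: power2_diff)
  ultimately show ?thesis by simp
qed

lemma compact_cube: "compact (unit_square \<times> freq_square)"
  by (intro compact_Times compact_cbox)

text \<open>The eigenvalues are values of the symbol at cell corners, so their average is a Riemann
  sum. The frequency mesh depends on \<open>N\<close> alone and is fixed first; the spatial mesh N /
  n is then refined through \<open>n\<close>.\<close>

lemma block_eigenvalue_distribution:
  fixes A :: "real^2 \<Rightarrow> complex^2^2" and F :: "complex \<Rightarrow> complex"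
  assumes A: "\<And>k l. separable_sum (\<lambda>x. A x $ k $ l)" and F: "continuous_on UNIV F"
    and B: "\<And>z. cmod (F z) \<le> B" and \<epsilon>: "\<epsilon> > 0"
  shows "\<exists>N0>0. \<forall>N\<ge>N0. \<exists>n0. \<forall>n\<ge>n0.
    cmod ((\<Sum>r<n\<^sup>2. F (block_eigenvalue (\<lambda>x. stencil (A x)) n N r)) / of_nat (n\<^sup>2)
      - (LINT z|\<mu>\<^sub>D. F (symbol_sum (\<lambda>x. stencil (A x)) z)) / of_real (4 * pi\<^sup>2)) \<le> \<epsilon>"
proof -
  let ?D = "unit_square \<times> freq_square"
  let ?\<rho> = "\<lambda>x. stencil (A x)"
  let ?\<Psi> = "\<lambda>z. F (symbol_sum ?\<rho> z)"
  have cont: "continuous_on ?D ?\<Psi>"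
    by (rule continuous_on_compose2[OF F symbol_continuous[OF A] subset_UNIV])
  have D: "?D \<in> sets lebesgue" by (rule fmeasurableD[OF lmeasurable_Times_bounded]) auto
  have meas: "?\<Psi> \<in> borel_measurable \<mu>\<^sub>D" by (rule continuous_imp_measurable_on_sets_lebesgue[OF cont D])
  have B0: "B \<ge> 0" by (rule order_trans[OF norm_ge_zero B[of 0]])
  have "uniformly_continuous_on ?D ?\<Psi>" by (rule compact_uniformly_continuous[OF cont compact_cube])
  then obtain \<delta> where \<delta>: "\<delta> > 0" "\<And>z w. z \<in> ?D \<Longrightarrow> w \<in> ?D \<Longrightarrow> dist z w < \<delta> \<Longrightarrow> dist (?\<Psi> z) (?\<Psi> w) < \<epsilon> / 2"
    unfolding uniformly_continuous_on_def using half_gt_zero[OF \<epsilon>] by metis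
  \<comment> \<open>Gives 2 pi / N \<le> \<delta> / 6; two coordinates in frequency and two in space
    add up to 4 \<delta> / 6.\<close>
  define N0 where "N0 = nat \<lceil>12 * pi / \<delta>\<rceil> + 1"
  have main: "cmod ((\<Sum>r<n\<^sup>2. F (block_eigenvalue ?\<rho> n N r)) / of_nat (n\<^sup>2) - (LINT z|\<mu>\<^sub>D. ?\<Psi> z) / of_real (4 * pi\<^sup>2)) \<le> \<epsilon>"
    if N: "N \<ge> N0" and n: "n \<ge> nat \<lceil>6 * real N / \<delta>\<rceil> + nat \<lceil>8 * B * real N / \<epsilon>\<rceil> + 1" for N n
  proof -
    have N1: "real N \<ge> 12 * pi / \<delta>" "N > 0" using N unfolding N0_def by linarith+
    have n1: "real n \<ge> 6 * real N / \<delta>" "real n \<ge> 8 * B * real N / \<epsilon>" "n > 0" using n by linarith+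
    have a: "real N / real n \<le> \<delta> / 6" using n1 \<delta>(1) by (simp add: field_simps)
    have b: "2 * pi / real N \<le> \<delta> / 6" using N1 \<delta>(1) by (simp add: field_simps)
    \<comment> \<open>The incomplete blocks are paid for twice, by the uncovered volume and by the
      default eigenvalues 0.\<close>
    have c: "2 * B * (2 * real N / real n) \<le> \<epsilon> / 2" using n1 \<epsilon> by (simp add: field_simps)
    let ?K = "full_range n N"
    let ?I = "{..<?K} \<times> {..<?K}"
    let ?t = "1 - (real ?K / real n)\<^sup>2"
    have K: "?K \<le> n" by (rule full_range_le)
    have r: "cmod ((\<Sum>i\<in>?I. ?\<Psi> (cell_point n N i)) / of_nat (n\<^sup>2) - (LINT z|\<mu>\<^sub>D. ?\<Psi> z) / of_real (4 * pi\<^sup>2)) \<le> \<epsilon> / 2 + B * ?t"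
    proof (rule riemann_cells(1)[OF N1(2) n1(3) meas])
      fix i z assume i: "i \<in> ?I" and z: "z \<in> box (cell_point n N i) (cell_point n N i + cell_size n N)"
      note zb = box_Pair_bounds[OF z[unfolded cell_size_def]]
      have zD: "z \<in> ?D" by (rule cell_in_square[OF N1(2) n1(3) i zb])
      have pD: "cell_point n N i \<in> ?D" by (rule cell_in_square[OF N1(2) n1(3) i]) simp_all
      have "dist z (cell_point n N i) \<le> 2 * (\<delta> / 6) + 2 * (\<delta> / 6)"
      proof (rule dist_le_components)
        show "\<bar>fst z $ k - fst (cell_point n N i) $ k\<bar> \<le> \<delta> / 6" for k using zb(1,2)[of k] a by linarith
        show "\<bar>snd z $ k - snd (cell_point n N i) $ k\<bar> \<le> \<delta> / 6" for k using zb(3,4)[of k] b by linarith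
      qed
      also have "\<dots> < \<delta>" using \<delta>(1) by simp
      finally show "cmod (?\<Psi> z - ?\<Psi> (cell_point n N i)) \<le> \<epsilon> / 2"
        using \<delta>(2)[OF zD pD] by (simp add: dist_norm)
    qed (use B \<epsilon> in simp_all)
    have "cmod (of_nat (n\<^sup>2 - ?K\<^sup>2) * F 0 / of_nat (n\<^sup>2)) = real (n\<^sup>2 - ?K\<^sup>2) / real (n\<^sup>2) * cmod (F 0)"
      by (simp add: norm_mult norm_divide norm_power)
    also have "real (n\<^sup>2 - ?K\<^sup>2) / real (n\<^sup>2) = ?t"
      using power_mono[OF K, of 2] n1(3) by (simp add: of_nat_diff diff_divide_distrib power_divide)
    also have "?t * cmod (F 0) \<le> ?t * B"
    proof (rule mult_left_mono[OF B])
      show "?t \<ge> 0" using K n1(3) by (simp add: power_le_one)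
    qed
    finally have e: "cmod (of_nat (n\<^sup>2 - ?K\<^sup>2) * F 0 / of_nat (n\<^sup>2)) \<le> ?t * B" .
    have "2 * B * ?t \<le> 2 * B * (2 * real N / real n)"
      using B0 by (intro mult_left_mono full_range_fraction N1 n1) simp
    moreover have "2 * (?t * B) = 2 * B * ?t" by (simp only: mult_ac)
    ultimately have t: "2 * (?t * B) \<le> \<epsilon> / 2" using c by linarith
    have "(\<Sum>r<n\<^sup>2. F (block_eigenvalue ?\<rho> n N r)) / of_nat (n\<^sup>2) - (LINT z|\<mu>\<^sub>D. ?\<Psi> z) / of_real (4 * pi\<^sup>2)
      = ((\<Sum>i\<in>?I. ?\<Psi> (cell_point n N i)) / of_nat (n\<^sup>2) - (LINT z|\<mu>\<^sub>D. ?\<Psi> z) / of_real (4 * pi\<^sup>2))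
         + of_nat (n\<^sup>2 - ?K\<^sup>2) * F 0 / of_nat (n\<^sup>2)"
      unfolding sum_block_eigenvalues add_divide_distrib by (simp only: diff_conv_add_uminus add_ac)
    also have "cmod \<dots> \<le> (\<epsilon> / 2 + B * ?t) + ?t * B"
      by (rule order_trans[OF norm_triangle_ineq add_mono[OF r e]])
    also have "\<dots> = \<epsilon> / 2 + 2 * (?t * B)" by simp
    finally show ?thesis using t by linarith
  qed
  have "N0 > 0" by (simp add: N0_def)
  then show ?thesis using main by blast
qed

text \<open>A linear modulus of continuity is used because the symbols are close in L^1 only; 36 is
  144 pi^2 divided by the area 4 pi^2.\<close>

lemma integral_symbol_diff:
  fixes A A' :: "real^2 \<Rightarrow> complex^2^2" and F :: "complex \<Rightarrow> complex"
  assumes A: "\<And>k l. integrable \<mu>\<^sub>S (\<lambda>x. A x $ k $ l)" and A': "\<And>k l. integrable \<mu>\<^sub>S (\<lambda>x. A' x $ k $ l)"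
    and \<delta>: "(\<Sum>k\<in>UNIV. \<Sum>l\<in>UNIV. LINT x|\<mu>\<^sub>S. cmod (A x $ k $ l - A' x $ k $ l)) \<le> \<delta>"
    and F: "continuous_on UNIV F" and B: "\<And>z. cmod (F z) \<le> B"
    and K: "\<And>s t. cmod (F s - F t) \<le> \<epsilon> + K * cmod (s - t)" "K \<ge> 0"
  shows "cmod ((LINT z|\<mu>\<^sub>D. F (symbol_sum (\<lambda>x. stencil (A' x)) z)) / of_real (4 * pi\<^sup>2)
     - (LINT z|\<mu>\<^sub>D. F (symbol_sum (\<lambda>x. stencil (A x)) z)) / of_real (4 * pi\<^sup>2)) \<le> \<epsilon> + 36 * K * \<delta>"
proof -
  let ?k = "symbol_sum (\<lambda>x. stencil (A x))" and ?k' = "symbol_sum (\<lambda>x. stencil (A' x))"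
  have D: "unit_square \<times> freq_square \<in> lmeasurable" by (rule lmeasurable_Times_bounded) auto
  interpret finite_measure \<mu>\<^sub>D using D by (rule finite_measure_lebesgue_on)
  have Fb: "F \<in> borel_measurable borel" using F by (rule borel_measurable_continuous_onI)
  have i: "integrable \<mu>\<^sub>D (\<lambda>z. F (symbol_sum (\<lambda>x. stencil (C x)) z))"
    if "\<And>k l. integrable \<mu>\<^sub>S (\<lambda>x. C x $ k $ l)" for C :: "real^2 \<Rightarrow> complex^2^2"
    by (rule integrable_const_bound[OF AE_I2[OF B] measurable_compose[OF symbol_measurable[OF that] Fb]])
  note l1 = symbol_diff_l1[OF A A']
  have c: "integrable \<mu>\<^sub>D (\<lambda>z. \<epsilon> + K * cmod (?k z - ?k' z))"
    by (intro Bochner_Integration.integrable_add integrable_mult_right l1(1) integrable_const)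
  have m: "measure \<mu>\<^sub>D (space \<mu>\<^sub>D) = 4 * pi\<^sup>2"
    using D riemann_cells(2)[of 1 1 "\<lambda>_. 0" 0 "\<lambda>_. 0" 0] by (simp add: measure_restrict_space fmeasurableD)
  have "cmod ((LINT z|\<mu>\<^sub>D. F (?k' z)) - (LINT z|\<mu>\<^sub>D. F (?k z))) = cmod (LINT z|\<mu>\<^sub>D. F (?k' z) - F (?k z))"
    by (simp only: Bochner_Integration.integral_diff[OF i[OF A'] i[OF A]])
  also have "\<dots> \<le> (LINT z|\<mu>\<^sub>D. cmod (F (?k' z) - F (?k z)))" by (rule integral_norm_bound)
  also have "\<dots> \<le> (LINT z|\<mu>\<^sub>D. \<epsilon> + K * cmod (?k z - ?k' z))"
  proof (rule integral_mono[OF integrable_norm[OF Bochner_Integration.integrable_diff[OF i[OF A'] i[OF A]]] c])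
    show "cmod (F (?k' z) - F (?k z)) \<le> \<epsilon> + K * cmod (?k z - ?k' z)" for z
      using K(1)[of "?k' z" "?k z"] unfolding norm_minus_commute[of "?k' z"] .
  qed
  also have "\<dots> = \<epsilon> * (4 * pi\<^sup>2) + K * (LINT z|\<mu>\<^sub>D. cmod (?k z - ?k' z))"
    unfolding Bochner_Integration.integral_add[OF integrable_const integrable_mult_right[OF l1(1)]]
      integral_mult_right_zero lebesgue_integral_const m by simp
  also have "\<dots> \<le> \<epsilon> * (4 * pi\<^sup>2) + K * (144 * pi\<^sup>2 * \<delta>)"
    using K(2) by (intro add_left_mono mult_left_mono order_trans[OF l1(2)] \<delta>) simp_all
  also have "\<dots> = (\<epsilon> + 36 * K * \<delta>) * (4 * pi\<^sup>2)" by (simp add: algebra_simps)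
  finally have "cmod ((LINT z|\<mu>\<^sub>D. F (?k' z)) - (LINT z|\<mu>\<^sub>D. F (?k z))) / (4 * pi\<^sup>2) \<le> \<epsilon> + 36 * K * \<delta>"
    by (simp only: divide_le_eq) simp
  then show ?thesis unfolding diff_divide_distrib[symmetric] norm_divide by (simp add: norm_mult norm_power)
qed

text \<open>Up to distance 1 the square is below the distance itself; beyond it the distance
  dominates the constant bound on the oscillation.\<close>

lemma Cc_linear_bound:
  assumes F: "Cc_complex F" and \<epsilon>: "\<epsilon> > 0"
  obtains K where "K \<ge> 0" "\<And>s t. cmod (F s - F t) \<le> \<epsilon> + K * cmod (s - t)"
proof -
  obtain C where C: "C \<ge> 0" "\<And>s t. cmod (F s - F t) \<le> \<epsilon> + C * (cmod (s - t))\<^sup>2"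
    using Cc_square_bound[OF F \<epsilon>] by blast
  obtain B where B: "\<And>z. cmod (F z) \<le> B" using Cc_complex_bounded[OF F] by blast
  have B0: "B \<ge> 0" by (rule order_trans[OF norm_ge_zero B[of 0]])
  have "cmod (F s - F t) \<le> \<epsilon> + (C + 2 * B) * cmod (s - t)" for s t
  proof (cases "cmod (s - t) \<le> 1")
    case True
    then have "C * (cmod (s - t))\<^sup>2 \<le> C * cmod (s - t)"
      using C(1) by (intro mult_left_mono) (simp_all add: power2_eq_square mult_left_le)
    moreover have "0 \<le> 2 * B * cmod (s - t)" using B0 by simp
    ultimately show ?thesis using C(2)[of s t] unfolding distrib_right by linarith
  next
    case False
    have "cmod (F s - F t) \<le> 2 * B" using norm_triangle_ineq4[of "F s" "F t"] B[of s] B[of t] by linarith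
    moreover have "2 * B * 1 \<le> 2 * B * cmod (s - t)" using False B0 by (intro mult_left_mono) auto
    moreover have "0 \<le> C * cmod (s - t)" using C(1) by simp
    ultimately show ?thesis using \<epsilon> unfolding distrib_right by linarith
  qed
  then show thesis using that[of "C + 2 * B"] C(1) B0 by simp
qed

text \<open>Two different comparisons are chained: from the stiffness matrix to its second order
  part by Frobenius cost, since the former may fail to be normal, and from there to the block matrix
  through resolvents, since only sums of moduli are under control.\<close>

lemma eigenvalue_average_bound:
  fixes A A' :: "real^2 \<Rightarrow> complex^2^2" and b :: "real^2 \<Rightarrow> complex^2" and c :: "real^2 \<Rightarrow> complex"
  assumes n: "n > 0" and N: "N > 0" and A: "\<And>k l. integrable \<mu>\<^sub>S (\<lambda>x. A x $ k $ l)"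
    and b: "\<And>k. integrable \<mu>\<^sub>S (\<lambda>x. b x $ k)" and c: "integrable \<mu>\<^sub>S c"
    and H: "\<And>x. x \<in> open_unit_square \<Longrightarrow> hermitian_matrix (A x)" and H': "\<And>x. hermitian_matrix (A' x)"
    and C1: "C1 \<ge> 0" "\<And>s t. cmod (F s - F t) \<le> \<epsilon> + C1 * (cmod (s - t))\<^sup>2"
    and C2: "C2 \<ge> 0" "\<And>s t. s \<in> \<real> \<Longrightarrow> t \<in> \<real> \<Longrightarrow> cmod (F s - F t) \<le> \<epsilon> + C2 * (cmod (1 / (s + \<i>) - 1 / (t + \<i>)))\<^sup>2"
    and low: "(\<Sum>r<n\<^sup>2. \<Sum>s<n\<^sup>2. (cmod (low_entry b c n r s))\<^sup>2) \<le> \<eta> * (real n)\<^sup>2"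
    and main: "(\<Sum>r<n\<^sup>2. \<Sum>s<n\<^sup>2. cmod (main_entry A n r s - local_matrix (\<lambda>x. stencil (A' x)) n r s)) \<le> \<delta>1 * (real n)\<^sup>2"
    and block: "(\<Sum>r<n\<^sup>2. \<Sum>s<n\<^sup>2. cmod (local_matrix (\<lambda>x. stencil (A' x)) n r s - block_matrix (\<lambda>x. stencil (A' x)) n N r s)) \<le> \<delta>2 * (real n)\<^sup>2"
  shows "cmod ((\<Sum>l\<in>#eigenvalue_mset (stiffness_matrix A b c n). F l) / of_nat (n\<^sup>2)
      - (\<Sum>r<n\<^sup>2. F (block_eigenvalue (\<lambda>x. stencil (A' x)) n N r)) / of_nat (n\<^sup>2))
    \<le> 2 * \<epsilon> + 10 * C1 * \<eta> + 2 * C2 * (\<delta>1 + \<delta>2)"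
proof -
  let ?\<rho> = "\<lambda>x. stencil (A' x)"
  let ?d = "n\<^sup>2"
  let ?X = "main_entry A n" and ?Y = "low_entry b c n"
  let ?S = "\<Sum>l\<in>#eigenvalue_mset (stiffness_matrix A b c n). F l"
  let ?G = "\<Sum>r<n\<^sup>2. F (block_eigenvalue ?\<rho> n N r)"
  obtain V x where V: "unitary_on ?d V" and x: "\<And>i. i < ?d \<Longrightarrow> x i \<in> \<real>"
    and X: "\<And>r s. r < ?d \<Longrightarrow> s < ?d \<Longrightarrow> ?X r s = (\<Sum>i<?d. V r i * x i * cnj (V s i))"
    by (rule hermitian_diagonalisation[of ?d ?X, OF main_entry_hermitian[OF H]]) blast+
  have S: "stiffness_matrix A b c n = mat_of ?d (\<lambda>r s. ?X r s + ?Y r s)"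
    using stiffness_matrix_carrier[of A b c n] by (intro eq_matI) (simp_all add: stiffness_entry[OF _ _ A b c])
  have 1: "cmod (?S - (\<Sum>i<?d. F (x i))) \<le> \<epsilon> * real ?d + 10 * C1 * (\<Sum>r<?d. \<Sum>s<?d. (cmod (?Y r s))\<^sup>2)"
    unfolding S by (rule perturbed_eigenvalue_sum[OF V x X C1(2,1)])
  have g: "block_eigenvalue ?\<rho> n N i \<in> \<real>" for i
    unfolding block_eigenvalue_def using symbol_real[OF H'] by simp
  have "cmod ((\<Sum>i<?d. F (x i)) - ?G) \<le> \<epsilon> * real ?d + 2 * C2 * (\<Sum>r<?d. \<Sum>s<?d. cmod ((\<Sum>i<?d. V r i * x i * cnj (V s i))
      - (\<Sum>i<?d. block_basis n N r i * block_eigenvalue ?\<rho> n N i * cnj (block_basis n N s i))))"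
    by (rule hermitian_eigenvalue_sum_diff[OF V x unitary_block_basis[OF N] g C2(2,1)])
  also have "(\<Sum>r<?d. \<Sum>s<?d. cmod ((\<Sum>i<?d. V r i * x i * cnj (V s i))
      - (\<Sum>i<?d. block_basis n N r i * block_eigenvalue ?\<rho> n N i * cnj (block_basis n N s i))))
    = (\<Sum>r<?d. \<Sum>s<?d. cmod (?X r s - block_matrix ?\<rho> n N r s))"
    by (intro sum.cong refl) (simp only: lessThan_iff X block_matrix_def)
  finally have 2: "cmod ((\<Sum>i<?d. F (x i)) - ?G) \<le> \<epsilon> * real ?d + 2 * C2 * (\<Sum>r<?d. \<Sum>s<?d. cmod (?X r s - block_matrix ?\<rho> n N r s))" .
  have "(\<Sum>r<?d. \<Sum>s<?d. cmod (?X r s - block_matrix ?\<rho> n N r s))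
     \<le> (\<Sum>r<?d. \<Sum>s<?d. cmod (?X r s - local_matrix ?\<rho> n r s) + cmod (local_matrix ?\<rho> n r s - block_matrix ?\<rho> n N r s))"
    by (intro sum_mono) (rule order_trans[OF _ norm_triangle_ineq], simp)
  also have "\<dots> \<le> \<delta>1 * (real n)\<^sup>2 + \<delta>2 * (real n)\<^sup>2" unfolding sum.distrib by (rule add_mono[OF main block])
  finally have m: "2 * C2 * (\<Sum>r<?d. \<Sum>s<?d. cmod (?X r s - block_matrix ?\<rho> n N r s)) \<le> 2 * C2 * (\<delta>1 * (real n)\<^sup>2 + \<delta>2 * (real n)\<^sup>2)"
    by (rule mult_left_mono) (use C2(1) in simp)
  have l: "10 * C1 * (\<Sum>r<?d. \<Sum>s<?d. (cmod (?Y r s))\<^sup>2) \<le> 10 * C1 * (\<eta> * (real n)\<^sup>2)"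
    by (rule mult_left_mono[OF low]) (use C1(1) in simp)
  have "cmod (?S - ?G) \<le> cmod (?S - (\<Sum>i<?d. F (x i))) + cmod ((\<Sum>i<?d. F (x i)) - ?G)"
    by (rule order_trans[OF _ norm_triangle_ineq]) simp
  also have "\<dots> \<le> (\<epsilon> * real ?d + 10 * C1 * (\<eta> * (real n)\<^sup>2)) + (\<epsilon> * real ?d + 2 * C2 * (\<delta>1 * (real n)\<^sup>2 + \<delta>2 * (real n)\<^sup>2))"
    using 1 2 l m by linarith
  also have "\<dots> = (2 * \<epsilon> + 10 * C1 * \<eta> + 2 * C2 * (\<delta>1 + \<delta>2)) * real ?d"
    by (simp add: algebra_simps)
  finally have "cmod (?S - ?G) / real ?d \<le> 2 * \<epsilon> + 10 * C1 * \<eta> + 2 * C2 * (\<delta>1 + \<delta>2)"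
    using n by (simp add: pos_divide_le_eq)
  then show ?thesis unfolding diff_divide_distrib[symmetric] norm_divide norm_of_nat .
qed

lemma norm_diff_triangle3:
  fixes t u v w :: complex
  assumes "cmod (t - u) \<le> x" "cmod (u - v) \<le> y" "cmod (v - w) \<le> z"
  shows "cmod (t - w) \<le> x + y + z"
  using assms norm_triangle_ineq[of "t - u" "u - v"] norm_triangle_ineq[of "t - v" "v - w"] by simp

lemma eigenvalue_average_tendsto:
  fixes A :: "real^2 \<Rightarrow> complex^2^2" and b :: "real^2 \<Rightarrow> complex^2" and c :: "real^2 \<Rightarrow> complex"
  assumes A: "\<And>k l. integrable \<mu>\<^sub>S (\<lambda>x. A x $ k $ l)"
    and b: "\<And>k. integrable \<mu>\<^sub>S (\<lambda>x. b x $ k)" and c: "integrable \<mu>\<^sub>S c"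
    and H: "\<forall>x\<in>open_unit_square. hermitian_matrix (A x)" and F: "Cc_complex F"
  shows "(\<lambda>n. (\<Sum>l\<in>#eigenvalue_mset (stiffness_matrix A b c n). F l) / of_nat (n\<^sup>2))
    \<longlonglongrightarrow> (LINT z|\<mu>\<^sub>D. F (symbol_sum (\<lambda>x. stencil (A x)) z)) / of_real (4 * pi\<^sup>2)"
proof (rule LIMSEQ_I)
  fix r :: real assume r: "r > 0"
  \<comment> \<open>Six \<epsilon> are spent in the end: four directly, one through \<eta> and one
    through \<open>M\<close>.\<close>
  define \<epsilon> where "\<epsilon> = r / 8"
  have \<epsilon>: "\<epsilon> > 0" using r by (simp add: \<epsilon>_def)
  have Fc: "continuous_on UNIV F" using F unfolding Cc_complex_def by (rule conjunct1)
  obtain B where B: "\<And>z. cmod (F z) \<le> B" using Cc_complex_bounded[OF F] by blast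
  obtain C1 where C1: "C1 \<ge> 0" "\<And>s t. cmod (F s - F t) \<le> \<epsilon> + C1 * (cmod (s - t))\<^sup>2"
    using Cc_square_bound[OF F \<epsilon>] by blast
  obtain C2 where C2: "C2 \<ge> 0" "\<And>s t. s \<in> \<real> \<Longrightarrow> t \<in> \<real> \<Longrightarrow> cmod (F s - F t) \<le> \<epsilon> + C2 * (cmod (1 / (s + \<i>) - 1 / (t + \<i>)))\<^sup>2"
    by (rule Cc_resolvent_bound[OF F \<epsilon>]) blast
  obtain K where K: "K \<ge> 0" "\<And>s t. cmod (F s - F t) \<le> \<epsilon> + K * cmod (s - t)"
    using Cc_linear_bound[OF F \<epsilon>] by blast
  \<comment> \<open>802 = 2 * 401 collects \<open>400 * \<delta>\<close> from the second order
    entries and \<delta> from the blocks; 36 K comes from the symbol.\<close>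
  define M where "M = 1 + 802 * C2 + 36 * K"
  have M: "M \<ge> 1" using C2(1) K(1) by (simp add: M_def)
  define \<delta> where "\<delta> = \<epsilon> / M"
  have \<delta>: "\<delta> > 0" using \<epsilon> M by (simp add: \<delta>_def)
  have M\<delta>: "802 * C2 * \<delta> + 36 * K * \<delta> \<le> \<epsilon>"
  proof -
    have "M * \<delta> = \<epsilon>" using M by (simp add: \<delta>_def)
    then show ?thesis using \<delta> by (simp add: M_def algebra_simps)
  qed
  have "\<exists>A'. (\<forall>k l. separable_sum (\<lambda>x. A' x $ k $ l)) \<and>
      (\<Sum>k\<in>UNIV. \<Sum>l\<in>UNIV. LINT x|\<mu>\<^sub>S. cmod (A x $ k $ l - A' x $ k $ l)) < \<delta> \<and> (\<forall>x. hermitian_matrix (A' x))"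
    by (rule separable_matrix_approximation[OF A \<delta>]) (use H in blast)
  then obtain A' where A': "(\<forall>k l. separable_sum (\<lambda>x. A' x $ k $ l)) \<and>
      (\<Sum>k\<in>UNIV. \<Sum>l\<in>UNIV. LINT x|\<mu>\<^sub>S. cmod (A x $ k $ l - A' x $ k $ l)) < \<delta> \<and> (\<forall>x. hermitian_matrix (A' x))" ..
  note sep = A'[THEN conjunct1, THEN spec, THEN spec]
    and close = A'[THEN conjunct2, THEN conjunct1] and H' = A'[THEN conjunct2, THEN conjunct2, THEN spec]
  let ?\<rho> = "\<lambda>x. stencil (A' x)"
  define \<eta> where "\<eta> = \<epsilon> / (1 + 10 * C1)"
  have \<eta>: "\<eta> > 0" "10 * C1 * \<eta> \<le> \<epsilon>" using \<epsilon> C1(1) by (simp_all add: \<eta>_def field_simps add_pos_nonneg)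
  from main_entry_local_approx[OF A sep close] obtain n1
    where n1: "\<forall>n\<ge>n1. (\<Sum>r<n\<^sup>2. \<Sum>s<n\<^sup>2. cmod (main_entry A n r s - local_matrix ?\<rho> n r s)) \<le> 400 * \<delta> * (real n)\<^sup>2" ..
  from low_entry_frobenius[OF b c \<eta>(1)] obtain n2
    where n2: "\<forall>n\<ge>n2. (\<Sum>r<n\<^sup>2. \<Sum>s<n\<^sup>2. (cmod (low_entry b c n r s))\<^sup>2) \<le> \<eta> * (real n)\<^sup>2" ..
  from local_block_approx[OF sep \<delta>] obtain N1 where N1: "N1 > 0 \<and> (\<forall>N\<ge>N1. \<exists>n0. \<forall>n\<ge>n0.
      (\<Sum>r<n\<^sup>2. \<Sum>s<n\<^sup>2. cmod (local_matrix ?\<rho> n r s - block_matrix ?\<rho> n N r s)) \<le> \<delta> * (real n)\<^sup>2)" ..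
  from block_eigenvalue_distribution[OF sep Fc B \<epsilon>] obtain N2 where N2: "N2 > 0 \<and> (\<forall>N\<ge>N2. \<exists>n0. \<forall>n\<ge>n0.
      cmod ((\<Sum>r<n\<^sup>2. F (block_eigenvalue ?\<rho> n N r)) / of_nat (n\<^sup>2)
      - (LINT z|\<mu>\<^sub>D. F (symbol_sum ?\<rho> z)) / of_real (4 * pi\<^sup>2)) \<le> \<epsilon>)" ..
  \<comment> \<open>The block length is fixed here, before \<open>n\<close> tends to
    infinity.\<close>
  define N where "N = max N1 N2"
  have N: "N \<ge> N1" "N \<ge> N2" by (simp_all add: N_def)
  from N1[THEN conjunct2, THEN spec, THEN mp, OF N(1)] obtain n3
    where n3: "\<forall>n\<ge>n3. (\<Sum>r<n\<^sup>2. \<Sum>s<n\<^sup>2. cmod (local_matrix ?\<rho> n r s - block_matrix ?\<rho> n N r s)) \<le> \<delta> * (real n)\<^sup>2" ..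
  from N2[THEN conjunct2, THEN spec, THEN mp, OF N(2)] obtain n4
    where n4: "\<forall>n\<ge>n4. cmod ((\<Sum>r<n\<^sup>2. F (block_eigenvalue ?\<rho> n N r)) / of_nat (n\<^sup>2)
      - (LINT z|\<mu>\<^sub>D. F (symbol_sum ?\<rho> z)) / of_real (4 * pi\<^sup>2)) \<le> \<epsilon>" ..
  have N0: "N > 0" using N1[THEN conjunct1] N(1) by (rule less_le_trans)
  let ?I = "\<lambda>C. (LINT z|\<mu>\<^sub>D. F (symbol_sum (\<lambda>x. stencil (C x)) z)) / of_real (4 * pi\<^sup>2)"
  have i: "cmod (?I A' - ?I A) \<le> \<epsilon> + 36 * K * \<delta>"
    by (rule integral_symbol_diff[OF A separable_integrable[OF sep] less_imp_le[OF close] Fc B K(2,1)])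
  have "cmod ((\<Sum>l\<in>#eigenvalue_mset (stiffness_matrix A b c n). F l) / of_nat (n\<^sup>2) - ?I A) < r"
    if n: "n \<ge> Suc (n1 + n2 + n3 + n4)" for n
  proof -
    let ?a = "(\<Sum>l\<in>#eigenvalue_mset (stiffness_matrix A b c n). F l) / of_nat (n\<^sup>2)"
    let ?g = "(\<Sum>r<n\<^sup>2. F (block_eigenvalue ?\<rho> n N r)) / of_nat (n\<^sup>2)"
    have nn: "n > 0" "n \<ge> n1" "n \<ge> n2" "n \<ge> n3" "n \<ge> n4" using n by linarith+
    have 1: "cmod (?a - ?g) \<le> 2 * \<epsilon> + 10 * C1 * \<eta> + 2 * C2 * (400 * \<delta> + \<delta>)"
      by (rule eigenvalue_average_bound[OF nn(1) N0 A b c bspec[OF H] H' C1 C2 n2[rule_format, OF nn(3)] n1[rule_format, OF nn(2)] n3[rule_format, OF nn(4)]])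
    have 2: "cmod (?a - ?I A) \<le> (2 * \<epsilon> + 10 * C1 * \<eta> + 2 * C2 * (400 * \<delta> + \<delta>)) + \<epsilon> + (\<epsilon> + 36 * K * \<delta>)"
      by (rule norm_diff_triangle3[OF 1 n4[rule_format, OF nn(5)] i])
    have 3: "(2 * \<epsilon> + 10 * C1 * \<eta> + 2 * C2 * (400 * \<delta> + \<delta>)) + \<epsilon> + (\<epsilon> + 36 * K * \<delta>)
       = 4 * \<epsilon> + 10 * C1 * \<eta> + (802 * C2 * \<delta> + 36 * K * \<delta>)" by (simp add: algebra_simps)
    have 4: "4 * \<epsilon> + 10 * C1 * \<eta> + (802 * C2 * \<delta> + 36 * K * \<delta>) < r"
      using \<eta>(2) M\<delta> r by (simp add: \<epsilon>_def)
    show ?thesis by (rule le_less_trans[OF 2[unfolded 3] 4])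
  qed
  then show "\<exists>no. \<forall>n\<ge>no. norm ((\<Sum>l\<in>#eigenvalue_mset (stiffness_matrix A b c n). F l) / of_nat (n\<^sup>2) - ?I A) < r"
    by (intro exI[of _ "Suc (n1 + n2 + n3 + n4)"] allI impI)
qed

theorem theorem6p1:
  fixes A :: "real^2 \<Rightarrow> complex^2^2"
    and b :: "real^2 \<Rightarrow> complex^2"
    and c :: "real^2 \<Rightarrow> complex"
  assumes "A absolutely_integrable_on open_unit_square"
    and "b absolutely_integrable_on open_unit_square"
    and "c absolutely_integrable_on open_unit_square"
  shows "GLT_sequence2 (stiffness_matrix A b c) (P1_symbol A) \<and>
    ((\<forall>x\<in>open_unit_square. hermitian_matrix (A x)) \<longrightarrow>
      spectral_distribution (\<lambda>n. n\<^sup>2) (stiffness_matrix A b c)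
        (unit_square \<times> freq_square) (P1_symbol A))"
proof (intro conjI impI)
  note A = integrable_matrix_component[OF assms(1)]
  note b = integrable_vector_component[OF assms(2)]
  note c = integrable_on_open_unit_square[OF assms(3)]
  show "GLT_sequence2 (stiffness_matrix A b c) (P1_symbol A)" by (rule GLT_stiffness_matrix[OF A b c])
  assume H: "\<forall>x\<in>open_unit_square. hermitian_matrix (A x)"
  \<comment> \<open>The Riemann sum theorem is applied to zero functions, for its statement on the
    area alone.\<close>
  have m: "measure lebesgue (unit_square \<times> freq_square) = 4 * pi\<^sup>2"
    by (rule riemann_cells(2)[of 1 1 "\<lambda>_. 0" 0 "\<lambda>_. 0" 0]) simp_all
  show "spectral_distribution (\<lambda>n. n\<^sup>2) (stiffness_matrix A b c) (unit_square \<times> freq_square) (P1_symbol A)"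
    unfolding spectral_distribution_def m P1_symbol_eq
  proof (intro conjI allI impI)
    show "stiffness_matrix A b c n \<in> carrier_mat (n\<^sup>2) (n\<^sup>2)" for n by (rule stiffness_matrix_carrier)
    show "filterlim (\<lambda>n::nat. n\<^sup>2) at_top sequentially"
      by (rule filterlim_at_top_mono[OF filterlim_ident]) (rule always_eventually, rule allI, simp only: power2_eq_square le_square)
    show "unit_square \<times> freq_square \<in> lmeasurable" by (rule lmeasurable_Times_bounded) auto
    show "0 < 4 * pi\<^sup>2" by simp
    show "symbol_sum (\<lambda>x. stencil (A x)) \<in> borel_measurable \<mu>\<^sub>D" by (rule symbol_measurable[OF A])
    show "(\<lambda>n. (\<Sum>l\<in>#eigenvalue_mset (stiffness_matrix A b c n). F l) / of_nat (n\<^sup>2))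
      \<longlonglongrightarrow> (LINT z|\<mu>\<^sub>D. F (symbol_sum (\<lambda>x. stencil (A x)) z)) / of_real (4 * pi\<^sup>2)" if "Cc_complex F" for F
      by (rule eigenvalue_average_tendsto[OF A b c H that])
  qed
qed

end
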